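(* Let $(\mathcal C,i,\boxtimes,\sigma)$ be a symmetric monoidal category. Then $\mathcal C$ classifies symmetric actions on $\mathcal C$: $\mathcal C$ acts symmetrically on itself via $\boxtimes:\mathcal C\times\mathcal C\to\mathcal C$, and for every symmetric monoidal category $\mathcal M$ and every symmetric action $\bullet:\mathcal M\times\mathcal C\to\mathcal C$, there is a unique $F_\bullet:\mathcal M\to\mathcal C$ through which $\bullet$ factors as $$\mathcal M\times\mathcal C\xrightarrow{\;F_\bullet\times\mathcal C\;}\mathcal C\times\mathcal C\xrightarrow{\;\boxtimes\;}\mathcal C .$$ In other words, $(\mathcal C,\boxtimes)$ is terminal in the 2-category $\mathrm{Act}^{\mathrm{cart}}_{\mathbf{SymMonCat}}(\mathcal C)$ of symmetric actions on $\mathcal C$, thus inducing an equivalence $$\mathbf{SymMonCat}/\mathcal C\;\simeq\;\mathrm{Act}^{\mathrm{cart}}_{\mathbf{SymMonCat}}(\mathcal C).$$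
   Context: Actegories. For a monoidal category $(\mathcal M,j,\otimes,\lambda,\rho,\alpha)$ a left $\mathcal M$-actegory (left $\mathcal M$-action) is a category $\mathcal C$ with a functor $\bullet:\mathcal M\times\mathcal C\to\mathcal C$ and natural isomorphisms $\eta_c:c\to j\bullet c$, $\mu_{m,n,c}:m\bullet(n\bullet c)\to(m\otimes n)\bullet c$ such that $(\alpha_{m,n,p}\bullet c)\circ\mu_{m\otimes n,p,c}\circ\mu_{m,n,p\bullet c}=\mu_{m,n\otimes p,c}\circ(m\bullet\mu_{n,p,c})$, $\mu_{j,m,c}\circ\eta_{m\bullet c}=\lambda_m^{-1}\bullet c$, $\mu_{m,j,c}\circ(m\bullet\eta_c)=\rho_m^{-1}\bullet c$. Symmetric actions. Let $(\mathcal M,j,\otimes,s)$ and $(\mathcal C,i,\boxtimes,\sigma)$ be symmetric monoidal. A symmetric (monoidal) action of $\mathcal M$ on $\mathcal C$ is a left $\mathcal M$-action $(\bullet,\eta,\mu)$ in which $\bullet:\mathcal M\times\mathcal C\to\mathcal C$ is a strong braided (symmetric) monoidal functor, with natural isomorphisms $\iota_{m,n,c,d}:(m\otimes n)\bullet(c\boxtimes d)\to(m\bullet c)\boxtimes(n\bullet d)$ satisfying in particular $\sigma_{m\bullet c,n\bullet d}\circ\iota_{m,n,c,d}=\iota_{n,m,d,c}\circ(s_{m,n}\bullet\sigma_{c,d})$, and $\eta,\mu$ are monoidal natural transformations; here $\otimes:\mathcal M\times\mathcal M\to\mathcal M$ is strong monoidal via $m\otimes s_{n,m'}\otimes n'$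 (up to associators). The self-action of $\mathcal C$ has unitor, multiplicator and interchanger built from the unitor, associator and symmetry of $\mathcal C$. Restriction. For a strong monoidal $R:\mathcal M\to\mathcal N$ with structure $(\epsilon,\varpi)$ and an $\mathcal N$-action $\star$, $R^*\star$ is the $\mathcal M$-action $(m,c)\mapsto R(m)\star c$ with unitor $(\epsilon\star c)\circ\eta_c$ and multiplicator $(\varpi_{m,m'}\star c)\circ\mu_{R(m),R(m'),c}$. The 2-category $\mathrm{Act}^{\mathrm{cart}}_{\mathbf{SymMonCat}}(\mathcal C)$: objects are pairs $(\mathcal M,\bullet)$ with $\mathcal M$ symmetric monoidal and $\bullet$ a symmetric action on $\mathcal C$; a morphism $(\mathcal M,\bullet)\to(\mathcal N,\star)$ is a strong symmetric monoidal functor $R:\mathcal M\to\mathcal N$ together with an identification $R^*\star\cong\bullet$ (a natural isomorphism $R(m)\star c\cong m\bullet c$ compatible with unitors, multiplicators and interchangers); 2-cells are monoidal natural transformations compatible with these identifications. $\mathbf{SymMonCat}$ is the 2-category of symmetric monoidal categories, strong symmetric monoidal functors and monoidal natural transformations, and $\mathbf{SymMonCat}/\mathcal C$ is its slice 2-category over $\mathcal C$. Uniqueness, terminality and slices are understood in the usual 2-categorical (pseudo) sense: triangles commute up to specified isomorphism, and the hom-category into the terminal object is equivalent to the one-object, one-morphism category. *)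

theory Defs
  imports Main "HOL-Library.FuncSet"
begin

record ('o, 'a) cat =
  Obj :: "'o set"
  Arr :: "'a set"
  Dom :: "'a \<Rightarrow> 'o"
  Cod :: "'a \<Rightarrow> 'o"
  Idt :: "'o \<Rightarrow> 'a"
  Comp :: "'a \<Rightarrow> 'a \<Rightarrow> 'a" (infixl "\<cdot>\<index>" 60)

text \<open>Composition is in applicative order: \<open>g \<cdot> f\<close> is first \<open>f\<close>, then \<open>g\<close>.\<close>

definition hom :: "('o, 'a, 'z) cat_scheme \<Rightarrow> 'o \<Rightarrow> 'o \<Rightarrow> 'a set" where
  "hom C x y = {f \<in> Arr C. Dom C f = x \<and> Cod C f = y}"

locale category =
  fixes C :: "('o, 'a, 'z) cat_scheme"
  assumes dom_obj: "f \<in> Arr C \<Longrightarrow> Dom C f \<in> Obj C"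
    and cod_obj: "f \<in> Arr C \<Longrightarrow> Cod C f \<in> Obj C"
    and idt_hom: "x \<in> Obj C \<Longrightarrow> Idt C x \<in> hom C x x"
    and comp_hom: "\<lbrakk>f \<in> hom C x y; g \<in> hom C y z\<rbrakk> \<Longrightarrow> g \<cdot>\<^bsub>C\<^esub> f \<in> hom C x z"
    and comp_assoc: "\<lbrakk>f \<in> hom C w x; g \<in> hom C x y; h \<in> hom C y z\<rbrakk>
      \<Longrightarrow> (h \<cdot>\<^bsub>C\<^esub> g) \<cdot>\<^bsub>C\<^esub> f = h \<cdot>\<^bsub>C\<^esub> (g \<cdot>\<^bsub>C\<^esub> f)"
    and comp_idt_right: "f \<in> hom C x y \<Longrightarrow> f \<cdot>\<^bsub>C\<^esub> Idt C x = f"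
    and comp_idt_left: "f \<in> hom C x y \<Longrightarrow> Idt C y \<cdot>\<^bsub>C\<^esub> f = f"

definition inverse_arrows :: "('o, 'a, 'z) cat_scheme \<Rightarrow> 'a \<Rightarrow> 'a \<Rightarrow> bool" where
  "inverse_arrows C f g \<longleftrightarrow> f \<in> Arr C \<and> g \<in> hom C (Cod C f) (Dom C f)
     \<and> g \<cdot>\<^bsub>C\<^esub> f = Idt C (Dom C f) \<and> f \<cdot>\<^bsub>C\<^esub> g = Idt C (Cod C f)"

definition is_iso :: "('o, 'a, 'z) cat_scheme \<Rightarrow> 'a \<Rightarrow> bool" where
  "is_iso C f \<longleftrightarrow> (\<exists>g. inverse_arrows C f g)"

definition inv_arr :: "('o, 'a, 'z) cat_scheme \<Rightarrow> 'a \<Rightarrow> 'a" where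
  "inv_arr C f = (THE g. inverse_arrows C f g)"

definition isomorphic :: "('o, 'a, 'z) cat_scheme \<Rightarrow> 'o \<Rightarrow> 'o \<Rightarrow> bool" where
  "isomorphic C x y \<longleftrightarrow> (\<exists>f \<in> hom C x y. is_iso C f)"

record ('o, 'a, 'p, 'b) fctr =
  FObj :: "'o \<Rightarrow> 'p"
  FArr :: "'a \<Rightarrow> 'b"

locale cat_functor = dom_cat: category A + cod_cat: category B
  for A :: "('o, 'a, 'z) cat_scheme" and B :: "('p, 'b, 'y) cat_scheme" +
  fixes F :: "('o, 'a, 'p, 'b, 'x) fctr_scheme"
  assumes fobj: "x \<in> Obj A \<Longrightarrow> FObj F x \<in> Obj B"
    and farr: "f \<in> hom A x y \<Longrightarrow> FArr F f \<in> hom B (FObj F x) (FObj F y)"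
    and farr_idt: "x \<in> Obj A \<Longrightarrow> FArr F (Idt A x) = Idt B (FObj F x)"
    and farr_comp: "\<lbrakk>f \<in> hom A x y; g \<in> hom A y z\<rbrakk>
      \<Longrightarrow> FArr F (g \<cdot>\<^bsub>A\<^esub> f) = FArr F g \<cdot>\<^bsub>B\<^esub> FArr F f"

locale nat_trans = source: cat_functor A B F + target: cat_functor A B G
  for A :: "('o, 'a, 'z) cat_scheme" and B :: "('p, 'b, 'y) cat_scheme"
    and F :: "('o, 'a, 'p, 'b, 'x) fctr_scheme" and G :: "('o, 'a, 'p, 'b, 'w) fctr_scheme" +
  fixes t :: "'o \<Rightarrow> 'b"
  assumes component: "x \<in> Obj A \<Longrightarrow> t x \<in> hom B (FObj F x) (FObj G x)"
    and naturality: "f \<in> hom A x y \<Longrightarrow> FArr G f \<cdot>\<^bsub>B\<^esub> t x = t y \<cdot>\<^bsub>B\<^esub> FArr F f"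

locale nat_iso = nat_trans A B F G t
  for A :: "('o, 'a, 'z) cat_scheme" and B :: "('p, 'b, 'y) cat_scheme"
    and F :: "('o, 'a, 'p, 'b, 'x) fctr_scheme" and G :: "('o, 'a, 'p, 'b, 'w) fctr_scheme"
    and t :: "'o \<Rightarrow> 'b" +
  assumes component_iso: "x \<in> Obj A \<Longrightarrow> is_iso B (t x)"

definition id_fctr :: "('o, 'a, 'o, 'a) fctr" where
  "id_fctr = \<lparr>FObj = \<lambda>x. x, FArr = \<lambda>f. f\<rparr>"

definition comp_fctr :: "('p, 'b, 'q, 'c, 'x) fctr_scheme \<Rightarrow> ('o, 'a, 'p, 'b, 'y) fctr_scheme
    \<Rightarrow> ('o, 'a, 'q, 'c) fctr" where
  "comp_fctr G F = \<lparr>FObj = \<lambda>x. FObj G (FObj F x), FArr = \<lambda>f. FArr G (FArr F f)\<rparr>"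

definition prod_cat :: "('o, 'a, 'z) cat_scheme \<Rightarrow> ('p, 'b, 'y) cat_scheme
    \<Rightarrow> ('o \<times> 'p, 'a \<times> 'b) cat" (infixr "\<times>\<^sub>c" 75) where
  "A \<times>\<^sub>c B = \<lparr>Obj = Obj A \<times> Obj B, Arr = Arr A \<times> Arr B,
     Dom = \<lambda>(f, g). (Dom A f, Dom B g), Cod = \<lambda>(f, g). (Cod A f, Cod B g),
     Idt = \<lambda>(x, y). (Idt A x, Idt B y),
     Comp = \<lambda>(f', g') (f, g). (f' \<cdot>\<^bsub>A\<^esub> f, g' \<cdot>\<^bsub>B\<^esub> g)\<rparr>"

definition one_cat :: "(unit, unit) cat" where
  "one_cat = \<lparr>Obj = {()}, Arr = {()}, Dom = \<lambda>_. (), Cod = \<lambda>_. (), Idt = \<lambda>_. (),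
     Comp = \<lambda>_ _. ()\<rparr>"

definition equivalent_categories ::
    "('o, 'a, 'z) cat_scheme \<Rightarrow> ('p, 'b, 'y) cat_scheme \<Rightarrow> bool" where
  "equivalent_categories A B \<longleftrightarrow>
     (\<exists>(F :: ('o, 'a, 'p, 'b) fctr) (G :: ('p, 'b, 'o, 'a) fctr) s t.
        cat_functor A B F \<and> cat_functor B A G
        \<and> nat_iso A A id_fctr (comp_fctr G F) s \<and> nat_iso B B (comp_fctr F G) id_fctr t)"

record ('o, 'a) moncat = "('o, 'a) cat" +
  Unt :: "'o"
  Tens :: "('o \<times> 'o, 'a \<times> 'a, 'o, 'a) fctr"
  Lunit :: "'o \<Rightarrow> 'a"
  Runit :: "'o \<Rightarrow> 'a"
  Assoc :: "'o \<Rightarrow> 'o \<Rightarrow> 'o \<Rightarrow> 'a"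

abbreviation tens_obj :: "('o, 'a, 'z) moncat_scheme \<Rightarrow> 'o \<Rightarrow> 'o \<Rightarrow> 'o" (infixl "\<otimes>\<index>" 70) where
  "x \<otimes>\<^bsub>C\<^esub> y \<equiv> FObj (Tens C) (x, y)"

abbreviation tens_arr :: "('o, 'a, 'z) moncat_scheme \<Rightarrow> 'a \<Rightarrow> 'a \<Rightarrow> 'a" (infixl "\<otimes>\<^sub>1\<index>" 70) where
  "f \<otimes>\<^sub>1\<^bsub>C\<^esub> g \<equiv> FArr (Tens C) (f, g)"

text \<open>Orientation: \<open>Lunit x : j \<otimes> x \<rightarrow> x\<close>, \<open>Runit x : x \<otimes> j \<rightarrow> x\<close>,
  \<open>Assoc x y z : (x \<otimes> y) \<otimes> z \<rightarrow> x \<otimes> (y \<otimes> z)\<close>.\<close>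

locale monoidal_category = category C
  for C :: "('o, 'a, 'z) moncat_scheme" +
  assumes unit_obj: "Unt C \<in> Obj C"
    and tens_functor: "cat_functor (C \<times>\<^sub>c C) C (Tens C)"
    and lunit_iso: "nat_iso C C
      \<lparr>FObj = \<lambda>x. Unt C \<otimes>\<^bsub>C\<^esub> x, FArr = \<lambda>f. Idt C (Unt C) \<otimes>\<^sub>1\<^bsub>C\<^esub> f\<rparr> id_fctr (Lunit C)"
    and runit_iso: "nat_iso C C
      \<lparr>FObj = \<lambda>x. x \<otimes>\<^bsub>C\<^esub> Unt C, FArr = \<lambda>f. f \<otimes>\<^sub>1\<^bsub>C\<^esub> Idt C (Unt C)\<rparr> id_fctr (Runit C)"
    and assoc_iso: "nat_iso (C \<times>\<^sub>c C \<times>\<^sub>c C) C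
      \<lparr>FObj = \<lambda>(x, y, z). (x \<otimes>\<^bsub>C\<^esub> y) \<otimes>\<^bsub>C\<^esub> z, FArr = \<lambda>(f, g, h). (f \<otimes>\<^sub>1\<^bsub>C\<^esub> g) \<otimes>\<^sub>1\<^bsub>C\<^esub> h\<rparr>
      \<lparr>FObj = \<lambda>(x, y, z). x \<otimes>\<^bsub>C\<^esub> (y \<otimes>\<^bsub>C\<^esub> z), FArr = \<lambda>(f, g, h). f \<otimes>\<^sub>1\<^bsub>C\<^esub> (g \<otimes>\<^sub>1\<^bsub>C\<^esub> h)\<rparr>
      (\<lambda>(x, y, z). Assoc C x y z)"
    and pentagon: "\<lbrakk>w \<in> Obj C; x \<in> Obj C; y \<in> Obj C; z \<in> Obj C\<rbrakk> \<Longrightarrow>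
      Assoc C w x (y \<otimes>\<^bsub>C\<^esub> z) \<cdot>\<^bsub>C\<^esub> Assoc C (w \<otimes>\<^bsub>C\<^esub> x) y z
      = (Idt C w \<otimes>\<^sub>1\<^bsub>C\<^esub> Assoc C x y z) \<cdot>\<^bsub>C\<^esub> Assoc C w (x \<otimes>\<^bsub>C\<^esub> y) z
          \<cdot>\<^bsub>C\<^esub> (Assoc C w x y \<otimes>\<^sub>1\<^bsub>C\<^esub> Idt C z)"
    and triangle: "\<lbrakk>x \<in> Obj C; y \<in> Obj C\<rbrakk> \<Longrightarrow>
      (Idt C x \<otimes>\<^sub>1\<^bsub>C\<^esub> Lunit C y) \<cdot>\<^bsub>C\<^esub> Assoc C x (Unt C) y = Runit C x \<otimes>\<^sub>1\<^bsub>C\<^esub> Idt C y"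

record ('o, 'a) smc = "('o, 'a) moncat" +
  Symm :: "'o \<Rightarrow> 'o \<Rightarrow> 'a"

locale symmetric_monoidal_category = monoidal_category C
  for C :: "('o, 'a) smc" +
  assumes symm_iso: "nat_iso (C \<times>\<^sub>c C) C (Tens C)
      \<lparr>FObj = \<lambda>(x, y). y \<otimes>\<^bsub>C\<^esub> x, FArr = \<lambda>(f, g). g \<otimes>\<^sub>1\<^bsub>C\<^esub> f\<rparr> (\<lambda>(x, y). Symm C x y)"
    and symm_symm: "\<lbrakk>x \<in> Obj C; y \<in> Obj C\<rbrakk> \<Longrightarrow>
      Symm C y x \<cdot>\<^bsub>C\<^esub> Symm C x y = Idt C (x \<otimes>\<^bsub>C\<^esub> y)"
    and hexagon: "\<lbrakk>x \<in> Obj C; y \<in> Obj C; z \<in> Obj C\<rbrakk> \<Longrightarrow>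
      Assoc C y z x \<cdot>\<^bsub>C\<^esub> Symm C x (y \<otimes>\<^bsub>C\<^esub> z) \<cdot>\<^bsub>C\<^esub> Assoc C x y z
      = (Idt C y \<otimes>\<^sub>1\<^bsub>C\<^esub> Symm C x z) \<cdot>\<^bsub>C\<^esub> Assoc C y x z \<cdot>\<^bsub>C\<^esub> (Symm C x y \<otimes>\<^sub>1\<^bsub>C\<^esub> Idt C z)"

definition prod_smc :: "('o, 'a) smc \<Rightarrow> ('p, 'b) smc \<Rightarrow> ('o \<times> 'p, 'a \<times> 'b) smc" where
  "prod_smc M C = \<lparr>Obj = Obj (M \<times>\<^sub>c C), Arr = Arr (M \<times>\<^sub>c C), Dom = Dom (M \<times>\<^sub>c C),
     Cod = Cod (M \<times>\<^sub>c C), Idt = Idt (M \<times>\<^sub>c C), Comp = Comp (M \<times>\<^sub>c C),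
     Unt = (Unt M, Unt C),
     Tens = \<lparr>FObj = \<lambda>((m, c), (n, d)). (m \<otimes>\<^bsub>M\<^esub> n, c \<otimes>\<^bsub>C\<^esub> d),
             FArr = \<lambda>((f, g), (f', g')). (f \<otimes>\<^sub>1\<^bsub>M\<^esub> f', g \<otimes>\<^sub>1\<^bsub>C\<^esub> g')\<rparr>,
     Lunit = \<lambda>(m, c). (Lunit M m, Lunit C c),
     Runit = \<lambda>(m, c). (Runit M m, Runit C c),
     Assoc = \<lambda>(m, c) (n, d) (p, e). (Assoc M m n p, Assoc C c d e),
     Symm = \<lambda>(m, c) (n, d). (Symm M m n, Symm C c d)\<rparr>"

text \<open>The middle-four interchange
  \<open>(a \<otimes> b) \<otimes> (c \<otimes> d) \<rightarrow> (a \<otimes> c) \<otimes> (b \<otimes> d)\<close>, that is, \<open>a \<otimes> s\<^sub>b\<^sub>c \<otimes> d\<close> up to associators.\<close>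

definition interchange :: "('o, 'a) smc \<Rightarrow> 'o \<Rightarrow> 'o \<Rightarrow> 'o \<Rightarrow> 'o \<Rightarrow> 'a" where
  "interchange C a b c d =
     inv_arr C (Assoc C a c (b \<otimes>\<^bsub>C\<^esub> d))
     \<cdot>\<^bsub>C\<^esub> (Idt C a \<otimes>\<^sub>1\<^bsub>C\<^esub> Assoc C c b d)
     \<cdot>\<^bsub>C\<^esub> (Idt C a \<otimes>\<^sub>1\<^bsub>C\<^esub> (Symm C b c \<otimes>\<^sub>1\<^bsub>C\<^esub> Idt C d))
     \<cdot>\<^bsub>C\<^esub> (Idt C a \<otimes>\<^sub>1\<^bsub>C\<^esub> inv_arr C (Assoc C b c d))
     \<cdot>\<^bsub>C\<^esub> Assoc C a b (c \<otimes>\<^bsub>C\<^esub> d)"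

text \<open>Orientation: \<open>FUnit R : j \<rightarrow> R j\<close> and \<open>FMult R (x, y) : R x \<otimes> R y \<rightarrow> R (x \<otimes> y)\<close>.\<close>

record ('o, 'a, 'p, 'b) monfctr = "('o, 'a, 'p, 'b) fctr" +
  FUnit :: "'b"
  FMult :: "'o \<times> 'o \<Rightarrow> 'b"

locale sym_mon_functor =
  dom_smc: symmetric_monoidal_category M + cod_smc: symmetric_monoidal_category N +
  cat_functor M N R
  for M :: "('o, 'a) smc" and N :: "('p, 'b) smc" and R :: "('o, 'a, 'p, 'b) monfctr" +
  assumes funit_hom: "FUnit R \<in> hom N (Unt N) (FObj R (Unt M))"
    and funit_iso: "is_iso N (FUnit R)"
    and fmult_iso: "nat_iso (M \<times>\<^sub>c M) N
      \<lparr>FObj = \<lambda>(x, y). FObj R x \<otimes>\<^bsub>N\<^esub> FObj R y, FArr = \<lambda>(f, g). FArr R f \<otimes>\<^sub>1\<^bsub>N\<^esub> FArr R g\<rparr>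
      \<lparr>FObj = \<lambda>(x, y). FObj R (x \<otimes>\<^bsub>M\<^esub> y), FArr = \<lambda>(f, g). FArr R (f \<otimes>\<^sub>1\<^bsub>M\<^esub> g)\<rparr>
      (FMult R)"
    and fmult_assoc: "\<lbrakk>x \<in> Obj M; y \<in> Obj M; z \<in> Obj M\<rbrakk> \<Longrightarrow>
      FArr R (Assoc M x y z) \<cdot>\<^bsub>N\<^esub> FMult R (x \<otimes>\<^bsub>M\<^esub> y, z)
        \<cdot>\<^bsub>N\<^esub> (FMult R (x, y) \<otimes>\<^sub>1\<^bsub>N\<^esub> Idt N (FObj R z))
      = FMult R (x, y \<otimes>\<^bsub>M\<^esub> z) \<cdot>\<^bsub>N\<^esub> (Idt N (FObj R x) \<otimes>\<^sub>1\<^bsub>N\<^esub> FMult R (y, z))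
        \<cdot>\<^bsub>N\<^esub> Assoc N (FObj R x) (FObj R y) (FObj R z)"
    and fmult_lunit: "x \<in> Obj M \<Longrightarrow>
      FArr R (Lunit M x) \<cdot>\<^bsub>N\<^esub> FMult R (Unt M, x) \<cdot>\<^bsub>N\<^esub> (FUnit R \<otimes>\<^sub>1\<^bsub>N\<^esub> Idt N (FObj R x))
      = Lunit N (FObj R x)"
    and fmult_runit: "x \<in> Obj M \<Longrightarrow>
      FArr R (Runit M x) \<cdot>\<^bsub>N\<^esub> FMult R (x, Unt M) \<cdot>\<^bsub>N\<^esub> (Idt N (FObj R x) \<otimes>\<^sub>1\<^bsub>N\<^esub> FUnit R)
      = Runit N (FObj R x)"
    and fmult_symm: "\<lbrakk>x \<in> Obj M; y \<in> Obj M\<rbrakk> \<Longrightarrow>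
      FArr R (Symm M x y) \<cdot>\<^bsub>N\<^esub> FMult R (x, y)
      = FMult R (y, x) \<cdot>\<^bsub>N\<^esub> Symm N (FObj R x) (FObj R y)"

locale mon_trans = nat_trans M N R S t
  for M :: "('o, 'a) smc" and N :: "('p, 'b) smc"
    and R :: "('o, 'a, 'p, 'b) monfctr" and S :: "('o, 'a, 'p, 'b) monfctr" and t :: "'o \<Rightarrow> 'b" +
  assumes unit_comp: "t (Unt M) \<cdot>\<^bsub>N\<^esub> FUnit R = FUnit S"
    and mult_comp: "\<lbrakk>x \<in> Obj M; y \<in> Obj M\<rbrakk> \<Longrightarrow>
      t (x \<otimes>\<^bsub>M\<^esub> y) \<cdot>\<^bsub>N\<^esub> FMult R (x, y) = FMult S (x, y) \<cdot>\<^bsub>N\<^esub> (t x \<otimes>\<^sub>1\<^bsub>N\<^esub> t y)"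

text \<open>HOL functions are total, so a functor or transformation is determined only on its carrier.
  The cells of the 2-categories below are therefore required to be extensional, so that equality
  of cells is equality on the carriers.\<close>

definition monfctr_ext :: "('o, 'a) smc \<Rightarrow> ('o, 'a, 'p, 'b) monfctr \<Rightarrow> bool" where
  "monfctr_ext M R \<longleftrightarrow> FObj R \<in> extensional (Obj M) \<and> FArr R \<in> extensional (Arr M)
     \<and> FMult R \<in> extensional (Obj M \<times> Obj M)"

definition id_monfctr :: "('o, 'a) smc \<Rightarrow> ('o, 'a, 'o, 'a) monfctr" where
  "id_monfctr M = \<lparr>FObj = \<lambda>x\<in>Obj M. x, FArr = \<lambda>f\<in>Arr M. f, FUnit = Idt M (Unt M),
     FMult = \<lambda>p\<in>Obj M \<times> Obj M. Idt M (fst p \<otimes>\<^bsub>M\<^esub> snd p)\<rparr>"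

definition comp_monfctr :: "('o, 'a) smc \<Rightarrow> ('q, 'c) smc \<Rightarrow> ('p, 'b, 'q, 'c) monfctr
    \<Rightarrow> ('o, 'a, 'p, 'b) monfctr \<Rightarrow> ('o, 'a, 'q, 'c) monfctr" where
  "comp_monfctr M P S R = \<lparr>FObj = \<lambda>x\<in>Obj M. FObj S (FObj R x),
     FArr = \<lambda>f\<in>Arr M. FArr S (FArr R f),
     FUnit = FArr S (FUnit R) \<cdot>\<^bsub>P\<^esub> FUnit S,
     FMult = \<lambda>p\<in>Obj M \<times> Obj M.
       FArr S (FMult R p) \<cdot>\<^bsub>P\<^esub> FMult S (FObj R (fst p), FObj R (snd p))\<rparr>"

text \<open>\<open>AUnit c : c \<rightarrow> j \<bullet> c\<close> is the unitor \<open>\<eta>\<close>, \<open>AMult m n c : m \<bullet> (n \<bullet> c) \<rightarrow> (m \<otimes> n) \<bullet> c\<close> the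
  multiplicator \<open>\<mu>\<close>, \<open>AInter m n c d : (m \<otimes> n) \<bullet> (c \<boxtimes> d) \<rightarrow> (m \<bullet> c) \<boxtimes> (n \<bullet> d)\<close> the interchanger
  \<open>\<iota>\<close>, and \<open>ANull : i \<rightarrow> j \<bullet> i\<close> the unit comparison of \<open>\<bullet>\<close> as a monoidal functor.\<close>

record ('m, 'f, 'o, 'a) action =
  Act :: "('m \<times> 'o, 'f \<times> 'a, 'o, 'a) fctr"
  AUnit :: "'o \<Rightarrow> 'a"
  AMult :: "'m \<Rightarrow> 'm \<Rightarrow> 'o \<Rightarrow> 'a"

record ('m, 'f, 'o, 'a) monaction = "('m, 'f, 'o, 'a) action" +
  ANull :: "'a"
  AInter :: "'m \<Rightarrow> 'm \<Rightarrow> 'o \<Rightarrow> 'o \<Rightarrow> 'a"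

abbreviation act_obj :: "('m, 'f, 'o, 'a, 'z) action_scheme \<Rightarrow> 'm \<Rightarrow> 'o \<Rightarrow> 'o"
    (infixr "\<bullet>\<index>" 72) where
  "m \<bullet>\<^bsub>A\<^esub> c \<equiv> FObj (Act A) (m, c)"

abbreviation act_arr :: "('m, 'f, 'o, 'a, 'z) action_scheme \<Rightarrow> 'f \<Rightarrow> 'a \<Rightarrow> 'a"
    (infixr "\<bullet>\<^sub>1\<index>" 72) where
  "f \<bullet>\<^sub>1\<^bsub>A\<^esub> g \<equiv> FArr (Act A) (f, g)"

locale left_action = acting: monoidal_category M + acted: category C
  for M :: "('m, 'f, 'y) moncat_scheme" and C :: "('o, 'a, 'x) cat_scheme" +
  fixes A :: "('m, 'f, 'o, 'a, 'z) action_scheme"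
  assumes act_functor: "cat_functor (M \<times>\<^sub>c C) C (Act A)"
    and aunit_iso: "nat_iso C C id_fctr
      \<lparr>FObj = \<lambda>c. Unt M \<bullet>\<^bsub>A\<^esub> c, FArr = \<lambda>g. Idt M (Unt M) \<bullet>\<^sub>1\<^bsub>A\<^esub> g\<rparr> (AUnit A)"
    and amult_iso: "nat_iso (M \<times>\<^sub>c M \<times>\<^sub>c C) C
      \<lparr>FObj = \<lambda>(m, n, c). m \<bullet>\<^bsub>A\<^esub> (n \<bullet>\<^bsub>A\<^esub> c), FArr = \<lambda>(f, f', g). f \<bullet>\<^sub>1\<^bsub>A\<^esub> (f' \<bullet>\<^sub>1\<^bsub>A\<^esub> g)\<rparr>
      \<lparr>FObj = \<lambda>(m, n, c). (m \<otimes>\<^bsub>M\<^esub> n) \<bullet>\<^bsub>A\<^esub> c, FArr = \<lambda>(f, f', g). (f \<otimes>\<^sub>1\<^bsub>M\<^esub> f') \<bullet>\<^sub>1\<^bsub>A\<^esub> g\<rparr>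
      (\<lambda>(m, n, c). AMult A m n c)"
    and amult_assoc: "\<lbrakk>m \<in> Obj M; n \<in> Obj M; p \<in> Obj M; c \<in> Obj C\<rbrakk> \<Longrightarrow>
      (Assoc M m n p \<bullet>\<^sub>1\<^bsub>A\<^esub> Idt C c) \<cdot>\<^bsub>C\<^esub> AMult A (m \<otimes>\<^bsub>M\<^esub> n) p c \<cdot>\<^bsub>C\<^esub> AMult A m n (p \<bullet>\<^bsub>A\<^esub> c)
      = AMult A m (n \<otimes>\<^bsub>M\<^esub> p) c \<cdot>\<^bsub>C\<^esub> (Idt M m \<bullet>\<^sub>1\<^bsub>A\<^esub> AMult A n p c)"
    and amult_aunit_left: "\<lbrakk>m \<in> Obj M; c \<in> Obj C\<rbrakk> \<Longrightarrow>
      AMult A (Unt M) m c \<cdot>\<^bsub>C\<^esub> AUnit A (m \<bullet>\<^bsub>A\<^esub> c) = inv_arr M (Lunit M m) \<bullet>\<^sub>1\<^bsub>A\<^esub> Idt C c"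
    and amult_aunit_right: "\<lbrakk>m \<in> Obj M; c \<in> Obj C\<rbrakk> \<Longrightarrow>
      AMult A m (Unt M) c \<cdot>\<^bsub>C\<^esub> (Idt M m \<bullet>\<^sub>1\<^bsub>A\<^esub> AUnit A c)
      = inv_arr M (Runit M m) \<bullet>\<^sub>1\<^bsub>A\<^esub> Idt C c"

text \<open>The functors between which \<open>\<bullet>\<close>, \<open>\<eta>\<close> and \<open>\<mu>\<close> live, with their (composite) monoidal
  structures. First \<open>\<bullet> : M \<times> C \<rightarrow> C\<close>; its multiplication is \<open>\<iota>\<close> inverted.\<close>

definition act_monfctr :: "('o, 'a) smc \<Rightarrow> ('m, 'f, 'o, 'a) monaction
    \<Rightarrow> ('m \<times> 'o, 'f \<times> 'a, 'o, 'a) monfctr" where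
  "act_monfctr C A = \<lparr>FObj = FObj (Act A), FArr = FArr (Act A), FUnit = ANull A,
     FMult = \<lambda>((m, c), (n, d)). inv_arr C (AInter A m n c d)\<rparr>"

text \<open>\<open>j \<bullet> - : C \<rightarrow> C\<close>, where \<open>j\<close> is the strong monoidal functor from the terminal category picking
  the unit of \<open>M\<close>, with multiplication \<open>Lunit j : j \<otimes> j \<rightarrow> j\<close>.\<close>

definition act_unit_monfctr :: "('m, 'f) smc \<Rightarrow> ('o, 'a) smc \<Rightarrow> ('m, 'f, 'o, 'a) monaction
    \<Rightarrow> ('o, 'a, 'o, 'a) monfctr" where
  "act_unit_monfctr M C A = \<lparr>FObj = \<lambda>c. Unt M \<bullet>\<^bsub>A\<^esub> c, FArr = \<lambda>g. Idt M (Unt M) \<bullet>\<^sub>1\<^bsub>A\<^esub> g,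
     FUnit = ANull A,
     FMult = \<lambda>(c, d). (Lunit M (Unt M) \<bullet>\<^sub>1\<^bsub>A\<^esub> Idt C (c \<otimes>\<^bsub>C\<^esub> d))
       \<cdot>\<^bsub>C\<^esub> inv_arr C (AInter A (Unt M) (Unt M) c d)\<rparr>"

text \<open>\<open>(m, n, c) \<mapsto> m \<bullet> (n \<bullet> c)\<close>, the composite \<open>\<bullet> \<circ> (M \<times> \<bullet>)\<close>.\<close>

definition act_act_monfctr :: "('m, 'f) smc \<Rightarrow> ('o, 'a) smc \<Rightarrow> ('m, 'f, 'o, 'a) monaction
    \<Rightarrow> ('m \<times> 'm \<times> 'o, 'f \<times> 'f \<times> 'a, 'o, 'a) monfctr" where
  "act_act_monfctr M C A = \<lparr>FObj = \<lambda>(m, n, c). m \<bullet>\<^bsub>A\<^esub> (n \<bullet>\<^bsub>A\<^esub> c),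
     FArr = \<lambda>(f, f', g). f \<bullet>\<^sub>1\<^bsub>A\<^esub> (f' \<bullet>\<^sub>1\<^bsub>A\<^esub> g),
     FUnit = (Idt M (Unt M) \<bullet>\<^sub>1\<^bsub>A\<^esub> ANull A) \<cdot>\<^bsub>C\<^esub> ANull A,
     FMult = \<lambda>((m, n, c), (m', n', c')).
       (Idt M (m \<otimes>\<^bsub>M\<^esub> m') \<bullet>\<^sub>1\<^bsub>A\<^esub> inv_arr C (AInter A n n' c c'))
       \<cdot>\<^bsub>C\<^esub> inv_arr C (AInter A m m' (n \<bullet>\<^bsub>A\<^esub> c) (n' \<bullet>\<^bsub>A\<^esub> c'))\<rparr>"

text \<open>\<open>(m, n, c) \<mapsto> (m \<otimes> n) \<bullet> c\<close>, the composite \<open>\<bullet> \<circ> (\<otimes> \<times> C)\<close>, where \<open>\<otimes> : M \<times> M \<rightarrow> M\<close> is strong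
  monoidal via the middle-four interchange.\<close>

definition tens_act_monfctr :: "('m, 'f) smc \<Rightarrow> ('o, 'a) smc \<Rightarrow> ('m, 'f, 'o, 'a) monaction
    \<Rightarrow> ('m \<times> 'm \<times> 'o, 'f \<times> 'f \<times> 'a, 'o, 'a) monfctr" where
  "tens_act_monfctr M C A = \<lparr>FObj = \<lambda>(m, n, c). (m \<otimes>\<^bsub>M\<^esub> n) \<bullet>\<^bsub>A\<^esub> c,
     FArr = \<lambda>(f, f', g). (f \<otimes>\<^sub>1\<^bsub>M\<^esub> f') \<bullet>\<^sub>1\<^bsub>A\<^esub> g,
     FUnit = (inv_arr M (Lunit M (Unt M)) \<bullet>\<^sub>1\<^bsub>A\<^esub> Idt C (Unt C)) \<cdot>\<^bsub>C\<^esub> ANull A,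
     FMult = \<lambda>((m, n, c), (m', n', c')).
       (interchange M m n m' n' \<bullet>\<^sub>1\<^bsub>A\<^esub> Idt C (c \<otimes>\<^bsub>C\<^esub> c'))
       \<cdot>\<^bsub>C\<^esub> inv_arr C (AInter A (m \<otimes>\<^bsub>M\<^esub> n) (m' \<otimes>\<^bsub>M\<^esub> n') c c')\<rparr>"

locale symmetric_action =
  acting: symmetric_monoidal_category M + acted: symmetric_monoidal_category C +
  left_action M C A
  for M :: "('m, 'f) smc" and C :: "('o, 'a) smc" and A :: "('m, 'f, 'o, 'a) monaction" +
  assumes ainter_iso: "nat_iso ((M \<times>\<^sub>c C) \<times>\<^sub>c (M \<times>\<^sub>c C)) C
      \<lparr>FObj = \<lambda>((m, c), (n, d)). (m \<otimes>\<^bsub>M\<^esub> n) \<bullet>\<^bsub>A\<^esub> (c \<otimes>\<^bsub>C\<^esub> d),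
       FArr = \<lambda>((f, g), (f', g')). (f \<otimes>\<^sub>1\<^bsub>M\<^esub> f') \<bullet>\<^sub>1\<^bsub>A\<^esub> (g \<otimes>\<^sub>1\<^bsub>C\<^esub> g')\<rparr>
      \<lparr>FObj = \<lambda>((m, c), (n, d)). (m \<bullet>\<^bsub>A\<^esub> c) \<otimes>\<^bsub>C\<^esub> (n \<bullet>\<^bsub>A\<^esub> d),
       FArr = \<lambda>((f, g), (f', g')). (f \<bullet>\<^sub>1\<^bsub>A\<^esub> g) \<otimes>\<^sub>1\<^bsub>C\<^esub> (f' \<bullet>\<^sub>1\<^bsub>A\<^esub> g')\<rparr>
      (\<lambda>((m, c), (n, d)). AInter A m n c d)"
    and act_sym_mon: "sym_mon_functor (prod_smc M C) C (act_monfctr C A)"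
    and aunit_mon: "mon_trans C C
      \<lparr>FObj = \<lambda>c. c, FArr = \<lambda>g. g, FUnit = Idt C (Unt C), FMult = \<lambda>(c, d). Idt C (c \<otimes>\<^bsub>C\<^esub> d)\<rparr>
      (act_unit_monfctr M C A) (AUnit A)"
    and amult_mon: "mon_trans (prod_smc M (prod_smc M C)) C
      (act_act_monfctr M C A) (tens_act_monfctr M C A) (\<lambda>(m, n, c). AMult A m n c)"

definition self_action :: "('o, 'a) smc \<Rightarrow> ('o, 'a, 'o, 'a) monaction" where
  "self_action C = \<lparr>Act = Tens C,
     AUnit = \<lambda>c. inv_arr C (Lunit C c),
     AMult = \<lambda>m n c. inv_arr C (Assoc C m n c),
     ANull = inv_arr C (Lunit C (Unt C)),
     AInter = interchange C\<rparr>"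

text \<open>Restriction \<open>R\<^sup>* B\<close> along \<open>R : M \<rightarrow> N\<close>. \<open>ANull\<close> and \<open>AInter\<close> are those of \<open>\<bullet> \<circ> (R \<times> C)\<close> as a composite of
  monoidal functors; \<open>AInter\<close> points against \<open>FMult\<close>, whence the inverse.\<close>

definition restriction :: "('n, 'g) smc \<Rightarrow> ('o, 'a) smc \<Rightarrow> ('m, 'f, 'n, 'g) monfctr
    \<Rightarrow> ('n, 'g, 'o, 'a) monaction \<Rightarrow> ('m, 'f, 'o, 'a) monaction" where
  "restriction N C R B = \<lparr>
     Act = \<lparr>FObj = \<lambda>(m, c). FObj R m \<bullet>\<^bsub>B\<^esub> c, FArr = \<lambda>(f, g). FArr R f \<bullet>\<^sub>1\<^bsub>B\<^esub> g\<rparr>,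
     AUnit = \<lambda>c. (FUnit R \<bullet>\<^sub>1\<^bsub>B\<^esub> Idt C c) \<cdot>\<^bsub>C\<^esub> AUnit B c,
     AMult = \<lambda>m n c. (FMult R (m, n) \<bullet>\<^sub>1\<^bsub>B\<^esub> Idt C c) \<cdot>\<^bsub>C\<^esub> AMult B (FObj R m) (FObj R n) c,
     ANull = (FUnit R \<bullet>\<^sub>1\<^bsub>B\<^esub> Idt C (Unt C)) \<cdot>\<^bsub>C\<^esub> ANull B,
     AInter = \<lambda>m n c d. AInter B (FObj R m) (FObj R n) c d
       \<cdot>\<^bsub>C\<^esub> (inv_arr N (FMult R (m, n)) \<bullet>\<^sub>1\<^bsub>B\<^esub> Idt C (c \<otimes>\<^bsub>C\<^esub> d))\<rparr>"

text \<open>An identification of two symmetric actions of \<open>M\<close> on \<open>C\<close>. Compatibility with \<open>ANull\<close> follows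
  from compatibility with the unitors, since monoidality of \<open>\<eta>\<close> forces \<open>ANull\<close> to be \<open>\<eta>\<close> at the
  unit.\<close>

locale action_identification =
  nat_iso "M \<times>\<^sub>c C" C "Act A" "Act B" t
  for M :: "('m, 'f) smc" and C :: "('o, 'a) smc"
    and A :: "('m, 'f, 'o, 'a) monaction" and B :: "('m, 'f, 'o, 'a) monaction"
    and t :: "'m \<times> 'o \<Rightarrow> 'a" +
  assumes aunit_comp: "c \<in> Obj C \<Longrightarrow> t (Unt M, c) \<cdot>\<^bsub>C\<^esub> AUnit A c = AUnit B c"
    and amult_comp: "\<lbrakk>m \<in> Obj M; n \<in> Obj M; c \<in> Obj C\<rbrakk> \<Longrightarrow>
      t (m \<otimes>\<^bsub>M\<^esub> n, c) \<cdot>\<^bsub>C\<^esub> AMult A m n c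
      = AMult B m n c \<cdot>\<^bsub>C\<^esub> t (m, n \<bullet>\<^bsub>B\<^esub> c) \<cdot>\<^bsub>C\<^esub> (Idt M m \<bullet>\<^sub>1\<^bsub>A\<^esub> t (n, c))"
    and ainter_comp: "\<lbrakk>m \<in> Obj M; n \<in> Obj M; c \<in> Obj C; d \<in> Obj C\<rbrakk> \<Longrightarrow>
      (t (m, c) \<otimes>\<^sub>1\<^bsub>C\<^esub> t (n, d)) \<cdot>\<^bsub>C\<^esub> AInter A m n c d
      = AInter B m n c d \<cdot>\<^bsub>C\<^esub> t (m \<otimes>\<^bsub>M\<^esub> n, c \<otimes>\<^bsub>C\<^esub> d)"

text \<open>A (strict) 2-category, presented as a category enriched in categories: 1-cells are the objects
  and 2-cells the arrows of the hom-categories.\<close>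

record ('x, 'f, 't) twocat =
  Obj2 :: "'x set"
  HomCat :: "'x \<Rightarrow> 'x \<Rightarrow> ('f, 't) cat"
  Id1 :: "'x \<Rightarrow> 'f"
  Comp2 :: "'x \<Rightarrow> 'x \<Rightarrow> 'x \<Rightarrow> ('f \<times> 'f, 't \<times> 't, 'f, 't) fctr"

abbreviation comp1 :: "('x, 'f, 't) twocat \<Rightarrow> 'x \<Rightarrow> 'x \<Rightarrow> 'x \<Rightarrow> 'f \<Rightarrow> 'f \<Rightarrow> 'f" where
  "comp1 A x y z g f \<equiv> FObj (Comp2 A x y z) (g, f)"

abbreviation hcomp :: "('x, 'f, 't) twocat \<Rightarrow> 'x \<Rightarrow> 'x \<Rightarrow> 'x \<Rightarrow> 't \<Rightarrow> 't \<Rightarrow> 't" where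
  "hcomp A x y z b a \<equiv> FArr (Comp2 A x y z) (b, a)"

abbreviation id2 :: "('x, 'f, 't) twocat \<Rightarrow> 'x \<Rightarrow> 'x \<Rightarrow> 'f \<Rightarrow> 't" where
  "id2 A x y f \<equiv> Idt (HomCat A x y) f"

locale two_category =
  fixes A :: "('x, 'f, 't) twocat"
  assumes homcat: "\<lbrakk>x \<in> Obj2 A; y \<in> Obj2 A\<rbrakk> \<Longrightarrow> category (HomCat A x y)"
    and id1: "x \<in> Obj2 A \<Longrightarrow> Id1 A x \<in> Obj (HomCat A x x)"
    and comp2: "\<lbrakk>x \<in> Obj2 A; y \<in> Obj2 A; z \<in> Obj2 A\<rbrakk> \<Longrightarrow>
      cat_functor (HomCat A y z \<times>\<^sub>c HomCat A x y) (HomCat A x z) (Comp2 A x y z)"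
    and comp1_assoc: "\<lbrakk>w \<in> Obj2 A; x \<in> Obj2 A; y \<in> Obj2 A; z \<in> Obj2 A;
        f \<in> Obj (HomCat A w x); g \<in> Obj (HomCat A x y); h \<in> Obj (HomCat A y z)\<rbrakk> \<Longrightarrow>
      comp1 A w x z (comp1 A x y z h g) f = comp1 A w y z h (comp1 A w x y g f)"
    and hcomp_assoc: "\<lbrakk>w \<in> Obj2 A; x \<in> Obj2 A; y \<in> Obj2 A; z \<in> Obj2 A;
        a \<in> Arr (HomCat A w x); b \<in> Arr (HomCat A x y); c \<in> Arr (HomCat A y z)\<rbrakk> \<Longrightarrow>
      hcomp A w x z (hcomp A x y z c b) a = hcomp A w y z c (hcomp A w x y b a)"
    and comp1_id_right: "\<lbrakk>x \<in> Obj2 A; y \<in> Obj2 A; f \<in> Obj (HomCat A x y)\<rbrakk> \<Longrightarrow>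
      comp1 A x x y f (Id1 A x) = f"
    and comp1_id_left: "\<lbrakk>x \<in> Obj2 A; y \<in> Obj2 A; f \<in> Obj (HomCat A x y)\<rbrakk> \<Longrightarrow>
      comp1 A x y y (Id1 A y) f = f"
    and hcomp_id_right: "\<lbrakk>x \<in> Obj2 A; y \<in> Obj2 A; a \<in> Arr (HomCat A x y)\<rbrakk> \<Longrightarrow>
      hcomp A x x y a (id2 A x x (Id1 A x)) = a"
    and hcomp_id_left: "\<lbrakk>x \<in> Obj2 A; y \<in> Obj2 A; a \<in> Arr (HomCat A x y)\<rbrakk> \<Longrightarrow>
      hcomp A x y y (id2 A y y (Id1 A y)) a = a"

definition equivalence_1cell :: "('x, 'f, 't) twocat \<Rightarrow> 'x \<Rightarrow> 'x \<Rightarrow> 'f \<Rightarrow> bool" where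
  "equivalence_1cell A x y f \<longleftrightarrow> f \<in> Obj (HomCat A x y)
     \<and> (\<exists>g \<in> Obj (HomCat A y x).
          isomorphic (HomCat A x x) (comp1 A x y x g f) (Id1 A x)
        \<and> isomorphic (HomCat A y y) (comp1 A y x y f g) (Id1 A y))"

definition two_terminal :: "('x, 'f, 't) twocat \<Rightarrow> 'x \<Rightarrow> bool" where
  "two_terminal A u \<longleftrightarrow> two_category A \<and> u \<in> Obj2 A
     \<and> (\<forall>x \<in> Obj2 A. equivalent_categories (HomCat A x u) one_cat)"

text \<open>\<open>PUnit P x : 1 \<Rightarrow> P 1\<close> and \<open>PComp P x y z (g, f) : P g \<circ> P f \<Rightarrow> P (g \<circ> f)\<close>.\<close>

record ('x, 'f, 't, 'y, 'g, 's) psfctr =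
  PObj :: "'x \<Rightarrow> 'y"
  PHom :: "'x \<Rightarrow> 'x \<Rightarrow> ('f, 't, 'g, 's) fctr"
  PUnit :: "'x \<Rightarrow> 's"
  PComp :: "'x \<Rightarrow> 'x \<Rightarrow> 'x \<Rightarrow> 'f \<times> 'f \<Rightarrow> 's"

abbreviation P1 :: "('x, 'f, 't, 'y, 'g, 's) psfctr \<Rightarrow> 'x \<Rightarrow> 'x \<Rightarrow> 'f \<Rightarrow> 'g" where
  "P1 P x y f \<equiv> FObj (PHom P x y) f"

abbreviation P2 :: "('x, 'f, 't, 'y, 'g, 's) psfctr \<Rightarrow> 'x \<Rightarrow> 'x \<Rightarrow> 't \<Rightarrow> 's" where
  "P2 P x y a \<equiv> FArr (PHom P x y) a"

locale pseudofunctor = source: two_category A + target: two_category B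
  for A :: "('x, 'f, 't) twocat" and B :: "('y, 'g, 's) twocat" +
  fixes P :: "('x, 'f, 't, 'y, 'g, 's) psfctr"
  assumes pobj: "x \<in> Obj2 A \<Longrightarrow> PObj P x \<in> Obj2 B"
    and phom: "\<lbrakk>x \<in> Obj2 A; y \<in> Obj2 A\<rbrakk> \<Longrightarrow>
      cat_functor (HomCat A x y) (HomCat B (PObj P x) (PObj P y)) (PHom P x y)"
    and punit: "x \<in> Obj2 A \<Longrightarrow>
      PUnit P x \<in> hom (HomCat B (PObj P x) (PObj P x)) (Id1 B (PObj P x)) (P1 P x x (Id1 A x))"
    and punit_iso: "x \<in> Obj2 A \<Longrightarrow> is_iso (HomCat B (PObj P x) (PObj P x)) (PUnit P x)"
    and pcomp_iso: "\<lbrakk>x \<in> Obj2 A; y \<in> Obj2 A; z \<in> Obj2 A\<rbrakk> \<Longrightarrow>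
      nat_iso (HomCat A y z \<times>\<^sub>c HomCat A x y) (HomCat B (PObj P x) (PObj P z))
        \<lparr>FObj = \<lambda>(g, f). comp1 B (PObj P x) (PObj P y) (PObj P z) (P1 P y z g) (P1 P x y f),
         FArr = \<lambda>(b, a). hcomp B (PObj P x) (PObj P y) (PObj P z) (P2 P y z b) (P2 P x y a)\<rparr>
        \<lparr>FObj = \<lambda>(g, f). P1 P x z (comp1 A x y z g f),
         FArr = \<lambda>(b, a). P2 P x z (hcomp A x y z b a)\<rparr>
        (PComp P x y z)"
    and pcomp_assoc: "\<lbrakk>w \<in> Obj2 A; x \<in> Obj2 A; y \<in> Obj2 A; z \<in> Obj2 A;
        f \<in> Obj (HomCat A w x); g \<in> Obj (HomCat A x y); h \<in> Obj (HomCat A y z)\<rbrakk> \<Longrightarrow>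
      PComp P w x z (comp1 A x y z h g, f)
        \<cdot>\<^bsub>HomCat B (PObj P w) (PObj P z)\<^esub>
        hcomp B (PObj P w) (PObj P x) (PObj P z)
          (PComp P x y z (h, g)) (id2 B (PObj P w) (PObj P x) (P1 P w x f))
      = PComp P w y z (h, comp1 A w x y g f)
        \<cdot>\<^bsub>HomCat B (PObj P w) (PObj P z)\<^esub>
        hcomp B (PObj P w) (PObj P y) (PObj P z)
          (id2 B (PObj P y) (PObj P z) (P1 P y z h)) (PComp P w x y (g, f))"
    and pcomp_punit_right: "\<lbrakk>x \<in> Obj2 A; y \<in> Obj2 A; f \<in> Obj (HomCat A x y)\<rbrakk> \<Longrightarrow>
      PComp P x x y (f, Id1 A x)
        \<cdot>\<^bsub>HomCat B (PObj P x) (PObj P y)\<^esub>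
        hcomp B (PObj P x) (PObj P x) (PObj P y)
          (id2 B (PObj P x) (PObj P y) (P1 P x y f)) (PUnit P x)
      = id2 B (PObj P x) (PObj P y) (P1 P x y f)"
    and pcomp_punit_left: "\<lbrakk>x \<in> Obj2 A; y \<in> Obj2 A; f \<in> Obj (HomCat A x y)\<rbrakk> \<Longrightarrow>
      PComp P x y y (Id1 A y, f)
        \<cdot>\<^bsub>HomCat B (PObj P x) (PObj P y)\<^esub>
        hcomp B (PObj P x) (PObj P y) (PObj P y)
          (PUnit P y) (id2 B (PObj P x) (PObj P y) (P1 P x y f))
      = id2 B (PObj P x) (PObj P y) (P1 P x y f)"

definition id_psfctr :: "('x, 'f, 't) twocat \<Rightarrow> ('x, 'f, 't, 'x, 'f, 't) psfctr" where
  "id_psfctr A = \<lparr>PObj = \<lambda>x. x, PHom = \<lambda>_ _. id_fctr, PUnit = \<lambda>x. id2 A x x (Id1 A x),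
     PComp = \<lambda>x y z (g, f). id2 A x z (comp1 A x y z g f)\<rparr>"

definition comp_psfctr :: "('z, 'h, 'r) twocat
    \<Rightarrow> ('y, 'g, 's, 'z, 'h, 'r) psfctr \<Rightarrow> ('x, 'f, 't, 'y, 'g, 's) psfctr
    \<Rightarrow> ('x, 'f, 't, 'z, 'h, 'r) psfctr" where
  "comp_psfctr D Q P = \<lparr>
     PObj = \<lambda>x. PObj Q (PObj P x),
     PHom = \<lambda>x y. comp_fctr (PHom Q (PObj P x) (PObj P y)) (PHom P x y),
     PUnit = \<lambda>x. P2 Q (PObj P x) (PObj P x) (PUnit P x)
       \<cdot>\<^bsub>HomCat D (PObj Q (PObj P x)) (PObj Q (PObj P x))\<^esub> PUnit Q (PObj P x),
     PComp = \<lambda>x y z (g, f). P2 Q (PObj P x) (PObj P z) (PComp P x y z (g, f))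
       \<cdot>\<^bsub>HomCat D (PObj Q (PObj P x)) (PObj Q (PObj P z))\<^esub>
       PComp Q (PObj P x) (PObj P y) (PObj P z) (P1 P y z g, P1 P x y f)\<rparr>"

text \<open>A pseudonatural transformation from \<open>P\<close> to \<open>Q\<close> has 1-cell components \<open>TObj s x : P x \<rightarrow> Q x\<close> and
  invertible 2-cells \<open>THom s x y f : Q f \<circ> TObj s x \<Rightarrow> TObj s y \<circ> P f\<close>.\<close>

record ('x, 'f, 'g, 's) pstrans =
  TObj :: "'x \<Rightarrow> 'g"
  THom :: "'x \<Rightarrow> 'x \<Rightarrow> 'f \<Rightarrow> 's"

locale pseudonatural = source: pseudofunctor A B P + target: pseudofunctor A B Q
  for A :: "('x, 'f, 't) twocat" and B :: "('y, 'g, 's) twocat"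
    and P :: "('x, 'f, 't, 'y, 'g, 's) psfctr" and Q :: "('x, 'f, 't, 'y, 'g, 's) psfctr" +
  fixes s :: "('x, 'f, 'g, 's) pstrans"
  assumes tobj: "x \<in> Obj2 A \<Longrightarrow> TObj s x \<in> Obj (HomCat B (PObj P x) (PObj Q x))"
    and thom_iso: "\<lbrakk>x \<in> Obj2 A; y \<in> Obj2 A\<rbrakk> \<Longrightarrow>
      nat_iso (HomCat A x y) (HomCat B (PObj P x) (PObj Q y))
        \<lparr>FObj = \<lambda>f. comp1 B (PObj P x) (PObj Q x) (PObj Q y) (P1 Q x y f) (TObj s x),
         FArr = \<lambda>a. hcomp B (PObj P x) (PObj Q x) (PObj Q y)
           (P2 Q x y a) (id2 B (PObj P x) (PObj Q x) (TObj s x))\<rparr>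
        \<lparr>FObj = \<lambda>f. comp1 B (PObj P x) (PObj P y) (PObj Q y) (TObj s y) (P1 P x y f),
         FArr = \<lambda>a. hcomp B (PObj P x) (PObj P y) (PObj Q y)
           (id2 B (PObj P y) (PObj Q y) (TObj s y)) (P2 P x y a)\<rparr>
        (THom s x y)"
    and thom_unit: "x \<in> Obj2 A \<Longrightarrow>
      THom s x x (Id1 A x)
        \<cdot>\<^bsub>HomCat B (PObj P x) (PObj Q x)\<^esub>
        hcomp B (PObj P x) (PObj Q x) (PObj Q x)
          (PUnit Q x) (id2 B (PObj P x) (PObj Q x) (TObj s x))
      = hcomp B (PObj P x) (PObj P x) (PObj Q x)
          (id2 B (PObj P x) (PObj Q x) (TObj s x)) (PUnit P x)"
    and thom_comp: "\<lbrakk>x \<in> Obj2 A; y \<in> Obj2 A; z \<in> Obj2 A;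
        f \<in> Obj (HomCat A x y); g \<in> Obj (HomCat A y z)\<rbrakk> \<Longrightarrow>
      THom s x z (comp1 A x y z g f)
        \<cdot>\<^bsub>HomCat B (PObj P x) (PObj Q z)\<^esub>
        hcomp B (PObj P x) (PObj Q x) (PObj Q z)
          (PComp Q x y z (g, f)) (id2 B (PObj P x) (PObj Q x) (TObj s x))
      = hcomp B (PObj P x) (PObj P z) (PObj Q z)
          (id2 B (PObj P z) (PObj Q z) (TObj s z)) (PComp P x y z (g, f))
        \<cdot>\<^bsub>HomCat B (PObj P x) (PObj Q z)\<^esub>
        hcomp B (PObj P x) (PObj P y) (PObj Q z)
          (THom s y z g) (id2 B (PObj P x) (PObj P y) (P1 P x y f))
        \<cdot>\<^bsub>HomCat B (PObj P x) (PObj Q z)\<^esub>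
        hcomp B (PObj P x) (PObj Q y) (PObj Q z)
          (id2 B (PObj Q y) (PObj Q z) (P1 Q y z g)) (THom s x y f)"

definition pseudonatural_equivalence :: "('x, 'f, 't) twocat \<Rightarrow> ('y, 'g, 's) twocat
    \<Rightarrow> ('x, 'f, 't, 'y, 'g, 's) psfctr \<Rightarrow> ('x, 'f, 't, 'y, 'g, 's) psfctr
    \<Rightarrow> ('x, 'f, 'g, 's) pstrans \<Rightarrow> bool" where
  "pseudonatural_equivalence A B P Q s \<longleftrightarrow> pseudonatural A B P Q s
     \<and> (\<forall>x \<in> Obj2 A. equivalence_1cell B (PObj P x) (PObj Q x) (TObj s x))"

definition biequivalence :: "('x, 'f, 't) twocat \<Rightarrow> ('y, 'g, 's) twocat
    \<Rightarrow> ('x, 'f, 't, 'y, 'g, 's) psfctr \<Rightarrow> bool" where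
  "biequivalence A B P \<longleftrightarrow> pseudofunctor A B P
     \<and> (\<exists>Q s t. pseudofunctor B A Q
          \<and> pseudonatural_equivalence A A (id_psfctr A) (comp_psfctr A Q P) s
          \<and> pseudonatural_equivalence B B (comp_psfctr B P Q) (id_psfctr B) t)"

text \<open>The pseudo-slice of a 2-category over an object \<open>c\<close>: a 1-cell \<open>(x, f) \<rightarrow> (y, g)\<close> is a 1-cell
  \<open>r : x \<rightarrow> y\<close> with an invertible 2-cell \<open>g \<circ> r \<Rightarrow> f\<close>. A 2-cell is stored with its source and
  target.\<close>

definition slice_hom :: "('x, 'f, 't) twocat \<Rightarrow> 'x \<Rightarrow> 'x \<times> 'f \<Rightarrow> 'x \<times> 'f
    \<Rightarrow> ('f \<times> 't, ('f \<times> 't) \<times> ('f \<times> 't) \<times> 't) cat" where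
  "slice_hom A c = (\<lambda>(x, f) (y, g).
     let cells = {(r, \<gamma>). r \<in> Obj (HomCat A x y)
           \<and> \<gamma> \<in> hom (HomCat A x c) (comp1 A x y c g r) f \<and> is_iso (HomCat A x c) \<gamma>}
     in \<lparr>Obj = cells,
         Arr = {((r, \<gamma>), (r', \<gamma>'), \<phi>) | r \<gamma> r' \<gamma>' \<phi>. (r, \<gamma>) \<in> cells \<and> (r', \<gamma>') \<in> cells
           \<and> \<phi> \<in> hom (HomCat A x y) r r'
           \<and> \<gamma>' \<cdot>\<^bsub>HomCat A x c\<^esub> hcomp A x y c (id2 A y c g) \<phi> = \<gamma>},
         Dom = \<lambda>(k, k', \<phi>). k,
         Cod = \<lambda>(k, k', \<phi>). k',
         Idt = \<lambda>k. (k, k, id2 A x y (fst k)),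
         Comp = \<lambda>(k', k'', \<psi>) (k, _, \<phi>). (k, k'', \<psi> \<cdot>\<^bsub>HomCat A x y\<^esub> \<phi>)\<rparr>)"

definition slice_comp1 :: "('x, 'f, 't) twocat \<Rightarrow> 'x \<Rightarrow> 'x \<times> 'f \<Rightarrow> 'x \<times> 'f \<Rightarrow> 'x \<times> 'f
    \<Rightarrow> 'f \<times> 't \<Rightarrow> 'f \<times> 't \<Rightarrow> 'f \<times> 't" where
  "slice_comp1 A c = (\<lambda>(x, f) (y, g) (z, h) (s, \<delta>) (r, \<gamma>).
     (comp1 A x y z s r, \<gamma> \<cdot>\<^bsub>HomCat A x c\<^esub> hcomp A x y c \<delta> (id2 A x y r)))"

definition slice_2cat :: "('x, 'f, 't) twocat \<Rightarrow> 'x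
    \<Rightarrow> ('x \<times> 'f, 'f \<times> 't, ('f \<times> 't) \<times> ('f \<times> 't) \<times> 't) twocat" where
  "slice_2cat A c = \<lparr>
     Obj2 = {(x, f). x \<in> Obj2 A \<and> f \<in> Obj (HomCat A x c)},
     HomCat = slice_hom A c,
     Id1 = \<lambda>(x, f). (Id1 A x, id2 A x c f),
     Comp2 = \<lambda>X Y Z. \<lparr>
       FObj = \<lambda>(k, l). slice_comp1 A c X Y Z k l,
       FArr = \<lambda>((k, k', \<psi>), (l, l', \<phi>)).
         (slice_comp1 A c X Y Z k l, slice_comp1 A c X Y Z k' l',
          hcomp A (fst X) (fst Y) (fst Z) \<psi> \<phi>)\<rparr>\<rparr>"

text \<open>A 2-cell is stored with its source and target. The types \<open>'o\<close> and \<open>'a\<close> play the role of the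
  universe in which the objects and arrows of the categories live.\<close>

definition smc_hom :: "('o, 'a) smc \<Rightarrow> ('p, 'b) smc
    \<Rightarrow> (('o, 'a, 'p, 'b) monfctr,
        ('o, 'a, 'p, 'b) monfctr \<times> ('o, 'a, 'p, 'b) monfctr \<times> ('o \<Rightarrow> 'b)) cat" where
  "smc_hom M N =
     (let cells = {R. sym_mon_functor M N R \<and> monfctr_ext M R}
      in \<lparr>Obj = cells,
          Arr = {(R, S, \<phi>). R \<in> cells \<and> S \<in> cells \<and> mon_trans M N R S \<phi> \<and> \<phi> \<in> extensional (Obj M)},
          Dom = \<lambda>(R, S, \<phi>). R,
          Cod = \<lambda>(R, S, \<phi>). S,
          Idt = \<lambda>R. (R, R, \<lambda>m\<in>Obj M. Idt N (FObj R m)),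
          Comp = \<lambda>(S, T, \<psi>) (R, _, \<phi>). (R, T, \<lambda>m\<in>Obj M. \<psi> m \<cdot>\<^bsub>N\<^esub> \<phi> m)\<rparr>)"

text \<open>Horizontal composite of \<open>\<phi> : R \<Rightarrow> R'\<close> and \<open>\<psi> : S \<Rightarrow> S'\<close>, given \<open>R'\<close> and \<open>S\<close>.\<close>

definition hcomp_trans :: "('o, 'a) smc \<Rightarrow> ('q, 'c) smc \<Rightarrow> ('p, 'b, 'q, 'c) monfctr
    \<Rightarrow> ('p \<Rightarrow> 'c) \<Rightarrow> ('o, 'a, 'p, 'b) monfctr \<Rightarrow> ('o \<Rightarrow> 'b) \<Rightarrow> ('o \<Rightarrow> 'c)" where
  "hcomp_trans M P S \<psi> R' \<phi> = (\<lambda>m\<in>Obj M. \<psi> (FObj R' m) \<cdot>\<^bsub>P\<^esub> FArr S (\<phi> m))"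

definition smc_2cat :: "(('o, 'a) smc, ('o, 'a, 'o, 'a) monfctr,
    ('o, 'a, 'o, 'a) monfctr \<times> ('o, 'a, 'o, 'a) monfctr \<times> ('o \<Rightarrow> 'a)) twocat" where
  "smc_2cat = \<lparr>
     Obj2 = {M. symmetric_monoidal_category M},
     HomCat = smc_hom,
     Id1 = id_monfctr,
     Comp2 = \<lambda>M N P. \<lparr>
       FObj = \<lambda>(S, R). comp_monfctr M P S R,
       FArr = \<lambda>((S, S', \<psi>), (R, R', \<phi>)).
         (comp_monfctr M P S R, comp_monfctr M P S' R', hcomp_trans M P S \<psi> R' \<phi>)\<rparr>\<rparr>"

text \<open>A 1-cell \<open>(M, A) \<rightarrow> (N, B)\<close> is \<open>R : M \<rightarrow> N\<close> with an identification \<open>R\<^sup>* B \<cong> A\<close>.\<close>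

definition act_hom :: "('o, 'a) smc
    \<Rightarrow> ('m, 'f) smc \<times> ('m, 'f, 'o, 'a) monaction \<Rightarrow> ('n, 'g) smc \<times> ('n, 'g, 'o, 'a) monaction
    \<Rightarrow> (('m, 'f, 'n, 'g) monfctr \<times> ('m \<times> 'o \<Rightarrow> 'a),
        (('m, 'f, 'n, 'g) monfctr \<times> ('m \<times> 'o \<Rightarrow> 'a))
        \<times> (('m, 'f, 'n, 'g) monfctr \<times> ('m \<times> 'o \<Rightarrow> 'a)) \<times> ('m \<Rightarrow> 'g)) cat" where
  "act_hom C = (\<lambda>(M, A) (N, B).
     let cells = {(R, \<theta>). sym_mon_functor M N R \<and> monfctr_ext M R
           \<and> action_identification M C (restriction N C R B) A \<theta>
           \<and> \<theta> \<in> extensional (Obj M \<times> Obj C)}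
     in \<lparr>Obj = cells,
         Arr = {((R, \<theta>), (R', \<theta>'), \<phi>) | R \<theta> R' \<theta>' \<phi>. (R, \<theta>) \<in> cells \<and> (R', \<theta>') \<in> cells
           \<and> mon_trans M N R R' \<phi> \<and> \<phi> \<in> extensional (Obj M)
           \<and> (\<forall>m \<in> Obj M. \<forall>c \<in> Obj C. \<theta>' (m, c) \<cdot>\<^bsub>C\<^esub> (\<phi> m \<bullet>\<^sub>1\<^bsub>B\<^esub> Idt C c) = \<theta> (m, c))},
         Dom = \<lambda>(k, k', \<phi>). k,
         Cod = \<lambda>(k, k', \<phi>). k',
         Idt = \<lambda>k. (k, k, \<lambda>m\<in>Obj M. Idt N (FObj (fst k) m)),
         Comp = \<lambda>(k', k'', \<psi>) (k, _, \<phi>). (k, k'', \<lambda>m\<in>Obj M. \<psi> m \<cdot>\<^bsub>N\<^esub> \<phi> m)\<rparr>)"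

definition act_comp1 :: "('o, 'a) smc \<Rightarrow> ('m, 'f) smc \<Rightarrow> ('p, 'h) smc
    \<Rightarrow> ('n, 'g, 'p, 'h) monfctr \<times> ('n \<times> 'o \<Rightarrow> 'a) \<Rightarrow> ('m, 'f, 'n, 'g) monfctr \<times> ('m \<times> 'o \<Rightarrow> 'a)
    \<Rightarrow> ('m, 'f, 'p, 'h) monfctr \<times> ('m \<times> 'o \<Rightarrow> 'a)" where
  "act_comp1 C M P = (\<lambda>(S, \<kappa>) (R, \<theta>). (comp_monfctr M P S R,
     \<lambda>p\<in>Obj M \<times> Obj C. \<theta> p \<cdot>\<^bsub>C\<^esub> \<kappa> (FObj R (fst p), snd p)))"

definition act_2cat :: "('o, 'a) smc
    \<Rightarrow> (('m, 'f) smc \<times> ('m, 'f, 'o, 'a) monaction,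
        ('m, 'f, 'm, 'f) monfctr \<times> ('m \<times> 'o \<Rightarrow> 'a),
        (('m, 'f, 'm, 'f) monfctr \<times> ('m \<times> 'o \<Rightarrow> 'a))
        \<times> (('m, 'f, 'm, 'f) monfctr \<times> ('m \<times> 'o \<Rightarrow> 'a)) \<times> ('m \<Rightarrow> 'f)) twocat" where
  "act_2cat C = \<lparr>
     Obj2 = {(M, A). symmetric_action M C A},
     HomCat = act_hom C,
     Id1 = \<lambda>(M, A). (id_monfctr M, \<lambda>p\<in>Obj M \<times> Obj C. Idt C (fst p \<bullet>\<^bsub>A\<^esub> snd p)),
     Comp2 = \<lambda>(M, _) _ (P, _). \<lparr>
       FObj = \<lambda>(k, l). act_comp1 C M P k l,
       FArr = \<lambda>((k, k', \<psi>), (l, l', \<phi>)).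
         (act_comp1 C M P k l, act_comp1 C M P k' l', hcomp_trans M P (fst k) \<psi> (fst l') \<phi>)\<rparr>\<rparr>"

text \<open>The 2-functor from the slice over \<open>C\<close> induced by the self-action: it restricts the self-action
  along \<open>F : M \<rightarrow> C\<close>, and sends \<open>(R, \<gamma>)\<close> with \<open>\<gamma> : G \<circ> R \<Rightarrow> F\<close> to \<open>R\<close> with the identification
  \<open>\<gamma>\<^sub>m \<boxtimes> c : G (R m) \<boxtimes> c \<rightarrow> F m \<boxtimes> c\<close>. Its comparison 2-cells are identities.\<close>

definition restrict_cell :: "('o, 'a) smc \<Rightarrow> ('m, 'f) smc
    \<Rightarrow> 'r \<times> ('q \<times> 's \<times> ('m \<Rightarrow> 'a)) \<Rightarrow> 'r \<times> ('m \<times> 'o \<Rightarrow> 'a)" where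
  "restrict_cell C M = (\<lambda>(R, (_, _, \<gamma>)).
     (R, \<lambda>p\<in>Obj M \<times> Obj C. \<gamma> (fst p) \<otimes>\<^sub>1\<^bsub>C\<^esub> Idt C (snd p)))"

definition self_restriction :: "('o, 'a) smc \<Rightarrow>
   (('o, 'a) smc \<times> ('o, 'a, 'o, 'a) monfctr,
    ('o, 'a, 'o, 'a) monfctr
      \<times> (('o, 'a, 'o, 'a) monfctr \<times> ('o, 'a, 'o, 'a) monfctr \<times> ('o \<Rightarrow> 'a)),
    (('o, 'a, 'o, 'a) monfctr
      \<times> (('o, 'a, 'o, 'a) monfctr \<times> ('o, 'a, 'o, 'a) monfctr \<times> ('o \<Rightarrow> 'a)))
    \<times> (('o, 'a, 'o, 'a) monfctr
      \<times> (('o, 'a, 'o, 'a) monfctr \<times> ('o, 'a, 'o, 'a) monfctr \<times> ('o \<Rightarrow> 'a)))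
    \<times> (('o, 'a, 'o, 'a) monfctr \<times> ('o, 'a, 'o, 'a) monfctr \<times> ('o \<Rightarrow> 'a)),
    ('o, 'a) smc \<times> ('o, 'a, 'o, 'a) monaction,
    ('o, 'a, 'o, 'a) monfctr \<times> ('o \<times> 'o \<Rightarrow> 'a),
    (('o, 'a, 'o, 'a) monfctr \<times> ('o \<times> 'o \<Rightarrow> 'a))
    \<times> (('o, 'a, 'o, 'a) monfctr \<times> ('o \<times> 'o \<Rightarrow> 'a)) \<times> ('o \<Rightarrow> 'a)) psfctr" where
  "self_restriction C =
     (let ob = (\<lambda>(M, F). (M, restriction C C F (self_action C)));
          ce = (\<lambda>X. restrict_cell C (fst X))
      in \<lparr>PObj = ob,
          PHom = \<lambda>X Y. \<lparr>FObj = ce X, FArr = \<lambda>(k, k', (_, _, \<phi>)). (ce X k, ce X k', \<phi>)\<rparr>,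
          PUnit = \<lambda>X. id2 (act_2cat C) (ob X) (ob X) (Id1 (act_2cat C) (ob X)),
          PComp = \<lambda>X Y Z (k, l). id2 (act_2cat C) (ob X) (ob Z)
            (comp1 (act_2cat C) (ob X) (ob Y) (ob Z) (ce Y k) (ce X l))\<rparr>)"

end

theory Submission
  imports Defs
begin

text \<open>
  For a symmetric action \<open>\<bullet>\<close> of \<open>M\<close> on \<open>C\<close> put \<open>F m = m \<bullet> i\<close>, the composite of the strong symmetric
  monoidal functors \<open>m \<mapsto> (m, i)\<close> and \<open>\<bullet> : M \<times> C \<rightarrow> C\<close>. Monoidality of \<open>\<bullet>\<close> gives
  \<open>\<theta> : F m \<boxtimes> c \<rightarrow> (m \<bullet> i) \<boxtimes> (j \<bullet> c) \<rightarrow> (m \<otimes> j) \<bullet> (i \<boxtimes> c) \<rightarrow> m \<bullet> c\<close>, and \<open>\<theta>\<close> identifies the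
  restriction of the self-action along \<open>F\<close> with \<open>\<bullet>\<close>. An identification \<open>t\<close> of two actions is
  compatible with interchangers and unitors, so \<open>t (m, c) \<circ> \<theta> = \<theta> \<circ> (t (m, i) \<boxtimes> c)\<close>: it is determined by
  the monoidal transformation \<open>t (-, i)\<close>, which gives uniqueness. For the equivalence, \<open>\<bullet> \<mapsto> F\<close> is a strict
  2-functor, inverse to restriction of the self-action up to \<open>\<theta>\<close> and \<open>\<rho> : F m \<boxtimes> i \<rightarrow> F m\<close>, whose naturality
  squares commute strictly.
\<close>

text \<open>Three points shape the proof. The interchange of four factors is at once the
  interchanger of the self-action and the monoidal structure of \<otimes> that enters the
  monoidality of the multiplicator, so its coherence is needed in full; it is derived from the
  pentagon and the hexagon through \<open>lswap\<close>, the exchange of the first two of three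
  factors bracketed to the right. Next, \<theta> is built from the interchanger and the unitor alone
  but must also respect the multiplicator. Only the assumption that the multiplicator is itself a
  monoidal transformation links the two; \<open>amult_rep_ident\<close> extracts this link. Finally,
  the functor represented by a restricted action equals a composite as a record
  (\<open>rep_functor_restriction\<close>), since both are cut down to the carriers. This is why the
  passage from actions to functors is strict, so that the coherence laws of pseudofunctors and
  pseudonatural transformations are checked once, with all comparison 2-cells identities.\<close>

text \<open>Below, the structure is an argument of the infix operators: \<open>g \<cdot>C f\<close> is \<open>Comp C g f\<close>, and
  \<open>\<boxtimes>\<close>, \<open>\<star>\<close> are the arrow parts of the tensor product and of an action.\<close>

no_notation Comp (infixl "\<cdot>\<index>" 60)
no_notation tens_obj (infixl "\<otimes>\<index>" 70)
no_notation tens_arr (infixl "\<otimes>\<^sub>1\<index>" 70)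
no_notation act_obj (infixr "\<bullet>\<index>" 72)
no_notation act_arr (infixr "\<bullet>\<^sub>1\<index>" 72)

abbreviation comp_in ("_ \<cdot>_ _" [60, 1000, 61] 60) where "g \<cdot>C f \<equiv> Comp C g f"
abbreviation tens_obj_in ("_ \<otimes>_ _" [70, 1000, 71] 70) where "x \<otimes>C y \<equiv> tens_obj C x y"
abbreviation tens_arr_in ("_ \<boxtimes>_ _" [70, 1000, 71] 70) where "f \<boxtimes>C g \<equiv> tens_arr C f g"
abbreviation act_obj_in ("_ \<bullet>_ _" [73, 1000, 72] 72) where "m \<bullet>A c \<equiv> act_obj A m c"
abbreviation act_arr_in ("_ \<star>_ _" [73, 1000, 72] 72) where "f \<star>A g \<equiv> act_arr A f g"

section \<open>Categories, functors and natural transformations\<close>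

lemma hom_iff: "f \<in> hom C x y \<longleftrightarrow> f \<in> Arr C \<and> Dom C f = x \<and> Cod C f = y"
  by (simp add: hom_def)

text \<open>The axioms of \<open>category\<close> speak of \<open>hom C x y\<close>; here
  composability is the equation \<open>Cod C f = Dom C g\<close>, the form in which side conditions
  are solved by rewriting in the later proofs.\<close>

lemma categoryI:
  assumes "\<And>f. f \<in> Arr C \<Longrightarrow> Dom C f \<in> Obj C \<and> Cod C f \<in> Obj C"
    and "\<And>x. x \<in> Obj C \<Longrightarrow> Idt C x \<in> Arr C \<and> Dom C (Idt C x) = x \<and> Cod C (Idt C x) = x"
    and "\<And>f g. \<lbrakk>f \<in> Arr C; g \<in> Arr C; Cod C f = Dom C g\<rbrakk> \<Longrightarrow>
      g \<cdot>C f \<in> Arr C \<and> Dom C (g \<cdot>C f) = Dom C f \<and> Cod C (g \<cdot>C f) = Cod C g"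
    and "\<And>f g h. \<lbrakk>f \<in> Arr C; g \<in> Arr C; h \<in> Arr C; Cod C f = Dom C g; Cod C g = Dom C h\<rbrakk> \<Longrightarrow>
      (h \<cdot>C g) \<cdot>C f = h \<cdot>C (g \<cdot>C f)"
    and "\<And>f. f \<in> Arr C \<Longrightarrow> f \<cdot>C Idt C (Dom C f) = f \<and> Idt C (Cod C f) \<cdot>C f = f"
  shows "category C"
  using assms by unfold_locales (auto simp: hom_iff)

context category
begin

lemma dom_obj' [simp]: "f \<in> Arr C \<Longrightarrow> Dom C f \<in> Obj C"
  and cod_obj' [simp]: "f \<in> Arr C \<Longrightarrow> Cod C f \<in> Obj C"
  by (auto intro: dom_obj cod_obj)

lemma idt_arr [simp]: "x \<in> Obj C \<Longrightarrow> Idt C x \<in> Arr C"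
  and dom_idt [simp]: "x \<in> Obj C \<Longrightarrow> Dom C (Idt C x) = x"
  and cod_idt [simp]: "x \<in> Obj C \<Longrightarrow> Cod C (Idt C x) = x"
  using idt_hom by (auto simp: hom_iff)

lemma comp_arr [simp]: "\<lbrakk>f \<in> Arr C; g \<in> Arr C; Cod C f = Dom C g\<rbrakk> \<Longrightarrow> g \<cdot>C f \<in> Arr C"
  and dom_comp [simp]: "\<lbrakk>f \<in> Arr C; g \<in> Arr C; Cod C f = Dom C g\<rbrakk> \<Longrightarrow> Dom C (g \<cdot>C f) = Dom C f"
  and cod_comp [simp]: "\<lbrakk>f \<in> Arr C; g \<in> Arr C; Cod C f = Dom C g\<rbrakk> \<Longrightarrow> Cod C (g \<cdot>C f) = Cod C g"
  using comp_hom[of f "Dom C f" "Cod C f" g "Cod C g"] by (auto simp: hom_iff)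

text \<open>As a rewrite rule this brackets every composite to the right. Coherence axioms later get
  primed copies, such as \<open>pentagon'\<close> and \<open>fmult_assoc'\<close>, whose sides
  already have this form.\<close>

lemma comp_assoc' [simp]:
  "\<lbrakk>f \<in> Arr C; g \<in> Arr C; h \<in> Arr C; Cod C f = Dom C g; Cod C g = Dom C h\<rbrakk>
    \<Longrightarrow> (h \<cdot>C g) \<cdot>C f = h \<cdot>C (g \<cdot>C f)"
  by (rule comp_assoc) (auto simp: hom_iff)

lemma comp_idt [simp]: "\<lbrakk>f \<in> Arr C; Dom C f = x\<rbrakk> \<Longrightarrow> f \<cdot>C Idt C x = f"
  and idt_comp [simp]: "\<lbrakk>f \<in> Arr C; Cod C f = x\<rbrakk> \<Longrightarrow> Idt C x \<cdot>C f = f"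
  using comp_idt_right[of f] comp_idt_left[of f] by (auto simp: hom_iff)

text \<open>In a right-bracketed composite the factors \<open>g\<close> and \<open>f\<close> are no
  longer a subterm once something follows them. This turns an equation for
  \<open>g \<cdot>C f\<close> into one that applies in the middle of a composite.\<close>

lemma comp_extend:
  assumes "g \<cdot>C f = h" "f \<in> Arr C" "g \<in> Arr C" "k \<in> Arr C" "Cod C f = Dom C g" "Cod C k = Dom C f"
  shows "g \<cdot>C (f \<cdot>C k) = h \<cdot>C k"
  using assms by auto

text \<open>The same for an equation with three factors on its left, such as the unit laws of a
  monoidal functor.\<close>

lemma comp_extend3:
  assumes "g \<cdot>C (f \<cdot>C e) = h" "e \<in> Arr C" "f \<in> Arr C" "g \<in> Arr C" "k \<in> Arr C"
    "Cod C f = Dom C g" "Cod C e = Dom C f" "Cod C k = Dom C e"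
  shows "g \<cdot>C (f \<cdot>C (e \<cdot>C k)) = h \<cdot>C k"
  using assms by auto

text \<open>Makes the definite description in \<open>inv_arr\<close> well defined.\<close>

lemma inverse_arrows_unique:
  assumes "inverse_arrows C f g" "inverse_arrows C f h"
  shows "g = h"
proof -
  have g: "f \<in> Arr C" "g \<in> Arr C" "Dom C g = Cod C f" "Cod C g = Dom C f"
    and h: "h \<in> Arr C" "Dom C h = Cod C f" "Cod C h = Dom C f"
    and e: "g \<cdot>C f = Idt C (Dom C f)" "f \<cdot>C h = Idt C (Cod C f)"
    using assms by (auto simp: inverse_arrows_def hom_iff)
  have "g = g \<cdot>C (f \<cdot>C h)" using e g by simp
  also have "\<dots> = (g \<cdot>C f) \<cdot>C h" using g h by (subst comp_assoc') auto
  also have "\<dots> = h" using e h by simp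
  finally show ?thesis .
qed

lemma inv_arr_eqI:
  assumes "f \<in> Arr C" "g \<in> Arr C" "Dom C g = Cod C f" "Cod C g = Dom C f"
    "g \<cdot>C f = Idt C (Dom C f)" "f \<cdot>C g = Idt C (Cod C f)"
  shows "inv_arr C f = g"
  unfolding inv_arr_def
  using assms by (intro the_equality inverse_arrows_unique) (auto simp: inverse_arrows_def hom_iff)

lemma is_isoI:
  assumes "f \<in> Arr C" "g \<in> Arr C" "Dom C g = Cod C f" "Cod C g = Dom C f"
    "g \<cdot>C f = Idt C (Dom C f)" "f \<cdot>C g = Idt C (Cod C f)"
  shows "is_iso C f"
  unfolding is_iso_def
  using assms by (auto simp: inverse_arrows_def hom_iff)

lemma inverse_arrows_inv: "is_iso C f \<Longrightarrow> inverse_arrows C f (inv_arr C f)"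
  unfolding is_iso_def inv_arr_def by (metis inverse_arrows_unique the_equality)

lemma iso_arr: "is_iso C f \<Longrightarrow> f \<in> Arr C"
  by (auto simp: is_iso_def inverse_arrows_def)

lemma inv_arr [simp]: "is_iso C f \<Longrightarrow> inv_arr C f \<in> Arr C"
  and dom_inv [simp]: "is_iso C f \<Longrightarrow> Dom C (inv_arr C f) = Cod C f"
  and cod_inv [simp]: "is_iso C f \<Longrightarrow> Cod C (inv_arr C f) = Dom C f"
  and inv_comp [simp]: "is_iso C f \<Longrightarrow> inv_arr C f \<cdot>C f = Idt C (Dom C f)"
  and comp_inv [simp]: "is_iso C f \<Longrightarrow> f \<cdot>C inv_arr C f = Idt C (Cod C f)"
  using inverse_arrows_inv[of f] by (auto simp: inverse_arrows_def hom_iff)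

lemma inv_comp_cancel [simp]:
  "\<lbrakk>is_iso C f; k \<in> Arr C; Cod C k = Dom C f\<rbrakk> \<Longrightarrow> inv_arr C f \<cdot>C (f \<cdot>C k) = k"
  by (subst comp_extend[OF inv_comp]) (auto intro: iso_arr)

lemma comp_inv_cancel [simp]:
  "\<lbrakk>is_iso C f; k \<in> Arr C; Cod C k = Cod C f\<rbrakk> \<Longrightarrow> f \<cdot>C (inv_arr C f \<cdot>C k) = k"
  by (subst comp_extend[OF comp_inv]) (auto intro: iso_arr)

lemma iso_inv [simp]: "is_iso C f \<Longrightarrow> is_iso C (inv_arr C f)"
  and inv_inv [simp]: "is_iso C f \<Longrightarrow> inv_arr C (inv_arr C f) = f"
  by (auto intro!: is_isoI[where g = f] inv_arr_eqI intro: iso_arr)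

lemma iso_idt [simp]: "x \<in> Obj C \<Longrightarrow> is_iso C (Idt C x)"
  and inv_idt [simp]: "x \<in> Obj C \<Longrightarrow> inv_arr C (Idt C x) = Idt C x"
  by (auto intro!: is_isoI[where g = "Idt C x"] inv_arr_eqI)

lemma iso_comp [simp]: "\<lbrakk>is_iso C f; is_iso C g; Cod C f = Dom C g\<rbrakk> \<Longrightarrow> is_iso C (g \<cdot>C f)"
  and inv_of_comp: "\<lbrakk>is_iso C f; is_iso C g; Cod C f = Dom C g\<rbrakk>
    \<Longrightarrow> inv_arr C (g \<cdot>C f) = inv_arr C f \<cdot>C inv_arr C g"
  using iso_arr[of f] iso_arr[of g]
  by (auto intro!: is_isoI[where g = "inv_arr C f \<cdot>C inv_arr C g"] inv_arr_eqI)

lemma iso_cancel_left: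
  assumes "f \<cdot>C g = f \<cdot>C h" "is_iso C f" "g \<in> Arr C" "h \<in> Arr C" "Cod C g = Dom C f" "Cod C h = Dom C f"
  shows "g = h"
  using assms inv_comp_cancel by metis

lemma iso_cancel_right:
  assumes "g \<cdot>C f = h \<cdot>C f" "is_iso C f" "g \<in> Arr C" "h \<in> Arr C" "Dom C g = Cod C f" "Dom C h = Cod C f"
  shows "g = h"
proof -
  note f = iso_arr[OF assms(2)]
  have "g = (g \<cdot>C f) \<cdot>C inv_arr C f" using assms(2-) f by simp
  also have "\<dots> = h" unfolding assms(1) using assms(2-) f by simp
  finally show ?thesis .
qed

end

section \<open>Functors and natural transformations in terms of domains and codomains\<close>

lemma cat_functorI:
  assumes "category A" "category B"
    and "\<And>x. x \<in> Obj A \<Longrightarrow> FObj F x \<in> Obj B"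
    and "\<And>f. f \<in> Arr A \<Longrightarrow> FArr F f \<in> Arr B \<and> Dom B (FArr F f) = FObj F (Dom A f)
      \<and> Cod B (FArr F f) = FObj F (Cod A f)"
    and "\<And>x. x \<in> Obj A \<Longrightarrow> FArr F (Idt A x) = Idt B (FObj F x)"
    and "\<And>f g. \<lbrakk>f \<in> Arr A; g \<in> Arr A; Cod A f = Dom A g\<rbrakk> \<Longrightarrow>
      FArr F (g \<cdot>A f) = FArr F g \<cdot>B FArr F f"
  shows "cat_functor A B F"
proof -
  interpret A: category A by fact
  interpret B: category B by fact
  show ?thesis using assms by unfold_locales (auto simp: hom_iff)
qed

context cat_functor
begin

lemma farr_arr [simp]: "f \<in> Arr A \<Longrightarrow> FArr F f \<in> Arr B"
  and dom_farr [simp]: "f \<in> Arr A \<Longrightarrow> Dom B (FArr F f) = FObj F (Dom A f)"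
  and cod_farr [simp]: "f \<in> Arr A \<Longrightarrow> Cod B (FArr F f) = FObj F (Cod A f)"
  using farr[of f "Dom A f" "Cod A f"] by (auto simp: hom_iff)

lemma fobj_obj [simp]: "x \<in> Obj A \<Longrightarrow> FObj F x \<in> Obj B"
  by (rule fobj)

lemma farr_comp' [simp]:
  "\<lbrakk>f \<in> Arr A; g \<in> Arr A; Cod A f = Dom A g\<rbrakk> \<Longrightarrow> FArr F (g \<cdot>A f) = FArr F g \<cdot>B FArr F f"
  by (rule farr_comp) (auto simp: hom_iff)

lemma farr_idt' [simp]: "x \<in> Obj A \<Longrightarrow> FArr F (Idt A x) = Idt B (FObj F x)"
  by (rule farr_idt)

lemma farr_iso [simp]: "is_iso A f \<Longrightarrow> is_iso B (FArr F f)"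
  and farr_inv: "is_iso A f \<Longrightarrow> FArr F (inv_arr A f) = inv_arr B (FArr F f)"
proof -
  assume f: "is_iso A f"
  note a = dom_cat.iso_arr[OF f]
  have 1: "FArr F (inv_arr A f) \<cdot>B FArr F f = Idt B (FObj F (Dom A f))"
    "FArr F f \<cdot>B FArr F (inv_arr A f) = Idt B (FObj F (Cod A f))"
    using f a by (simp_all flip: farr_comp')
  show "is_iso B (FArr F f)"
    by (rule cod_cat.is_isoI[where g = "FArr F (inv_arr A f)"]) (use f a 1 in auto)
  show "FArr F (inv_arr A f) = inv_arr B (FArr F f)"
    by (rule cod_cat.inv_arr_eqI[symmetric]) (use f a 1 in auto)
qed

end

lemma nat_transI:
  assumes "cat_functor A B F" "cat_functor A B G"
    and "\<And>x. x \<in> Obj A \<Longrightarrow> t x \<in> Arr B \<and> Dom B (t x) = FObj F x \<and> Cod B (t x) = FObj G x"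
    and "\<And>f. f \<in> Arr A \<Longrightarrow> FArr G f \<cdot>B t (Dom A f) = t (Cod A f) \<cdot>B FArr F f"
  shows "nat_trans A B F G t"
proof -
  interpret F: cat_functor A B F by fact
  interpret G: cat_functor A B G by fact
  show ?thesis using assms by unfold_locales (auto simp: hom_iff)
qed

lemma nat_isoI:
  assumes "cat_functor A B F" "cat_functor A B G"
    and "\<And>x. x \<in> Obj A \<Longrightarrow> is_iso B (t x) \<and> Dom B (t x) = FObj F x \<and> Cod B (t x) = FObj G x"
    and "\<And>f. f \<in> Arr A \<Longrightarrow> FArr G f \<cdot>B t (Dom A f) = t (Cod A f) \<cdot>B FArr F f"
  shows "nat_iso A B F G t"
proof -
  interpret F: cat_functor A B F by fact
  have "nat_trans A B F G t"
    using assms by (intro nat_transI) (auto intro: F.cod_cat.iso_arr)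
  then show ?thesis using assms by (simp add: nat_iso_def nat_iso_axioms_def)
qed

context nat_trans
begin

lemma component_arr [simp]: "x \<in> Obj A \<Longrightarrow> t x \<in> Arr B"
  and dom_component [simp]: "x \<in> Obj A \<Longrightarrow> Dom B (t x) = FObj F x"
  and cod_component [simp]: "x \<in> Obj A \<Longrightarrow> Cod B (t x) = FObj G x"
  using component[of x] by (auto simp: hom_iff)

lemma naturality': "\<lbrakk>f \<in> Arr A; Dom A f = x\<rbrakk> \<Longrightarrow> FArr G f \<cdot>B t x = t (Cod A f) \<cdot>B FArr F f"
  by (rule naturality) (auto simp: hom_iff)

end

declare nat_iso.component_iso [simp]

lemma id_fctr_simps [simp]: "FObj id_fctr x = x" "FArr id_fctr f = f"
  by (simp_all add: id_fctr_def)

lemma prod_cat_simps [simp]: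
  "Obj (A \<times>\<^sub>c B) = Obj A \<times> Obj B" "Arr (A \<times>\<^sub>c B) = Arr A \<times> Arr B"
  "Dom (A \<times>\<^sub>c B) (f, g) = (Dom A f, Dom B g)" "Cod (A \<times>\<^sub>c B) (f, g) = (Cod A f, Cod B g)"
  "Idt (A \<times>\<^sub>c B) (x, y) = (Idt A x, Idt B y)"
  "(f', g') \<cdot>(A \<times>\<^sub>c B) (f, g) = (f' \<cdot>A f, g' \<cdot>B g)"
  by (auto simp: prod_cat_def)

lemma category_prod:
  assumes "category A" "category B"
  shows "category (A \<times>\<^sub>c B)"
proof -
  interpret A: category A by fact
  interpret B: category B by fact
  show ?thesis by (rule categoryI) auto
qed

lemma prod_inverse_arrows:
  assumes "inverse_arrows A f f'" "inverse_arrows B g g'"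
  shows "inverse_arrows (A \<times>\<^sub>c B) (f, g) (f', g')"
  using assms by (auto simp: inverse_arrows_def hom_iff)

lemma is_iso_prod:
  assumes "is_iso A f" "is_iso B g"
  shows "is_iso (A \<times>\<^sub>c B) (f, g)"
  using assms prod_inverse_arrows unfolding is_iso_def by metis

section \<open>Monoidal categories\<close>

abbreviation (in category) idarr ("\<one>") where "\<one> \<equiv> Idt C"

context monoidal_category
begin

abbreviation uobj ("\<j>") where "\<j> \<equiv> Unt C"
abbreviation \<alpha> where "\<alpha> \<equiv> Assoc C"
abbreviation \<ll> where "\<ll> \<equiv> Lunit C"
abbreviation \<rr> where "\<rr> \<equiv> Runit C"

interpretation T: cat_functor "C \<times>\<^sub>c C" C "Tens C" by (rule tens_functor)
interpretation L: nat_iso C C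
      "\<lparr>FObj = \<lambda>x. \<j> \<otimes>C x, FArr = \<lambda>f. \<one> \<j> \<boxtimes>C f\<rparr>" id_fctr \<ll> by (rule lunit_iso)
interpretation R: nat_iso C C
      "\<lparr>FObj = \<lambda>x. x \<otimes>C \<j>, FArr = \<lambda>f. f \<boxtimes>C \<one> \<j>\<rparr>" id_fctr \<rr> by (rule runit_iso)
interpretation A: nat_iso "C \<times>\<^sub>c C \<times>\<^sub>c C" C
      "\<lparr>FObj = \<lambda>(x, y, z). (x \<otimes>C y) \<otimes>C z, FArr = \<lambda>(f, g, h). (f \<boxtimes>C g) \<boxtimes>C h\<rparr>"
      "\<lparr>FObj = \<lambda>(x, y, z). x \<otimes>C (y \<otimes>C z), FArr = \<lambda>(f, g, h). f \<boxtimes>C (g \<boxtimes>C h)\<rparr>"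
      "\<lambda>(x, y, z). \<alpha> x y z" by (rule assoc_iso)

lemmas unit_obj' [simp] = unit_obj

lemma tens_obj_obj [simp]: "\<lbrakk>x \<in> Obj C; y \<in> Obj C\<rbrakk> \<Longrightarrow> x \<otimes>C y \<in> Obj C"
  using T.fobj[of "(x, y)"] by simp

lemma tens_arr_arr [simp]: "\<lbrakk>f \<in> Arr C; g \<in> Arr C\<rbrakk> \<Longrightarrow> f \<boxtimes>C g \<in> Arr C"
  and dom_tens [simp]: "\<lbrakk>f \<in> Arr C; g \<in> Arr C\<rbrakk> \<Longrightarrow> Dom C (f \<boxtimes>C g) = Dom C f \<otimes>C Dom C g"
  and cod_tens [simp]: "\<lbrakk>f \<in> Arr C; g \<in> Arr C\<rbrakk> \<Longrightarrow> Cod C (f \<boxtimes>C g) = Cod C f \<otimes>C Cod C g"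
  using T.farr_arr[of "(f, g)"] T.dom_farr[of "(f, g)"] T.cod_farr[of "(f, g)"] by simp_all

lemma tens_idt [simp]: "\<lbrakk>x \<in> Obj C; y \<in> Obj C\<rbrakk> \<Longrightarrow> \<one> x \<boxtimes>C \<one> y = \<one> (x \<otimes>C y)"
  using T.farr_idt[of "(x, y)"] by simp

lemma tens_comp [simp]:
  "\<lbrakk>f \<in> Arr C; g \<in> Arr C; f' \<in> Arr C; g' \<in> Arr C; Cod C f' = Dom C f; Cod C g' = Dom C g\<rbrakk>
    \<Longrightarrow> (f \<boxtimes>C g) \<cdot>C (f' \<boxtimes>C g') = (f \<cdot>C f') \<boxtimes>C (g \<cdot>C g')"
  using T.farr_comp'[of "(f', g')" "(f, g)"] by simp

text \<open>\<open>tens_comp\<close> with a further factor behind it; together the two rules gather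
  adjacent tensors into one at every position of a right-bracketed composite.\<close>

lemma tens_comp_ext [simp]:
  "\<lbrakk>f \<in> Arr C; g \<in> Arr C; f' \<in> Arr C; g' \<in> Arr C; Cod C f' = Dom C f; Cod C g' = Dom C g;
    k \<in> Arr C; Cod C k = Dom C f' \<otimes>C Dom C g'\<rbrakk>
    \<Longrightarrow> (f \<boxtimes>C g) \<cdot>C ((f' \<boxtimes>C g') \<cdot>C k) = ((f \<cdot>C f') \<boxtimes>C (g \<cdot>C g')) \<cdot>C k"
  by (subst comp_extend[OF tens_comp]) auto

lemma iso_tens [simp]: "\<lbrakk>is_iso C f; is_iso C g\<rbrakk> \<Longrightarrow> is_iso C (f \<boxtimes>C g)"
  and inv_tens: "\<lbrakk>is_iso C f; is_iso C g\<rbrakk> \<Longrightarrow> inv_arr C (f \<boxtimes>C g) = inv_arr C f \<boxtimes>C inv_arr C g"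
  using iso_arr[of f] iso_arr[of g]
  by (auto intro!: is_isoI[where g = "inv_arr C f \<boxtimes>C inv_arr C g"] inv_arr_eqI)

lemma lunit_simps [simp]:
  assumes "x \<in> Obj C"
  shows "\<ll> x \<in> Arr C" "Dom C (\<ll> x) = \<j> \<otimes>C x" "Cod C (\<ll> x) = x" "is_iso C (\<ll> x)"
  using assms L.component_arr[of x] L.dom_component[of x] L.cod_component[of x] L.component_iso[of x]
  by (simp_all add: id_fctr_def)

lemma lunit_nat: "\<lbrakk>f \<in> Arr C; Dom C f = x\<rbrakk> \<Longrightarrow> f \<cdot>C \<ll> x = \<ll> (Cod C f) \<cdot>C (\<one> \<j> \<boxtimes>C f)"
  using L.naturality'[of f x] by (simp add: id_fctr_def)

lemma runit_simps [simp]: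
  assumes "x \<in> Obj C"
  shows "\<rr> x \<in> Arr C" "Dom C (\<rr> x) = x \<otimes>C \<j>" "Cod C (\<rr> x) = x" "is_iso C (\<rr> x)"
  using assms R.component_arr[of x] R.dom_component[of x] R.cod_component[of x] R.component_iso[of x]
  by (simp_all add: id_fctr_def)

lemma runit_nat: "\<lbrakk>f \<in> Arr C; Dom C f = x\<rbrakk> \<Longrightarrow> f \<cdot>C \<rr> x = \<rr> (Cod C f) \<cdot>C (f \<boxtimes>C \<one> \<j>)"
  using R.naturality'[of f x] by (simp add: id_fctr_def)

lemma assoc_simps [simp]:
  assumes "x \<in> Obj C" "y \<in> Obj C" "z \<in> Obj C"
  shows "\<alpha> x y z \<in> Arr C" "Dom C (\<alpha> x y z) = (x \<otimes>C y) \<otimes>C z"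
    "Cod C (\<alpha> x y z) = x \<otimes>C (y \<otimes>C z)" "is_iso C (\<alpha> x y z)"
  using assms A.component_arr[of "(x, y, z)"] A.dom_component[of "(x, y, z)"]
    A.cod_component[of "(x, y, z)"] A.component_iso[of "(x, y, z)"]
  by simp_all

lemma assoc_nat:
  "\<lbrakk>f \<in> Arr C; g \<in> Arr C; h \<in> Arr C; Cod C f = x; Cod C g = y; Cod C h = z\<rbrakk>
    \<Longrightarrow> \<alpha> x y z \<cdot>C ((f \<boxtimes>C g) \<boxtimes>C h) = (f \<boxtimes>C (g \<boxtimes>C h)) \<cdot>C \<alpha> (Dom C f) (Dom C g) (Dom C h)"
  using A.naturality'[of "(f, g, h)" "(Dom C f, Dom C g, Dom C h)"] by simp

text \<open>Stated separately because \<open>\<one> x \<boxtimes>C \<one> y\<close> is rewritten to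
  \<open>\<one> (x \<otimes>C y)\<close>, after which \<open>assoc_nat\<close> no longer
  matches.\<close>

lemma assoc_nat_idt:
  "\<lbrakk>x \<in> Obj C; y \<in> Obj C; h \<in> Arr C; Cod C h = z\<rbrakk>
    \<Longrightarrow> \<alpha> x y z \<cdot>C (\<one> (x \<otimes>C y) \<boxtimes>C h) = (\<one> x \<boxtimes>C (\<one> y \<boxtimes>C h)) \<cdot>C \<alpha> x y (Dom C h)"
  using assoc_nat[of "\<one> x" "\<one> y" h x y z] by simp

text \<open>By \<open>lunit_nat\<close> the functor \<open>\<one> \<j> \<boxtimes>C -\<close> is
  isomorphic to the identity, hence faithful.\<close>

lemma lunit_faithful:
  assumes "\<one> \<j> \<boxtimes>C f = \<one> \<j> \<boxtimes>C g" "f \<in> Arr C" "g \<in> Arr C" "Dom C f = Dom C g" "Cod C f = Cod C g"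
  shows "f = g"
proof (rule iso_cancel_right[where f = "\<ll> (Dom C f)"])
  show "f \<cdot>C \<ll> (Dom C f) = g \<cdot>C \<ll> (Dom C f)"
    using assms lunit_nat[of f "Dom C g"] lunit_nat[of g "Dom C g"] by simp
qed (use assms in auto)

text \<open>Besides its use for coherence, this is what makes 2-cells into the self-action unique:
  they are determined after tensoring with the unit.\<close>

lemma runit_faithful:
  assumes "f \<boxtimes>C \<one> \<j> = g \<boxtimes>C \<one> \<j>" "f \<in> Arr C" "g \<in> Arr C" "Dom C f = Dom C g" "Cod C f = Cod C g"
  shows "f = g"
proof (rule iso_cancel_right[where f = "\<rr> (Dom C f)"])
  show "f \<cdot>C \<rr> (Dom C f) = g \<cdot>C \<rr> (Dom C f)"
    using assms runit_nat[of f "Dom C g"] runit_nat[of g "Dom C g"] by simp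
qed (use assms in auto)

lemma pentagon':
  "\<lbrakk>w \<in> Obj C; x \<in> Obj C; y \<in> Obj C; z \<in> Obj C\<rbrakk> \<Longrightarrow>
      (\<one> w \<boxtimes>C \<alpha> x y z) \<cdot>C (\<alpha> w (x \<otimes>C y) z \<cdot>C (\<alpha> w x y \<boxtimes>C \<one> z))
      = \<alpha> w x (y \<otimes>C z) \<cdot>C \<alpha> (w \<otimes>C x) y z"
  using pentagon[of w x y z] by simp

text \<open>Kelly's consequence of the axioms. It suffices to compare after tensoring with the unit
  on the left; there the pentagon for \<j>, \<j>, x, y and two instances of the triangle give the
  claim up to the isomorphism \<open>?e\<close>, which is cancelled.\<close>

lemma lunit_tens:
  assumes [simp]: "x \<in> Obj C" "y \<in> Obj C"
  shows "\<ll> (x \<otimes>C y) \<cdot>C \<alpha> \<j> x y = \<ll> x \<boxtimes>C \<one> y"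
proof (rule lunit_faithful)
  let ?e = "\<alpha> \<j> (\<j> \<otimes>C x) y \<cdot>C (\<alpha> \<j> \<j> x \<boxtimes>C \<one> y)"
  have "(\<one> \<j> \<boxtimes>C (\<ll> (x \<otimes>C y) \<cdot>C \<alpha> \<j> x y)) \<cdot>C ?e
      = (\<one> \<j> \<boxtimes>C \<ll> (x \<otimes>C y)) \<cdot>C ((\<one> \<j> \<boxtimes>C \<alpha> \<j> x y) \<cdot>C ?e)"
    by simp
  also have "\<dots> = ((\<one> \<j> \<boxtimes>C \<ll> (x \<otimes>C y)) \<cdot>C \<alpha> \<j> \<j> (x \<otimes>C y)) \<cdot>C \<alpha> (\<j> \<otimes>C \<j>) x y"
    by (simp only: pentagon' unit_obj assms) simp
  also have "\<dots> = \<alpha> \<j> x y \<cdot>C ((\<rr> \<j> \<boxtimes>C \<one> x) \<boxtimes>C \<one> y)"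
    by (subst triangle) (simp_all add: assoc_nat)
  also have "\<dots> = \<alpha> \<j> x y \<cdot>C ((\<one> \<j> \<boxtimes>C \<ll> x) \<boxtimes>C \<one> y) \<cdot>C (\<alpha> \<j> \<j> x \<boxtimes>C \<one> y)"
    by (simp add: triangle)
  also have "\<dots> = (\<one> \<j> \<boxtimes>C (\<ll> x \<boxtimes>C \<one> y)) \<cdot>C ?e"
    by (subst assoc_nat) simp_all
  finally have *: "(\<one> \<j> \<boxtimes>C (\<ll> (x \<otimes>C y) \<cdot>C \<alpha> \<j> x y)) \<cdot>C ?e = (\<one> \<j> \<boxtimes>C (\<ll> x \<boxtimes>C \<one> y)) \<cdot>C ?e" .
  show "\<one> \<j> \<boxtimes>C (\<ll> (x \<otimes>C y) \<cdot>C \<alpha> \<j> x y) = \<one> \<j> \<boxtimes>C (\<ll> x \<boxtimes>C \<one> y)"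
    by (rule iso_cancel_right[OF *]) simp_all
qed simp_all

text \<open>The mirror image: tensoring with the unit on the right is faithful, and the pentagon for
  x, y, \<j>, \<j> is combined with two triangles.\<close>

lemma runit_tens:
  assumes [simp]: "x \<in> Obj C" "y \<in> Obj C"
  shows "(\<one> x \<boxtimes>C \<rr> y) \<cdot>C \<alpha> x y \<j> = \<rr> (x \<otimes>C y)"
proof (rule runit_faithful)
  have "\<alpha> x y \<j> \<cdot>C (((\<one> x \<boxtimes>C \<rr> y) \<cdot>C \<alpha> x y \<j>) \<boxtimes>C \<one> \<j>)
      = \<alpha> x y \<j> \<cdot>C ((\<one> x \<boxtimes>C \<rr> y) \<boxtimes>C \<one> \<j>) \<cdot>C (\<alpha> x y \<j> \<boxtimes>C \<one> \<j>)"
    by simp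
  also have "\<dots> = (\<one> x \<boxtimes>C (\<rr> y \<boxtimes>C \<one> \<j>)) \<cdot>C \<alpha> x (y \<otimes>C \<j>) \<j> \<cdot>C (\<alpha> x y \<j> \<boxtimes>C \<one> \<j>)"
    by (subst assoc_nat) simp_all
  also have "\<dots> = (\<one> x \<boxtimes>C (\<one> y \<boxtimes>C \<ll> \<j>)) \<cdot>C ((\<one> x \<boxtimes>C \<alpha> y \<j> \<j>) \<cdot>C (\<alpha> x (y \<otimes>C \<j>) \<j> \<cdot>C (\<alpha> x y \<j> \<boxtimes>C \<one> \<j>)))"
    by (simp flip: triangle)
  also have "\<dots> = (\<one> x \<boxtimes>C (\<one> y \<boxtimes>C \<ll> \<j>)) \<cdot>C \<alpha> x y (\<j> \<otimes>C \<j>) \<cdot>C \<alpha> (x \<otimes>C y) \<j> \<j>"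
    by (simp only: pentagon' unit_obj assms) simp
  also have "\<dots> = \<alpha> x y \<j> \<cdot>C ((\<one> (x \<otimes>C y) \<boxtimes>C \<ll> \<j>) \<cdot>C \<alpha> (x \<otimes>C y) \<j> \<j>)"
    using comp_extend[OF assoc_nat_idt[of x y "\<ll> \<j>" \<j>], of "\<alpha> (x \<otimes>C y) \<j> \<j>"] by simp
  also have "\<dots> = \<alpha> x y \<j> \<cdot>C (\<rr> (x \<otimes>C y) \<boxtimes>C \<one> \<j>)"
    by (subst triangle) simp_all
  finally have *: "\<alpha> x y \<j> \<cdot>C (((\<one> x \<boxtimes>C \<rr> y) \<cdot>C \<alpha> x y \<j>) \<boxtimes>C \<one> \<j>) = \<alpha> x y \<j> \<cdot>C (\<rr> (x \<otimes>C y) \<boxtimes>C \<one> \<j>)" .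
  show "((\<one> x \<boxtimes>C \<rr> y) \<cdot>C \<alpha> x y \<j>) \<boxtimes>C \<one> \<j> = \<rr> (x \<otimes>C y) \<boxtimes>C \<one> \<j>"
    by (rule iso_cancel_left[OF *]) simp_all
qed simp_all

text \<open>Naturality of \<ll> at \<open>\<ll> \<j>\<close> identifies
  \<open>\<ll> (\<j> \<otimes>C \<j>)\<close> with
  \<open>\<one> \<j> \<boxtimes>C \<ll> \<j>\<close>; then \<open>lunit_tens\<close> and the
  triangle compare the two unitors after tensoring with the unit.\<close>

lemma lunit_unit: "\<ll> \<j> = \<rr> \<j>"
proof (rule runit_faithful)
  have "\<ll> \<j> \<cdot>C \<ll> (\<j> \<otimes>C \<j>) = \<ll> \<j> \<cdot>C (\<one> \<j> \<boxtimes>C \<ll> \<j>)"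
    using lunit_nat[of "\<ll> \<j>" "\<j> \<otimes>C \<j>"] by simp
  then have "\<ll> (\<j> \<otimes>C \<j>) = \<one> \<j> \<boxtimes>C \<ll> \<j>"
    by (rule iso_cancel_left) simp_all
  then show "\<ll> \<j> \<boxtimes>C \<one> \<j> = \<rr> \<j> \<boxtimes>C \<one> \<j>"
    using lunit_tens[of \<j> \<j>] triangle[of \<j> \<j>] by simp
qed simp_all

end

section \<open>The middle-four interchange\<close>

context symmetric_monoidal_category
begin

abbreviation \<ss> where "\<ss> \<equiv> Symm C"
abbreviation \<xi> where "\<xi> \<equiv> interchange C"

interpretation S: nat_iso "C \<times>\<^sub>c C" C "Tens C"
    "\<lparr>FObj = \<lambda>(x, y). y \<otimes>C x, FArr = \<lambda>(f, g). g \<boxtimes>C f\<rparr>" "\<lambda>(x, y). \<ss> x y"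
  by (rule symm_iso)

lemma symm_simps [simp]:
  assumes "x \<in> Obj C" "y \<in> Obj C"
  shows "\<ss> x y \<in> Arr C" "Dom C (\<ss> x y) = x \<otimes>C y" "Cod C (\<ss> x y) = y \<otimes>C x" "is_iso C (\<ss> x y)"
  using assms S.component_arr[of "(x, y)"] S.dom_component[of "(x, y)"]
    S.cod_component[of "(x, y)"] S.component_iso[of "(x, y)"]
  by simp_all

lemma symm_nat:
  "\<lbrakk>f \<in> Arr C; g \<in> Arr C; Cod C f = x; Cod C g = y\<rbrakk>
    \<Longrightarrow> \<ss> x y \<cdot>C (f \<boxtimes>C g) = (g \<boxtimes>C f) \<cdot>C \<ss> (Dom C f) (Dom C g)"
  using S.naturality'[of "(f, g)" "(Dom C f, Dom C g)"] by simp

lemmas symm_symm' [simp] = symm_symm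

lemma hexagon':
  "\<lbrakk>x \<in> Obj C; y \<in> Obj C; z \<in> Obj C\<rbrakk> \<Longrightarrow>
      \<alpha> y z x \<cdot>C (\<ss> x (y \<otimes>C z) \<cdot>C \<alpha> x y z)
      = (\<one> y \<boxtimes>C \<ss> x z) \<cdot>C (\<alpha> y x z \<cdot>C (\<ss> x y \<boxtimes>C \<one> z))"
  using hexagon[of x y z] by simp

text \<open>The unit coherence of the symmetry, derived from the hexagon for x, \<j>, \<j>. Both
  sides are compared after tensoring with the unit on the right and composing with the isomorphism
  \<open>\<ss> x \<j>\<close>.\<close>

lemma lunit_symm:
  assumes [simp]: "x \<in> Obj C"
  shows "\<ll> x \<cdot>C \<ss> x \<j> = \<rr> x"
proof (rule runit_faithful)
  have "\<ss> x \<j> \<cdot>C (\<rr> x \<boxtimes>C \<one> \<j>) = \<ss> x \<j> \<cdot>C (\<one> x \<boxtimes>C \<ll> \<j>) \<cdot>C \<alpha> x \<j> \<j>"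
    by (simp flip: triangle)
  also have "\<dots> = (\<ll> \<j> \<boxtimes>C \<one> x) \<cdot>C \<ss> x (\<j> \<otimes>C \<j>) \<cdot>C \<alpha> x \<j> \<j>"
    by (subst symm_nat) simp_all
  also have "\<dots> = \<ll> (\<j> \<otimes>C x) \<cdot>C (\<alpha> \<j> \<j> x \<cdot>C (\<ss> x (\<j> \<otimes>C \<j>) \<cdot>C \<alpha> x \<j> \<j>))"
    by (subst lunit_tens[symmetric]) simp_all
  also have "\<dots> = \<ll> (\<j> \<otimes>C x) \<cdot>C (\<one> \<j> \<boxtimes>C \<ss> x \<j>) \<cdot>C \<alpha> \<j> x \<j> \<cdot>C (\<ss> x \<j> \<boxtimes>C \<one> \<j>)"
    by (subst hexagon') simp_all
  also have "\<dots> = \<ss> x \<j> \<cdot>C (\<ll> (x \<otimes>C \<j>) \<cdot>C \<alpha> \<j> x \<j>) \<cdot>C (\<ss> x \<j> \<boxtimes>C \<one> \<j>)"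
    using comp_extend[OF lunit_nat[of "\<ss> x \<j>" "x \<otimes>C \<j>", symmetric]] by simp
  also have "\<dots> = \<ss> x \<j> \<cdot>C ((\<ll> x \<cdot>C \<ss> x \<j>) \<boxtimes>C \<one> \<j>)"
    by (subst lunit_tens) simp_all
  finally show "(\<ll> x \<cdot>C \<ss> x \<j>) \<boxtimes>C \<one> \<j> = \<rr> x \<boxtimes>C \<one> \<j>"
    by (rule iso_cancel_left[OF sym]) simp_all
qed simp_all

text \<open>Since \<open>\<ll> \<j>\<close> and \<open>\<rr> \<j>\<close> agree,
  \<open>lunit_symm\<close> leaves no room for a nontrivial symmetry of the unit with
  itself.\<close>

lemma symm_unit: "\<ss> \<j> \<j> = \<one> (\<j> \<otimes>C \<j>)"
proof (rule iso_cancel_left[where f = "\<ll> \<j>"])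
  show "\<ll> \<j> \<cdot>C \<ss> \<j> \<j> = \<ll> \<j> \<cdot>C \<one> (\<j> \<otimes>C \<j>)"
    by (simp add: lunit_symm lunit_unit[symmetric])
qed simp_all

text \<open>The exchange of the first two of three factors bracketed to the right. The middle-four
  interchange is a single \<open>lswap\<close> between associators (\<open>interchange_eq\<close>),
  so its coherence reduces to hexagons for \<open>lswap\<close> in which hardly any rebracketing
  occurs.\<close>

definition lswap where
  "lswap x y z = \<alpha> y x z \<cdot>C ((\<ss> x y \<boxtimes>C \<one> z) \<cdot>C inv_arr C (\<alpha> x y z))"

lemma lswap_simps [simp]:
  assumes "x \<in> Obj C" "y \<in> Obj C" "z \<in> Obj C"
  shows "lswap x y z \<in> Arr C" "Dom C (lswap x y z) = x \<otimes>C (y \<otimes>C z)"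
    "Cod C (lswap x y z) = y \<otimes>C (x \<otimes>C z)" "is_iso C (lswap x y z)"
  using assms by (simp_all add: lswap_def)

lemma lswap_assoc:
  "\<lbrakk>x \<in> Obj C; y \<in> Obj C; z \<in> Obj C\<rbrakk>
    \<Longrightarrow> lswap x y z \<cdot>C \<alpha> x y z = \<alpha> y x z \<cdot>C (\<ss> x y \<boxtimes>C \<one> z)"
  by (simp add: lswap_def)

lemma lswap_lswap:
  assumes [simp]: "x \<in> Obj C" "y \<in> Obj C" "z \<in> Obj C"
  shows "lswap y x z \<cdot>C lswap x y z = \<one> (x \<otimes>C (y \<otimes>C z))"
  by (simp add: lswap_def)

lemma assoc_inv_nat:
  assumes [simp]: "f \<in> Arr C" "g \<in> Arr C" "h \<in> Arr C" and d: "Cod C f = x" "Cod C g = y" "Cod C h = z"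
  shows "inv_arr C (\<alpha> x y z) \<cdot>C (f \<boxtimes>C (g \<boxtimes>C h)) = ((f \<boxtimes>C g) \<boxtimes>C h) \<cdot>C inv_arr C (\<alpha> (Dom C f) (Dom C g) (Dom C h))"
  by (rule iso_cancel_right[where f = "\<alpha> (Dom C f) (Dom C g) (Dom C h)"], rule iso_cancel_left[where f = "\<alpha> x y z"])
    (simp_all add: assoc_nat flip: d)

lemma lswap_nat:
  assumes [simp]: "f \<in> Arr C" "g \<in> Arr C" "h \<in> Arr C" and d: "Cod C f = x" "Cod C g = y" "Cod C h = z"
  shows "lswap x y z \<cdot>C (f \<boxtimes>C (g \<boxtimes>C h)) = (g \<boxtimes>C (f \<boxtimes>C h)) \<cdot>C lswap (Dom C f) (Dom C g) (Dom C h)"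
proof -
  have "lswap x y z \<cdot>C (f \<boxtimes>C (g \<boxtimes>C h))
      = \<alpha> y x z \<cdot>C (\<ss> x y \<boxtimes>C \<one> z) \<cdot>C (inv_arr C (\<alpha> x y z) \<cdot>C (f \<boxtimes>C (g \<boxtimes>C h)))"
    by (simp add: lswap_def flip: d)
  also have "\<dots> = (\<alpha> y x z \<cdot>C ((g \<boxtimes>C f) \<boxtimes>C h)) \<cdot>C (\<ss> (Dom C f) (Dom C g) \<boxtimes>C \<one> (Dom C h)) \<cdot>C inv_arr C (\<alpha> (Dom C f) (Dom C g) (Dom C h))"
    by (subst assoc_inv_nat) (simp_all add: symm_nat flip: d)
  also have "\<dots> = (g \<boxtimes>C (f \<boxtimes>C h)) \<cdot>C lswap (Dom C f) (Dom C g) (Dom C h)"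
    by (subst assoc_nat) (simp_all add: lswap_def flip: d)
  finally show ?thesis .
qed

lemma lswap_nat_idt:
  assumes [simp]: "x \<in> Obj C" "y \<in> Obj C" "h \<in> Arr C" and d: "Cod C h = z"
  shows "lswap x y z \<cdot>C (\<one> x \<boxtimes>C (\<one> y \<boxtimes>C h)) = (\<one> y \<boxtimes>C (\<one> x \<boxtimes>C h)) \<cdot>C lswap x y (Dom C h)"
  using lswap_nat[of "\<one> x" "\<one> y" h x y z] d by simp

lemma assoc_tens:
  assumes [simp]: "w \<in> Obj C" "x \<in> Obj C" "y \<in> Obj C" "z \<in> Obj C"
  shows "\<alpha> w (x \<otimes>C y) z \<cdot>C (\<alpha> w x y \<boxtimes>C \<one> z)
    = (\<one> w \<boxtimes>C inv_arr C (\<alpha> x y z)) \<cdot>C (\<alpha> w x (y \<otimes>C z) \<cdot>C \<alpha> (w \<otimes>C x) y z)"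
  by (simp flip: pentagon')

text \<open>Exchanging x and y does not depend on how the factors behind them are bracketed. After
  precomposition with \<open>\<alpha> x y z \<boxtimes>C \<one> t\<close> both sides consist of
  pentagons around the same symmetry, and naturality of \<alpha> matches them.\<close>

lemma lswap_tens_right:
  assumes [simp]: "x \<in> Obj C" "y \<in> Obj C" "z \<in> Obj C" "t \<in> Obj C"
  shows "(\<one> y \<boxtimes>C \<alpha> x z t) \<cdot>C (\<alpha> y (x \<otimes>C z) t \<cdot>C (lswap x y z \<boxtimes>C \<one> t))
    = lswap x y (z \<otimes>C t) \<cdot>C ((\<one> x \<boxtimes>C \<alpha> y z t) \<cdot>C \<alpha> x (y \<otimes>C z) t)"
proof (rule iso_cancel_right[where f = "\<alpha> x y z \<boxtimes>C \<one> t"])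
  have "((\<one> y \<boxtimes>C \<alpha> x z t) \<cdot>C (\<alpha> y (x \<otimes>C z) t \<cdot>C (lswap x y z \<boxtimes>C \<one> t))) \<cdot>C (\<alpha> x y z \<boxtimes>C \<one> t)
      = ((\<one> y \<boxtimes>C \<alpha> x z t) \<cdot>C (\<alpha> y (x \<otimes>C z) t \<cdot>C (\<alpha> y x z \<boxtimes>C \<one> t))) \<cdot>C ((\<ss> x y \<boxtimes>C \<one> z) \<boxtimes>C \<one> t)"
    by (simp add: lswap_assoc)
  also have "\<dots> = \<alpha> y x (z \<otimes>C t) \<cdot>C (\<alpha> (y \<otimes>C x) z t \<cdot>C ((\<ss> x y \<boxtimes>C \<one> z) \<boxtimes>C \<one> t))"
    by (subst pentagon') simp_all
  also have "\<dots> = (\<alpha> y x (z \<otimes>C t) \<cdot>C (\<ss> x y \<boxtimes>C \<one> (z \<otimes>C t))) \<cdot>C \<alpha> (x \<otimes>C y) z t"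
    by (subst assoc_nat) simp_all
  also have "\<dots> = lswap x y (z \<otimes>C t) \<cdot>C (\<alpha> x y (z \<otimes>C t) \<cdot>C \<alpha> (x \<otimes>C y) z t)"
    by (subst lswap_assoc[symmetric]) simp_all
  also have "\<dots> = (lswap x y (z \<otimes>C t) \<cdot>C ((\<one> x \<boxtimes>C \<alpha> y z t) \<cdot>C \<alpha> x (y \<otimes>C z) t)) \<cdot>C (\<alpha> x y z \<boxtimes>C \<one> t)"
    by (subst pentagon'[symmetric]) simp_all
  finally show "((\<one> y \<boxtimes>C \<alpha> x z t) \<cdot>C (\<alpha> y (x \<otimes>C z) t \<cdot>C (lswap x y z \<boxtimes>C \<one> t))) \<cdot>C (\<alpha> x y z \<boxtimes>C \<one> t)
    = (lswap x y (z \<otimes>C t) \<cdot>C ((\<one> x \<boxtimes>C \<alpha> y z t) \<cdot>C \<alpha> x (y \<otimes>C z) t)) \<cdot>C (\<alpha> x y z \<boxtimes>C \<one> t)" .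
qed simp_all

text \<open>The two hexagons, with all objects bracketed to the right.\<close>

lemma lswap_hexagon:
  assumes [simp]: "x \<in> Obj C" "y \<in> Obj C" "z \<in> Obj C" "t \<in> Obj C"
  shows "\<alpha> y z (x \<otimes>C t) \<cdot>C lswap x (y \<otimes>C z) t
    = (\<one> y \<boxtimes>C lswap x z t) \<cdot>C (lswap x y (z \<otimes>C t) \<cdot>C (\<one> x \<boxtimes>C \<alpha> y z t))"
proof -
  \<comment> \<open>Precomposing with this isomorphism makes both sides start at ((x y) z) t, where
    the hexagon tensored with t applies.\<close>
  let ?e = "\<alpha> x (y \<otimes>C z) t \<cdot>C (\<alpha> x y z \<boxtimes>C \<one> t)"
  have "(\<alpha> y z (x \<otimes>C t) \<cdot>C lswap x (y \<otimes>C z) t) \<cdot>C ?e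
      = \<alpha> y z (x \<otimes>C t) \<cdot>C (\<alpha> (y \<otimes>C z) x t \<cdot>C ((\<ss> x (y \<otimes>C z) \<cdot>C \<alpha> x y z) \<boxtimes>C \<one> t))"
    by (simp add: lswap_def)
  also have "\<dots> = (\<alpha> y z (x \<otimes>C t) \<cdot>C \<alpha> (y \<otimes>C z) x t) \<cdot>C ((\<ss> x (y \<otimes>C z) \<cdot>C \<alpha> x y z) \<boxtimes>C \<one> t)"
    by simp
  also have "\<dots> = (\<one> y \<boxtimes>C \<alpha> z x t) \<cdot>C (\<alpha> y (z \<otimes>C x) t \<cdot>C ((\<alpha> y z x \<cdot>C (\<ss> x (y \<otimes>C z) \<cdot>C \<alpha> x y z)) \<boxtimes>C \<one> t))"
    by (subst pentagon'[symmetric]) simp_all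
  also have "\<dots> = (\<one> y \<boxtimes>C \<alpha> z x t) \<cdot>C (\<alpha> y (z \<otimes>C x) t \<cdot>C ((\<one> y \<boxtimes>C \<ss> x z) \<boxtimes>C \<one> t)) \<cdot>C ((\<alpha> y x z \<cdot>C (\<ss> x y \<boxtimes>C \<one> z)) \<boxtimes>C \<one> t)"
    by (subst hexagon') simp_all
  also have "\<dots> = (\<one> y \<boxtimes>C (\<alpha> z x t \<cdot>C (\<ss> x z \<boxtimes>C \<one> t))) \<cdot>C (\<alpha> y (x \<otimes>C z) t \<cdot>C ((\<alpha> y x z \<cdot>C (\<ss> x y \<boxtimes>C \<one> z)) \<boxtimes>C \<one> t))"
    by (subst assoc_nat) simp_all
  also have "\<dots> = (\<one> y \<boxtimes>C lswap x z t) \<cdot>C ((\<one> y \<boxtimes>C \<alpha> x z t) \<cdot>C (\<alpha> y (x \<otimes>C z) t \<cdot>C (lswap x y z \<boxtimes>C \<one> t))) \<cdot>C (\<alpha> x y z \<boxtimes>C \<one> t)"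
    by (simp add: lswap_assoc)
  also have "\<dots> = ((\<one> y \<boxtimes>C lswap x z t) \<cdot>C (lswap x y (z \<otimes>C t) \<cdot>C (\<one> x \<boxtimes>C \<alpha> y z t))) \<cdot>C ?e"
    by (subst lswap_tens_right) simp_all
  finally show ?thesis
    by (rule iso_cancel_right) simp_all
qed

text \<open>Obtained from \<open>lswap_hexagon\<close> by inversion: \<open>lswap\<close> is an
  involution up to exchanging its arguments, so the hexagon in one variable yields the one in the
  other.\<close>

lemma lswap_tens_left:
  assumes [simp]: "x \<in> Obj C" "y \<in> Obj C" "z \<in> Obj C" "t \<in> Obj C"
  shows "(\<one> z \<boxtimes>C \<alpha> x y t) \<cdot>C lswap (x \<otimes>C y) z t
    = lswap x z (y \<otimes>C t) \<cdot>C ((\<one> x \<boxtimes>C lswap y z t) \<cdot>C \<alpha> x y (z \<otimes>C t))"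
proof -
  have "(\<alpha> x y (z \<otimes>C t) \<cdot>C lswap z (x \<otimes>C y) t) \<cdot>C lswap (x \<otimes>C y) z t = \<alpha> x y (z \<otimes>C t)"
    by (simp add: lswap_lswap)
  then have 1: "(\<one> x \<boxtimes>C lswap z y t) \<cdot>C (lswap z x (y \<otimes>C t) \<cdot>C ((\<one> z \<boxtimes>C \<alpha> x y t) \<cdot>C lswap (x \<otimes>C y) z t)) = \<alpha> x y (z \<otimes>C t)"
    by (subst (asm) lswap_hexagon) simp_all
  show ?thesis
    by (simp add: lswap_lswap comp_extend[OF lswap_lswap] flip: 1)
qed

text \<open>Combines the three middle factors of the definition into one \<open>lswap\<close>; the
  coherence proofs of this section work with this form.\<close>

lemma interchange_eq:
  assumes [simp]: "a \<in> Obj C" "b \<in> Obj C" "c \<in> Obj C" "d \<in> Obj C"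
  shows "\<xi> a b c d = inv_arr C (\<alpha> a c (b \<otimes>C d)) \<cdot>C ((\<one> a \<boxtimes>C lswap b c d) \<cdot>C \<alpha> a b (c \<otimes>C d))"
  by (simp add: interchange_def lswap_def)

lemma interchange_simps [simp]:
  assumes "a \<in> Obj C" "b \<in> Obj C" "c \<in> Obj C" "d \<in> Obj C"
  shows "\<xi> a b c d \<in> Arr C" "Dom C (\<xi> a b c d) = (a \<otimes>C b) \<otimes>C (c \<otimes>C d)"
    "Cod C (\<xi> a b c d) = (a \<otimes>C c) \<otimes>C (b \<otimes>C d)" "is_iso C (\<xi> a b c d)"
  using assms by (simp_all add: interchange_eq)

lemma assoc_interchange:
  "\<lbrakk>a \<in> Obj C; b \<in> Obj C; c \<in> Obj C; d \<in> Obj C\<rbrakk>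
    \<Longrightarrow> \<alpha> a c (b \<otimes>C d) \<cdot>C \<xi> a b c d = (\<one> a \<boxtimes>C lswap b c d) \<cdot>C \<alpha> a b (c \<otimes>C d)"
  by (simp add: interchange_eq)

lemma interchange_interchange [simp]:
  assumes [simp]: "a \<in> Obj C" "b \<in> Obj C" "c \<in> Obj C" "d \<in> Obj C"
  shows "\<xi> a c b d \<cdot>C \<xi> a b c d = \<one> ((a \<otimes>C b) \<otimes>C (c \<otimes>C d))"
  by (simp add: interchange_eq lswap_lswap tens_comp_ext)

text \<open>Because of this both the interchanger of the self-action and its inverse, the structure
  map of the monoidal functor, are interchanges; they differ by exchanging the two middle
  arguments.\<close>

lemma inv_interchange:
  assumes [simp]: "a \<in> Obj C" "b \<in> Obj C" "c \<in> Obj C" "d \<in> Obj C"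
  shows "inv_arr C (\<xi> a b c d) = \<xi> a c b d"
  by (rule inv_arr_eqI) simp_all

lemma interchange_nat:
  assumes [simp]: "f \<in> Arr C" "g \<in> Arr C" "h \<in> Arr C" "k \<in> Arr C"
    and d: "Cod C f = a" "Cod C g = b" "Cod C h = c" "Cod C k = d"
  shows "\<xi> a b c d \<cdot>C ((f \<boxtimes>C g) \<boxtimes>C (h \<boxtimes>C k))
    = ((f \<boxtimes>C h) \<boxtimes>C (g \<boxtimes>C k)) \<cdot>C \<xi> (Dom C f) (Dom C g) (Dom C h) (Dom C k)"
proof -
  have "\<xi> a b c d \<cdot>C ((f \<boxtimes>C g) \<boxtimes>C (h \<boxtimes>C k))
     = inv_arr C (\<alpha> a c (b \<otimes>C d)) \<cdot>C ((\<one> a \<boxtimes>C lswap b c d) \<cdot>C (\<alpha> a b (c \<otimes>C d) \<cdot>C ((f \<boxtimes>C g) \<boxtimes>C (h \<boxtimes>C k))))"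
    by (simp add: interchange_eq flip: d)
  also have "\<dots> = (inv_arr C (\<alpha> a c (b \<otimes>C d)) \<cdot>C (f \<boxtimes>C (h \<boxtimes>C (g \<boxtimes>C k)))) \<cdot>C ((\<one> (Dom C f) \<boxtimes>C lswap (Dom C g) (Dom C h) (Dom C k)) \<cdot>C \<alpha> (Dom C f) (Dom C g) (Dom C h \<otimes>C Dom C k))"
    by (subst assoc_nat) (simp_all add: lswap_nat flip: d)
  also have "\<dots> = ((f \<boxtimes>C h) \<boxtimes>C (g \<boxtimes>C k)) \<cdot>C \<xi> (Dom C f) (Dom C g) (Dom C h) (Dom C k)"
    by (subst assoc_inv_nat) (simp_all add: interchange_eq flip: d)
  finally show ?thesis .
qed

text \<open>Prepares \<open>interchange_assoc\<close>: under full bracketing to the right an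
  interchange tensored with a further object becomes one \<open>lswap\<close>. The pentagon is used
  at both ends and \<open>lswap_tens_right\<close> in between.\<close>

lemma interchange_tens_right:
  assumes [simp]: "a \<in> Obj C" "b \<in> Obj C" "c \<in> Obj C" "d \<in> Obj C" "t \<in> Obj C"
  shows "\<alpha> a b (c \<otimes>C (d \<otimes>C t)) \<cdot>C ((\<one> (a \<otimes>C b) \<boxtimes>C \<alpha> c d t) \<cdot>C (\<alpha> (a \<otimes>C b) (c \<otimes>C d) t \<cdot>C (\<xi> a c b d \<boxtimes>C \<one> t)))
    = (\<one> a \<boxtimes>C (lswap c b (d \<otimes>C t) \<cdot>C (\<one> c \<boxtimes>C \<alpha> b d t))) \<cdot>C (\<alpha> a c ((b \<otimes>C d) \<otimes>C t) \<cdot>C \<alpha> (a \<otimes>C c) (b \<otimes>C d) t)"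
proof -
  have "\<alpha> a b (c \<otimes>C (d \<otimes>C t)) \<cdot>C ((\<one> (a \<otimes>C b) \<boxtimes>C \<alpha> c d t) \<cdot>C (\<alpha> (a \<otimes>C b) (c \<otimes>C d) t \<cdot>C (\<xi> a c b d \<boxtimes>C \<one> t)))
     = (\<one> a \<boxtimes>C (\<one> b \<boxtimes>C \<alpha> c d t)) \<cdot>C (\<alpha> a b ((c \<otimes>C d) \<otimes>C t) \<cdot>C \<alpha> (a \<otimes>C b) (c \<otimes>C d) t) \<cdot>C (\<xi> a c b d \<boxtimes>C \<one> t)"
    by (simp add: assoc_nat_idt comp_extend[OF assoc_nat_idt])
  also have "\<dots> = (\<one> a \<boxtimes>C ((\<one> b \<boxtimes>C \<alpha> c d t) \<cdot>C \<alpha> b (c \<otimes>C d) t)) \<cdot>C (\<alpha> a (b \<otimes>C (c \<otimes>C d)) t \<cdot>C ((\<alpha> a b (c \<otimes>C d) \<cdot>C \<xi> a c b d) \<boxtimes>C \<one> t))"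
    by (subst pentagon'[symmetric]) simp_all
  also have "\<dots> = (\<one> a \<boxtimes>C ((\<one> b \<boxtimes>C \<alpha> c d t) \<cdot>C \<alpha> b (c \<otimes>C d) t)) \<cdot>C (\<alpha> a (b \<otimes>C (c \<otimes>C d)) t \<cdot>C ((\<one> a \<boxtimes>C lswap c b d) \<boxtimes>C \<one> t)) \<cdot>C (\<alpha> a c (b \<otimes>C d) \<boxtimes>C \<one> t)"
    by (subst assoc_interchange) simp_all
  also have "\<dots> = (\<one> a \<boxtimes>C ((\<one> b \<boxtimes>C \<alpha> c d t) \<cdot>C (\<alpha> b (c \<otimes>C d) t \<cdot>C (lswap c b d \<boxtimes>C \<one> t)))) \<cdot>C (\<alpha> a (c \<otimes>C (b \<otimes>C d)) t \<cdot>C (\<alpha> a c (b \<otimes>C d) \<boxtimes>C \<one> t))"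
    by (subst assoc_nat) simp_all
  also have "\<dots> = (\<one> a \<boxtimes>C (lswap c b (d \<otimes>C t) \<cdot>C (\<one> c \<boxtimes>C \<alpha> b d t))) \<cdot>C ((\<one> a \<boxtimes>C \<alpha> c (b \<otimes>C d) t) \<cdot>C (\<alpha> a (c \<otimes>C (b \<otimes>C d)) t \<cdot>C (\<alpha> a c (b \<otimes>C d) \<boxtimes>C \<one> t)))"
    by (subst lswap_tens_right) simp_all
  also have "\<dots> = (\<one> a \<boxtimes>C (lswap c b (d \<otimes>C t) \<cdot>C (\<one> c \<boxtimes>C \<alpha> b d t))) \<cdot>C (\<alpha> a c ((b \<otimes>C d) \<otimes>C t) \<cdot>C \<alpha> (a \<otimes>C c) (b \<otimes>C d) t)"
    by (subst pentagon') simp_all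
  finally show ?thesis .
qed

text \<open>The associativity law of \<otimes> as a monoidal functor. The left side moves a' b' past
  c in one block and the right side moves a' past b c in one block. The two hexagons split the
  blocks into single exchanges, which then agree up to the order of two independent ones.\<close>

lemma interchange_assoc:
  assumes [simp]: "a \<in> Obj C" "b \<in> Obj C" "c \<in> Obj C" "a' \<in> Obj C" "b' \<in> Obj C" "c' \<in> Obj C"
  shows "(\<alpha> a b c \<boxtimes>C \<alpha> a' b' c') \<cdot>C (\<xi> (a \<otimes>C b) (a' \<otimes>C b') c c' \<cdot>C (\<xi> a a' b b' \<boxtimes>C \<one> (c \<otimes>C c')))
    = \<xi> a a' (b \<otimes>C c) (b' \<otimes>C c') \<cdot>C ((\<one> (a \<otimes>C a') \<boxtimes>C \<xi> b b' c c') \<cdot>C \<alpha> (a \<otimes>C a') (b \<otimes>C b') (c \<otimes>C c'))"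
    (is "?l = ?r")
\<comment> \<open>The cancelled isomorphism brackets the common target fully to the right.\<close>
proof (rule iso_cancel_left[where f = "(\<one> a \<boxtimes>C \<alpha> b c (a' \<otimes>C (b' \<otimes>C c'))) \<cdot>C \<alpha> a (b \<otimes>C c) (a' \<otimes>C (b' \<otimes>C c'))"])
  let ?t = "a' \<otimes>C (b' \<otimes>C c')"
  \<comment> \<open>The exchange of a' with b commutes with that of b' with c, because they act on
    disjoint factors; formally this is naturality of \<open>lswap\<close>.\<close>
  have N: "(\<one> b \<boxtimes>C (\<one> a' \<boxtimes>C lswap b' c c')) \<cdot>C lswap a' b (b' \<otimes>C (c \<otimes>C c'))
      = lswap a' b (c \<otimes>C (b' \<otimes>C c')) \<cdot>C (\<one> a' \<boxtimes>C (\<one> b \<boxtimes>C lswap b' c c'))"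
    by (simp add: lswap_nat_idt)
  let ?e = "\<alpha> a a' ((b \<otimes>C b') \<otimes>C (c \<otimes>C c')) \<cdot>C \<alpha> (a \<otimes>C a') (b \<otimes>C b') (c \<otimes>C c')"
  have "((\<one> a \<boxtimes>C \<alpha> b c ?t) \<cdot>C \<alpha> a (b \<otimes>C c) ?t) \<cdot>C ?l
    = ((\<one> a \<boxtimes>C \<alpha> b c ?t) \<cdot>C (\<alpha> a (b \<otimes>C c) ?t \<cdot>C (\<alpha> a b c \<boxtimes>C \<one> ?t))) \<cdot>C ((\<one> ((a \<otimes>C b) \<otimes>C c) \<boxtimes>C \<alpha> a' b' c') \<cdot>C (\<xi> (a \<otimes>C b) (a' \<otimes>C b') c c' \<cdot>C (\<xi> a a' b b' \<boxtimes>C \<one> (c \<otimes>C c'))))"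
    by simp
  also have "\<dots> = \<alpha> a b (c \<otimes>C ?t) \<cdot>C ((\<alpha> (a \<otimes>C b) c ?t \<cdot>C (\<one> ((a \<otimes>C b) \<otimes>C c) \<boxtimes>C \<alpha> a' b' c')) \<cdot>C (\<xi> (a \<otimes>C b) (a' \<otimes>C b') c c' \<cdot>C (\<xi> a a' b b' \<boxtimes>C \<one> (c \<otimes>C c'))))"
    by (subst pentagon') simp_all
  also have "\<dots> = \<alpha> a b (c \<otimes>C ?t) \<cdot>C ((\<one> (a \<otimes>C b) \<boxtimes>C (\<one> c \<boxtimes>C \<alpha> a' b' c')) \<cdot>C (\<alpha> (a \<otimes>C b) c ((a' \<otimes>C b') \<otimes>C c') \<cdot>C \<xi> (a \<otimes>C b) (a' \<otimes>C b') c c')) \<cdot>C (\<xi> a a' b b' \<boxtimes>C \<one> (c \<otimes>C c'))"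
    by (subst assoc_nat_idt) simp_all
  also have "\<dots> = \<alpha> a b (c \<otimes>C ?t) \<cdot>C ((\<one> (a \<otimes>C b) \<boxtimes>C ((\<one> c \<boxtimes>C \<alpha> a' b' c') \<cdot>C lswap (a' \<otimes>C b') c c')) \<cdot>C (\<alpha> (a \<otimes>C b) (a' \<otimes>C b') (c \<otimes>C c') \<cdot>C (\<xi> a a' b b' \<boxtimes>C \<one> (c \<otimes>C c'))))"
    by (subst assoc_interchange) simp_all
  also have "\<dots> = (\<alpha> a b (c \<otimes>C ?t) \<cdot>C (\<one> (a \<otimes>C b) \<boxtimes>C (lswap a' c (b' \<otimes>C c') \<cdot>C (\<one> a' \<boxtimes>C lswap b' c c')))) \<cdot>C ((\<one> (a \<otimes>C b) \<boxtimes>C \<alpha> a' b' (c \<otimes>C c')) \<cdot>C (\<alpha> (a \<otimes>C b) (a' \<otimes>C b') (c \<otimes>C c') \<cdot>C (\<xi> a a' b b' \<boxtimes>C \<one> (c \<otimes>C c'))))"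
    by (subst lswap_tens_left) simp_all
  also have "\<dots> = (\<one> a \<boxtimes>C (\<one> b \<boxtimes>C (lswap a' c (b' \<otimes>C c') \<cdot>C (\<one> a' \<boxtimes>C lswap b' c c')))) \<cdot>C (\<alpha> a b (a' \<otimes>C (b' \<otimes>C (c \<otimes>C c'))) \<cdot>C ((\<one> (a \<otimes>C b) \<boxtimes>C \<alpha> a' b' (c \<otimes>C c')) \<cdot>C (\<alpha> (a \<otimes>C b) (a' \<otimes>C b') (c \<otimes>C c') \<cdot>C (\<xi> a a' b b' \<boxtimes>C \<one> (c \<otimes>C c')))))"
    by (subst assoc_nat_idt) simp_all
  also have "\<dots> = (\<one> a \<boxtimes>C ((\<one> b \<boxtimes>C lswap a' c (b' \<otimes>C c')) \<cdot>C (((\<one> b \<boxtimes>C (\<one> a' \<boxtimes>C lswap b' c c')) \<cdot>C lswap a' b (b' \<otimes>C (c \<otimes>C c'))) \<cdot>C (\<one> a' \<boxtimes>C \<alpha> b b' (c \<otimes>C c'))))) \<cdot>C ?e"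
    by (subst interchange_tens_right) simp_all
  also have "\<dots> = (\<one> a \<boxtimes>C ((\<one> b \<boxtimes>C lswap a' c (b' \<otimes>C c')) \<cdot>C (lswap a' b (c \<otimes>C (b' \<otimes>C c')) \<cdot>C (\<one> a' \<boxtimes>C ((\<one> b \<boxtimes>C lswap b' c c') \<cdot>C \<alpha> b b' (c \<otimes>C c')))))) \<cdot>C ?e"
    by (subst N) simp_all
  also have "\<dots> = (\<one> a \<boxtimes>C (((\<one> b \<boxtimes>C lswap a' c (b' \<otimes>C c')) \<cdot>C (lswap a' b (c \<otimes>C (b' \<otimes>C c')) \<cdot>C (\<one> a' \<boxtimes>C \<alpha> b c (b' \<otimes>C c')))) \<cdot>C (\<one> a' \<boxtimes>C \<xi> b b' c c'))) \<cdot>C ?e"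
    by (subst assoc_interchange[symmetric]) simp_all
  also have "\<dots> = (\<one> a \<boxtimes>C \<alpha> b c ?t) \<cdot>C (((\<one> a \<boxtimes>C lswap a' (b \<otimes>C c) (b' \<otimes>C c')) \<cdot>C (\<one> a \<boxtimes>C (\<one> a' \<boxtimes>C \<xi> b b' c c'))) \<cdot>C ?e)"
    by (subst lswap_hexagon[symmetric]) simp_all
  also have "\<dots> = (\<one> a \<boxtimes>C \<alpha> b c ?t) \<cdot>C (((\<one> a \<boxtimes>C lswap a' (b \<otimes>C c) (b' \<otimes>C c')) \<cdot>C \<alpha> a a' ((b \<otimes>C c) \<otimes>C (b' \<otimes>C c'))) \<cdot>C ((\<one> (a \<otimes>C a') \<boxtimes>C \<xi> b b' c c') \<cdot>C \<alpha> (a \<otimes>C a') (b \<otimes>C b') (c \<otimes>C c')))"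
    by (simp add: comp_extend[OF assoc_nat_idt])
  also have "\<dots> = ((\<one> a \<boxtimes>C \<alpha> b c ?t) \<cdot>C \<alpha> a (b \<otimes>C c) ?t) \<cdot>C ?r"
    by (subst assoc_interchange[symmetric]) simp_all
  finally show "((\<one> a \<boxtimes>C \<alpha> b c ?t) \<cdot>C \<alpha> a (b \<otimes>C c) ?t) \<cdot>C ?l = ((\<one> a \<boxtimes>C \<alpha> b c ?t) \<cdot>C \<alpha> a (b \<otimes>C c) ?t) \<cdot>C ?r" .
qed simp_all

text \<open>The triangle, transported along the symmetry with the unit by
  \<open>lunit_symm\<close>.\<close>

lemma lunit_lswap:
  assumes [simp]: "x \<in> Obj C" "z \<in> Obj C"
  shows "\<ll> (x \<otimes>C z) \<cdot>C lswap x \<j> z = \<one> x \<boxtimes>C \<ll> z"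
proof (rule iso_cancel_right[where f = "\<alpha> x \<j> z"])
  have "(\<ll> (x \<otimes>C z) \<cdot>C lswap x \<j> z) \<cdot>C \<alpha> x \<j> z = (\<ll> (x \<otimes>C z) \<cdot>C \<alpha> \<j> x z) \<cdot>C (\<ss> x \<j> \<boxtimes>C \<one> z)"
    by (simp add: lswap_assoc)
  also have "\<dots> = (\<one> x \<boxtimes>C \<ll> z) \<cdot>C \<alpha> x \<j> z"
    by (subst lunit_tens) (simp_all add: lunit_symm triangle)
  finally show "(\<ll> (x \<otimes>C z) \<cdot>C lswap x \<j> z) \<cdot>C \<alpha> x \<j> z = (\<one> x \<boxtimes>C \<ll> z) \<cdot>C \<alpha> x \<j> z" .
qed simp_all

lemma lswap_lunit:
  assumes [simp]: "x \<in> Obj C" "z \<in> Obj C"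
  shows "(\<one> x \<boxtimes>C \<ll> z) \<cdot>C lswap \<j> x z = \<ll> (x \<otimes>C z)"
  by (simp add: lswap_lswap flip: lunit_lswap)

lemma lswap_unit:
  assumes [simp]: "z \<in> Obj C"
  shows "lswap \<j> \<j> z = \<one> (\<j> \<otimes>C (\<j> \<otimes>C z))"
  by (simp add: lswap_def symm_unit)

text \<open>The two exchanged factors are both the unit, and \<open>symm_unit\<close> applies. This
  removes the interchange from the computation of \<theta> for the self-action and from that of the
  multiplicator in \<open>amult_rep_ident\<close>.\<close>

lemma interchange_unit_middle:
  assumes [simp]: "x \<in> Obj C" "z \<in> Obj C"
  shows "\<xi> x \<j> \<j> z = \<one> ((x \<otimes>C \<j>) \<otimes>C (\<j> \<otimes>C z))"
  by (simp add: interchange_eq lswap_unit)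

text \<open>The left unit law of \<otimes> as a monoidal functor; read differently, it says that
  \<ll> is multiplicative. The reduction rests on \<open>lunit_tens\<close> and
  \<open>lswap_lunit\<close>.\<close>

lemma interchange_lunit:
  assumes [simp]: "c \<in> Obj C" "d \<in> Obj C"
  shows "(\<ll> c \<boxtimes>C \<ll> d) \<cdot>C \<xi> \<j> \<j> c d = \<ll> (c \<otimes>C d) \<cdot>C (\<ll> \<j> \<boxtimes>C \<one> (c \<otimes>C d))"
proof (rule iso_cancel_right[where f = "\<xi> \<j> c \<j> d"])
  have "\<ll> (c \<otimes>C d) \<cdot>C (\<ll> \<j> \<boxtimes>C \<one> (c \<otimes>C d)) = \<ll> (c \<otimes>C d) \<cdot>C (\<one> \<j> \<boxtimes>C \<ll> (c \<otimes>C d)) \<cdot>C \<alpha> \<j> \<j> (c \<otimes>C d)"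
    by (simp add: lunit_unit triangle)
  also have "\<dots> = \<ll> (c \<otimes>C d) \<cdot>C (\<one> \<j> \<boxtimes>C (\<one> c \<boxtimes>C \<ll> d)) \<cdot>C (\<one> \<j> \<boxtimes>C lswap \<j> c d) \<cdot>C \<alpha> \<j> \<j> (c \<otimes>C d)"
    by (simp add: lswap_lunit)
  also have "\<dots> = (\<ll> (c \<otimes>C d) \<cdot>C (\<one> \<j> \<boxtimes>C (\<one> c \<boxtimes>C \<ll> d))) \<cdot>C (\<alpha> \<j> c (\<j> \<otimes>C d) \<cdot>C \<xi> \<j> \<j> c d)"
    by (subst assoc_interchange) simp_all
  also have "\<dots> = (\<one> c \<boxtimes>C \<ll> d) \<cdot>C (\<ll> (c \<otimes>C (\<j> \<otimes>C d)) \<cdot>C \<alpha> \<j> c (\<j> \<otimes>C d)) \<cdot>C \<xi> \<j> \<j> c d"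
    using lunit_nat[of "\<one> c \<boxtimes>C \<ll> d" "c \<otimes>C (\<j> \<otimes>C d)"] comp_extend[OF lunit_nat[of "\<one> c \<boxtimes>C \<ll> d" "c \<otimes>C (\<j> \<otimes>C d)"]] by simp
  also have "\<dots> = (\<ll> c \<boxtimes>C \<ll> d) \<cdot>C \<xi> \<j> \<j> c d"
    by (subst lunit_tens) simp_all
  finally show "((\<ll> c \<boxtimes>C \<ll> d) \<cdot>C \<xi> \<j> \<j> c d) \<cdot>C \<xi> \<j> c \<j> d = (\<ll> (c \<otimes>C d) \<cdot>C (\<ll> \<j> \<boxtimes>C \<one> (c \<otimes>C d))) \<cdot>C \<xi> \<j> c \<j> d"
    by simp
qed simp_all

text \<open>Multiplicativity of \<rr>: this gives \<open>mon_trans_runit\<close>, and it simplifies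
  the units of M in \<open>rep_ident_inter\<close>.\<close>

lemma interchange_runit:
  assumes [simp]: "m \<in> Obj C" "n \<in> Obj C"
  shows "(\<rr> m \<boxtimes>C \<rr> n) \<cdot>C \<xi> m n \<j> \<j> = \<rr> (m \<otimes>C n) \<cdot>C (\<one> (m \<otimes>C n) \<boxtimes>C \<ll> \<j>)"
proof -
  have "(\<rr> m \<boxtimes>C \<rr> n) \<cdot>C \<xi> m n \<j> \<j> = (\<one> m \<boxtimes>C \<rr> n) \<cdot>C (\<rr> m \<boxtimes>C \<one> (n \<otimes>C \<j>)) \<cdot>C \<xi> m n \<j> \<j>"
    by simp
  also have "\<dots> = (\<one> m \<boxtimes>C \<rr> n) \<cdot>C (\<one> m \<boxtimes>C \<ll> (n \<otimes>C \<j>)) \<cdot>C (\<alpha> m \<j> (n \<otimes>C \<j>) \<cdot>C \<xi> m n \<j> \<j>)"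
    by (subst triangle[symmetric]) simp_all
  also have "\<dots> = (\<one> m \<boxtimes>C (\<rr> n \<cdot>C (\<ll> (n \<otimes>C \<j>) \<cdot>C lswap n \<j> \<j>))) \<cdot>C \<alpha> m n (\<j> \<otimes>C \<j>)"
    by (subst assoc_interchange) simp_all
  also have "\<dots> = (\<one> m \<boxtimes>C \<rr> n) \<cdot>C (\<one> m \<boxtimes>C (\<one> n \<boxtimes>C \<ll> \<j>)) \<cdot>C \<alpha> m n (\<j> \<otimes>C \<j>)"
    by (subst lunit_lswap) simp_all
  also have "\<dots> = ((\<one> m \<boxtimes>C \<rr> n) \<cdot>C \<alpha> m n \<j>) \<cdot>C (\<one> (m \<otimes>C n) \<boxtimes>C \<ll> \<j>)"
    by (simp add: assoc_nat_idt)
  also have "\<dots> = \<rr> (m \<otimes>C n) \<cdot>C (\<one> (m \<otimes>C n) \<boxtimes>C \<ll> \<j>)"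
    by (subst runit_tens) simp_all
  finally show ?thesis .
qed

text \<open>Composing with \<open>\<one> y \<boxtimes>C \<ss> x z\<close> completes the left side to
  a hexagon, in which the symmetry of x with y \<otimes> z cancels against its inverse.\<close>

lemma symm_lswap:
  assumes [simp]: "x \<in> Obj C" "y \<in> Obj C" "z \<in> Obj C"
  shows "lswap x y z \<cdot>C \<ss> (y \<otimes>C z) x = (\<one> y \<boxtimes>C \<ss> z x) \<cdot>C \<alpha> y z x"
proof -
  have "(\<one> y \<boxtimes>C \<ss> x z) \<cdot>C (lswap x y z \<cdot>C \<ss> (y \<otimes>C z) x)
      = ((\<one> y \<boxtimes>C \<ss> x z) \<cdot>C (\<alpha> y x z \<cdot>C (\<ss> x y \<boxtimes>C \<one> z))) \<cdot>C inv_arr C (\<alpha> x y z) \<cdot>C \<ss> (y \<otimes>C z) x"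
    by (simp add: lswap_def)
  also have "\<dots> = \<alpha> y z x"
    by (subst hexagon'[symmetric]) simp_all
  finally have *: "(\<one> y \<boxtimes>C \<ss> x z) \<cdot>C (lswap x y z \<cdot>C \<ss> (y \<otimes>C z) x) = \<alpha> y z x" .
  show ?thesis
    by (simp flip: *)
qed

lemma symm_tens_left:
  assumes [simp]: "x \<in> Obj C" "y \<in> Obj C" "z \<in> Obj C"
  shows "\<ss> (y \<otimes>C z) x = lswap y x z \<cdot>C ((\<one> y \<boxtimes>C \<ss> z x) \<cdot>C \<alpha> y z x)"
  by (simp add: comp_extend[OF lswap_lswap] flip: symm_lswap)

text \<open>The functor \<otimes> is symmetric. Up to the associator at the target both sides first
  exchange a' with b, then a with b, then a' with b'.\<close>

lemma interchange_symm:
  assumes [simp]: "a \<in> Obj C" "a' \<in> Obj C" "b \<in> Obj C" "b' \<in> Obj C"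
  shows "(\<ss> a b \<boxtimes>C \<ss> a' b') \<cdot>C \<xi> a a' b b' = \<xi> b b' a a' \<cdot>C \<ss> (a \<otimes>C a') (b \<otimes>C b')"
proof (rule iso_cancel_left[where f = "\<alpha> b a (b' \<otimes>C a')"])
  have 1: "lswap a b (b' \<otimes>C a') \<cdot>C (\<one> a \<boxtimes>C (\<one> b \<boxtimes>C \<ss> a' b')) = (\<one> b \<boxtimes>C (\<one> a \<boxtimes>C \<ss> a' b')) \<cdot>C lswap a b (a' \<otimes>C b')"
    by (simp add: lswap_nat_idt)
  have "\<alpha> b a (b' \<otimes>C a') \<cdot>C ((\<ss> a b \<boxtimes>C \<ss> a' b') \<cdot>C \<xi> a a' b b')
      = (\<alpha> b a (b' \<otimes>C a') \<cdot>C (\<ss> a b \<boxtimes>C \<one> (b' \<otimes>C a'))) \<cdot>C ((\<one> (a \<otimes>C b) \<boxtimes>C \<ss> a' b') \<cdot>C \<xi> a a' b b')"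
    by simp
  also have "\<dots> = lswap a b (b' \<otimes>C a') \<cdot>C ((\<one> a \<boxtimes>C (\<one> b \<boxtimes>C \<ss> a' b')) \<cdot>C (\<alpha> a b (a' \<otimes>C b') \<cdot>C \<xi> a a' b b'))"
    by (subst lswap_assoc[symmetric]) (simp_all add: comp_extend[OF assoc_nat_idt])
  also have "\<dots> = (lswap a b (b' \<otimes>C a') \<cdot>C (\<one> a \<boxtimes>C (\<one> b \<boxtimes>C \<ss> a' b'))) \<cdot>C ((\<one> a \<boxtimes>C lswap a' b b') \<cdot>C \<alpha> a a' (b \<otimes>C b'))"
    by (subst assoc_interchange) simp_all
  also have "\<dots> = (\<one> b \<boxtimes>C (\<one> a \<boxtimes>C \<ss> a' b')) \<cdot>C (lswap a b (a' \<otimes>C b') \<cdot>C ((\<one> a \<boxtimes>C lswap a' b b') \<cdot>C \<alpha> a a' (b \<otimes>C b')))"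
    by (subst 1) simp_all
  finally have L: "\<alpha> b a (b' \<otimes>C a') \<cdot>C ((\<ss> a b \<boxtimes>C \<ss> a' b') \<cdot>C \<xi> a a' b b') = \<dots>" .

  \<comment> \<open>The hexagon in the second argument of the symmetry, solved for the composite
    with the target associator.\<close>
  have h: "\<alpha> b b' (a \<otimes>C a') \<cdot>C \<ss> (a \<otimes>C a') (b \<otimes>C b')
      = (\<one> b \<boxtimes>C \<ss> (a \<otimes>C a') b') \<cdot>C (\<alpha> b (a \<otimes>C a') b' \<cdot>C ((\<ss> (a \<otimes>C a') b \<boxtimes>C \<one> b') \<cdot>C inv_arr C (\<alpha> (a \<otimes>C a') b b')))"
    by (rule iso_cancel_right[where f = "\<alpha> (a \<otimes>C a') b b'"]) (simp_all add: hexagon')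
  have "\<alpha> b a (b' \<otimes>C a') \<cdot>C (\<xi> b b' a a' \<cdot>C \<ss> (a \<otimes>C a') (b \<otimes>C b'))
      = (\<one> b \<boxtimes>C lswap b' a a') \<cdot>C (\<alpha> b b' (a \<otimes>C a') \<cdot>C \<ss> (a \<otimes>C a') (b \<otimes>C b'))"
    by (simp add: assoc_interchange comp_extend[OF assoc_interchange])
  also have "\<dots> = (\<one> b \<boxtimes>C (lswap b' a a' \<cdot>C \<ss> (a \<otimes>C a') b')) \<cdot>C (\<alpha> b (a \<otimes>C a') b' \<cdot>C ((\<ss> (a \<otimes>C a') b \<boxtimes>C \<one> b') \<cdot>C inv_arr C (\<alpha> (a \<otimes>C a') b b')))"
    by (subst h) simp_all
  \<comment> \<open>Here \<open>\<ss>\<close> has to be a symmetry and not just a braiding: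
    \<open>lswap b' a a'\<close> undoes the exchange of a with b' that \<open>symm_tens_left\<close>
    introduces.\<close>
  also have "\<dots> = (\<one> b \<boxtimes>C ((\<one> a \<boxtimes>C \<ss> a' b') \<cdot>C \<alpha> a a' b')) \<cdot>C (\<alpha> b (a \<otimes>C a') b' \<cdot>C (((lswap a b a' \<cdot>C ((\<one> a \<boxtimes>C \<ss> a' b) \<cdot>C \<alpha> a a' b)) \<boxtimes>C \<one> b') \<cdot>C inv_arr C (\<alpha> (a \<otimes>C a') b b')))"
    by (simp add: symm_tens_left comp_extend[OF lswap_lswap])
  also have "\<dots> = (\<one> b \<boxtimes>C (\<one> a \<boxtimes>C \<ss> a' b')) \<cdot>C (((\<one> b \<boxtimes>C \<alpha> a a' b') \<cdot>C (\<alpha> b (a \<otimes>C a') b' \<cdot>C (lswap a b a' \<boxtimes>C \<one> b'))) \<cdot>C ((((\<one> a \<boxtimes>C \<ss> a' b) \<cdot>C \<alpha> a a' b) \<boxtimes>C \<one> b') \<cdot>C inv_arr C (\<alpha> (a \<otimes>C a') b b')))"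
    by simp
  also have "\<dots> = (\<one> b \<boxtimes>C (\<one> a \<boxtimes>C \<ss> a' b')) \<cdot>C (lswap a b (a' \<otimes>C b') \<cdot>C ((\<one> a \<boxtimes>C \<alpha> b a' b') \<cdot>C ((\<alpha> a (b \<otimes>C a') b' \<cdot>C ((\<one> a \<boxtimes>C \<ss> a' b) \<boxtimes>C \<one> b')) \<cdot>C ((\<alpha> a a' b \<boxtimes>C \<one> b') \<cdot>C inv_arr C (\<alpha> (a \<otimes>C a') b b')))))"
    by (subst lswap_tens_right) simp_all
  also have "\<dots> = (\<one> b \<boxtimes>C (\<one> a \<boxtimes>C \<ss> a' b')) \<cdot>C (lswap a b (a' \<otimes>C b') \<cdot>C ((\<one> a \<boxtimes>C (\<alpha> b a' b' \<cdot>C (\<ss> a' b \<boxtimes>C \<one> b'))) \<cdot>C ((\<alpha> a (a' \<otimes>C b) b' \<cdot>C (\<alpha> a a' b \<boxtimes>C \<one> b')) \<cdot>C inv_arr C (\<alpha> (a \<otimes>C a') b b'))))"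
    by (subst assoc_nat) simp_all
  also have "\<dots> = (\<one> b \<boxtimes>C (\<one> a \<boxtimes>C \<ss> a' b')) \<cdot>C (lswap a b (a' \<otimes>C b') \<cdot>C ((\<one> a \<boxtimes>C lswap a' b b') \<cdot>C \<alpha> a a' (b \<otimes>C b')))"
    by (subst assoc_tens) (simp_all add: lswap_def)
  finally show "\<alpha> b a (b' \<otimes>C a') \<cdot>C ((\<ss> a b \<boxtimes>C \<ss> a' b') \<cdot>C \<xi> a a' b b') = \<alpha> b a (b' \<otimes>C a') \<cdot>C (\<xi> b b' a a' \<cdot>C \<ss> (a \<otimes>C a') (b \<otimes>C b'))"
    using L by simp
qed simp_all

end

section \<open>Symmetric monoidal functors\<close>

lemma prod_smc_simps [simp]:
  "Obj (prod_smc M C) = Obj M \<times> Obj C" "Arr (prod_smc M C) = Arr M \<times> Arr C"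
  "Dom (prod_smc M C) (f, g) = (Dom M f, Dom C g)" "Cod (prod_smc M C) (f, g) = (Cod M f, Cod C g)"
  "Idt (prod_smc M C) (m, c) = (Idt M m, Idt C c)"
  "(f', g') \<cdot>(prod_smc M C) (f, g) = (f' \<cdot>M f, g' \<cdot>C g)"
  "Unt (prod_smc M C) = (Unt M, Unt C)"
  "(m, c) \<otimes>(prod_smc M C) (n, d) = (m \<otimes>M n, c \<otimes>C d)"
  "(f, g) \<boxtimes>(prod_smc M C) (f', g') = (f \<boxtimes>M f', g \<boxtimes>C g')"
  "Lunit (prod_smc M C) (m, c) = (Lunit M m, Lunit C c)"
  "Runit (prod_smc M C) (m, c) = (Runit M m, Runit C c)"
  "Assoc (prod_smc M C) (m, c) (n, d) (p, e) = (Assoc M m n p, Assoc C c d e)"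
  "Symm (prod_smc M C) (m, c) (n, d) = (Symm M m n, Symm C c d)"
  by (simp_all add: prod_smc_def)

lemma category_prod_smc:
  assumes "category M" "category C"
  shows "category (prod_smc M C)"
proof -
  interpret M: category M by fact
  interpret C: category C by fact
  show ?thesis by (rule categoryI) auto
qed

lemma prod_smc_iso [simp]:
  assumes "category M" "category C" "is_iso M f" "is_iso C g"
  shows "is_iso (prod_smc M C) (f, g)" "inv_arr (prod_smc M C) (f, g) = (inv_arr M f, inv_arr C g)"
proof -
  interpret M: category M by fact
  interpret C: category C by fact
  interpret P: category "prod_smc M C" by (rule category_prod_smc) fact+
  show "is_iso (prod_smc M C) (f, g)"
    by (rule P.is_isoI[where g = "(inv_arr M f, inv_arr C g)"]) (simp_all add: assms M.iso_arr C.iso_arr)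
  show "inv_arr (prod_smc M C) (f, g) = (inv_arr M f, inv_arr C g)"
    by (rule P.inv_arr_eqI) (simp_all add: assms M.iso_arr C.iso_arr)
qed

lemma smc_category: "symmetric_monoidal_category C \<Longrightarrow> category C"
  by (simp add: symmetric_monoidal_category_def monoidal_category_def)

lemma smc_prod:
  assumes "symmetric_monoidal_category M" "symmetric_monoidal_category C"
  shows "symmetric_monoidal_category (prod_smc M C)"
proof -
  interpret M: symmetric_monoidal_category M by fact
  interpret C: symmetric_monoidal_category C by fact
  interpret P: category "prod_smc M C"
    by (rule category_prod_smc) unfold_locales
  note cats = M.category_axioms C.category_axioms P.category_axioms
    category_prod[OF P.category_axioms P.category_axioms]
    category_prod[OF P.category_axioms category_prod[OF P.category_axioms P.category_axioms]]
  show ?thesis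
  proof (intro symmetric_monoidal_category.intro monoidal_category.intro
      monoidal_category_axioms.intro symmetric_monoidal_category_axioms.intro)
    show "category (prod_smc M C)" ..
    show "Unt (prod_smc M C) \<in> Obj (prod_smc M C)" by simp
    show T: "cat_functor (prod_smc M C \<times>\<^sub>c prod_smc M C) (prod_smc M C) (Tens (prod_smc M C))"
      by (rule cat_functorI) (auto simp: cats)
    show "nat_iso (prod_smc M C) (prod_smc M C)
      \<lparr>FObj = \<lambda>x. Unt (prod_smc M C) \<otimes>(prod_smc M C) x,
       FArr = \<lambda>f. Idt (prod_smc M C) (Unt (prod_smc M C)) \<boxtimes>(prod_smc M C) f\<rparr>
      id_fctr (Lunit (prod_smc M C))"
      by (rule nat_isoI; (rule cat_functorI)?) (auto simp: cats M.lunit_nat C.lunit_nat)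
    show "nat_iso (prod_smc M C) (prod_smc M C)
      \<lparr>FObj = \<lambda>x. x \<otimes>(prod_smc M C) Unt (prod_smc M C),
       FArr = \<lambda>f. f \<boxtimes>(prod_smc M C) Idt (prod_smc M C) (Unt (prod_smc M C))\<rparr>
      id_fctr (Runit (prod_smc M C))"
      by (rule nat_isoI; (rule cat_functorI)?) (auto simp: cats M.runit_nat C.runit_nat)
    show "nat_iso (prod_smc M C \<times>\<^sub>c prod_smc M C \<times>\<^sub>c prod_smc M C) (prod_smc M C)
      \<lparr>FObj = \<lambda>(x, y, z). (x \<otimes>(prod_smc M C) y) \<otimes>(prod_smc M C) z,
       FArr = \<lambda>(f, g, h). (f \<boxtimes>(prod_smc M C) g) \<boxtimes>(prod_smc M C) h\<rparr>
      \<lparr>FObj = \<lambda>(x, y, z). x \<otimes>(prod_smc M C) (y \<otimes>(prod_smc M C) z),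
       FArr = \<lambda>(f, g, h). f \<boxtimes>(prod_smc M C) (g \<boxtimes>(prod_smc M C) h)\<rparr>
      (\<lambda>(x, y, z). Assoc (prod_smc M C) x y z)"
      by (rule nat_isoI; (rule cat_functorI)?) (auto simp: cats M.assoc_nat C.assoc_nat)
    show "nat_iso (prod_smc M C \<times>\<^sub>c prod_smc M C) (prod_smc M C) (Tens (prod_smc M C))
      \<lparr>FObj = \<lambda>(x, y). y \<otimes>(prod_smc M C) x, FArr = \<lambda>(f, g). g \<boxtimes>(prod_smc M C) f\<rparr>
      (\<lambda>(x, y). Symm (prod_smc M C) x y)"
      by (rule nat_isoI; (rule T cat_functorI)?) (auto simp: cats M.symm_nat C.symm_nat)
  qed (auto simp: M.pentagon' C.pentagon' M.triangle C.triangle M.hexagon' C.hexagon')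
qed

text \<open>The inverse associators inside the interchange are computed componentwise by
  \<open>prod_smc_iso\<close>. This makes \<open>fmult_interchange\<close> available for an action,
  seen as a functor on \<open>prod_smc M C\<close>.\<close>

lemma interchange_prod:
  assumes "symmetric_monoidal_category M" "symmetric_monoidal_category C"
    and [simp]: "m \<in> Obj M" "n \<in> Obj M" "p \<in> Obj M" "q \<in> Obj M"
      "c \<in> Obj C" "d \<in> Obj C" "e \<in> Obj C" "e' \<in> Obj C"
  shows "interchange (prod_smc M C) (m, c) (n, d) (p, e) (q, e')
    = (interchange M m n p q, interchange C c d e e')"
proof -
  interpret M: symmetric_monoidal_category M by fact
  interpret C: symmetric_monoidal_category C by fact
  show ?thesis
    by (simp add: interchange_def M.category_axioms C.category_axioms)
qed

section \<open>Strong symmetric monoidal functors\<close>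

lemma sym_mon_functorI:
  assumes "symmetric_monoidal_category M" "symmetric_monoidal_category N" "cat_functor M N R"
    and "is_iso N (FUnit R)" "Dom N (FUnit R) = Unt N" "Cod N (FUnit R) = FObj R (Unt M)"
    and "\<And>x y. \<lbrakk>x \<in> Obj M; y \<in> Obj M\<rbrakk> \<Longrightarrow> is_iso N (FMult R (x, y))
      \<and> Dom N (FMult R (x, y)) = FObj R x \<otimes>N FObj R y \<and> Cod N (FMult R (x, y)) = FObj R (x \<otimes>M y)"
    and "\<And>f g. \<lbrakk>f \<in> Arr M; g \<in> Arr M\<rbrakk> \<Longrightarrow> FArr R (f \<boxtimes>M g) \<cdot>N FMult R (Dom M f, Dom M g)
      = FMult R (Cod M f, Cod M g) \<cdot>N (FArr R f \<boxtimes>N FArr R g)"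
    and "\<And>x y z. \<lbrakk>x \<in> Obj M; y \<in> Obj M; z \<in> Obj M\<rbrakk> \<Longrightarrow>
      FArr R (Assoc M x y z) \<cdot>N (FMult R (x \<otimes>M y, z)
        \<cdot>N (FMult R (x, y) \<boxtimes>N Idt N (FObj R z)))
      = FMult R (x, y \<otimes>M z) \<cdot>N ((Idt N (FObj R x) \<boxtimes>N FMult R (y, z))
        \<cdot>N Assoc N (FObj R x) (FObj R y) (FObj R z))"
    and "\<And>x. x \<in> Obj M \<Longrightarrow>
      FArr R (Lunit M x) \<cdot>N (FMult R (Unt M, x) \<cdot>N (FUnit R \<boxtimes>N Idt N (FObj R x)))
      = Lunit N (FObj R x)"
    and "\<And>x. x \<in> Obj M \<Longrightarrow>
      FArr R (Runit M x) \<cdot>N (FMult R (x, Unt M) \<cdot>N (Idt N (FObj R x) \<boxtimes>N FUnit R))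
      = Runit N (FObj R x)"
    and "\<And>x y. \<lbrakk>x \<in> Obj M; y \<in> Obj M\<rbrakk> \<Longrightarrow>
      FArr R (Symm M x y) \<cdot>N FMult R (x, y)
      = FMult R (y, x) \<cdot>N Symm N (FObj R x) (FObj R y)"
  shows "sym_mon_functor M N R"
proof -
  interpret M: symmetric_monoidal_category M by fact
  interpret N: symmetric_monoidal_category N by fact
  interpret R: cat_functor M N R by fact
  have i: "\<And>x y. \<lbrakk>x \<in> Obj M; y \<in> Obj M\<rbrakk> \<Longrightarrow> FMult R (x, y) \<in> Arr N"
    using assms(7) N.iso_arr by blast
  have u: "FUnit R \<in> Arr N" using assms(4) N.iso_arr by blast
  have "nat_iso (M \<times>\<^sub>c M) N
      \<lparr>FObj = \<lambda>(x, y). FObj R x \<otimes>N FObj R y, FArr = \<lambda>(f, g). FArr R f \<boxtimes>N FArr R g\<rparr>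
      \<lparr>FObj = \<lambda>(x, y). FObj R (x \<otimes>M y), FArr = \<lambda>(f, g). FArr R (f \<boxtimes>M g)\<rparr>
      (FMult R)"
    by (rule nat_isoI; (rule cat_functorI)?)
      (use assms(7,8) in \<open>auto simp: category_prod M.category_axioms N.category_axioms simp flip: M.tens_comp R.farr_comp'\<close>)
  with assms i u show ?thesis
    by (intro sym_mon_functor.intro sym_mon_functor_axioms.intro) (simp_all add: hom_iff)
qed

context sym_mon_functor
begin

interpretation X: nat_iso "M \<times>\<^sub>c M" N
      "\<lparr>FObj = \<lambda>(x, y). FObj R x \<otimes>N FObj R y, FArr = \<lambda>(f, g). FArr R f \<boxtimes>N FArr R g\<rparr>"
      "\<lparr>FObj = \<lambda>(x, y). FObj R (x \<otimes>M y), FArr = \<lambda>(f, g). FArr R (f \<boxtimes>M g)\<rparr>"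
      "FMult R" by (rule fmult_iso)

lemma funit_simps [simp]: "FUnit R \<in> Arr N" "Dom N (FUnit R) = Unt N"
  "Cod N (FUnit R) = FObj R (Unt M)" "is_iso N (FUnit R)"
  using funit_hom funit_iso by (simp_all add: hom_iff)

lemma fmult_simps [simp]:
  assumes "x \<in> Obj M" "y \<in> Obj M"
  shows "FMult R (x, y) \<in> Arr N" "Dom N (FMult R (x, y)) = FObj R x \<otimes>N FObj R y"
    "Cod N (FMult R (x, y)) = FObj R (x \<otimes>M y)" "is_iso N (FMult R (x, y))"
  using assms X.component_arr[of "(x, y)"] X.dom_component[of "(x, y)"]
    X.cod_component[of "(x, y)"] X.component_iso[of "(x, y)"]
  by simp_all

lemma fmult_nat:
  "\<lbrakk>f \<in> Arr M; g \<in> Arr M; Dom M f = x; Dom M g = y\<rbrakk> \<Longrightarrow> FArr R (f \<boxtimes>M g) \<cdot>N FMult R (x, y)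
      = FMult R (Cod M f, Cod M g) \<cdot>N (FArr R f \<boxtimes>N FArr R g)"
  using X.naturality'[of "(f, g)" "(x, y)"] by simp

text \<open>The one-sided forms are needed because the image of an identity is rewritten to an
  identity, so that \<open>fmult_nat\<close> itself does not match.\<close>

lemma fmult_nat_left:
  "\<lbrakk>f \<in> Arr M; y \<in> Obj M; Dom M f = x\<rbrakk> \<Longrightarrow> FArr R (f \<boxtimes>M Idt M y) \<cdot>N FMult R (x, y)
      = FMult R (Cod M f, y) \<cdot>N (FArr R f \<boxtimes>N Idt N (FObj R y))"
  using fmult_nat[of f "Idt M y" x y] by simp

lemma fmult_nat_right:
  "\<lbrakk>g \<in> Arr M; x \<in> Obj M; Dom M g = y\<rbrakk> \<Longrightarrow> FArr R (Idt M x \<boxtimes>M g) \<cdot>N FMult R (x, y)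
      = FMult R (x, Cod M g) \<cdot>N (Idt N (FObj R x) \<boxtimes>N FArr R g)"
  using fmult_nat[of "Idt M x" g x y] by simp

lemma fmult_assoc':
  "\<lbrakk>x \<in> Obj M; y \<in> Obj M; z \<in> Obj M\<rbrakk> \<Longrightarrow>
      FArr R (Assoc M x y z) \<cdot>N (FMult R (x \<otimes>M y, z)
        \<cdot>N (FMult R (x, y) \<boxtimes>N Idt N (FObj R z)))
      = FMult R (x, y \<otimes>M z) \<cdot>N ((Idt N (FObj R x) \<boxtimes>N FMult R (y, z))
        \<cdot>N Assoc N (FObj R x) (FObj R y) (FObj R z))"
  using fmult_assoc[of x y z] by simp

lemma fmult_lunit':
  "x \<in> Obj M \<Longrightarrow>
      FArr R (Lunit M x) \<cdot>N (FMult R (Unt M, x) \<cdot>N (FUnit R \<boxtimes>N Idt N (FObj R x)))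
      = Lunit N (FObj R x)"
  using fmult_lunit[of x] by simp

lemma fmult_runit':
  "x \<in> Obj M \<Longrightarrow>
      FArr R (Runit M x) \<cdot>N (FMult R (x, Unt M) \<cdot>N (Idt N (FObj R x) \<boxtimes>N FUnit R))
      = Runit N (FObj R x)"
  using fmult_runit[of x] by simp

text \<open>\<open>lswap\<close> consists of two associators and one symmetry, which
  \<open>fmult_assoc\<close> and \<open>fmult_symm\<close> carry through R; precomposition with the
  associator removes the inverse one.\<close>

lemma fmult_lswap:
  assumes [simp]: "x \<in> Obj M" "y \<in> Obj M" "z \<in> Obj M"
  shows "FArr R (dom_smc.lswap x y z) \<cdot>N
      (FMult R (x, y \<otimes>M z) \<cdot>N (Idt N (FObj R x) \<boxtimes>N FMult R (y, z)))
    = FMult R (y, x \<otimes>M z) \<cdot>N ((Idt N (FObj R y) \<boxtimes>N FMult R (x, z))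
        \<cdot>N cod_smc.lswap (FObj R x) (FObj R y) (FObj R z))"
    (is "?l = ?r")
proof (rule cod_smc.iso_cancel_right[where f = "Assoc N (FObj R x) (FObj R y) (FObj R z)"])
  have "?l \<cdot>N Assoc N (FObj R x) (FObj R y) (FObj R z)
    = FArr R (dom_smc.lswap x y z) \<cdot>N (FMult R (x, y \<otimes>M z) \<cdot>N ((Idt N (FObj R x) \<boxtimes>N FMult R (y, z))
        \<cdot>N Assoc N (FObj R x) (FObj R y) (FObj R z)))"
    by simp
  also have "\<dots> = FArr R (dom_smc.lswap x y z \<cdot>M Assoc M x y z) \<cdot>N (FMult R (x \<otimes>M y, z)
        \<cdot>N (FMult R (x, y) \<boxtimes>N Idt N (FObj R z)))"
    by (subst fmult_assoc'[symmetric]) simp_all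
  also have "\<dots> = FArr R (Assoc M y x z) \<cdot>N ((FArr R (Symm M x y \<boxtimes>M Idt M z) \<cdot>N FMult R (x \<otimes>M y, z))
        \<cdot>N (FMult R (x, y) \<boxtimes>N Idt N (FObj R z)))"
    by (subst dom_smc.lswap_assoc) simp_all
  also have "\<dots> = (FArr R (Assoc M y x z) \<cdot>N (FMult R (y \<otimes>M x, z)
        \<cdot>N (FMult R (y, x) \<boxtimes>N Idt N (FObj R z)))) \<cdot>N (Symm N (FObj R x) (FObj R y) \<boxtimes>N Idt N (FObj R z))"
    by (subst fmult_nat_left) (simp_all add: fmult_symm)
  also have "\<dots> = ?r \<cdot>N Assoc N (FObj R x) (FObj R y) (FObj R z)"
    by (subst fmult_assoc') (simp_all add: cod_smc.lswap_assoc)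
  finally show "?l \<cdot>N Assoc N (FObj R x) (FObj R y) (FObj R z) = ?r \<cdot>N Assoc N (FObj R x) (FObj R y) (FObj R z)" .
qed simp_all

text \<open>R respects the interchange because it respects \<open>lswap\<close>. For R the action
  functor this is the key to the interchanger of \<theta>; for R the functor along which one
  restricts, it keeps the multiplicator monoidal.\<close>

lemma fmult_interchange:
  assumes [simp]: "a \<in> Obj M" "b \<in> Obj M" "c \<in> Obj M" "d \<in> Obj M"
  shows "FArr R (interchange M a b c d) \<cdot>N (FMult R (a \<otimes>M b, c \<otimes>M d) \<cdot>N (FMult R (a, b) \<boxtimes>N FMult R (c, d)))
    = FMult R (a \<otimes>M c, b \<otimes>M d) \<cdot>N ((FMult R (a, c) \<boxtimes>N FMult R (b, d))
      \<cdot>N interchange N (FObj R a) (FObj R b) (FObj R c) (FObj R d))"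
    (is "?l = ?r")
proof (rule cod_smc.iso_cancel_left[where f = "FArr R (Assoc M a c (b \<otimes>M d))"])
  \<comment> \<open>Rewrites the structure map for four factors paired two by two into the one for
    bracketing to the right. It is applied to a, b, c, d at the source and to a, c, b, d at the
    target.\<close>
  have N: "FArr R (Assoc M x y (z \<otimes>M w)) \<cdot>N (FMult R (x \<otimes>M y, z \<otimes>M w) \<cdot>N (FMult R (x, y) \<boxtimes>N FMult R (z, w)))
    = FMult R (x, y \<otimes>M (z \<otimes>M w)) \<cdot>N ((Idt N (FObj R x) \<boxtimes>N (FMult R (y, z \<otimes>M w) \<cdot>N (Idt N (FObj R y) \<boxtimes>N FMult R (z, w))))
      \<cdot>N Assoc N (FObj R x) (FObj R y) (FObj R z \<otimes>N FObj R w))"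
    if [simp]: "x \<in> Obj M" "y \<in> Obj M" "z \<in> Obj M" "w \<in> Obj M" for x y z w
  proof -
    have "FArr R (Assoc M x y (z \<otimes>M w)) \<cdot>N (FMult R (x \<otimes>M y, z \<otimes>M w) \<cdot>N (FMult R (x, y) \<boxtimes>N FMult R (z, w)))
      = (FArr R (Assoc M x y (z \<otimes>M w)) \<cdot>N (FMult R (x \<otimes>M y, z \<otimes>M w) \<cdot>N (FMult R (x, y) \<boxtimes>N Idt N (FObj R (z \<otimes>M w)))))
         \<cdot>N (Idt N (FObj R x \<otimes>N FObj R y) \<boxtimes>N FMult R (z, w))"
      by simp
    also have "\<dots> = FMult R (x, y \<otimes>M (z \<otimes>M w)) \<cdot>N ((Idt N (FObj R x) \<boxtimes>N (FMult R (y, z \<otimes>M w) \<cdot>N (Idt N (FObj R y) \<boxtimes>N FMult R (z, w))))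
      \<cdot>N Assoc N (FObj R x) (FObj R y) (FObj R z \<otimes>N FObj R w))"
      by (subst fmult_assoc') (simp_all add: cod_smc.assoc_nat_idt)
    finally show ?thesis .
  qed
  have "FArr R (Assoc M a c (b \<otimes>M d)) \<cdot>N ?l
    = FArr R (Assoc M a c (b \<otimes>M d) \<cdot>M interchange M a b c d) \<cdot>N (FMult R (a \<otimes>M b, c \<otimes>M d) \<cdot>N (FMult R (a, b) \<boxtimes>N FMult R (c, d)))"
    by simp
  also have "\<dots> = FArr R (Idt M a \<boxtimes>M dom_smc.lswap b c d) \<cdot>N (FArr R (Assoc M a b (c \<otimes>M d)) \<cdot>N (FMult R (a \<otimes>M b, c \<otimes>M d) \<cdot>N (FMult R (a, b) \<boxtimes>N FMult R (c, d))))"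
    by (subst dom_smc.assoc_interchange) simp_all
  also have "\<dots> = (FArr R (Idt M a \<boxtimes>M dom_smc.lswap b c d) \<cdot>N FMult R (a, b \<otimes>M (c \<otimes>M d))) \<cdot>N ((Idt N (FObj R a) \<boxtimes>N (FMult R (b, c \<otimes>M d) \<cdot>N (Idt N (FObj R b) \<boxtimes>N FMult R (c, d))))
      \<cdot>N Assoc N (FObj R a) (FObj R b) (FObj R c \<otimes>N FObj R d))"
    by (subst N) simp_all
  also have "\<dots> = FMult R (a, c \<otimes>M (b \<otimes>M d)) \<cdot>N ((Idt N (FObj R a) \<boxtimes>N (FMult R (c, b \<otimes>M d) \<cdot>N (Idt N (FObj R c) \<boxtimes>N FMult R (b, d))))
      \<cdot>N ((Idt N (FObj R a) \<boxtimes>N cod_smc.lswap (FObj R b) (FObj R c) (FObj R d)) \<cdot>N Assoc N (FObj R a) (FObj R b) (FObj R c \<otimes>N FObj R d)))"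
    by (subst fmult_nat_right) (simp_all add: fmult_lswap)
  also have "\<dots> = (FMult R (a, c \<otimes>M (b \<otimes>M d)) \<cdot>N ((Idt N (FObj R a) \<boxtimes>N (FMult R (c, b \<otimes>M d) \<cdot>N (Idt N (FObj R c) \<boxtimes>N FMult R (b, d))))
      \<cdot>N Assoc N (FObj R a) (FObj R c) (FObj R b \<otimes>N FObj R d))) \<cdot>N interchange N (FObj R a) (FObj R b) (FObj R c) (FObj R d)"
    by (subst cod_smc.assoc_interchange[symmetric]) simp_all
  also have "\<dots> = FArr R (Assoc M a c (b \<otimes>M d)) \<cdot>N ?r"
    by (subst N[symmetric]) simp_all
  finally show "FArr R (Assoc M a c (b \<otimes>M d)) \<cdot>N ?l = FArr R (Assoc M a c (b \<otimes>M d)) \<cdot>N ?r" .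
qed simp_all

end

section \<open>Identity and composite functors\<close>

lemma id_monfctr_simps [simp]:
  "x \<in> Obj M \<Longrightarrow> FObj (id_monfctr M) x = x"
  "f \<in> Arr M \<Longrightarrow> FArr (id_monfctr M) f = f"
  "FUnit (id_monfctr M) = Idt M (Unt M)"
  "\<lbrakk>x \<in> Obj M; y \<in> Obj M\<rbrakk> \<Longrightarrow> FMult (id_monfctr M) (x, y) = Idt M (x \<otimes>M y)"
  by (simp_all add: id_monfctr_def)

lemma comp_monfctr_simps [simp]:
  "x \<in> Obj M \<Longrightarrow> FObj (comp_monfctr M P S R) x = FObj S (FObj R x)"
  "f \<in> Arr M \<Longrightarrow> FArr (comp_monfctr M P S R) f = FArr S (FArr R f)"
  "FUnit (comp_monfctr M P S R) = FArr S (FUnit R) \<cdot>P FUnit S"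
  "\<lbrakk>x \<in> Obj M; y \<in> Obj M\<rbrakk> \<Longrightarrow> FMult (comp_monfctr M P S R) (x, y)
    = FArr S (FMult R (x, y)) \<cdot>P FMult S (FObj R x, FObj R y)"
  by (simp_all add: comp_monfctr_def)

lemma monfctr_ext_id [simp]: "monfctr_ext M (id_monfctr M)"
  and monfctr_ext_comp [simp]: "monfctr_ext M (comp_monfctr M P S R)"
  by (simp_all add: monfctr_ext_def id_monfctr_def comp_monfctr_def)

text \<open>The 2-categories are strict, so their laws for 1-cells are equations of records.
  Extensionality reduces these to the values on the carriers.\<close>

lemma monfctr_eqI:
  assumes "monfctr_ext M R" "monfctr_ext M S" "FUnit R = FUnit S"
    and "\<And>x. x \<in> Obj M \<Longrightarrow> FObj R x = FObj S x" "\<And>f. f \<in> Arr M \<Longrightarrow> FArr R f = FArr S f"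
    and "\<And>x y. \<lbrakk>x \<in> Obj M; y \<in> Obj M\<rbrakk> \<Longrightarrow> FMult R (x, y) = FMult S (x, y)"
  shows "R = S"
proof -
  have "FObj R = FObj S" "FArr R = FArr S" "FMult R = FMult S"
    using assms by (auto simp: monfctr_ext_def intro: extensionalityI)
  with assms(3) show ?thesis by (intro monfctr.equality) simp_all
qed

lemma sym_mon_functor_id:
  assumes "symmetric_monoidal_category M"
  shows "sym_mon_functor M M (id_monfctr M)"
proof -
  interpret M: symmetric_monoidal_category M by fact
  show ?thesis
    by (intro sym_mon_functorI cat_functorI) (simp_all add: assms M.category_axioms)
qed

lemma sym_mon_functor_comp:
  assumes "sym_mon_functor M N R" "sym_mon_functor N P S"
  shows "sym_mon_functor M P (comp_monfctr M P S R)"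
proof -
  interpret R: sym_mon_functor M N R by fact
  interpret S: sym_mon_functor N P S by fact
  note [simp] = S.cod_smc.comp_extend[OF S.fmult_nat] S.fmult_nat
  show ?thesis
  proof (intro sym_mon_functorI cat_functorI)
    fix f g assume [simp]: "f \<in> Arr M" "g \<in> Arr M"
    show "FArr (comp_monfctr M P S R) (f \<boxtimes>M g) \<cdot>P FMult (comp_monfctr M P S R) (Dom M f, Dom M g)
      = FMult (comp_monfctr M P S R) (Cod M f, Cod M g) \<cdot>P
        (FArr (comp_monfctr M P S R) f \<boxtimes>P FArr (comp_monfctr M P S R) g)"
      using arg_cong[OF R.fmult_nat[of f g "Dom M f" "Dom M g"], of "FArr S"]
        S.cod_smc.comp_extend[of "FArr S (FArr R (f \<boxtimes>M g))" "FArr S (FMult R (Dom M f, Dom M g))"]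
      by simp
  next
    fix x y z assume [simp]: "x \<in> Obj M" "y \<in> Obj M" "z \<in> Obj M"
    show "FArr (comp_monfctr M P S R) (Assoc M x y z) \<cdot>P (FMult (comp_monfctr M P S R) (x \<otimes>M y, z)
        \<cdot>P (FMult (comp_monfctr M P S R) (x, y) \<boxtimes>P Idt P (FObj (comp_monfctr M P S R) z)))
      = FMult (comp_monfctr M P S R) (x, y \<otimes>M z) \<cdot>P ((Idt P (FObj (comp_monfctr M P S R) x) \<boxtimes>P FMult (comp_monfctr M P S R) (y, z))
        \<cdot>P Assoc P (FObj (comp_monfctr M P S R) x) (FObj (comp_monfctr M P S R) y) (FObj (comp_monfctr M P S R) z))"
    proof -
      \<comment> \<open>The part that involves only the structure of S at images of R. What comes
        from R is collected under \<open>FArr S\<close>, so that the associativity laws of R and of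
        S apply one after the other.\<close>
      let ?k = "FMult S (FObj R x \<otimes>N FObj R y, FObj R z) \<cdot>P (FMult S (FObj R x, FObj R y) \<boxtimes>P Idt P (FObj S (FObj R z)))"
      have "FMult S (FObj R (x \<otimes>M y), FObj R z) \<cdot>P ((FArr S (FMult R (x, y)) \<cdot>P FMult S (FObj R x, FObj R y)) \<boxtimes>P Idt P (FObj S (FObj R z)))
        = FArr S (FMult R (x, y) \<boxtimes>N Idt N (FObj R z)) \<cdot>P ?k"
        by simp
      then have "?thesis \<longleftrightarrow> FArr S (FArr R (Assoc M x y z) \<cdot>N (FMult R (x \<otimes>M y, z)
          \<cdot>N (FMult R (x, y) \<boxtimes>N Idt N (FObj R z)))) \<cdot>P ?k
        = FArr S (FMult R (x, y \<otimes>M z)) \<cdot>P ((FArr S (Idt N (FObj R x) \<boxtimes>N FMult R (y, z)) \<cdot>P FMult S (FObj R x, FObj R y \<otimes>N FObj R z))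
          \<cdot>P ((Idt P (FObj S (FObj R x)) \<boxtimes>P FMult S (FObj R y, FObj R z))
          \<cdot>P Assoc P (FObj S (FObj R x)) (FObj S (FObj R y)) (FObj S (FObj R z))))"
        by (subst S.fmult_nat_right) simp_all
      then show ?thesis
        by (simp add: R.fmult_assoc' S.fmult_assoc')
    qed
  next
    fix x assume [simp]: "x \<in> Obj M"
    show "FArr (comp_monfctr M P S R) (Lunit M x) \<cdot>P (FMult (comp_monfctr M P S R) (Unt M, x) \<cdot>P
        (FUnit (comp_monfctr M P S R) \<boxtimes>P Idt P (FObj (comp_monfctr M P S R) x)))
      = Lunit P (FObj (comp_monfctr M P S R) x)"
    proof -
      have "FArr S (FArr R (Lunit M x) \<cdot>N (FMult R (Unt M, x) \<cdot>N (FUnit R \<boxtimes>N Idt N (FObj R x)))) \<cdot>P (FMult S (Unt N, FObj R x) \<cdot>P (FUnit S \<boxtimes>P Idt P (FObj S (FObj R x))))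
        = Lunit P (FObj S (FObj R x))"
        by (simp add: R.fmult_lunit' S.fmult_lunit')
      then show ?thesis
        by (simp add: S.fmult_nat_left S.cod_smc.comp_extend[OF S.fmult_nat_left])
    qed
    show "FArr (comp_monfctr M P S R) (Runit M x) \<cdot>P (FMult (comp_monfctr M P S R) (x, Unt M) \<cdot>P
        (Idt P (FObj (comp_monfctr M P S R) x) \<boxtimes>P FUnit (comp_monfctr M P S R)))
      = Runit P (FObj (comp_monfctr M P S R) x)"
    proof -
      have "FArr S (FArr R (Runit M x) \<cdot>N (FMult R (x, Unt M) \<cdot>N (Idt N (FObj R x) \<boxtimes>N FUnit R))) \<cdot>P (FMult S (FObj R x, Unt N) \<cdot>P (Idt P (FObj S (FObj R x)) \<boxtimes>P FUnit S))
        = Runit P (FObj S (FObj R x))"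
        by (simp add: R.fmult_runit' S.fmult_runit')
      then show ?thesis
        by (simp add: S.fmult_nat_right S.cod_smc.comp_extend[OF S.fmult_nat_right])
    qed
  next
    fix x y assume [simp]: "x \<in> Obj M" "y \<in> Obj M"
    show "FArr (comp_monfctr M P S R) (Symm M x y) \<cdot>P FMult (comp_monfctr M P S R) (x, y)
      = FMult (comp_monfctr M P S R) (y, x) \<cdot>P Symm P (FObj (comp_monfctr M P S R) x) (FObj (comp_monfctr M P S R) y)"
      using arg_cong[OF R.fmult_symm[of x y], of "FArr S"]
        S.cod_smc.comp_extend[of "FArr S (FArr R (Symm M x y))" "FArr S (FMult R (x, y))"]
      by (simp add: S.fmult_symm)
  qed (simp_all add: R.dom_smc.symmetric_monoidal_category_axioms S.cod_smc.symmetric_monoidal_category_axioms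
      R.dom_smc.category_axioms S.cod_smc.category_axioms)
qed

section \<open>Monoidal transformations and their composites\<close>

lemma mon_transI:
  assumes "cat_functor M N R" "cat_functor M N S"
    and "\<And>x. x \<in> Obj M \<Longrightarrow> t x \<in> Arr N \<and> Dom N (t x) = FObj R x \<and> Cod N (t x) = FObj S x"
    and "\<And>f. f \<in> Arr M \<Longrightarrow> FArr S f \<cdot>N t (Dom M f) = t (Cod M f) \<cdot>N FArr R f"
    and "t (Unt M) \<cdot>N FUnit R = FUnit S"
    and "\<And>x y. \<lbrakk>x \<in> Obj M; y \<in> Obj M\<rbrakk> \<Longrightarrow>
      t (x \<otimes>M y) \<cdot>N FMult R (x, y) = FMult S (x, y) \<cdot>N (t x \<boxtimes>N t y)"
  shows "mon_trans M N R S t"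
  using assms by (intro mon_trans.intro mon_trans_axioms.intro nat_transI) auto

lemma mon_trans_id:
  assumes "sym_mon_functor M N R"
  shows "mon_trans M N R R (\<lambda>m\<in>Obj M. Idt N (FObj R m))"
proof -
  interpret R: sym_mon_functor M N R by fact
  show ?thesis
    by (intro mon_transI) (simp_all add: R.cat_functor_axioms)
qed

lemma mon_trans_vcomp:
  assumes "sym_mon_functor M N R" "sym_mon_functor M N S" "sym_mon_functor M N T"
    and "mon_trans M N R S \<phi>" "mon_trans M N S T \<psi>"
  shows "mon_trans M N R T (\<lambda>m\<in>Obj M. \<psi> m \<cdot>N \<phi> m)"
proof -
  interpret R: sym_mon_functor M N R by fact
  interpret S: sym_mon_functor M N S by fact
  interpret T: sym_mon_functor M N T by fact
  interpret p: mon_trans M N R S \<phi> by fact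
  interpret q: mon_trans M N S T \<psi> by fact
  show ?thesis
  proof (intro mon_transI)
    fix f assume [simp]: "f \<in> Arr M"
    show "FArr T f \<cdot>N (\<lambda>m\<in>Obj M. \<psi> m \<cdot>N \<phi> m) (Dom M f) = (\<lambda>m\<in>Obj M. \<psi> m \<cdot>N \<phi> m) (Cod M f) \<cdot>N FArr R f"
      by (simp add: R.cod_smc.comp_extend[OF q.naturality'] flip: p.naturality')
  next
    fix x y assume [simp]: "x \<in> Obj M" "y \<in> Obj M"
    show "(\<lambda>m\<in>Obj M. \<psi> m \<cdot>N \<phi> m) (x \<otimes>M y) \<cdot>N FMult R (x, y) = FMult T (x, y) \<cdot>N
      ((\<lambda>m\<in>Obj M. \<psi> m \<cdot>N \<phi> m) x \<boxtimes>N (\<lambda>m\<in>Obj M. \<psi> m \<cdot>N \<phi> m) y)"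
      by (simp add: p.mult_comp R.cod_smc.comp_extend[OF q.mult_comp])
  qed (simp_all add: R.cat_functor_axioms T.cat_functor_axioms p.unit_comp q.unit_comp)
qed

lemma mon_trans_inv:
  assumes "sym_mon_functor M N R" "sym_mon_functor M N S" "mon_trans M N R S \<phi>"
    and "\<And>m. m \<in> Obj M \<Longrightarrow> is_iso N (\<phi> m)"
  shows "mon_trans M N S R (\<lambda>m\<in>Obj M. inv_arr N (\<phi> m))"
proof -
  interpret R: sym_mon_functor M N R by fact
  interpret S: sym_mon_functor M N S by fact
  interpret p: mon_trans M N R S \<phi> by fact
  note [simp] = assms(4)
  show ?thesis
  proof (intro mon_transI)
    fix f assume [simp]: "f \<in> Arr M"
    show "FArr R f \<cdot>N (\<lambda>m\<in>Obj M. inv_arr N (\<phi> m)) (Dom M f) = (\<lambda>m\<in>Obj M. inv_arr N (\<phi> m)) (Cod M f) \<cdot>N FArr S f"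
      by (rule R.cod_smc.iso_cancel_left[where f = "\<phi> (Cod M f)"],
          rule R.cod_smc.iso_cancel_right[where f = "\<phi> (Dom M f)"])
        (simp_all add: p.naturality')
  next
    show "(\<lambda>m\<in>Obj M. inv_arr N (\<phi> m)) (Unt M) \<cdot>N FUnit S = FUnit R"
      by (simp flip: p.unit_comp)
  next
    fix x y assume [simp]: "x \<in> Obj M" "y \<in> Obj M"
    show "(\<lambda>m\<in>Obj M. inv_arr N (\<phi> m)) (x \<otimes>M y) \<cdot>N FMult S (x, y) = FMult R (x, y) \<cdot>N
      ((\<lambda>m\<in>Obj M. inv_arr N (\<phi> m)) x \<boxtimes>N (\<lambda>m\<in>Obj M. inv_arr N (\<phi> m)) y)"
      by (rule R.cod_smc.iso_cancel_left[where f = "\<phi> (x \<otimes>M y)"],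
          rule R.cod_smc.iso_cancel_right[where f = "\<phi> x \<boxtimes>N \<phi> y"])
        (simp_all add: p.mult_comp R.cod_smc.comp_extend[OF p.mult_comp])
  qed (simp_all add: R.cat_functor_axioms S.cat_functor_axioms)
qed

lemma mon_trans_hcomp:
  assumes "sym_mon_functor M N R" "sym_mon_functor M N R'" "sym_mon_functor N P S" "sym_mon_functor N P S'"
    and "mon_trans M N R R' \<phi>" "mon_trans N P S S' \<psi>"
  shows "mon_trans M P (comp_monfctr M P S R) (comp_monfctr M P S' R') (hcomp_trans M P S \<psi> R' \<phi>)"
proof -
  interpret R: sym_mon_functor M N R by fact
  interpret R': sym_mon_functor M N R' by fact
  interpret S: sym_mon_functor N P S by fact
  interpret S': sym_mon_functor N P S' by fact
  interpret p: mon_trans M N R R' \<phi> by fact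
  interpret q: mon_trans N P S S' \<psi> by fact
  interpret SR: sym_mon_functor M P "comp_monfctr M P S R" by (rule sym_mon_functor_comp) fact+
  interpret SR': sym_mon_functor M P "comp_monfctr M P S' R'" by (rule sym_mon_functor_comp) fact+
  show ?thesis
  proof (intro mon_transI)
    fix f assume [simp]: "f \<in> Arr M"
    show "FArr (comp_monfctr M P S' R') f \<cdot>P hcomp_trans M P S \<psi> R' \<phi> (Dom M f)
      = hcomp_trans M P S \<psi> R' \<phi> (Cod M f) \<cdot>P FArr (comp_monfctr M P S R) f"
      using arg_cong[OF p.naturality'[of f "Dom M f"], of "FArr S"]
      by (simp add: hcomp_trans_def S.cod_smc.comp_extend[OF q.naturality'])
  next
    have "hcomp_trans M P S \<psi> R' \<phi> (Unt M) \<cdot>P FUnit (comp_monfctr M P S R)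
      = \<psi> (FObj R' (Unt M)) \<cdot>P (FArr S (\<phi> (Unt M) \<cdot>N FUnit R) \<cdot>P FUnit S)"
      by (simp add: hcomp_trans_def)
    also have "\<dots> = FUnit (comp_monfctr M P S' R')"
      using S.cod_smc.comp_extend[OF q.naturality'[of "FUnit R'" "Unt N", symmetric]]
      by (simp add: p.unit_comp q.unit_comp)
    finally show "hcomp_trans M P S \<psi> R' \<phi> (Unt M) \<cdot>P FUnit (comp_monfctr M P S R) = FUnit (comp_monfctr M P S' R')" .
  next
    fix x y assume [simp]: "x \<in> Obj M" "y \<in> Obj M"
    have "hcomp_trans M P S \<psi> R' \<phi> (x \<otimes>M y) \<cdot>P FMult (comp_monfctr M P S R) (x, y)
      = \<psi> (FObj R' (x \<otimes>M y)) \<cdot>P (FArr S (\<phi> (x \<otimes>M y) \<cdot>N FMult R (x, y)) \<cdot>P FMult S (FObj R x, FObj R y))"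
      by (simp add: hcomp_trans_def)
    also have "\<dots> = (\<psi> (FObj R' (x \<otimes>M y)) \<cdot>P FArr S (FMult R' (x, y))) \<cdot>P (FArr S (\<phi> x \<boxtimes>N \<phi> y) \<cdot>P FMult S (FObj R x, FObj R y))"
      by (simp add: p.mult_comp)
    also have "\<dots> = FArr S' (FMult R' (x, y)) \<cdot>P (\<psi> (FObj R' x \<otimes>N FObj R' y) \<cdot>P (FMult S (FObj R' x, FObj R' y) \<cdot>P (FArr S (\<phi> x) \<boxtimes>P FArr S (\<phi> y))))"
      using q.naturality'[of "FMult R' (x, y)" "FObj R' x \<otimes>N FObj R' y", symmetric]
        S.cod_smc.comp_extend[OF q.naturality'[of "FMult R' (x, y)" "FObj R' x \<otimes>N FObj R' y", symmetric]]
      by (simp add: S.fmult_nat)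
    also have "\<dots> = FMult (comp_monfctr M P S' R') (x, y) \<cdot>P
      (hcomp_trans M P S \<psi> R' \<phi> x \<boxtimes>P hcomp_trans M P S \<psi> R' \<phi> y)"
      by (simp add: hcomp_trans_def S.cod_smc.comp_extend[OF q.mult_comp])
    finally show "hcomp_trans M P S \<psi> R' \<phi> (x \<otimes>M y) \<cdot>P FMult (comp_monfctr M P S R) (x, y) = \<dots>" .
  qed (use SR.cat_functor_axioms SR'.cat_functor_axioms in \<open>auto simp: hcomp_trans_def\<close>)
qed

section \<open>The 2-category of symmetric monoidal categories\<close>

text \<open>\<open>comp_monfctr\<close> restricts to the carriers, so this equation holds on the
  nose for extensional R.\<close>

lemma comp_monfctr_id_left:
  assumes "sym_mon_functor M N R" "monfctr_ext M R"
  shows "comp_monfctr M N (id_monfctr N) R = R"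
proof -
  interpret R: sym_mon_functor M N R by fact
  show ?thesis using assms(2) by (intro monfctr_eqI[where M = M]) simp_all
qed

lemma comp_monfctr_id_right:
  assumes "sym_mon_functor M N R" "monfctr_ext M R"
  shows "comp_monfctr M N R (id_monfctr M) = R"
proof -
  interpret R: sym_mon_functor M N R by fact
  show ?thesis using assms(2) by (intro monfctr_eqI[where M = M]) simp_all
qed

lemma comp_monfctr_assoc:
  assumes "sym_mon_functor M N R" "sym_mon_functor N P S" "sym_mon_functor P Q T"
  shows "comp_monfctr M Q (comp_monfctr N Q T S) R = comp_monfctr M Q T (comp_monfctr M P S R)"
proof -
  interpret R: sym_mon_functor M N R by fact
  interpret S: sym_mon_functor N P S by fact
  interpret T: sym_mon_functor P Q T by fact
  show ?thesis by (intro monfctr_eqI[where M = M]) simp_all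
qed

lemma hcomp_trans_ext [simp]: "hcomp_trans M P S \<psi> R' \<phi> \<in> extensional (Obj M)"
  by (simp add: hcomp_trans_def)

lemma hcomp_trans_id:
  assumes "sym_mon_functor M N R" "sym_mon_functor N P S"
  shows "hcomp_trans M P S (\<lambda>m\<in>Obj N. Idt P (FObj S m)) R (\<lambda>m\<in>Obj M. Idt N (FObj R m))
    = (\<lambda>m\<in>Obj M. Idt P (FObj S (FObj R m)))"
proof -
  interpret R: sym_mon_functor M N R by fact
  interpret S: sym_mon_functor N P S by fact
  show ?thesis by (rule extensionalityI[where A = "Obj M"]) (simp_all add: hcomp_trans_def)
qed

lemma hcomp_trans_vcomp:
  assumes "sym_mon_functor M N R" "sym_mon_functor M N R'" "sym_mon_functor M N R''"
    and "sym_mon_functor N P S" "sym_mon_functor N P S'" "sym_mon_functor N P S''"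
    and "mon_trans M N R R' \<phi>" "mon_trans M N R' R'' \<phi>'" "mon_trans N P S S' \<psi>" "mon_trans N P S' S'' \<psi>'"
  shows "hcomp_trans M P S (\<lambda>n\<in>Obj N. \<psi>' n \<cdot>P \<psi> n) R'' (\<lambda>m\<in>Obj M. \<phi>' m \<cdot>N \<phi> m)
    = (\<lambda>m\<in>Obj M. hcomp_trans M P S' \<psi>' R'' \<phi>' m \<cdot>P hcomp_trans M P S \<psi> R' \<phi> m)"
proof (rule extensionalityI[where A = "Obj M"])
  interpret R: sym_mon_functor M N R by fact
  interpret R': sym_mon_functor M N R' by fact
  interpret R'': sym_mon_functor M N R'' by fact
  interpret S: sym_mon_functor N P S by fact
  interpret S': sym_mon_functor N P S' by fact
  interpret S'': sym_mon_functor N P S'' by fact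
  interpret p: mon_trans M N R R' \<phi> by fact
  interpret p': mon_trans M N R' R'' \<phi>' by fact
  interpret q: mon_trans N P S S' \<psi> by fact
  interpret q': mon_trans N P S' S'' \<psi>' by fact
  fix m assume [simp]: "m \<in> Obj M"
  show "hcomp_trans M P S (\<lambda>n\<in>Obj N. \<psi>' n \<cdot>P \<psi> n) R'' (\<lambda>m\<in>Obj M. \<phi>' m \<cdot>N \<phi> m) m
    = (\<lambda>m\<in>Obj M. hcomp_trans M P S' \<psi>' R'' \<phi>' m \<cdot>P hcomp_trans M P S \<psi> R' \<phi> m) m"
    using S.cod_smc.comp_extend[OF q.naturality'[of "\<phi>' m" "FObj R' m"]]
    by (simp add: hcomp_trans_def)
qed simp_all

lemma hcomp_trans_assoc:
  assumes "sym_mon_functor M N R" "sym_mon_functor M N R'"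
    and "sym_mon_functor N P S" "sym_mon_functor N P S'"
    and "sym_mon_functor P Q T" "sym_mon_functor P Q T'"
    and "mon_trans M N R R' \<phi>" "mon_trans N P S S' \<psi>" "mon_trans P Q T T' \<omega>"
  shows "hcomp_trans M Q (comp_monfctr N Q T S) (hcomp_trans N Q T \<omega> S' \<psi>) R' \<phi>
    = hcomp_trans M Q T \<omega> (comp_monfctr M P S' R') (hcomp_trans M P S \<psi> R' \<phi>)"
proof (rule extensionalityI[where A = "Obj M"])
  interpret R: sym_mon_functor M N R by fact
  interpret R': sym_mon_functor M N R' by fact
  interpret S: sym_mon_functor N P S by fact
  interpret S': sym_mon_functor N P S' by fact
  interpret T: sym_mon_functor P Q T by fact
  interpret T': sym_mon_functor P Q T' by fact
  interpret p: mon_trans M N R R' \<phi> by fact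
  interpret q: mon_trans N P S S' \<psi> by fact
  interpret r: mon_trans P Q T T' \<omega> by fact
  fix m assume [simp]: "m \<in> Obj M"
  show "hcomp_trans M Q (comp_monfctr N Q T S) (hcomp_trans N Q T \<omega> S' \<psi>) R' \<phi> m
    = hcomp_trans M Q T \<omega> (comp_monfctr M P S' R') (hcomp_trans M P S \<psi> R' \<phi>) m"
    by (simp add: hcomp_trans_def)
qed simp_all

lemma hcomp_trans_id_right:
  assumes "sym_mon_functor M N R" "sym_mon_functor M N R'" "mon_trans M N R R' \<phi>" "\<phi> \<in> extensional (Obj M)"
  shows "hcomp_trans M N R \<phi> (id_monfctr M) (\<lambda>m\<in>Obj M. Idt M (FObj (id_monfctr M) m)) = \<phi>"
proof (rule extensionalityI[where A = "Obj M"])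
  interpret R: sym_mon_functor M N R by fact
  interpret R': sym_mon_functor M N R' by fact
  interpret p: mon_trans M N R R' \<phi> by fact
  fix m assume [simp]: "m \<in> Obj M"
  show "hcomp_trans M N R \<phi> (id_monfctr M) (\<lambda>m\<in>Obj M. Idt M (FObj (id_monfctr M) m)) m = \<phi> m"
    by (simp add: hcomp_trans_def)
qed (simp_all add: assms)

lemma hcomp_trans_id_left:
  assumes "sym_mon_functor M N R" "sym_mon_functor M N R'" "mon_trans M N R R' \<phi>" "\<phi> \<in> extensional (Obj M)"
  shows "hcomp_trans M N (id_monfctr N) (\<lambda>m\<in>Obj N. Idt N (FObj (id_monfctr N) m)) R' \<phi> = \<phi>"
proof (rule extensionalityI[where A = "Obj M"])
  interpret R: sym_mon_functor M N R by fact
  interpret R': sym_mon_functor M N R' by fact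
  interpret p: mon_trans M N R R' \<phi> by fact
  fix m assume [simp]: "m \<in> Obj M"
  show "hcomp_trans M N (id_monfctr N) (\<lambda>m\<in>Obj N. Idt N (FObj (id_monfctr N) m)) R' \<phi> m = \<phi> m"
    by (simp add: hcomp_trans_def)
qed (simp_all add: assms)

lemma vcomp_trans_id:
  assumes "sym_mon_functor M N R" "sym_mon_functor M N S" "mon_trans M N R S \<phi>" "\<phi> \<in> extensional (Obj M)"
  shows "(\<lambda>m\<in>Obj M. \<phi> m \<cdot>N (\<lambda>m\<in>Obj M. Idt N (FObj R m)) m) = \<phi>"
    and "(\<lambda>m\<in>Obj M. (\<lambda>m\<in>Obj M. Idt N (FObj S m)) m \<cdot>N \<phi> m) = \<phi>"
proof -
  interpret R: sym_mon_functor M N R by fact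
  interpret p: mon_trans M N R S \<phi> by fact
  show "(\<lambda>m\<in>Obj M. \<phi> m \<cdot>N (\<lambda>m\<in>Obj M. Idt N (FObj R m)) m) = \<phi>"
    "(\<lambda>m\<in>Obj M. (\<lambda>m\<in>Obj M. Idt N (FObj S m)) m \<cdot>N \<phi> m) = \<phi>"
    by (rule extensionalityI[where A = "Obj M"]; simp add: assms(4))+
qed

lemma vcomp_trans_assoc:
  assumes "sym_mon_functor M N R" "mon_trans M N R S \<phi>" "mon_trans M N S T \<psi>" "mon_trans M N T U \<omega>"
  shows "(\<lambda>m\<in>Obj M. (\<lambda>m\<in>Obj M. \<omega> m \<cdot>N \<psi> m) m \<cdot>N \<phi> m)
    = (\<lambda>m\<in>Obj M. \<omega> m \<cdot>N (\<lambda>m\<in>Obj M. \<psi> m \<cdot>N \<phi> m) m)"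
proof -
  interpret R: sym_mon_functor M N R by fact
  interpret p: mon_trans M N R S \<phi> by fact
  interpret q: mon_trans M N S T \<psi> by fact
  interpret r: mon_trans M N T U \<omega> by fact
  show ?thesis by (rule extensionalityI[where A = "Obj M"]) simp_all
qed

lemma smc_hom_simps:
  "Obj (smc_hom M N) = {R. sym_mon_functor M N R \<and> monfctr_ext M R}"
  "(R, S, \<phi>) \<in> Arr (smc_hom M N) \<longleftrightarrow> sym_mon_functor M N R \<and> monfctr_ext M R
    \<and> sym_mon_functor M N S \<and> monfctr_ext M S \<and> mon_trans M N R S \<phi> \<and> \<phi> \<in> extensional (Obj M)"
  "Dom (smc_hom M N) (R, S, \<phi>) = R"
  "Cod (smc_hom M N) (R, S, \<phi>) = S"
  "Idt (smc_hom M N) R = (R, R, \<lambda>m\<in>Obj M. Idt N (FObj R m))"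
  "(S', T, \<psi>) \<cdot>(smc_hom M N) (R, S, \<phi>) = (R, T, \<lambda>m\<in>Obj M. \<psi> m \<cdot>N \<phi> m)"
  by (simp_all add: smc_hom_def)

lemma category_smc_hom: "category (smc_hom M N)"
proof (rule categoryI)
  \<comment> \<open>The restricted functions stay folded here and in the next case, because
    \<open>vcomp_trans_id\<close> and \<open>vcomp_trans_assoc\<close> are stated with nested
    restrictions.\<close>
  fix f assume "f \<in> Arr (smc_hom M N)"
  then show "f \<cdot>(smc_hom M N) Idt (smc_hom M N) (Dom (smc_hom M N) f) = f \<and>
      Idt (smc_hom M N) (Cod (smc_hom M N) f) \<cdot>(smc_hom M N) f = f"
    by (cases f) (auto simp: smc_hom_simps simp del: restrict_apply intro: vcomp_trans_id)
next
  fix f g h assume "f \<in> Arr (smc_hom M N)" "g \<in> Arr (smc_hom M N)" "h \<in> Arr (smc_hom M N)"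
    "Cod (smc_hom M N) f = Dom (smc_hom M N) g" "Cod (smc_hom M N) g = Dom (smc_hom M N) h"
  then show "(h \<cdot>(smc_hom M N) g) \<cdot>(smc_hom M N) f = h \<cdot>(smc_hom M N) (g \<cdot>(smc_hom M N) f)"
    by (cases f; cases g; cases h) (auto simp: smc_hom_simps simp del: restrict_apply intro: vcomp_trans_assoc)
next
  fix f g assume "f \<in> Arr (smc_hom M N)" "g \<in> Arr (smc_hom M N)"
    "Cod (smc_hom M N) f = Dom (smc_hom M N) g"
  then show "g \<cdot>(smc_hom M N) f \<in> Arr (smc_hom M N) \<and>
      Dom (smc_hom M N) (g \<cdot>(smc_hom M N) f) = Dom (smc_hom M N) f \<and>
      Cod (smc_hom M N) (g \<cdot>(smc_hom M N) f) = Cod (smc_hom M N) g"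
    by (cases f; cases g) (auto simp: smc_hom_simps intro: mon_trans_vcomp)
qed (auto simp: smc_hom_simps mon_trans_id)

text \<open>With \<open>smc_hom_iso_component\<close> this shows that invertible 2-cells are the
  pointwise invertible ones. The slice asks for invertible 2-cells, while identifications of actions
  are invertible pointwise.\<close>

lemma smc_hom_is_iso:
  assumes "(R, S, \<phi>) \<in> Arr (smc_hom M N)" "\<And>m. m \<in> Obj M \<Longrightarrow> is_iso N (\<phi> m)"
  shows "is_iso (smc_hom M N) (R, S, \<phi>)"
proof -
  interpret category "smc_hom M N" by (rule category_smc_hom)
  have R: "sym_mon_functor M N R" and S: "sym_mon_functor M N S"
    and p: "mon_trans M N R S \<phi>" "\<phi> \<in> extensional (Obj M)"
    using assms(1) by (simp_all add: smc_hom_simps)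
  interpret R: sym_mon_functor M N R by fact
  interpret p: mon_trans M N R S \<phi> by fact
  have i: "(S, R, \<lambda>m\<in>Obj M. inv_arr N (\<phi> m)) \<in> Arr (smc_hom M N)"
    using assms R S p mon_trans_inv[OF R S p(1)] by (simp add: smc_hom_simps)
  show ?thesis
    by (rule is_isoI[OF assms(1) i]) (auto simp: smc_hom_simps assms(2) intro!: restrict_ext)
qed

lemma smc_hom_iso_component:
  assumes "is_iso (smc_hom M N) (R, S, \<phi>)" "m \<in> Obj M"
  shows "is_iso N (\<phi> m)"
proof -
  obtain \<psi> where a: "(R, S, \<phi>) \<in> Arr (smc_hom M N)" "(S, R, \<psi>) \<in> Arr (smc_hom M N)"
    and e: "(S, R, \<psi>) \<cdot>(smc_hom M N) (R, S, \<phi>) = Idt (smc_hom M N) R"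
    "(R, S, \<phi>) \<cdot>(smc_hom M N) (S, R, \<psi>) = Idt (smc_hom M N) S"
    using assms(1) unfolding is_iso_def inverse_arrows_def hom_iff
    by (metis prod_cases3 smc_hom_simps(3,4))
  interpret R: sym_mon_functor M N R using a by (simp add: smc_hom_simps)
  interpret p: mon_trans M N R S \<phi> using a by (simp add: smc_hom_simps)
  interpret q: mon_trans M N S R \<psi> using a by (simp add: smc_hom_simps)
  have "\<psi> m \<cdot>N \<phi> m = Idt N (FObj R m)" "\<phi> m \<cdot>N \<psi> m = Idt N (FObj S m)"
    using e assms(2) by (simp_all add: smc_hom_simps fun_eq_iff) (metis restrict_apply')+
  then show ?thesis
    using assms(2) by (intro R.cod_smc.is_isoI[where g = "\<psi> m"]) simp_all
qed

lemma smc_2cat_simps: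
  "Obj2 smc_2cat = {M. symmetric_monoidal_category M}"
  "HomCat smc_2cat = smc_hom"
  "Id1 smc_2cat = id_monfctr"
  "comp1 smc_2cat M N P S R = comp_monfctr M P S R"
  "hcomp smc_2cat M N P (S, S', \<psi>) (R, R', \<phi>)
    = (comp_monfctr M P S R, comp_monfctr M P S' R', hcomp_trans M P S \<psi> R' \<phi>)"
  by (simp_all add: smc_2cat_def)

lemma two_category_smc: "two_category smc_2cat"
proof (rule two_category.intro)
  fix M N P :: "('a, 'b) smc"
  assume "M \<in> Obj2 smc_2cat" "N \<in> Obj2 smc_2cat" "P \<in> Obj2 smc_2cat"
  show "cat_functor (HomCat smc_2cat N P \<times>\<^sub>c HomCat smc_2cat M N) (HomCat smc_2cat M P) (Comp2 smc_2cat M N P)"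
  proof (rule cat_functorI)
    fix f g
    assume "f \<in> Arr (HomCat smc_2cat N P \<times>\<^sub>c HomCat smc_2cat M N)"
      "g \<in> Arr (HomCat smc_2cat N P \<times>\<^sub>c HomCat smc_2cat M N)"
      "Cod (HomCat smc_2cat N P \<times>\<^sub>c HomCat smc_2cat M N) f = Dom (HomCat smc_2cat N P \<times>\<^sub>c HomCat smc_2cat M N) g"
    then show "FArr (Comp2 smc_2cat M N P) (g \<cdot>(HomCat smc_2cat N P \<times>\<^sub>c HomCat smc_2cat M N) f)
      = FArr (Comp2 smc_2cat M N P) g \<cdot>(HomCat smc_2cat M P) FArr (Comp2 smc_2cat M N P) f"
      by (cases f; cases g) (auto simp: smc_2cat_simps smc_hom_simps hcomp_trans_vcomp)
  qed (auto simp: smc_2cat_simps smc_hom_simps category_smc_hom category_prod sym_mon_functor_comp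
      mon_trans_hcomp hcomp_trans_id intro!: restrict_ext)
qed (auto simp: smc_2cat_simps smc_hom_simps category_smc_hom sym_mon_functor_id comp_monfctr_assoc
    comp_monfctr_id_left comp_monfctr_id_right hcomp_trans_assoc hcomp_trans_id_left hcomp_trans_id_right)

section \<open>Slices and strict 2-functors\<close>

context two_category
begin

lemmas homcat' [simp] = homcat
lemmas id1_obj [simp] = id1

lemma
  assumes [simp]: "x \<in> Obj2 A" "y \<in> Obj2 A" "z \<in> Obj2 A"
  shows comp1_obj [simp]: "\<lbrakk>g \<in> Obj (HomCat A y z); f \<in> Obj (HomCat A x y)\<rbrakk> \<Longrightarrow> comp1 A x y z g f \<in> Obj (HomCat A x z)"
    and hcomp_arr [simp]: "\<lbrakk>b \<in> Arr (HomCat A y z); a \<in> Arr (HomCat A x y)\<rbrakk> \<Longrightarrow> hcomp A x y z b a \<in> Arr (HomCat A x z)"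
    and dom_hcomp [simp]: "\<lbrakk>b \<in> Arr (HomCat A y z); a \<in> Arr (HomCat A x y)\<rbrakk> \<Longrightarrow>
      Dom (HomCat A x z) (hcomp A x y z b a) = comp1 A x y z (Dom (HomCat A y z) b) (Dom (HomCat A x y) a)"
    and cod_hcomp [simp]: "\<lbrakk>b \<in> Arr (HomCat A y z); a \<in> Arr (HomCat A x y)\<rbrakk> \<Longrightarrow>
      Cod (HomCat A x z) (hcomp A x y z b a) = comp1 A x y z (Cod (HomCat A y z) b) (Cod (HomCat A x y) a)"
    and hcomp_id2 [simp]: "\<lbrakk>g \<in> Obj (HomCat A y z); f \<in> Obj (HomCat A x y)\<rbrakk> \<Longrightarrow>
      hcomp A x y z (id2 A y z g) (id2 A x y f) = id2 A x z (comp1 A x y z g f)"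
    and hcomp_comp: "\<lbrakk>b \<in> Arr (HomCat A y z); b' \<in> Arr (HomCat A y z); a \<in> Arr (HomCat A x y); a' \<in> Arr (HomCat A x y);
      Cod (HomCat A y z) b = Dom (HomCat A y z) b'; Cod (HomCat A x y) a = Dom (HomCat A x y) a'\<rbrakk> \<Longrightarrow>
      hcomp A x y z (b' \<cdot>(HomCat A y z) b) (a' \<cdot>(HomCat A x y) a)
      = hcomp A x y z b' a' \<cdot>(HomCat A x z) hcomp A x y z b a"
    and hcomp_iso [simp]: "\<lbrakk>is_iso (HomCat A y z) b; is_iso (HomCat A x y) a\<rbrakk> \<Longrightarrow> is_iso (HomCat A x z) (hcomp A x y z b a)"
proof -
  interpret F: cat_functor "HomCat A y z \<times>\<^sub>c HomCat A x y" "HomCat A x z" "Comp2 A x y z"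
    by (rule comp2) fact+
  show "\<lbrakk>g \<in> Obj (HomCat A y z); f \<in> Obj (HomCat A x y)\<rbrakk> \<Longrightarrow> comp1 A x y z g f \<in> Obj (HomCat A x z)"
    using F.fobj_obj[of "(g, f)"] by simp
  show "\<lbrakk>g \<in> Obj (HomCat A y z); f \<in> Obj (HomCat A x y)\<rbrakk> \<Longrightarrow>
      hcomp A x y z (id2 A y z g) (id2 A x y f) = id2 A x z (comp1 A x y z g f)"
    using F.farr_idt'[of "(g, f)"] by simp
  assume "b \<in> Arr (HomCat A y z)" "a \<in> Arr (HomCat A x y)"
  then show "hcomp A x y z b a \<in> Arr (HomCat A x z)"
    "Dom (HomCat A x z) (hcomp A x y z b a) = comp1 A x y z (Dom (HomCat A y z) b) (Dom (HomCat A x y) a)"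
    "Cod (HomCat A x z) (hcomp A x y z b a) = comp1 A x y z (Cod (HomCat A y z) b) (Cod (HomCat A x y) a)"
    using F.farr_arr[of "(b, a)"] F.dom_farr[of "(b, a)"] F.cod_farr[of "(b, a)"] by simp_all
next
  interpret F: cat_functor "HomCat A y z \<times>\<^sub>c HomCat A x y" "HomCat A x z" "Comp2 A x y z"
    by (rule comp2) fact+
  show "\<lbrakk>b \<in> Arr (HomCat A y z); b' \<in> Arr (HomCat A y z); a \<in> Arr (HomCat A x y); a' \<in> Arr (HomCat A x y);
      Cod (HomCat A y z) b = Dom (HomCat A y z) b'; Cod (HomCat A x y) a = Dom (HomCat A x y) a'\<rbrakk> \<Longrightarrow>
      hcomp A x y z (b' \<cdot>(HomCat A y z) b) (a' \<cdot>(HomCat A x y) a)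
      = hcomp A x y z b' a' \<cdot>(HomCat A x z) hcomp A x y z b a"
    using F.farr_comp'[of "(b, a)" "(b', a')"] by simp
  show "\<lbrakk>is_iso (HomCat A y z) b; is_iso (HomCat A x y) a\<rbrakk> \<Longrightarrow> is_iso (HomCat A x z) (hcomp A x y z b a)"
    using F.farr_iso[OF is_iso_prod] by simp
qed

end

section \<open>The pseudo-slice of a 2-category over an object\<close>

context
  fixes A :: "('x, 'f, 't) twocat" and c :: 'x
begin

lemma slice_hom_simps:
  "(r, \<gamma>) \<in> Obj (slice_hom A c (x, f) (y, g)) \<longleftrightarrow> r \<in> Obj (HomCat A x y)
     \<and> \<gamma> \<in> Arr (HomCat A x c) \<and> Dom (HomCat A x c) \<gamma> = comp1 A x y c g r \<and> Cod (HomCat A x c) \<gamma> = f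
     \<and> is_iso (HomCat A x c) \<gamma>"
  "((r, \<gamma>), (r', \<gamma>'), \<phi>) \<in> Arr (slice_hom A c (x, f) (y, g)) \<longleftrightarrow>
     (r, \<gamma>) \<in> Obj (slice_hom A c (x, f) (y, g)) \<and> (r', \<gamma>') \<in> Obj (slice_hom A c (x, f) (y, g))
     \<and> \<phi> \<in> Arr (HomCat A x y) \<and> Dom (HomCat A x y) \<phi> = r \<and> Cod (HomCat A x y) \<phi> = r'
     \<and> \<gamma>' \<cdot>(HomCat A x c) hcomp A x y c (id2 A y c g) \<phi> = \<gamma>"
  "Dom (slice_hom A c (x, f) (y, g)) (k, k', \<phi>) = k"
  "Cod (slice_hom A c (x, f) (y, g)) (k, k', \<phi>) = k'"
  "Idt (slice_hom A c (x, f) (y, g)) k = (k, k, id2 A x y (fst k))"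
  "(k', k'', \<psi>) \<cdot>(slice_hom A c (x, f) (y, g)) (l, l', \<phi>) = (l, k'', \<psi> \<cdot>(HomCat A x y) \<phi>)"
  by (auto simp: slice_hom_def hom_iff Let_def)

lemma slice_2cat_simps:
  "(x, f) \<in> Obj2 (slice_2cat A c) \<longleftrightarrow> x \<in> Obj2 A \<and> f \<in> Obj (HomCat A x c)"
  "HomCat (slice_2cat A c) = slice_hom A c"
  "Id1 (slice_2cat A c) (x, f) = (Id1 A x, id2 A x c f)"
  "comp1 (slice_2cat A c) (x, f) (y, g) (z, h) (s, \<delta>) (r, \<gamma>)
    = (comp1 A x y z s r, \<gamma> \<cdot>(HomCat A x c) hcomp A x y c \<delta> (id2 A x y r))"
  "hcomp (slice_2cat A c) (x, f) (y, g) (z, h) (k, k', \<psi>) (l, l', \<phi>)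
    = (comp1 (slice_2cat A c) (x, f) (y, g) (z, h) k l, comp1 (slice_2cat A c) (x, f) (y, g) (z, h) k' l',
       hcomp A x y z \<psi> \<phi>)"
  by (simp_all add: slice_2cat_def slice_comp1_def)

lemma category_slice_hom:
  assumes "two_category A" and [simp]: "c \<in> Obj2 A" "x \<in> Obj2 A" "y \<in> Obj2 A"
    and [simp]: "f \<in> Obj (HomCat A x c)" "g \<in> Obj (HomCat A y c)"
  shows "category (slice_hom A c (x, f) (y, g))" (is "category ?S")
proof -
  interpret A: two_category A by fact
  interpret xy: category "HomCat A x y" by simp
  interpret xc: category "HomCat A x c" by simp
  interpret yc: category "HomCat A y c" by simp
  show ?thesis
  proof (rule categoryI)
    fix k l assume k: "k \<in> Arr ?S" "l \<in> Arr ?S" and kl: "Cod ?S k = Dom ?S l"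
    obtain r \<gamma> r' \<gamma>' \<phi> r'' \<gamma>'' \<psi> where e: "k = ((r, \<gamma>), (r', \<gamma>'), \<phi>)" "l = ((r', \<gamma>'), (r'', \<gamma>''), \<psi>)"
      using kl by (cases k; cases l) (auto simp: slice_hom_simps)
    \<comment> \<open>Whiskering with g preserves vertical composition, so the two triangles can be
      pasted.\<close>
    have "hcomp A x y c (id2 A y c g) (\<psi> \<cdot>(HomCat A x y) \<phi>)
      = hcomp A x y c (id2 A y c g) \<psi> \<cdot>(HomCat A x c) hcomp A x y c (id2 A y c g) \<phi>"
      using k A.hcomp_comp[of x y c "id2 A y c g" "id2 A y c g" \<phi> \<psi>] by (simp add: e slice_hom_simps)
    then have "\<gamma>'' \<cdot>(HomCat A x c) hcomp A x y c (id2 A y c g) (\<psi> \<cdot>(HomCat A x y) \<phi>)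
      = (\<gamma>'' \<cdot>(HomCat A x c) hcomp A x y c (id2 A y c g) \<psi>) \<cdot>(HomCat A x c) hcomp A x y c (id2 A y c g) \<phi>"
      using k by (subst xc.comp_assoc') (auto simp: e slice_hom_simps)
    then show "l \<cdot>?S k \<in> Arr ?S \<and> Dom ?S (l \<cdot>?S k) = Dom ?S k \<and> Cod ?S (l \<cdot>?S k) = Cod ?S l"
      using k by (simp add: e slice_hom_simps)
  qed (auto simp: slice_hom_simps)
qed

lemma two_category_slice:
  assumes "two_category A" and [simp]: "c \<in> Obj2 A"
  shows "two_category (slice_2cat A c)" (is "two_category ?S")
proof -
  interpret A: two_category A by fact
  have cell: "comp1 ?S (x, f) (y, g) (z, h) (s, \<delta>) (r, \<gamma>) \<in> Obj (slice_hom A c (x, f) (z, h))"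
    if [simp]: "x \<in> Obj2 A" "y \<in> Obj2 A" "z \<in> Obj2 A"
      "f \<in> Obj (HomCat A x c)" "g \<in> Obj (HomCat A y c)" "h \<in> Obj (HomCat A z c)"
      and k: "(s, \<delta>) \<in> Obj (slice_hom A c (y, g) (z, h))" "(r, \<gamma>) \<in> Obj (slice_hom A c (x, f) (y, g))"
    for x f y g z h s \<delta> r \<gamma>
  proof -
    interpret xc: category "HomCat A x c" by simp
    interpret xy: category "HomCat A x y" by simp
    show ?thesis
      using k by (simp add: slice_2cat_simps slice_hom_simps A.comp1_assoc)
  qed
  have hcell: "hcomp ?S (x, f) (y, g) (z, h) ((s, \<delta>), (s', \<delta>'), \<psi>) ((r, \<gamma>), (r', \<gamma>'), \<phi>) \<in> Arr (slice_hom A c (x, f) (z, h))"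
    if [simp]: "x \<in> Obj2 A" "y \<in> Obj2 A" "z \<in> Obj2 A"
      "f \<in> Obj (HomCat A x c)" "g \<in> Obj (HomCat A y c)" "h \<in> Obj (HomCat A z c)"
      and k: "((s, \<delta>), (s', \<delta>'), \<psi>) \<in> Arr (slice_hom A c (y, g) (z, h))" "((r, \<gamma>), (r', \<gamma>'), \<phi>) \<in> Arr (slice_hom A c (x, f) (y, g))"
    for x f y g z h s \<delta> s' \<delta>' \<psi> r \<gamma> r' \<gamma>' \<phi>
  proof -
    interpret xc: category "HomCat A x c" by simp
    interpret yc: category "HomCat A y c" by simp
    interpret zc: category "HomCat A z c" by simp
    interpret xy: category "HomCat A x y" by simp
    interpret yz: category "HomCat A y z" by simp
    have a: "\<psi> \<in> Arr (HomCat A y z)" "Dom (HomCat A y z) \<psi> = s" "Cod (HomCat A y z) \<psi> = s'"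
      "\<phi> \<in> Arr (HomCat A x y)" "Dom (HomCat A x y) \<phi> = r" "Cod (HomCat A x y) \<phi> = r'"
      "\<delta> \<in> Arr (HomCat A y c)" "Dom (HomCat A y c) \<delta> = comp1 A y z c h s" "Cod (HomCat A y c) \<delta> = g"
      "\<delta>' \<in> Arr (HomCat A y c)" "Dom (HomCat A y c) \<delta>' = comp1 A y z c h s'" "Cod (HomCat A y c) \<delta>' = g"
      "\<gamma>' \<in> Arr (HomCat A x c)" "Dom (HomCat A x c) \<gamma>' = comp1 A x y c g r'" "Cod (HomCat A x c) \<gamma>' = f"
      and e: "\<delta>' \<cdot>(HomCat A y c) hcomp A y z c (id2 A z c h) \<psi> = \<delta>"
        "\<gamma>' \<cdot>(HomCat A x c) hcomp A x y c (id2 A y c g) \<phi> = \<gamma>"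
      using k by (simp_all add: slice_hom_simps)
    have o: "r \<in> Obj (HomCat A x y)" "s \<in> Obj (HomCat A y z)" "r' \<in> Obj (HomCat A x y)" "s' \<in> Obj (HomCat A y z)"
      using k by (simp_all add: slice_hom_simps)
    \<comment> \<open>The interchange law is used twice: once to merge \<psi> with \<delta>' into
      \<delta>, and once to slide \<phi> past \<delta>, where the triangle of \<phi> takes
      over.\<close>
    have "hcomp A x y c \<delta>' (id2 A x y r') \<cdot>(HomCat A x c) hcomp A x z c (id2 A z c h) (hcomp A x y z \<psi> \<phi>)
      = hcomp A x y c \<delta>' (id2 A x y r') \<cdot>(HomCat A x c) hcomp A x y c (hcomp A y z c (id2 A z c h) \<psi>) \<phi>"
      using a by (simp add: A.hcomp_assoc)
    also have "\<dots> = hcomp A x y c \<delta> \<phi>"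
      using a o by (simp add: e flip: A.hcomp_comp)
    also have "\<dots> = hcomp A x y c (id2 A y c g \<cdot>(HomCat A y c) \<delta>) (\<phi> \<cdot>(HomCat A x y) id2 A x y r)"
      using a o by simp
    also have "\<dots> = hcomp A x y c (id2 A y c g) \<phi> \<cdot>(HomCat A x c) hcomp A x y c \<delta> (id2 A x y r)"
      using a o by (subst A.hcomp_comp) simp_all
    finally have "\<gamma>' \<cdot>(HomCat A x c) (hcomp A x y c \<delta>' (id2 A x y r') \<cdot>(HomCat A x c) hcomp A x z c (id2 A z c h) (hcomp A x y z \<psi> \<phi>))
      = (\<gamma>' \<cdot>(HomCat A x c) hcomp A x y c (id2 A y c g) \<phi>) \<cdot>(HomCat A x c) hcomp A x y c \<delta> (id2 A x y r)"
      using a o by simp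
    then have "(\<gamma>' \<cdot>(HomCat A x c) hcomp A x y c \<delta>' (id2 A x y r')) \<cdot>(HomCat A x c) hcomp A x z c (id2 A z c h) (hcomp A x y z \<psi> \<phi>)
      = \<gamma> \<cdot>(HomCat A x c) hcomp A x y c \<delta> (id2 A x y r)"
      unfolding e using a o by (simp add: A.comp1_assoc)
    moreover have "comp1 ?S (x, f) (y, g) (z, h) (s, \<delta>) (r, \<gamma>) \<in> Obj (slice_hom A c (x, f) (z, h))"
      "comp1 ?S (x, f) (y, g) (z, h) (s', \<delta>') (r', \<gamma>') \<in> Obj (slice_hom A c (x, f) (z, h))"
      using k by (auto intro!: cell simp: slice_hom_simps(2))
    ultimately show ?thesis
      using a by (simp add: slice_2cat_simps slice_hom_simps(2))
  qed
  show ?thesis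
  proof (rule two_category.intro)
    fix X Y assume X: "X \<in> Obj2 ?S" and Y: "Y \<in> Obj2 ?S"
    obtain x f y g where e: "X = (x, f)" "Y = (y, g)" by (cases X; cases Y)
    have [simp]: "x \<in> Obj2 A" "y \<in> Obj2 A" "f \<in> Obj (HomCat A x c)" "g \<in> Obj (HomCat A y c)"
      using X Y by (simp_all add: e slice_2cat_simps)
    interpret xc: category "HomCat A x c" by simp
    interpret yc: category "HomCat A y c" by simp
    interpret xx: category "HomCat A x x" by simp
    interpret xy: category "HomCat A x y" by simp
    show "category (HomCat ?S X Y)"
      using assms by (simp add: e slice_2cat_simps category_slice_hom)
    show "Id1 ?S X \<in> Obj (HomCat ?S X X)"
      by (simp add: e slice_2cat_simps slice_hom_simps A.comp1_id_right)
    fix k assume "k \<in> Obj (HomCat ?S X Y)"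
    then show "comp1 ?S X X Y k (Id1 ?S X) = k" "comp1 ?S X Y Y (Id1 ?S Y) k = k"
      by (cases k; simp add: e slice_2cat_simps slice_hom_simps A.comp1_id_right A.comp1_id_left
          A.hcomp_id_right)+
  next
    fix X Y k assume X: "X \<in> Obj2 ?S" and Y: "Y \<in> Obj2 ?S"
    obtain x f y g where e: "X = (x, f)" "Y = (y, g)" by (cases X; cases Y)
    have [simp]: "x \<in> Obj2 A" "y \<in> Obj2 A" "f \<in> Obj (HomCat A x c)" "g \<in> Obj (HomCat A y c)"
      using X Y by (simp_all add: e slice_2cat_simps)
    interpret xc: category "HomCat A x c" by simp
    assume "k \<in> Arr (HomCat ?S X Y)"
    then show "hcomp ?S X X Y k (id2 ?S X X (Id1 ?S X)) = k" "hcomp ?S X Y Y (id2 ?S Y Y (Id1 ?S Y)) k = k"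
      by (cases k; simp add: e slice_2cat_simps slice_hom_simps A.comp1_id_right A.comp1_id_left
          A.hcomp_id_right A.hcomp_id_left split: prod.splits; auto simp: slice_2cat_simps slice_hom_simps A.comp1_id_right A.comp1_id_left
          A.hcomp_id_right A.hcomp_id_left)+
  next
    fix X Y Z assume X: "X \<in> Obj2 ?S" and Y: "Y \<in> Obj2 ?S" and Z: "Z \<in> Obj2 ?S"
    obtain x f y g z h where e: "X = (x, f)" "Y = (y, g)" "Z = (z, h)" by (cases X; cases Y; cases Z)
    have [simp]: "x \<in> Obj2 A" "y \<in> Obj2 A" "z \<in> Obj2 A"
      "f \<in> Obj (HomCat A x c)" "g \<in> Obj (HomCat A y c)" "h \<in> Obj (HomCat A z c)"
      using X Y Z by (simp_all add: e slice_2cat_simps)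
    interpret xy: category "HomCat A x y" by simp
    interpret yz: category "HomCat A y z" by simp
    note cat = category_slice_hom[OF assms(1,2)]
    show "cat_functor (HomCat ?S Y Z \<times>\<^sub>c HomCat ?S X Y) (HomCat ?S X Z) (Comp2 ?S X Y Z)"
    proof (rule cat_functorI)
      fix p assume "p \<in> Obj (HomCat ?S Y Z \<times>\<^sub>c HomCat ?S X Y)"
      then show "FObj (Comp2 ?S X Y Z) p \<in> Obj (HomCat ?S X Z)"
        by (auto simp: e slice_2cat_simps(2) intro: cell)
    next
      fix p assume p: "p \<in> Arr (HomCat ?S Y Z \<times>\<^sub>c HomCat ?S X Y)"
      obtain s \<delta> s' \<delta>' \<psi> r \<gamma> r' \<gamma>' \<phi> where "p = (((s, \<delta>), (s', \<delta>'), \<psi>), ((r, \<gamma>), (r', \<gamma>'), \<phi>))"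
        by (metis prod.exhaust)
      then show "FArr (Comp2 ?S X Y Z) p \<in> Arr (HomCat ?S X Z)
        \<and> Dom (HomCat ?S X Z) (FArr (Comp2 ?S X Y Z) p) = FObj (Comp2 ?S X Y Z) (Dom (HomCat ?S Y Z \<times>\<^sub>c HomCat ?S X Y) p)
        \<and> Cod (HomCat ?S X Z) (FArr (Comp2 ?S X Y Z) p) = FObj (Comp2 ?S X Y Z) (Cod (HomCat ?S Y Z \<times>\<^sub>c HomCat ?S X Y) p)"
        using p hcell[of x y z f g h s \<delta> s' \<delta>' \<psi> r \<gamma> r' \<gamma>' \<phi>]
        by (simp add: e slice_2cat_simps slice_hom_simps(3,4))
    next
      fix p assume "p \<in> Obj (HomCat ?S Y Z \<times>\<^sub>c HomCat ?S X Y)"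
      then show "FArr (Comp2 ?S X Y Z) (Idt (HomCat ?S Y Z \<times>\<^sub>c HomCat ?S X Y) p) = Idt (HomCat ?S X Z) (FObj (Comp2 ?S X Y Z) p)"
        by (auto simp: e slice_2cat_simps slice_hom_simps)
    next
      fix p q assume "p \<in> Arr (HomCat ?S Y Z \<times>\<^sub>c HomCat ?S X Y)" "q \<in> Arr (HomCat ?S Y Z \<times>\<^sub>c HomCat ?S X Y)"
        "Cod (HomCat ?S Y Z \<times>\<^sub>c HomCat ?S X Y) p = Dom (HomCat ?S Y Z \<times>\<^sub>c HomCat ?S X Y) q"
      then show "FArr (Comp2 ?S X Y Z) (q \<cdot>(HomCat ?S Y Z \<times>\<^sub>c HomCat ?S X Y) p)
        = FArr (Comp2 ?S X Y Z) q \<cdot>(HomCat ?S X Z) FArr (Comp2 ?S X Y Z) p"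
        by (cases p; cases q) (auto simp: e slice_2cat_simps slice_hom_simps A.hcomp_comp)
    qed (simp_all add: e slice_2cat_simps(2) category_prod cat)
  next
    fix W X Y Z assume W: "W \<in> Obj2 ?S" and X: "X \<in> Obj2 ?S" and Y: "Y \<in> Obj2 ?S" and Z: "Z \<in> Obj2 ?S"
    obtain w d x f y g z h where e: "W = (w, d)" "X = (x, f)" "Y = (y, g)" "Z = (z, h)" by (cases W; cases X; cases Y; cases Z)
    have [simp]: "w \<in> Obj2 A" "x \<in> Obj2 A" "y \<in> Obj2 A" "z \<in> Obj2 A" "d \<in> Obj (HomCat A w c)"
      "f \<in> Obj (HomCat A x c)" "g \<in> Obj (HomCat A y c)" "h \<in> Obj (HomCat A z c)"
      using W X Y Z by (simp_all add: e slice_2cat_simps)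
    interpret wx: category "HomCat A w x" by simp
    interpret xy: category "HomCat A x y" by simp
    interpret wc: category "HomCat A w c" by simp
    interpret wy: category "HomCat A w y" by simp
    interpret xc: category "HomCat A x c" by simp
    \<comment> \<open>Separated out because a slice 2-cell records its end 1-cells: associativity of
      horizontal composition needs this equation at both ends.\<close>
    have 1: "comp1 ?S W X Z (comp1 ?S X Y Z n l) k = comp1 ?S W Y Z n (comp1 ?S W X Y l k)"
      if k: "k \<in> Obj (HomCat ?S W X)" and l: "l \<in> Obj (HomCat ?S X Y)" and n: "n \<in> Obj (HomCat ?S Y Z)" for k l n
    proof -
      obtain r \<gamma> s \<delta> t \<epsilon> where e': "k = (r, \<gamma>)" "l = (s, \<delta>)" "n = (t, \<epsilon>)" by (cases k; cases l; cases n)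
      have "hcomp A w x c (\<delta> \<cdot>(HomCat A x c) hcomp A x y c \<epsilon> (id2 A x y s)) (id2 A w x r \<cdot>(HomCat A w x) id2 A w x r)
        = hcomp A w x c \<delta> (id2 A w x r) \<cdot>(HomCat A w c) hcomp A w x c (hcomp A x y c \<epsilon> (id2 A x y s)) (id2 A w x r)"
        using k l n by (intro A.hcomp_comp) (simp_all add: e e' slice_2cat_simps slice_hom_simps)
      then show ?thesis
        using k l n by (simp add: e e' slice_2cat_simps slice_hom_simps A.comp1_assoc A.hcomp_assoc)
    qed
    fix p q v
    show "comp1 ?S W X Z (comp1 ?S X Y Z v q) p = comp1 ?S W Y Z v (comp1 ?S W X Y q p)"
      if "p \<in> Obj (HomCat ?S W X)" "q \<in> Obj (HomCat ?S X Y)" "v \<in> Obj (HomCat ?S Y Z)"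
      using that by (rule 1)
    fix k l n
    assume a: "k \<in> Arr (HomCat ?S W X)" "l \<in> Arr (HomCat ?S X Y)" "n \<in> Arr (HomCat ?S Y Z)"
    obtain r \<gamma> s \<delta> t \<epsilon> r' \<gamma>' s' \<delta>' t' \<epsilon>' \<phi> \<psi> \<omega> where
      e': "k = ((r, \<gamma>), (r', \<gamma>'), \<phi>)" "l = ((s, \<delta>), (s', \<delta>'), \<psi>)" "n = ((t, \<epsilon>), (t', \<epsilon>'), \<omega>)"
      by (metis prod.exhaust)
    show "hcomp ?S W X Z (hcomp ?S X Y Z n l) k = hcomp ?S W Y Z n (hcomp ?S W X Y l k)"
      using a 1[of "(r, \<gamma>)" "(s, \<delta>)" "(t, \<epsilon>)"] 1[of "(r', \<gamma>')" "(s', \<delta>')" "(t', \<epsilon>')"]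
      by (simp add: e e' slice_2cat_simps(2,5) slice_hom_simps(2) A.hcomp_assoc)
  qed
qed

end

text \<open>A pseudofunctor that preserves composition and identities strictly and whose comparison
  2-cells are identities. Both directions of the biequivalence are of this kind, and so are their
  composites; the coherence laws are verified only in the sublocale below.\<close>

locale strict_psfctr = source: two_category A + target: two_category B
  for A :: "('x, 'f, 't) twocat" and B :: "('y, 'g, 's) twocat" +
  fixes P :: "('x, 'f, 't, 'y, 'g, 's) psfctr"
  assumes sobj: "x \<in> Obj2 A \<Longrightarrow> PObj P x \<in> Obj2 B"
    and shom: "\<lbrakk>x \<in> Obj2 A; y \<in> Obj2 A\<rbrakk> \<Longrightarrow>
      cat_functor (HomCat A x y) (HomCat B (PObj P x) (PObj P y)) (PHom P x y)"
    and sid: "x \<in> Obj2 A \<Longrightarrow> P1 P x x (Id1 A x) = Id1 B (PObj P x)"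
    and scomp1: "\<lbrakk>x \<in> Obj2 A; y \<in> Obj2 A; z \<in> Obj2 A; f \<in> Obj (HomCat A x y); g \<in> Obj (HomCat A y z)\<rbrakk> \<Longrightarrow>
      P1 P x z (comp1 A x y z g f) = comp1 B (PObj P x) (PObj P y) (PObj P z) (P1 P y z g) (P1 P x y f)"
    and shcomp: "\<lbrakk>x \<in> Obj2 A; y \<in> Obj2 A; z \<in> Obj2 A; a \<in> Arr (HomCat A x y); b \<in> Arr (HomCat A y z)\<rbrakk> \<Longrightarrow>
      P2 P x z (hcomp A x y z b a) = hcomp B (PObj P x) (PObj P y) (PObj P z) (P2 P y z b) (P2 P x y a)"
    and sunit: "x \<in> Obj2 A \<Longrightarrow> PUnit P x = id2 B (PObj P x) (PObj P x) (Id1 B (PObj P x))"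
    and spcomp: "\<lbrakk>x \<in> Obj2 A; y \<in> Obj2 A; z \<in> Obj2 A; f \<in> Obj (HomCat A x y); g \<in> Obj (HomCat A y z)\<rbrakk> \<Longrightarrow>
      PComp P x y z (g, f) = id2 B (PObj P x) (PObj P z)
        (comp1 B (PObj P x) (PObj P y) (PObj P z) (P1 P y z g) (P1 P x y f))"
begin

lemma
  assumes [simp]: "x \<in> Obj2 A" "y \<in> Obj2 A"
  shows p1_obj [simp]: "f \<in> Obj (HomCat A x y) \<Longrightarrow> P1 P x y f \<in> Obj (HomCat B (PObj P x) (PObj P y))"
    and p2_arr [simp]: "a \<in> Arr (HomCat A x y) \<Longrightarrow> P2 P x y a \<in> Arr (HomCat B (PObj P x) (PObj P y))"
    and dom_p2 [simp]: "a \<in> Arr (HomCat A x y) \<Longrightarrow>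
      Dom (HomCat B (PObj P x) (PObj P y)) (P2 P x y a) = P1 P x y (Dom (HomCat A x y) a)"
    and cod_p2 [simp]: "a \<in> Arr (HomCat A x y) \<Longrightarrow>
      Cod (HomCat B (PObj P x) (PObj P y)) (P2 P x y a) = P1 P x y (Cod (HomCat A x y) a)"
    and p2_id [simp]: "f \<in> Obj (HomCat A x y) \<Longrightarrow>
      P2 P x y (id2 A x y f) = id2 B (PObj P x) (PObj P y) (P1 P x y f)"
proof -
  interpret F: cat_functor "HomCat A x y" "HomCat B (PObj P x) (PObj P y)" "PHom P x y"
    by (rule shom) fact+
  show "f \<in> Obj (HomCat A x y) \<Longrightarrow> P1 P x y f \<in> Obj (HomCat B (PObj P x) (PObj P y))"
    "f \<in> Obj (HomCat A x y) \<Longrightarrow>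
      P2 P x y (id2 A x y f) = id2 B (PObj P x) (PObj P y) (P1 P x y f)" by simp_all
  assume "a \<in> Arr (HomCat A x y)"
  then show "P2 P x y a \<in> Arr (HomCat B (PObj P x) (PObj P y))"
    "Dom (HomCat B (PObj P x) (PObj P y)) (P2 P x y a) = P1 P x y (Dom (HomCat A x y) a)"
    "Cod (HomCat B (PObj P x) (PObj P y)) (P2 P x y a) = P1 P x y (Cod (HomCat A x y) a)" by simp_all
qed

lemmas sobj' [simp] = sobj

sublocale pseudofunctor A B P
proof (intro pseudofunctor.intro pseudofunctor_axioms.intro)
  fix x assume [simp]: "x \<in> Obj2 A"
  interpret H: category "HomCat B (PObj P x) (PObj P x)" by simp
  show "PUnit P x \<in> hom (HomCat B (PObj P x) (PObj P x)) (Id1 B (PObj P x)) (P1 P x x (Id1 A x))"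
    "is_iso (HomCat B (PObj P x) (PObj P x)) (PUnit P x)"
    by (simp_all add: sunit sid hom_iff)
  fix y z assume [simp]: "y \<in> Obj2 A" "z \<in> Obj2 A"
  interpret K: category "HomCat B (PObj P x) (PObj P z)" by simp
  interpret E: cat_functor "HomCat A x z" "HomCat B (PObj P x) (PObj P z)" "PHom P x z" by (rule shom) simp_all
  interpret F: cat_functor "HomCat A y z" "HomCat B (PObj P y) (PObj P z)" "PHom P y z" by (rule shom) simp_all
  interpret G: cat_functor "HomCat A x y" "HomCat B (PObj P x) (PObj P y)" "PHom P x y" by (rule shom) simp_all
  show "nat_iso (HomCat A y z \<times>\<^sub>c HomCat A x y) (HomCat B (PObj P x) (PObj P z))
        \<lparr>FObj = \<lambda>(g, f). comp1 B (PObj P x) (PObj P y) (PObj P z) (P1 P y z g) (P1 P x y f),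
         FArr = \<lambda>(b, a). hcomp B (PObj P x) (PObj P y) (PObj P z) (P2 P y z b) (P2 P x y a)\<rparr>
        \<lparr>FObj = \<lambda>(g, f). P1 P x z (comp1 A x y z g f),
         FArr = \<lambda>(b, a). P2 P x z (hcomp A x y z b a)\<rparr>
        (PComp P x y z)"
    by (rule nat_isoI; (rule cat_functorI)?)
      (auto simp: category_prod scomp1 shcomp spcomp target.hcomp_comp source.hcomp_comp)
next
  fix w x y z f g h assume [simp]: "w \<in> Obj2 A" "x \<in> Obj2 A" "y \<in> Obj2 A" "z \<in> Obj2 A"
    "f \<in> Obj (HomCat A w x)" "g \<in> Obj (HomCat A x y)" "h \<in> Obj (HomCat A y z)"
  interpret K: category "HomCat B (PObj P w) (PObj P z)" by simp
  show "PComp P w x z (comp1 A x y z h g, f)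
        \<cdot>(HomCat B (PObj P w) (PObj P z))
        hcomp B (PObj P w) (PObj P x) (PObj P z)
          (PComp P x y z (h, g)) (id2 B (PObj P w) (PObj P x) (P1 P w x f))
      = PComp P w y z (h, comp1 A w x y g f)
        \<cdot>(HomCat B (PObj P w) (PObj P z))
        hcomp B (PObj P w) (PObj P y) (PObj P z)
          (id2 B (PObj P y) (PObj P z) (P1 P y z h)) (PComp P w x y (g, f))"
    by (simp add: spcomp scomp1 target.comp1_assoc)
next
  fix x y f assume [simp]: "x \<in> Obj2 A" "y \<in> Obj2 A" "f \<in> Obj (HomCat A x y)"
  interpret K: category "HomCat B (PObj P x) (PObj P y)" by simp
  show "PComp P x x y (f, Id1 A x)
        \<cdot>(HomCat B (PObj P x) (PObj P y))
        hcomp B (PObj P x) (PObj P x) (PObj P y)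
          (id2 B (PObj P x) (PObj P y) (P1 P x y f)) (PUnit P x)
      = id2 B (PObj P x) (PObj P y) (P1 P x y f)"
    "PComp P x y y (Id1 A y, f)
        \<cdot>(HomCat B (PObj P x) (PObj P y))
        hcomp B (PObj P x) (PObj P y) (PObj P y)
          (PUnit P y) (id2 B (PObj P x) (PObj P y) (P1 P x y f))
      = id2 B (PObj P x) (PObj P y) (P1 P x y f)"
    by (simp_all add: spcomp sunit sid target.comp1_id_left target.comp1_id_right)
qed (simp_all add: sobj shom source.two_category_axioms target.two_category_axioms)

end

lemma strict_psfctr_id:
  assumes "two_category A"
  shows "strict_psfctr A A (id_psfctr A)"
proof -
  interpret two_category A by fact
  show ?thesis
    by (intro strict_psfctr.intro strict_psfctr_axioms.intro cat_functorI)
      (simp_all add: assms id_psfctr_def category.dom_obj' category.cod_obj')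
qed

text \<open>\<open>comp_psfctr\<close> composes a comparison cell of Q with the Q-image of one of P.
  By strictness both are identities on the same 1-cell.\<close>

lemma strict_psfctr_comp:
  assumes "strict_psfctr A B P" "strict_psfctr B D Q"
  shows "strict_psfctr A D (comp_psfctr D Q P)"
proof -
  interpret P: strict_psfctr A B P by fact
  interpret Q: strict_psfctr B D Q by fact
  have f: "cat_functor (HomCat A x y) (HomCat D (PObj Q (PObj P x)) (PObj Q (PObj P y)))
     (comp_fctr (PHom Q (PObj P x) (PObj P y)) (PHom P x y))" if [simp]: "x \<in> Obj2 A" "y \<in> Obj2 A" for x y
  proof -
    interpret F: cat_functor "HomCat A x y" "HomCat B (PObj P x) (PObj P y)" "PHom P x y" by (rule P.shom) simp_all
    interpret G: cat_functor "HomCat B (PObj P x) (PObj P y)" "HomCat D (PObj Q (PObj P x)) (PObj Q (PObj P y))" "PHom Q (PObj P x) (PObj P y)"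
      by (rule Q.shom) simp_all
    show ?thesis
      by (rule cat_functorI) (simp_all add: comp_fctr_def)
  qed
  show ?thesis
  proof (intro strict_psfctr.intro strict_psfctr_axioms.intro)
    fix x assume [simp]: "x \<in> Obj2 A"
    interpret K: category "HomCat D (PObj Q (PObj P x)) (PObj Q (PObj P x))" by simp
    show "PUnit (comp_psfctr D Q P) x = id2 D (PObj (comp_psfctr D Q P) x) (PObj (comp_psfctr D Q P) x) (Id1 D (PObj (comp_psfctr D Q P) x))"
      by (simp add: comp_psfctr_def P.sunit Q.sunit Q.sid)
  next
    fix x y z f g assume [simp]: "x \<in> Obj2 A" "y \<in> Obj2 A" "z \<in> Obj2 A" "f \<in> Obj (HomCat A x y)" "g \<in> Obj (HomCat A y z)"
    interpret K: category "HomCat D (PObj Q (PObj P x)) (PObj Q (PObj P z))" by simp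
    show "PComp (comp_psfctr D Q P) x y z (g, f) = id2 D (PObj (comp_psfctr D Q P) x) (PObj (comp_psfctr D Q P) z)
        (comp1 D (PObj (comp_psfctr D Q P) x) (PObj (comp_psfctr D Q P) y) (PObj (comp_psfctr D Q P) z)
          (P1 (comp_psfctr D Q P) y z g) (P1 (comp_psfctr D Q P) x y f))"
      by (simp add: comp_psfctr_def comp_fctr_def P.spcomp Q.spcomp Q.scomp1)
  qed (simp_all add: f comp_psfctr_def P.source.two_category_axioms Q.target.two_category_axioms,
      simp_all add: comp_fctr_def P.sid Q.sid P.scomp1 Q.scomp1 P.shcomp Q.shcomp)
qed

text \<open>By \<open>nat1\<close> the two sides of each naturality square are the same 1-cell, so
  an identity can serve as the comparison 2-cell; its naturality in 2-cells is then
  \<open>nat2\<close>.\<close>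

lemma strict_pseudonatural:
  assumes "strict_psfctr A B P" "strict_psfctr A B Q"
    and tobj: "\<And>x. x \<in> Obj2 A \<Longrightarrow> s x \<in> Obj (HomCat B (PObj P x) (PObj Q x))"
    and nat1: "\<And>x y f. \<lbrakk>x \<in> Obj2 A; y \<in> Obj2 A; f \<in> Obj (HomCat A x y)\<rbrakk> \<Longrightarrow>
      comp1 B (PObj P x) (PObj Q x) (PObj Q y) (P1 Q x y f) (s x)
      = comp1 B (PObj P x) (PObj P y) (PObj Q y) (s y) (P1 P x y f)"
    and nat2: "\<And>x y a. \<lbrakk>x \<in> Obj2 A; y \<in> Obj2 A; a \<in> Arr (HomCat A x y)\<rbrakk> \<Longrightarrow>
      hcomp B (PObj P x) (PObj Q x) (PObj Q y) (P2 Q x y a) (id2 B (PObj P x) (PObj Q x) (s x))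
      = hcomp B (PObj P x) (PObj P y) (PObj Q y) (id2 B (PObj P y) (PObj Q y) (s y)) (P2 P x y a)"
  shows "pseudonatural A B P Q \<lparr>TObj = s, THom = \<lambda>x y f. id2 B (PObj P x) (PObj Q y)
    (comp1 B (PObj P x) (PObj Q x) (PObj Q y) (P1 Q x y f) (s x))\<rparr>"
proof -
  interpret P: strict_psfctr A B P by fact
  interpret Q: strict_psfctr A B Q by fact
  note [simp] = tobj
  show ?thesis
  proof (intro pseudonatural.intro pseudonatural_axioms.intro, goal_cases)
    case (4 x y)
    note [simp] = 4
    interpret F: cat_functor "HomCat A x y" "HomCat B (PObj P x) (PObj P y)" "PHom P x y" by (rule P.shom) simp_all
    interpret G: cat_functor "HomCat A x y" "HomCat B (PObj Q x) (PObj Q y)" "PHom Q x y" by (rule Q.shom) simp_all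
    interpret S: category "HomCat B (PObj P x) (PObj Q x)" by simp
    interpret T: category "HomCat B (PObj P y) (PObj Q y)" by simp
    interpret U: category "HomCat B (PObj P x) (PObj Q y)" by simp
    show ?case
      by (rule nat_isoI; (rule cat_functorI)?)
        (use P.target.hcomp_comp[of "PObj P x" "PObj Q x" "PObj Q y" _ _ "id2 B (PObj P x) (PObj Q x) (s x)" "id2 B (PObj P x) (PObj Q x) (s x)"]
          P.target.hcomp_comp[of "PObj P x" "PObj P y" "PObj Q y" "id2 B (PObj P y) (PObj Q y) (s y)" "id2 B (PObj P y) (PObj Q y) (s y)"] in
         \<open>simp_all add: nat1 nat2\<close>)
  next
    case (5 x)
    note [simp] = 5
    interpret U: category "HomCat B (PObj P x) (PObj Q x)" by simp
    show ?case
      by (simp add: P.sunit Q.sunit P.sid Q.sid P.target.comp1_id_left P.target.comp1_id_right)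
  next
    case (6 x y z f g)
    note [simp] = 6
    interpret U: category "HomCat B (PObj P x) (PObj Q z)" by simp
    \<comment> \<open>Every 2-cell in the composition law is an identity, and it remains to match
      their 1-cells by \<open>nat1\<close> and associativity.\<close>
    have "comp1 B (PObj P x) (PObj P z) (PObj Q z) (s z) (comp1 B (PObj P x) (PObj P y) (PObj P z) (P1 P y z g) (P1 P x y f))
      = comp1 B (PObj P x) (PObj P y) (PObj Q z) (comp1 B (PObj P y) (PObj P z) (PObj Q z) (s z) (P1 P y z g)) (P1 P x y f)"
      by (simp add: P.target.comp1_assoc)
    then show ?case
      by (simp add: P.spcomp Q.spcomp P.scomp1 Q.scomp1 nat1 P.target.comp1_assoc flip: nat1)
  qed (simp_all add: P.pseudofunctor_axioms Q.pseudofunctor_axioms)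
qed

section \<open>Symmetric actions\<close>

context left_action
begin

interpretation T: cat_functor "M \<times>\<^sub>c C" C "Act A" by (rule act_functor)
interpretation U: nat_iso C C id_fctr "\<lparr>FObj = \<lambda>c. Unt M \<bullet>A c, FArr = \<lambda>g. Idt M (Unt M) \<star>A g\<rparr>" "AUnit A"
  by (rule aunit_iso)
interpretation V: nat_iso "M \<times>\<^sub>c M \<times>\<^sub>c C" C
      "\<lparr>FObj = \<lambda>(m, n, c). m \<bullet>A (n \<bullet>A c), FArr = \<lambda>(f, f', g). f \<star>A (f' \<star>A g)\<rparr>"
      "\<lparr>FObj = \<lambda>(m, n, c). (m \<otimes>M n) \<bullet>A c, FArr = \<lambda>(f, f', g). (f \<boxtimes>M f') \<star>A g\<rparr>"
      "\<lambda>(m, n, c). AMult A m n c"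
  by (rule amult_iso)

lemma act_obj [simp]: "\<lbrakk>m \<in> Obj M; c \<in> Obj C\<rbrakk> \<Longrightarrow> m \<bullet>A c \<in> Obj C"
  using T.fobj[of "(m, c)"] by simp

lemma act_arr [simp]: "\<lbrakk>f \<in> Arr M; g \<in> Arr C\<rbrakk> \<Longrightarrow> f \<star>A g \<in> Arr C"
  and dom_act [simp]: "\<lbrakk>f \<in> Arr M; g \<in> Arr C\<rbrakk> \<Longrightarrow> Dom C (f \<star>A g) = Dom M f \<bullet>A Dom C g"
  and cod_act [simp]: "\<lbrakk>f \<in> Arr M; g \<in> Arr C\<rbrakk> \<Longrightarrow> Cod C (f \<star>A g) = Cod M f \<bullet>A Cod C g"
  using T.farr_arr[of "(f, g)"] T.dom_farr[of "(f, g)"] T.cod_farr[of "(f, g)"] by simp_all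

lemma act_idt [simp]: "\<lbrakk>m \<in> Obj M; c \<in> Obj C\<rbrakk> \<Longrightarrow> Idt M m \<star>A Idt C c = Idt C (m \<bullet>A c)"
  using T.farr_idt[of "(m, c)"] by simp

lemma act_comp [simp]:
  "\<lbrakk>f \<in> Arr M; g \<in> Arr C; f' \<in> Arr M; g' \<in> Arr C; Cod M f' = Dom M f; Cod C g' = Dom C g\<rbrakk>
    \<Longrightarrow> (f \<star>A g) \<cdot>C (f' \<star>A g') = (f \<cdot>M f') \<star>A (g \<cdot>C g')"
  using T.farr_comp'[of "(f', g')" "(f, g)"] by simp

lemma act_comp_ext [simp]:
  "\<lbrakk>f \<in> Arr M; g \<in> Arr C; f' \<in> Arr M; g' \<in> Arr C; Cod M f' = Dom M f; Cod C g' = Dom C g;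
    k \<in> Arr C; Cod C k = Dom M f' \<bullet>A Dom C g'\<rbrakk>
    \<Longrightarrow> (f \<star>A g) \<cdot>C ((f' \<star>A g') \<cdot>C k) = ((f \<cdot>M f') \<star>A (g \<cdot>C g')) \<cdot>C k"
  by (subst acted.comp_extend[OF act_comp]) auto

lemma iso_act [simp]: "\<lbrakk>is_iso M f; is_iso C g\<rbrakk> \<Longrightarrow> is_iso C (f \<star>A g)"
  and inv_act: "\<lbrakk>is_iso M f; is_iso C g\<rbrakk> \<Longrightarrow> inv_arr C (f \<star>A g) = inv_arr M f \<star>A inv_arr C g"
  using acting.iso_arr[of f] acted.iso_arr[of g]
  by (auto intro!: acted.is_isoI[where g = "inv_arr M f \<star>A inv_arr C g"] acted.inv_arr_eqI)

lemma aunit_simps [simp]: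
  assumes "c \<in> Obj C"
  shows "AUnit A c \<in> Arr C" "Dom C (AUnit A c) = c" "Cod C (AUnit A c) = Unt M \<bullet>A c" "is_iso C (AUnit A c)"
  using assms U.component_arr[of c] U.dom_component[of c] U.cod_component[of c] U.component_iso[of c]
  by simp_all

lemma aunit_nat: "\<lbrakk>g \<in> Arr C; Dom C g = c\<rbrakk> \<Longrightarrow> (Idt M (Unt M) \<star>A g) \<cdot>C AUnit A c = AUnit A (Cod C g) \<cdot>C g"
  using U.naturality'[of g c] by simp

lemma amult_simps [simp]:
  assumes "m \<in> Obj M" "n \<in> Obj M" "c \<in> Obj C"
  shows "AMult A m n c \<in> Arr C" "Dom C (AMult A m n c) = m \<bullet>A (n \<bullet>A c)"
    "Cod C (AMult A m n c) = (m \<otimes>M n) \<bullet>A c" "is_iso C (AMult A m n c)"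
  using assms V.component_arr[of "(m, n, c)"] V.dom_component[of "(m, n, c)"] V.cod_component[of "(m, n, c)"]
    V.component_iso[of "(m, n, c)"]
  by simp_all

lemma amult_nat:
  "\<lbrakk>f \<in> Arr M; f' \<in> Arr M; g \<in> Arr C; Cod M f = m; Cod M f' = n; Cod C g = c\<rbrakk>
    \<Longrightarrow> AMult A m n c \<cdot>C (f \<star>A (f' \<star>A g)) = ((f \<boxtimes>M f') \<star>A g) \<cdot>C AMult A (Dom M f) (Dom M f') (Dom C g)"
  using V.naturality'[of "(f, f', g)" "(Dom M f, Dom M f', Dom C g)"] by simp

lemma amult_nat_left:
  "\<lbrakk>f \<in> Arr M; n \<in> Obj M; c \<in> Obj C; Cod M f = m\<rbrakk>
    \<Longrightarrow> AMult A m n c \<cdot>C (f \<star>A Idt C (n \<bullet>A c)) = ((f \<boxtimes>M Idt M n) \<star>A Idt C c) \<cdot>C AMult A (Dom M f) n c"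
  using amult_nat[of f "Idt M n" "Idt C c" m n c] by simp

lemma amult_assoc':
  "\<lbrakk>m \<in> Obj M; n \<in> Obj M; p \<in> Obj M; c \<in> Obj C\<rbrakk> \<Longrightarrow>
      (Assoc M m n p \<star>A Idt C c) \<cdot>C (AMult A (m \<otimes>M n) p c \<cdot>C AMult A m n (p \<bullet>A c))
      = AMult A m (n \<otimes>M p) c \<cdot>C (Idt M m \<star>A AMult A n p c)"
  using amult_assoc[of m n p c] by simp

end

text \<open>The interchanger points against the multiplication of the monoidal functor \<bullet>.
  This is its inverse, with the arguments paired as (m, c), (n, d), the two objects of the product
  category that are multiplied.\<close>

definition action_mult :: "('o, 'a) smc \<Rightarrow> ('m, 'f, 'o, 'a) monaction \<Rightarrow> 'm \<Rightarrow> 'o \<Rightarrow> 'm \<Rightarrow> 'o \<Rightarrow> 'a" where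
  "action_mult C A m c n d = inv_arr C (AInter A m n c d)"

context symmetric_action
begin

interpretation I: nat_iso "(M \<times>\<^sub>c C) \<times>\<^sub>c (M \<times>\<^sub>c C)" C
      "\<lparr>FObj = \<lambda>((m, c), (n, d)). (m \<otimes>M n) \<bullet>A (c \<otimes>C d),
       FArr = \<lambda>((f, g), (f', g')). (f \<boxtimes>M f') \<star>A (g \<boxtimes>C g')\<rparr>"
      "\<lparr>FObj = \<lambda>((m, c), (n, d)). (m \<bullet>A c) \<otimes>C (n \<bullet>A d),
       FArr = \<lambda>((f, g), (f', g')). (f \<star>A g) \<boxtimes>C (f' \<star>A g')\<rparr>"
      "\<lambda>((m, c), (n, d)). AInter A m n c d"
  by (rule ainter_iso)
interpretation G: sym_mon_functor "prod_smc M C" C "act_monfctr C A" by (rule act_sym_mon)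
interpretation aunit: mon_trans C C
      "\<lparr>FObj = \<lambda>c. c, FArr = \<lambda>g. g, FUnit = Idt C (Unt C), FMult = \<lambda>(c, d). Idt C (c \<otimes>C d)\<rparr>"
      "act_unit_monfctr M C A" "AUnit A" by (rule aunit_mon)
interpretation amult: mon_trans "prod_smc M (prod_smc M C)" C
      "act_act_monfctr M C A" "tens_act_monfctr M C A" "\<lambda>(m, n, c). AMult A m n c" by (rule amult_mon)

text \<open>Not the multiplicator of the action, which is always written \<open>AMult\<close>, but
  the inverse interchanger.\<close>

abbreviation \<mu> where "\<mu> \<equiv> action_mult C A"

lemma act_monfctr_simps:
  "FObj (act_monfctr C A) x = FObj (Act A) x" "FArr (act_monfctr C A) f = FArr (Act A) f"
  "FUnit (act_monfctr C A) = ANull A" "FMult (act_monfctr C A) ((m, c), (n, d)) = \<mu> m c n d"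
  by (simp_all add: act_monfctr_def action_mult_def)

lemma ainter_simps [simp]:
  assumes "m \<in> Obj M" "n \<in> Obj M" "c \<in> Obj C" "d \<in> Obj C"
  shows "AInter A m n c d \<in> Arr C" "Dom C (AInter A m n c d) = (m \<otimes>M n) \<bullet>A (c \<otimes>C d)"
    "Cod C (AInter A m n c d) = (m \<bullet>A c) \<otimes>C (n \<bullet>A d)" "is_iso C (AInter A m n c d)"
  using assms I.component_arr[of "((m, c), (n, d))"] I.dom_component[of "((m, c), (n, d))"]
    I.cod_component[of "((m, c), (n, d))"] I.component_iso[of "((m, c), (n, d))"]
  by simp_all

lemma action_mult_simps [simp]:
  assumes "m \<in> Obj M" "n \<in> Obj M" "c \<in> Obj C" "d \<in> Obj C"
  shows "\<mu> m c n d \<in> Arr C" "Dom C (\<mu> m c n d) = (m \<bullet>A c) \<otimes>C (n \<bullet>A d)"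
    "Cod C (\<mu> m c n d) = (m \<otimes>M n) \<bullet>A (c \<otimes>C d)" "is_iso C (\<mu> m c n d)"
    "inv_arr C (\<mu> m c n d) = AInter A m n c d"
  using assms by (simp_all add: action_mult_def)

lemma anull_simps [simp]: "ANull A \<in> Arr C" "Dom C (ANull A) = Unt C" "Cod C (ANull A) = Unt M \<bullet>A Unt C"
  "is_iso C (ANull A)"
  using G.funit_simps by (simp_all add: act_monfctr_simps)

text \<open>The unit condition of the unitor as a monoidal transformation out of the identity
  functor.\<close>

lemma anull_eq: "ANull A = AUnit A (Unt C)"
  using aunit.unit_comp by (simp add: act_unit_monfctr_def)

lemma action_mult_nat:
  assumes "f \<in> Arr M" "f' \<in> Arr M" "g \<in> Arr C" "g' \<in> Arr C" "Dom M f = m" "Dom M f' = n" "Dom C g = c" "Dom C g' = d"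
  shows "((f \<boxtimes>M f') \<star>A (g \<boxtimes>C g')) \<cdot>C \<mu> m c n d
    = \<mu> (Cod M f) (Cod C g) (Cod M f') (Cod C g') \<cdot>C ((f \<star>A g) \<boxtimes>C (f' \<star>A g'))"
  using assms G.fmult_nat[of "(f, g)" "(f', g')" "(m, c)" "(n, d)"] by (simp add: act_monfctr_simps)

lemma action_mult_assoc:
  assumes "m \<in> Obj M" "n \<in> Obj M" "p \<in> Obj M" "c \<in> Obj C" "d \<in> Obj C" "e \<in> Obj C"
  shows "(Assoc M m n p \<star>A Assoc C c d e) \<cdot>C (\<mu> (m \<otimes>M n) (c \<otimes>C d) p e \<cdot>C (\<mu> m c n d \<boxtimes>C Idt C (p \<bullet>A e)))
    = \<mu> m c (n \<otimes>M p) (d \<otimes>C e) \<cdot>C ((Idt C (m \<bullet>A c) \<boxtimes>C \<mu> n d p e) \<cdot>C Assoc C (m \<bullet>A c) (n \<bullet>A d) (p \<bullet>A e))"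
  using assms G.fmult_assoc'[of "(m, c)" "(n, d)" "(p, e)"] by (simp add: act_monfctr_simps)

lemma action_mult_lunit:
  assumes "m \<in> Obj M" "c \<in> Obj C"
  shows "(Lunit M m \<star>A Lunit C c) \<cdot>C (\<mu> (Unt M) (Unt C) m c \<cdot>C (ANull A \<boxtimes>C Idt C (m \<bullet>A c))) = Lunit C (m \<bullet>A c)"
  using assms G.fmult_lunit'[of "(m, c)"] by (simp add: act_monfctr_simps)

lemma action_mult_symm:
  assumes "m \<in> Obj M" "n \<in> Obj M" "c \<in> Obj C" "d \<in> Obj C"
  shows "(Symm M m n \<star>A Symm C c d) \<cdot>C \<mu> m c n d = \<mu> n d m c \<cdot>C Symm C (m \<bullet>A c) (n \<bullet>A d)"
  using assms G.fmult_symm[of "(m, c)" "(n, d)"] by (simp add: act_monfctr_simps)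

text \<open>\<open>fmult_interchange\<close> for the action as a monoidal functor on the product,
  with the interchange of the product split into its components.\<close>

lemma action_mult_interchange:
  assumes "m \<in> Obj M" "n \<in> Obj M" "p \<in> Obj M" "q \<in> Obj M" "c \<in> Obj C" "d \<in> Obj C" "e \<in> Obj C" "e' \<in> Obj C"
  shows "(interchange M m n p q \<star>A interchange C c d e e') \<cdot>C
      (\<mu> (m \<otimes>M n) (c \<otimes>C d) (p \<otimes>M q) (e \<otimes>C e') \<cdot>C (\<mu> m c n d \<boxtimes>C \<mu> p e q e'))
    = \<mu> (m \<otimes>M p) (c \<otimes>C e) (n \<otimes>M q) (d \<otimes>C e') \<cdot>C ((\<mu> m c p e \<boxtimes>C \<mu> n d q e')
      \<cdot>C interchange C (m \<bullet>A c) (n \<bullet>A d) (p \<bullet>A e) (q \<bullet>A e'))"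
  using assms G.fmult_interchange[of "(m, c)" "(n, d)" "(p, e)" "(q, e')"]
  by (simp add: act_monfctr_simps interchange_prod acting.symmetric_monoidal_category_axioms
      acted.symmetric_monoidal_category_axioms)

lemma aunit_tens:
  assumes "c \<in> Obj C" "d \<in> Obj C"
  shows "AUnit A (c \<otimes>C d) = (Lunit M (Unt M) \<star>A Idt C (c \<otimes>C d)) \<cdot>C (\<mu> (Unt M) c (Unt M) d \<cdot>C (AUnit A c \<boxtimes>C AUnit A d))"
  using assms aunit.mult_comp[of c d] by (simp add: act_unit_monfctr_def flip: action_mult_def)

text \<open>The multiplicativity of the multiplicator. The interchange of M on the right is the
  monoidal structure of \<otimes> in the target functor.\<close>

lemma amult_tens:
  assumes "m \<in> Obj M" "m' \<in> Obj M" "n \<in> Obj M" "n' \<in> Obj M" "c \<in> Obj C" "c' \<in> Obj C"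
  shows "AMult A (m \<otimes>M m') (n \<otimes>M n') (c \<otimes>C c') \<cdot>C ((Idt M (m \<otimes>M m') \<star>A \<mu> n c n' c') \<cdot>C \<mu> m (n \<bullet>A c) m' (n' \<bullet>A c'))
    = (interchange M m n m' n' \<star>A Idt C (c \<otimes>C c')) \<cdot>C (\<mu> (m \<otimes>M n) c (m' \<otimes>M n') c' \<cdot>C (AMult A m n c \<boxtimes>C AMult A m' n' c'))"
  using assms amult.mult_comp[of "(m, n, c)" "(m', n', c')"]
  by (simp add: act_act_monfctr_def tens_act_monfctr_def flip: action_mult_def)

end

text \<open>Everything about the interchanger is asked for its inverse \<open>u\<close>, the
  direction of a monoidal structure map. Three laws are derived here: naturality of the
  interchanger, the right unit law of \<bullet>, and the unit condition of the
  multiplicator.\<close>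

lemma symmetric_actionI:
  assumes M: "symmetric_monoidal_category M" and C: "symmetric_monoidal_category C"
    and F: "cat_functor (M \<times>\<^sub>c C) C (Act A)"
    and unit: "\<And>c. c \<in> Obj C \<Longrightarrow> is_iso C (AUnit A c) \<and> Dom C (AUnit A c) = c \<and> Cod C (AUnit A c) = Unt M \<bullet>A c"
      "\<And>g. g \<in> Arr C \<Longrightarrow> (Idt M (Unt M) \<star>A g) \<cdot>C AUnit A (Dom C g) = AUnit A (Cod C g) \<cdot>C g"
    and mult: "\<And>m n c. \<lbrakk>m \<in> Obj M; n \<in> Obj M; c \<in> Obj C\<rbrakk> \<Longrightarrow> is_iso C (AMult A m n c)
        \<and> Dom C (AMult A m n c) = m \<bullet>A (n \<bullet>A c) \<and> Cod C (AMult A m n c) = (m \<otimes>M n) \<bullet>A c"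
      "\<And>f f' g. \<lbrakk>f \<in> Arr M; f' \<in> Arr M; g \<in> Arr C\<rbrakk> \<Longrightarrow> AMult A (Cod M f) (Cod M f') (Cod C g) \<cdot>C (f \<star>A (f' \<star>A g))
        = ((f \<boxtimes>M f') \<star>A g) \<cdot>C AMult A (Dom M f) (Dom M f') (Dom C g)"
      "\<And>m n p c. \<lbrakk>m \<in> Obj M; n \<in> Obj M; p \<in> Obj M; c \<in> Obj C\<rbrakk> \<Longrightarrow>
        (Assoc M m n p \<star>A Idt C c) \<cdot>C (AMult A (m \<otimes>M n) p c \<cdot>C AMult A m n (p \<bullet>A c))
        = AMult A m (n \<otimes>M p) c \<cdot>C (Idt M m \<star>A AMult A n p c)"
      "\<And>m c. \<lbrakk>m \<in> Obj M; c \<in> Obj C\<rbrakk> \<Longrightarrow>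
        AMult A (Unt M) m c \<cdot>C AUnit A (m \<bullet>A c) = inv_arr M (Lunit M m) \<star>A Idt C c"
      "\<And>m c. \<lbrakk>m \<in> Obj M; c \<in> Obj C\<rbrakk> \<Longrightarrow>
        AMult A m (Unt M) c \<cdot>C (Idt M m \<star>A AUnit A c) = inv_arr M (Runit M m) \<star>A Idt C c"
    and inter: "\<And>m n c d. \<lbrakk>m \<in> Obj M; n \<in> Obj M; c \<in> Obj C; d \<in> Obj C\<rbrakk> \<Longrightarrow> is_iso C (AInter A m n c d)
        \<and> Dom C (AInter A m n c d) = (m \<otimes>M n) \<bullet>A (c \<otimes>C d) \<and> Cod C (AInter A m n c d) = (m \<bullet>A c) \<otimes>C (n \<bullet>A d)"
    and u: "\<And>m n c d. \<lbrakk>m \<in> Obj M; n \<in> Obj M; c \<in> Obj C; d \<in> Obj C\<rbrakk> \<Longrightarrow> inv_arr C (AInter A m n c d) = u m c n d"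
    and u_nat: "\<And>f f' g g'. \<lbrakk>f \<in> Arr M; f' \<in> Arr M; g \<in> Arr C; g' \<in> Arr C\<rbrakk> \<Longrightarrow>
        ((f \<boxtimes>M f') \<star>A (g \<boxtimes>C g')) \<cdot>C u (Dom M f) (Dom C g) (Dom M f') (Dom C g')
        = u (Cod M f) (Cod C g) (Cod M f') (Cod C g') \<cdot>C ((f \<star>A g) \<boxtimes>C (f' \<star>A g'))"
    and u_assoc: "\<And>m n p c d e. \<lbrakk>m \<in> Obj M; n \<in> Obj M; p \<in> Obj M; c \<in> Obj C; d \<in> Obj C; e \<in> Obj C\<rbrakk> \<Longrightarrow>
        (Assoc M m n p \<star>A Assoc C c d e) \<cdot>C (u (m \<otimes>M n) (c \<otimes>C d) p e \<cdot>C (u m c n d \<boxtimes>C Idt C (p \<bullet>A e)))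
        = u m c (n \<otimes>M p) (d \<otimes>C e) \<cdot>C ((Idt C (m \<bullet>A c) \<boxtimes>C u n d p e) \<cdot>C Assoc C (m \<bullet>A c) (n \<bullet>A d) (p \<bullet>A e))"
    and u_lunit: "\<And>m c. \<lbrakk>m \<in> Obj M; c \<in> Obj C\<rbrakk> \<Longrightarrow>
        (Lunit M m \<star>A Lunit C c) \<cdot>C (u (Unt M) (Unt C) m c \<cdot>C (AUnit A (Unt C) \<boxtimes>C Idt C (m \<bullet>A c))) = Lunit C (m \<bullet>A c)"
    and u_symm: "\<And>m n c d. \<lbrakk>m \<in> Obj M; n \<in> Obj M; c \<in> Obj C; d \<in> Obj C\<rbrakk> \<Longrightarrow>
        (Symm M m n \<star>A Symm C c d) \<cdot>C u m c n d = u n d m c \<cdot>C Symm C (m \<bullet>A c) (n \<bullet>A d)"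
    and null: "ANull A = AUnit A (Unt C)"
    and unit_tens: "\<And>c d. \<lbrakk>c \<in> Obj C; d \<in> Obj C\<rbrakk> \<Longrightarrow>
        AUnit A (c \<otimes>C d) = (Lunit M (Unt M) \<star>A Idt C (c \<otimes>C d)) \<cdot>C (u (Unt M) c (Unt M) d \<cdot>C (AUnit A c \<boxtimes>C AUnit A d))"
    and mult_tens: "\<And>m m' n n' c c'. \<lbrakk>m \<in> Obj M; m' \<in> Obj M; n \<in> Obj M; n' \<in> Obj M; c \<in> Obj C; c' \<in> Obj C\<rbrakk> \<Longrightarrow>
        AMult A (m \<otimes>M m') (n \<otimes>M n') (c \<otimes>C c') \<cdot>C ((Idt M (m \<otimes>M m') \<star>A u n c n' c') \<cdot>C u m (n \<bullet>A c) m' (n' \<bullet>A c'))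
        = (interchange M m n m' n' \<star>A Idt C (c \<otimes>C c')) \<cdot>C (u (m \<otimes>M n) c (m' \<otimes>M n') c' \<cdot>C (AMult A m n c \<boxtimes>C AMult A m' n' c'))"
  shows "symmetric_action M C A"
proof -
  interpret M: symmetric_monoidal_category M by fact
  interpret C: symmetric_monoidal_category C by fact
  interpret P: symmetric_monoidal_category "prod_smc M C" by (rule smc_prod) fact+
  note cats = M.category_axioms C.category_axioms P.category_axioms category_prod category_prod_smc
  have [simp]: "AUnit A c \<in> Arr C" if "c \<in> Obj C" for c using that unit(1) C.iso_arr by blast
  have [simp]: "AMult A m n c \<in> Arr C" if "m \<in> Obj M" "n \<in> Obj M" "c \<in> Obj C" for m n c
    using that mult(1) C.iso_arr by blast
  have [simp]: "AInter A m n c d \<in> Arr C" if "m \<in> Obj M" "n \<in> Obj M" "c \<in> Obj C" "d \<in> Obj C" for m n c d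
    using that inter(1) C.iso_arr by blast
  interpret L: left_action M C A
  proof (intro left_action.intro left_action_axioms.intro)
    interpret T: cat_functor "M \<times>\<^sub>c C" C "Act A" by fact
    have o: "m \<bullet>A c \<in> Obj C" if "m \<in> Obj M" "c \<in> Obj C" for m c
      using that T.fobj[of "(m, c)"] by simp
    have a: "f \<star>A g \<in> Arr C \<and> Dom C (f \<star>A g) = Dom M f \<bullet>A Dom C g \<and> Cod C (f \<star>A g) = Cod M f \<bullet>A Cod C g"
      if "f \<in> Arr M" "g \<in> Arr C" for f g
      using that T.farr_arr[of "(f, g)"] T.dom_farr[of "(f, g)"] T.cod_farr[of "(f, g)"] by simp
    have i: "Idt M m \<star>A Idt C c = Idt C (m \<bullet>A c)" if "m \<in> Obj M" "c \<in> Obj C" for m c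
      using that T.farr_idt[of "(m, c)"] by simp
    have k: "(f \<cdot>M f') \<star>A (g \<cdot>C g') = (f \<star>A g) \<cdot>C (f' \<star>A g')"
      if "f \<in> Arr M" "g \<in> Arr C" "f' \<in> Arr M" "g' \<in> Arr C" "Cod M f' = Dom M f" "Cod C g' = Dom C g" for f g f' g'
      using that T.farr_comp'[of "(f', g')" "(f, g)"] by simp
    have k1: "Idt M m \<star>A (g \<cdot>C g') = (Idt M m \<star>A g) \<cdot>C (Idt M m \<star>A g')"
      if "m \<in> Obj M" "g \<in> Arr C" "g' \<in> Arr C" "Cod C g' = Dom C g" for m g g'
      using that k[of "Idt M m" g "Idt M m" g'] by simp
    show "nat_iso C C id_fctr \<lparr>FObj = \<lambda>c. Unt M \<bullet>A c, FArr = \<lambda>g. Idt M (Unt M) \<star>A g\<rparr> (AUnit A)"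
      by (rule nat_isoI; (rule cat_functorI)?) (simp_all add: cats unit o a i k1)
    show "nat_iso (M \<times>\<^sub>c M \<times>\<^sub>c C) C
      \<lparr>FObj = \<lambda>(m, n, c). m \<bullet>A (n \<bullet>A c), FArr = \<lambda>(f, f', g). f \<star>A (f' \<star>A g)\<rparr>
      \<lparr>FObj = \<lambda>(m, n, c). (m \<otimes>M n) \<bullet>A c, FArr = \<lambda>(f, f', g). (f \<boxtimes>M f') \<star>A g\<rparr>
      (\<lambda>(m, n, c). AMult A m n c)"
      by (rule nat_isoI; (rule cat_functorI)?) (auto simp: cats mult(1,2) o a i k simp flip: M.tens_comp)
    fix m n p c assume "m \<in> Obj M" "n \<in> Obj M" "p \<in> Obj M" "c \<in> Obj C"
    then show "(Assoc M m n p \<star>A Idt C c) \<cdot>C AMult A (m \<otimes>M n) p c \<cdot>C AMult A m n (p \<bullet>A c)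
      = AMult A m (n \<otimes>M p) c \<cdot>C (Idt M m \<star>A AMult A n p c)"
      using mult(3) by (simp add: mult(1) o a)
  qed (use M.monoidal_category_axioms C.category_axioms F mult(4,5) in simp_all)
  have us [simp]: "is_iso C (u m c n d)" "u m c n d \<in> Arr C" "Dom C (u m c n d) = (m \<bullet>A c) \<otimes>C (n \<bullet>A d)"
    "Cod C (u m c n d) = (m \<otimes>M n) \<bullet>A (c \<otimes>C d)" "inv_arr C (u m c n d) = AInter A m n c d"
    if "m \<in> Obj M" "c \<in> Obj C" "n \<in> Obj M" "d \<in> Obj C" for m c n d
    using that inter by (simp_all flip: u)
  \<comment> \<open>Naturality of a pointwise inverse, obtained from \<open>u_nat\<close> by
    cancelling \<open>u\<close> at the codomains.\<close>
  have nat: "((f \<star>A g) \<boxtimes>C (f' \<star>A g')) \<cdot>C AInter A (Dom M f) (Dom M f') (Dom C g) (Dom C g')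
        = AInter A (Cod M f) (Cod M f') (Cod C g) (Cod C g') \<cdot>C ((f \<boxtimes>M f') \<star>A (g \<boxtimes>C g'))"
    if [simp]: "f \<in> Arr M" "f' \<in> Arr M" "g \<in> Arr C" "g' \<in> Arr C" for f f' g g'
    by (rule C.iso_cancel_left[where f = "u (Cod M f) (Cod C g) (Cod M f') (Cod C g')"])
      (use C.comp_extend[OF u_nat[of f f' g g', symmetric], of "AInter A (Dom M f) (Dom M f') (Dom C g) (Dom C g')"] in
        \<open>simp_all add: inter flip: u\<close>)
  show ?thesis
  proof (intro symmetric_action.intro symmetric_action_axioms.intro)
    show "nat_iso ((M \<times>\<^sub>c C) \<times>\<^sub>c (M \<times>\<^sub>c C)) C
      \<lparr>FObj = \<lambda>((m, c), (n, d)). (m \<otimes>M n) \<bullet>A (c \<otimes>C d),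
       FArr = \<lambda>((f, g), (f', g')). (f \<boxtimes>M f') \<star>A (g \<boxtimes>C g')\<rparr>
      \<lparr>FObj = \<lambda>((m, c), (n, d)). (m \<bullet>A c) \<otimes>C (n \<bullet>A d),
       FArr = \<lambda>((f, g), (f', g')). (f \<star>A g) \<boxtimes>C (f' \<star>A g')\<rparr>
      (\<lambda>((m, c), (n, d)). AInter A m n c d)"
      by (rule nat_isoI; (rule cat_functorI)?) (auto simp: cats inter nat)
    show "sym_mon_functor (prod_smc M C) C (act_monfctr C A)"
    proof (intro sym_mon_functorI)
      show "cat_functor (prod_smc M C) C (act_monfctr C A)"
        by (rule cat_functorI) (auto simp: cats act_monfctr_def)
      fix x assume "x \<in> Obj (prod_smc M C)"
      then obtain m c where x: "x = (m, c)" and [simp]: "m \<in> Obj M" "c \<in> Obj C" by auto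
      show "FArr (act_monfctr C A) (Runit (prod_smc M C) x) \<cdot>C
        (FMult (act_monfctr C A) (x, Unt (prod_smc M C)) \<cdot>C
         (Idt C (FObj (act_monfctr C A) x) \<boxtimes>C FUnit (act_monfctr C A))) = Runit C (FObj (act_monfctr C A) x)"
      proof -
        \<comment> \<open>The right unit law is the left one conjugated by symmetries:
          \<open>lunit_symm\<close> introduces those of M and C, and \<open>u_symm\<close> trades
          them for the symmetry of the values.\<close>
        have "(Runit M m \<star>A Runit C c) \<cdot>C (u m c (Unt M) (Unt C) \<cdot>C (Idt C (m \<bullet>A c) \<boxtimes>C AUnit A (Unt C)))
          = (Lunit M m \<star>A Lunit C c) \<cdot>C ((Symm M m (Unt M) \<star>A Symm C c (Unt C)) \<cdot>C u m c (Unt M) (Unt C)) \<cdot>C (Idt C (m \<bullet>A c) \<boxtimes>C AUnit A (Unt C))"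
          by (simp add: M.lunit_symm C.lunit_symm unit(1))
        also have "\<dots> = (Lunit M m \<star>A Lunit C c) \<cdot>C u (Unt M) (Unt C) m c \<cdot>C (Symm C (m \<bullet>A c) (Unt M \<bullet>A Unt C) \<cdot>C (Idt C (m \<bullet>A c) \<boxtimes>C AUnit A (Unt C)))"
          by (simp add: u_symm unit(1))
        also have "\<dots> = ((Lunit M m \<star>A Lunit C c) \<cdot>C (u (Unt M) (Unt C) m c \<cdot>C (AUnit A (Unt C) \<boxtimes>C Idt C (m \<bullet>A c)))) \<cdot>C Symm C (m \<bullet>A c) (Unt C)"
          by (subst C.symm_nat) (simp_all add: unit(1))
        also have "\<dots> = Runit C (m \<bullet>A c)"
          by (subst u_lunit) (simp_all add: C.lunit_symm)
        finally show ?thesis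
          by (simp add: x act_monfctr_def u null)
      qed
    qed (auto simp: act_monfctr_def u null unit(1) u_nat u_assoc u_lunit u_symm M C smc_prod)
    show "mon_trans C C \<lparr>FObj = \<lambda>c. c, FArr = \<lambda>g. g, FUnit = Idt C (Unt C), FMult = \<lambda>(c, d). Idt C (c \<otimes>C d)\<rparr>
      (act_unit_monfctr M C A) (AUnit A)"
      by (intro mon_transI cat_functorI) (auto simp: cats act_unit_monfctr_def unit null u unit_tens)
    show "mon_trans (prod_smc M (prod_smc M C)) C (act_act_monfctr M C A) (tens_act_monfctr M C A)
      (\<lambda>(m, n, c). AMult A m n c)"
    proof (intro mon_transI)
      \<comment> \<open>The unit condition of the multiplicator is its left unit law at the unit
        object, after naturality of the unitor at itself.\<close>
      show "(case Unt (prod_smc M (prod_smc M C)) of (m, n, c) \<Rightarrow> AMult A m n c) \<cdot>C FUnit (act_act_monfctr M C A)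
        = FUnit (tens_act_monfctr M C A)"
        using mult(4)[of "Unt M" "Unt C"] C.comp_extend[OF mult(4)[of "Unt M" "Unt C"], of "AUnit A (Unt C)"]
        by (simp add: act_act_monfctr_def tens_act_monfctr_def null unit L.aunit_nat)
    next
      show "cat_functor (prod_smc M (prod_smc M C)) C (act_act_monfctr M C A)"
        by (rule cat_functorI) (auto simp: cats act_act_monfctr_def)
      show "cat_functor (prod_smc M (prod_smc M C)) C (tens_act_monfctr M C A)"
        by (rule cat_functorI) (auto simp: cats tens_act_monfctr_def simp flip: M.tens_comp)
    qed (auto simp: cats act_act_monfctr_def tens_act_monfctr_def mult(1,2) u mult_tens)
  qed (fact M C L.left_action_axioms)+
qed

section \<open>The self-action\<close>

lemma self_action_simps [simp]:
  "m \<bullet>(self_action C) c = m \<otimes>C c" "f \<star>(self_action C) g = f \<boxtimes>C g"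
  "AUnit (self_action C) c = inv_arr C (Lunit C c)" "AMult (self_action C) m n c = inv_arr C (Assoc C m n c)"
  "ANull (self_action C) = inv_arr C (Lunit C (Unt C))" "AInter (self_action C) m n c d = interchange C m n c d"
  by (simp_all add: self_action_def)

text \<open>The laws of the interchanger are coherence laws of the interchange, with
  \<open>inv_interchange\<close> supplying \<open>u\<close>; the laws of unitor and multiplicator
  are inverted forms of pentagon, triangle and \<open>lunit_tens\<close>. The two monoidality
  conditions come from \<open>interchange_lunit\<close> and
  \<open>interchange_assoc\<close>.\<close>

lemma symmetric_action_self:
  assumes "symmetric_monoidal_category C"
  shows "symmetric_action C C (self_action C)"
proof -
  interpret symmetric_monoidal_category C by fact
  show ?thesis
  proof (rule symmetric_actionI[where u = "\<lambda>m c n d. interchange C m c n d"])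
    show "cat_functor (C \<times>\<^sub>c C) C (Act (self_action C))"
      using tens_functor by (simp add: self_action_def)
  next
    fix g assume [simp]: "g \<in> Arr C"
    have "Idt C (Unt C) \<boxtimes>C g = inv_arr C (Lunit C (Cod C g)) \<cdot>C (g \<cdot>C Lunit C (Dom C g))"
      by (simp add: lunit_nat[of g "Dom C g"])
    then show "Idt C (Unt C) \<star>(self_action C) g \<cdot>C AUnit (self_action C) (Dom C g) = AUnit (self_action C) (Cod C g) \<cdot>C g"
      by simp
  next
    fix f f' g assume [simp]: "f \<in> Arr C" "f' \<in> Arr C" "g \<in> Arr C"
    show "AMult (self_action C) (Cod C f) (Cod C f') (Cod C g) \<cdot>C (f \<star>(self_action C) (f' \<star>(self_action C) g))
      = ((f \<boxtimes>C f') \<star>(self_action C) g) \<cdot>C AMult (self_action C) (Dom C f) (Dom C f') (Dom C g)"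
      by (simp add: assoc_inv_nat)
  next
    fix m n p c assume [simp]: "m \<in> Obj C" "n \<in> Obj C" "p \<in> Obj C" "c \<in> Obj C"
    \<comment> \<open>The multiplicator is an inverse associator, so this is the pentagon read
      backwards; cancelling associators at both ends restores the usual form.\<close>
    show "(Assoc C m n p \<star>(self_action C) Idt C c) \<cdot>C (AMult (self_action C) (m \<otimes>C n) p c \<cdot>C AMult (self_action C) m n (p \<bullet>(self_action C) c))
      = AMult (self_action C) m (n \<otimes>C p) c \<cdot>C (Idt C m \<star>(self_action C) AMult (self_action C) n p c)"
      by (rule iso_cancel_left[where f = "Assoc C m (n \<otimes>C p) c"], rule iso_cancel_right[where f = "Assoc C m n (p \<otimes>C c) \<cdot>C Assoc C (m \<otimes>C n) p c"])
        (simp_all add: comp_extend3[OF pentagon'] comp_extend[OF assoc_tens])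
  next
    fix m c assume [simp]: "m \<in> Obj C" "c \<in> Obj C"
    show "AMult (self_action C) (Unt C) m c \<cdot>C AUnit (self_action C) (m \<bullet>(self_action C) c)
      = inv_arr C (Lunit C m) \<star>(self_action C) Idt C c"
      using lunit_tens[of m c] inv_of_comp[of "Assoc C (Unt C) m c" "Lunit C (m \<otimes>C c)"] by (simp add: inv_tens)
    show "AMult (self_action C) m (Unt C) c \<cdot>C (Idt C m \<star>(self_action C) AUnit (self_action C) c)
      = inv_arr C (Runit C m) \<star>(self_action C) Idt C c"
      using triangle[of m c] inv_of_comp[of "Assoc C m (Unt C) c" "Idt C m \<boxtimes>C Lunit C c"] by (simp add: inv_tens)
    have "(Lunit C m \<boxtimes>C Lunit C c) \<cdot>C (interchange C (Unt C) (Unt C) m c \<cdot>C (inv_arr C (Lunit C (Unt C)) \<boxtimes>C Idt C (m \<otimes>C c)))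
      = ((Lunit C m \<boxtimes>C Lunit C c) \<cdot>C interchange C (Unt C) (Unt C) m c) \<cdot>C (inv_arr C (Lunit C (Unt C)) \<boxtimes>C Idt C (m \<otimes>C c))"
      by simp
    also have "\<dots> = Lunit C (m \<otimes>C c)"
      by (subst interchange_lunit) simp_all
    finally show "(Lunit C m \<star>(self_action C) Lunit C c) \<cdot>C (interchange C (Unt C) (Unt C) m c \<cdot>C
        (AUnit (self_action C) (Unt C) \<boxtimes>C Idt C (m \<bullet>(self_action C) c))) = Lunit C (m \<bullet>(self_action C) c)"
      by simp
  next
    fix c d assume [simp]: "c \<in> Obj C" "d \<in> Obj C"
    \<comment> \<open>The unitor at c \<otimes> d and its inverse are inserted in front, because
      \<open>interchange_lunit\<close> needs that unitor to its left.\<close>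
    have "(Lunit C (Unt C) \<boxtimes>C Idt C (c \<otimes>C d)) \<cdot>C (interchange C (Unt C) c (Unt C) d \<cdot>C (inv_arr C (Lunit C c) \<boxtimes>C inv_arr C (Lunit C d)))
      = inv_arr C (Lunit C (c \<otimes>C d)) \<cdot>C (Lunit C (c \<otimes>C d) \<cdot>C (Lunit C (Unt C) \<boxtimes>C Idt C (c \<otimes>C d))) \<cdot>C
        (interchange C (Unt C) c (Unt C) d \<cdot>C (inv_arr C (Lunit C c) \<boxtimes>C inv_arr C (Lunit C d)))"
      by simp
    also have "\<dots> = inv_arr C (Lunit C (c \<otimes>C d))"
      by (subst interchange_lunit[symmetric]) (simp_all add: comp_extend[OF interchange_interchange])
    finally show "AUnit (self_action C) (c \<otimes>C d) = (Lunit C (Unt C) \<star>(self_action C) Idt C (c \<otimes>C d)) \<cdot>C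
        (interchange C (Unt C) c (Unt C) d \<cdot>C (AUnit (self_action C) c \<boxtimes>C AUnit (self_action C) d))"
      by simp
  next
    fix m m' n n' c c' assume [simp]: "m \<in> Obj C" "m' \<in> Obj C" "n \<in> Obj C" "n' \<in> Obj C" "c \<in> Obj C" "c' \<in> Obj C"
    have "Assoc C (m \<otimes>C m') (n \<otimes>C n') (c \<otimes>C c') \<cdot>C ((interchange C m n m' n' \<boxtimes>C Idt C (c \<otimes>C c')) \<cdot>C
        (interchange C (m \<otimes>C n) c (m' \<otimes>C n') c' \<cdot>C (inv_arr C (Assoc C m n c) \<boxtimes>C inv_arr C (Assoc C m' n' c'))))
      = (Idt C (m \<otimes>C m') \<boxtimes>C interchange C n c n' c') \<cdot>C interchange C m (n \<otimes>C c) m' (n' \<otimes>C c')"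
      (is "?l = ?r")
    proof (rule iso_cancel_left[where f = "interchange C m m' (n \<otimes>C c) (n' \<otimes>C c') \<cdot>C (Idt C (m \<otimes>C m') \<boxtimes>C interchange C n n' c c')"])
      \<comment> \<open>The cancelled isomorphism is the inverse of \<open>?r\<close>, so both sides
        turn into the identity; on the left this is \<open>interchange_assoc\<close> followed by two
        cancelling interchanges.\<close>
      have "(interchange C m m' (n \<otimes>C c) (n' \<otimes>C c') \<cdot>C (Idt C (m \<otimes>C m') \<boxtimes>C interchange C n n' c c')) \<cdot>C ?l
        = (interchange C m m' (n \<otimes>C c) (n' \<otimes>C c') \<cdot>C ((Idt C (m \<otimes>C m') \<boxtimes>C interchange C n n' c c') \<cdot>C Assoc C (m \<otimes>C m') (n \<otimes>C n') (c \<otimes>C c'))) \<cdot>C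
          ((interchange C m n m' n' \<boxtimes>C Idt C (c \<otimes>C c')) \<cdot>C
        (interchange C (m \<otimes>C n) c (m' \<otimes>C n') c' \<cdot>C (inv_arr C (Assoc C m n c) \<boxtimes>C inv_arr C (Assoc C m' n' c'))))"
        by simp
      also have "\<dots> = Idt C ((m \<otimes>C (n \<otimes>C c)) \<otimes>C (m' \<otimes>C (n' \<otimes>C c')))"
        by (subst interchange_assoc[symmetric]) (simp_all add: comp_extend[OF interchange_interchange])
      also have "\<dots> = (interchange C m m' (n \<otimes>C c) (n' \<otimes>C c') \<cdot>C (Idt C (m \<otimes>C m') \<boxtimes>C interchange C n n' c c')) \<cdot>C ?r"
        by simp
      finally show "(interchange C m m' (n \<otimes>C c) (n' \<otimes>C c') \<cdot>C (Idt C (m \<otimes>C m') \<boxtimes>C interchange C n n' c c')) \<cdot>C ?l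
        = (interchange C m m' (n \<otimes>C c) (n' \<otimes>C c') \<cdot>C (Idt C (m \<otimes>C m') \<boxtimes>C interchange C n n' c c')) \<cdot>C ?r" .
    qed simp_all
    then show "AMult (self_action C) (m \<otimes>C m') (n \<otimes>C n') (c \<otimes>C c') \<cdot>C
        ((Idt C (m \<otimes>C m') \<star>(self_action C) interchange C n c n' c') \<cdot>C interchange C m (n \<bullet>(self_action C) c) m' (n' \<bullet>(self_action C) c'))
      = (interchange C m n m' n' \<star>(self_action C) Idt C (c \<otimes>C c')) \<cdot>C
        (interchange C (m \<otimes>C n) c (m' \<otimes>C n') c' \<cdot>C (AMult (self_action C) m n c \<boxtimes>C AMult (self_action C) m' n' c'))"
      by (simp flip: \<open>?l = ?r\<close>)
  qed (simp_all add: symmetric_monoidal_category_axioms inv_interchange interchange_nat interchange_assoc interchange_symm)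
qed

section \<open>Restriction\<close>

text \<open>The structure maps of a restricted action have the form of an arrow
  \<open>f' \<star>A g\<close> after a structure map \<open>k\<close> of the given action. This
  moves the first factor out through the multiplicator.\<close>

lemma (in left_action) amult_nat_comp:
  assumes "f \<in> Arr M" "f' \<in> Arr M" "g \<in> Arr C" "k \<in> Arr C" "Cod C k = Dom M f' \<bullet>A Dom C g"
    "Cod M f = m" "Cod M f' = n" "Cod C g = c"
  shows "AMult A m n c \<cdot>C (f \<star>A ((f' \<star>A g) \<cdot>C k))
    = ((f \<boxtimes>M f') \<star>A g) \<cdot>C (AMult A (Dom M f) (Dom M f') (Dom C g) \<cdot>C (Idt M (Dom M f) \<star>A k))"
proof -
  have "AMult A m n c \<cdot>C (f \<star>A ((f' \<star>A g) \<cdot>C k)) = (AMult A m n c \<cdot>C (f \<star>A (f' \<star>A g))) \<cdot>C (Idt M (Dom M f) \<star>A k)"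
    using assms by auto
  then show ?thesis
    using assms by (subst (asm) amult_nat) auto
qed

text \<open>The counterpart for the inverse interchanger: the outer factors of two such composites
  leave the tensor product together.\<close>

lemma (in symmetric_action) action_mult_nat_comp:
  assumes "f \<in> Arr M" "f' \<in> Arr M" "g \<in> Arr C" "g' \<in> Arr C" "Cod M f = m" "Cod M f' = n" "Cod C g = c" "Cod C g' = d"
    and "k \<in> Arr C" "k' \<in> Arr C" "Cod C k = Dom M f \<bullet>A Dom C g" "Cod C k' = Dom M f' \<bullet>A Dom C g'"
  shows "\<mu> m c n d \<cdot>C (((f \<star>A g) \<cdot>C k) \<boxtimes>C ((f' \<star>A g') \<cdot>C k'))
    = ((f \<boxtimes>M f') \<star>A (g \<boxtimes>C g')) \<cdot>C (\<mu> (Dom M f) (Dom C g) (Dom M f') (Dom C g') \<cdot>C (k \<boxtimes>C k'))"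
proof -
  have "\<mu> m c n d \<cdot>C (((f \<star>A g) \<cdot>C k) \<boxtimes>C ((f' \<star>A g') \<cdot>C k'))
    = (\<mu> m c n d \<cdot>C ((f \<star>A g) \<boxtimes>C (f' \<star>A g'))) \<cdot>C (k \<boxtimes>C k')"
    using assms by auto
  also have "\<dots> = ((f \<boxtimes>M f') \<star>A (g \<boxtimes>C g')) \<cdot>C (\<mu> (Dom M f) (Dom C g) (Dom M f') (Dom C g') \<cdot>C (k \<boxtimes>C k'))"
    using assms by (auto simp flip: action_mult_nat)
  finally show ?thesis .
qed

lemma (in symmetric_action) action_mult_nat_comp_left:
  assumes "f \<in> Arr M" "n \<in> Obj M" "g \<in> Arr C" "d \<in> Obj C" "Cod M f = m" "Cod C g = c"
    and "k \<in> Arr C" "Cod C k = Dom M f \<bullet>A Dom C g"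
  shows "\<mu> m c n d \<cdot>C (((f \<star>A g) \<cdot>C k) \<boxtimes>C Idt C (n \<bullet>A d))
    = ((f \<boxtimes>M Idt M n) \<star>A (g \<boxtimes>C Idt C d)) \<cdot>C (\<mu> (Dom M f) (Dom C g) n d \<cdot>C (k \<boxtimes>C Idt C (n \<bullet>A d)))"
  using assms action_mult_nat_comp[of f "Idt M n" g "Idt C d" m n c d k "Idt C (n \<bullet>A d)"] by auto

lemma (in symmetric_action) action_mult_nat_comp_right:
  assumes "m \<in> Obj M" "f' \<in> Arr M" "c \<in> Obj C" "g' \<in> Arr C" "Cod M f' = n" "Cod C g' = d"
    and "k' \<in> Arr C" "Cod C k' = Dom M f' \<bullet>A Dom C g'"
  shows "\<mu> m c n d \<cdot>C (Idt C (m \<bullet>A c) \<boxtimes>C ((f' \<star>A g') \<cdot>C k'))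
    = ((Idt M m \<boxtimes>M f') \<star>A (Idt C c \<boxtimes>C g')) \<cdot>C (\<mu> m c (Dom M f') (Dom C g') \<cdot>C (Idt C (m \<bullet>A c) \<boxtimes>C k'))"
  using assms action_mult_nat_comp[of "Idt M m" f' "Idt C c" g' m n c d "Idt C (m \<bullet>A c)" k'] by auto

lemma restriction_simps:
  "m \<bullet>(restriction N C R B) c = FObj R m \<bullet>B c"
  "f \<star>(restriction N C R B) g = FArr R f \<star>B g"
  "AUnit (restriction N C R B) c = (FUnit R \<star>B Idt C c) \<cdot>C AUnit B c"
  "AMult (restriction N C R B) m n c = (FMult R (m, n) \<star>B Idt C c) \<cdot>C AMult B (FObj R m) (FObj R n) c"
  "ANull (restriction N C R B) = (FUnit R \<star>B Idt C (Unt C)) \<cdot>C ANull B"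
  "AInter (restriction N C R B) m n c d = AInter B (FObj R m) (FObj R n) c d
       \<cdot>C (inv_arr N (FMult R (m, n)) \<star>B Idt C (c \<otimes>C d))"
  by (simp_all add: restriction_def)

lemma action_mult_restriction:
  assumes "sym_mon_functor M N R" "symmetric_action N C B" "m \<in> Obj M" "n \<in> Obj M" "c \<in> Obj C" "d \<in> Obj C"
  shows "action_mult C (restriction N C R B) m c n d
    = (FMult R (m, n) \<star>B Idt C (c \<otimes>C d)) \<cdot>C action_mult C B (FObj R m) c (FObj R n) d"
proof -
  interpret R: sym_mon_functor M N R by fact
  interpret B: symmetric_action N C B by fact
  show ?thesis
    using assms(3-) by (simp add: action_mult_def restriction_simps B.acted.inv_of_comp B.inv_act)
qed

text \<open>Each axiom separates into two. Naturality collects the structure maps of R in the first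
  argument of the action, where a law of monoidal functors applies; what is left is the same axiom
  for B at images of R.\<close>

lemma symmetric_action_restriction:
  assumes "sym_mon_functor M N R" "symmetric_action N C B"
  shows "symmetric_action M C (restriction N C R B)"
proof -
  interpret R: sym_mon_functor M N R by fact
  interpret B: symmetric_action N C B by fact
  note cats = R.dom_smc.category_axioms B.acted.category_axioms category_prod
  let ?R = "restriction N C R B"
  show ?thesis
  proof (rule symmetric_actionI[where u = "\<lambda>m c n d. (FMult R (m, n) \<star>B Idt C (c \<otimes>C d)) \<cdot>C action_mult C B (FObj R m) c (FObj R n) d"])
    show "cat_functor (M \<times>\<^sub>c C) C (Act ?R)"
      by (rule cat_functorI) (auto simp: cats restriction_def)
  next
    fix g assume [simp]: "g \<in> Arr C"
    show "Idt M (Unt M) \<star>?R g \<cdot>C AUnit ?R (Dom C g) = AUnit ?R (Cod C g) \<cdot>C g"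
      by (simp add: restriction_simps flip: B.aunit_nat)
  next
    fix f f' g assume [simp]: "f \<in> Arr M" "f' \<in> Arr M" "g \<in> Arr C"
    show "AMult ?R (Cod M f) (Cod M f') (Cod C g) \<cdot>C (f \<star>?R (f' \<star>?R g))
      = ((f \<boxtimes>M f') \<star>?R g) \<cdot>C AMult ?R (Dom M f) (Dom M f') (Dom C g)"
      by (simp add: restriction_simps B.amult_nat R.fmult_nat)
  next
    fix m n p c assume [simp]: "m \<in> Obj M" "n \<in> Obj M" "p \<in> Obj M" "c \<in> Obj C"
    have "(Assoc M m n p \<star>?R Idt C c) \<cdot>C (AMult ?R (m \<otimes>M n) p c \<cdot>C AMult ?R m n (p \<bullet>?R c))
      = ((FArr R (Assoc M m n p) \<cdot>N (FMult R (m \<otimes>M n, p) \<cdot>N (FMult R (m, n) \<boxtimes>N Idt N (FObj R p)))) \<star>B Idt C c)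
        \<cdot>C (AMult B (FObj R m \<otimes>N FObj R n) (FObj R p) c \<cdot>C AMult B (FObj R m) (FObj R n) (FObj R p \<bullet>B c))"
      by (simp add: restriction_simps B.acted.comp_extend[OF B.amult_nat_left])
    also have "\<dots> = ((FMult R (m, n \<otimes>M p) \<cdot>N (Idt N (FObj R m) \<boxtimes>N FMult R (n, p))) \<star>B Idt C c) \<cdot>C
      ((Assoc N (FObj R m) (FObj R n) (FObj R p) \<star>B Idt C c) \<cdot>C (AMult B (FObj R m \<otimes>N FObj R n) (FObj R p) c \<cdot>C AMult B (FObj R m) (FObj R n) (FObj R p \<bullet>B c)))"
      by (simp add: R.fmult_assoc')
    also have "\<dots> = AMult ?R m (n \<otimes>M p) c \<cdot>C (Idt M m \<star>?R AMult ?R n p c)"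
      by (subst B.amult_assoc') (simp_all add: restriction_simps B.amult_nat_comp)
    finally show "(Assoc M m n p \<star>?R Idt C c) \<cdot>C (AMult ?R (m \<otimes>M n) p c \<cdot>C AMult ?R m n (p \<bullet>?R c))
      = AMult ?R m (n \<otimes>M p) c \<cdot>C (Idt M m \<star>?R AMult ?R n p c)" .
  next
    fix m c assume [simp]: "m \<in> Obj M" "c \<in> Obj C"
    \<comment> \<open>The unit laws of R, solved for the images of the inverse unitors, since the
      unit axioms of an action are stated with these.\<close>
    have 1: "FMult R (Unt M, m) \<cdot>N (FUnit R \<boxtimes>N Idt N (FObj R m)) \<cdot>N inv_arr N (Lunit N (FObj R m)) = FArr R (inv_arr M (Lunit M m))"
      by (rule R.cod_smc.iso_cancel_left[where f = "FArr R (Lunit M m)"]) (simp_all add: R.cod_smc.comp_extend3[OF R.fmult_lunit'] R.farr_inv)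
    have 2: "FMult R (m, Unt M) \<cdot>N (Idt N (FObj R m) \<boxtimes>N FUnit R) \<cdot>N inv_arr N (Runit N (FObj R m)) = FArr R (inv_arr M (Runit M m))"
      by (rule R.cod_smc.iso_cancel_left[where f = "FArr R (Runit M m)"]) (simp_all add: R.cod_smc.comp_extend3[OF R.fmult_runit'] R.farr_inv)
    have "AMult ?R (Unt M) m c \<cdot>C AUnit ?R (m \<bullet>?R c)
      = ((FMult R (Unt M, m) \<cdot>N (FUnit R \<boxtimes>N Idt N (FObj R m))) \<star>B Idt C c) \<cdot>C (AMult B (Unt N) (FObj R m) c \<cdot>C AUnit B (FObj R m \<bullet>B c))"
      by (simp add: restriction_simps B.acted.comp_extend[OF B.amult_nat_left])
    also have "\<dots> = inv_arr M (Lunit M m) \<star>?R Idt C c"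
      using 1 by (subst B.amult_aunit_left) (simp_all add: restriction_simps)
    finally show "AMult ?R (Unt M) m c \<cdot>C AUnit ?R (m \<bullet>?R c) = inv_arr M (Lunit M m) \<star>?R Idt C c" .
    have "AMult ?R m (Unt M) c \<cdot>C (Idt M m \<star>?R AUnit ?R c)
      = ((FMult R (m, Unt M) \<cdot>N (Idt N (FObj R m) \<boxtimes>N FUnit R)) \<star>B Idt C c) \<cdot>C (AMult B (FObj R m) (Unt N) c \<cdot>C (Idt N (FObj R m) \<star>B AUnit B c))"
      by (simp add: restriction_simps B.amult_nat_comp)
    also have "\<dots> = inv_arr M (Runit M m) \<star>?R Idt C c"
      using 2 by (subst B.amult_aunit_right) (simp_all add: restriction_simps)
    finally show "AMult ?R m (Unt M) c \<cdot>C (Idt M m \<star>?R AUnit ?R c) = inv_arr M (Runit M m) \<star>?R Idt C c" .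
  next
    show "inv_arr C (AInter ?R m n c d) = (FMult R (m, n) \<star>B Idt C (c \<otimes>C d)) \<cdot>C action_mult C B (FObj R m) c (FObj R n) d"
      if "m \<in> Obj M" "n \<in> Obj M" "c \<in> Obj C" "d \<in> Obj C" for m n c d
      using action_mult_restriction[OF assms that] by (simp add: action_mult_def)
  next
    fix f f' g g' assume [simp]: "f \<in> Arr M" "f' \<in> Arr M" "g \<in> Arr C" "g' \<in> Arr C"
    show "((f \<boxtimes>M f') \<star>?R (g \<boxtimes>C g')) \<cdot>C ((FMult R (Dom M f, Dom M f') \<star>B Idt C (Dom C g \<otimes>C Dom C g')) \<cdot>C action_mult C B (FObj R (Dom M f)) (Dom C g) (FObj R (Dom M f')) (Dom C g'))
      = ((FMult R (Cod M f, Cod M f') \<star>B Idt C (Cod C g \<otimes>C Cod C g')) \<cdot>C action_mult C B (FObj R (Cod M f)) (Cod C g) (FObj R (Cod M f')) (Cod C g')) \<cdot>C ((f \<star>?R g) \<boxtimes>C (f' \<star>?R g'))"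
      using B.action_mult_nat[of "FArr R f" "FArr R f'" g g', symmetric] by (simp add: restriction_simps R.fmult_nat)
  next
    fix m n p c d e assume [simp]: "m \<in> Obj M" "n \<in> Obj M" "p \<in> Obj M" "c \<in> Obj C" "d \<in> Obj C" "e \<in> Obj C"
    show "(Assoc M m n p \<star>?R Assoc C c d e) \<cdot>C (((FMult R (m \<otimes>M n, p) \<star>B Idt C ((c \<otimes>C d) \<otimes>C e)) \<cdot>C action_mult C B (FObj R (m \<otimes>M n)) (c \<otimes>C d) (FObj R p) e) \<cdot>C
        (((FMult R (m, n) \<star>B Idt C (c \<otimes>C d)) \<cdot>C action_mult C B (FObj R m) c (FObj R n) d) \<boxtimes>C Idt C (p \<bullet>?R e)))
      = ((FMult R (m, n \<otimes>M p) \<star>B Idt C (c \<otimes>C (d \<otimes>C e))) \<cdot>C action_mult C B (FObj R m) c (FObj R (n \<otimes>M p)) (d \<otimes>C e)) \<cdot>C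
        ((Idt C (m \<bullet>?R c) \<boxtimes>C ((FMult R (n, p) \<star>B Idt C (d \<otimes>C e)) \<cdot>C action_mult C B (FObj R n) d (FObj R p) e)) \<cdot>C Assoc C (m \<bullet>?R c) (n \<bullet>?R d) (p \<bullet>?R e))"
    proof -
      \<comment> \<open>The part that belongs to B. All of R is collected in front of it, for
        \<open>fmult_assoc'\<close> to act on, before the associativity of B is applied to
        \<open>?k\<close>.\<close>
      let ?k = "action_mult C B (FObj R m \<otimes>N FObj R n) (c \<otimes>C d) (FObj R p) e \<cdot>C (action_mult C B (FObj R m) c (FObj R n) d \<boxtimes>C Idt C (FObj R p \<bullet>B e))"
      have "?thesis \<longleftrightarrow> ((FArr R (Assoc M m n p) \<cdot>N (FMult R (m \<otimes>M n, p) \<cdot>N (FMult R (m, n) \<boxtimes>N Idt N (FObj R p)))) \<star>B Assoc C c d e) \<cdot>C ?k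
        = ((FMult R (m, n \<otimes>M p) \<cdot>N (Idt N (FObj R m) \<boxtimes>N FMult R (n, p))) \<star>B Idt C (c \<otimes>C (d \<otimes>C e))) \<cdot>C
          (action_mult C B (FObj R m) c (FObj R n \<otimes>N FObj R p) (d \<otimes>C e) \<cdot>C ((Idt C (FObj R m \<bullet>B c) \<boxtimes>C action_mult C B (FObj R n) d (FObj R p) e)
            \<cdot>C Assoc C (FObj R m \<bullet>B c) (FObj R n \<bullet>B d) (FObj R p \<bullet>B e)))"
        using B.acted.comp_extend[OF B.action_mult_nat_comp_right[of "FObj R m" "FMult R (n, p)" c "Idt C (d \<otimes>C e)" "FObj R (n \<otimes>M p)" "d \<otimes>C e"
            "action_mult C B (FObj R n) d (FObj R p) e"], of "Assoc C (FObj R m \<bullet>B c) (FObj R n \<bullet>B d) (FObj R p \<bullet>B e)"]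
        by (simp add: restriction_simps B.action_mult_nat_comp_left)
      also have "\<dots> \<longleftrightarrow> ((FMult R (m, n \<otimes>M p) \<cdot>N (Idt N (FObj R m) \<boxtimes>N FMult R (n, p))) \<star>B Idt C (c \<otimes>C (d \<otimes>C e))) \<cdot>C
          ((Assoc N (FObj R m) (FObj R n) (FObj R p) \<star>B Assoc C c d e) \<cdot>C ?k)
        = ((FMult R (m, n \<otimes>M p) \<cdot>N (Idt N (FObj R m) \<boxtimes>N FMult R (n, p))) \<star>B Idt C (c \<otimes>C (d \<otimes>C e))) \<cdot>C
          (action_mult C B (FObj R m) c (FObj R n \<otimes>N FObj R p) (d \<otimes>C e) \<cdot>C ((Idt C (FObj R m \<bullet>B c) \<boxtimes>C action_mult C B (FObj R n) d (FObj R p) e)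
            \<cdot>C Assoc C (FObj R m \<bullet>B c) (FObj R n \<bullet>B d) (FObj R p \<bullet>B e)))"
        by (simp add: R.fmult_assoc')
      finally show ?thesis
        by (subst (asm) B.action_mult_assoc) simp_all
    qed
  next
    fix m c assume [simp]: "m \<in> Obj M" "c \<in> Obj C"
    show "(Lunit M m \<star>?R Lunit C c) \<cdot>C (((FMult R (Unt M, m) \<star>B Idt C (Unt C \<otimes>C c)) \<cdot>C action_mult C B (FObj R (Unt M)) (Unt C) (FObj R m) c) \<cdot>C (AUnit ?R (Unt C) \<boxtimes>C Idt C (m \<bullet>?R c))) = Lunit C (m \<bullet>?R c)"
    proof -
      have "(Lunit M m \<star>?R Lunit C c) \<cdot>C (((FMult R (Unt M, m) \<star>B Idt C (Unt C \<otimes>C c)) \<cdot>C action_mult C B (FObj R (Unt M)) (Unt C) (FObj R m) c) \<cdot>C (AUnit ?R (Unt C) \<boxtimes>C Idt C (m \<bullet>?R c)))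
        = ((FArr R (Lunit M m) \<cdot>N (FMult R (Unt M, m) \<cdot>N (FUnit R \<boxtimes>N Idt N (FObj R m)))) \<star>B Lunit C c) \<cdot>C
          (action_mult C B (Unt N) (Unt C) (FObj R m) c \<cdot>C (ANull B \<boxtimes>C Idt C (FObj R m \<bullet>B c)))"
        by (simp add: restriction_simps B.action_mult_nat_comp_left B.anull_eq)
      also have "\<dots> = Lunit C (m \<bullet>?R c)"
        by (simp add: R.fmult_lunit' B.action_mult_lunit restriction_simps)
      finally show ?thesis .
    qed
  next
    fix m n c d assume [simp]: "m \<in> Obj M" "n \<in> Obj M" "c \<in> Obj C" "d \<in> Obj C"
    show "(Symm M m n \<star>?R Symm C c d) \<cdot>C ((FMult R (m, n) \<star>B Idt C (c \<otimes>C d)) \<cdot>C action_mult C B (FObj R m) c (FObj R n) d)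
      = ((FMult R (n, m) \<star>B Idt C (d \<otimes>C c)) \<cdot>C action_mult C B (FObj R n) d (FObj R m) c) \<cdot>C Symm C (m \<bullet>?R c) (n \<bullet>?R d)"
      by (simp add: restriction_simps R.fmult_symm flip: B.action_mult_symm)
  next
    show "ANull ?R = AUnit ?R (Unt C)" by (simp add: restriction_simps B.anull_eq)
  next
    fix c d assume [simp]: "c \<in> Obj C" "d \<in> Obj C"
    show "AUnit ?R (c \<otimes>C d) = (Lunit M (Unt M) \<star>?R Idt C (c \<otimes>C d)) \<cdot>C (((FMult R (Unt M, Unt M) \<star>B Idt C (c \<otimes>C d)) \<cdot>C action_mult C B (FObj R (Unt M)) c (FObj R (Unt M)) d) \<cdot>C (AUnit ?R c \<boxtimes>C AUnit ?R d))"
    proof -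
      \<comment> \<open>R is compatible with the multiplication of the unit object: the unit law of
        R with \<open>FUnit R\<close> in both slots, then naturality of the left unitor at
        \<open>FUnit R\<close>.\<close>
      have "FArr R (Lunit M (Unt M)) \<cdot>N (FMult R (Unt M, Unt M) \<cdot>N (FUnit R \<boxtimes>N FUnit R))
        = (FArr R (Lunit M (Unt M)) \<cdot>N (FMult R (Unt M, Unt M) \<cdot>N (FUnit R \<boxtimes>N Idt N (FObj R (Unt M))))) \<cdot>N (Idt N (Unt N) \<boxtimes>N FUnit R)"
        by simp
      also have "\<dots> = FUnit R \<cdot>N Lunit N (Unt N)"
        using R.cod_smc.lunit_nat[of "FUnit R" "Unt N"] by (subst R.fmult_lunit') simp_all
      finally have "(FArr R (Lunit M (Unt M)) \<cdot>N (FMult R (Unt M, Unt M) \<cdot>N (FUnit R \<boxtimes>N FUnit R))) \<star>B Idt C (c \<otimes>C d)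
        = (FUnit R \<star>B Idt C (c \<otimes>C d)) \<cdot>C (Lunit N (Unt N) \<star>B Idt C (c \<otimes>C d))"
        by simp
      then show ?thesis
        by (simp add: restriction_simps B.action_mult_nat_comp B.aunit_tens[of c d])
    qed
  next
    fix m m' n n' c c' assume [simp]: "m \<in> Obj M" "m' \<in> Obj M" "n \<in> Obj M" "n' \<in> Obj M" "c \<in> Obj C" "c' \<in> Obj C"
    show "AMult ?R (m \<otimes>M m') (n \<otimes>M n') (c \<otimes>C c') \<cdot>C ((Idt M (m \<otimes>M m') \<star>?R ((FMult R (n, n') \<star>B Idt C (c \<otimes>C c')) \<cdot>C action_mult C B (FObj R n) c (FObj R n') c')) \<cdot>C
        ((FMult R (m, m') \<star>B Idt C ((n \<bullet>?R c) \<otimes>C (n' \<bullet>?R c'))) \<cdot>C action_mult C B (FObj R m) (n \<bullet>?R c) (FObj R m') (n' \<bullet>?R c')))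
      = (interchange M m n m' n' \<star>?R Idt C (c \<otimes>C c')) \<cdot>C (((FMult R (m \<otimes>M n, m' \<otimes>M n') \<star>B Idt C (c \<otimes>C c')) \<cdot>C action_mult C B (FObj R (m \<otimes>M n)) c (FObj R (m' \<otimes>M n')) c') \<cdot>C (AMult ?R m n c \<boxtimes>C AMult ?R m' n' c'))"
    proof -
      \<comment> \<open>Again R and B separate: \<open>amult_tens\<close> is applied to B, and the
        interchange of N that it produces is absorbed into R by
        \<open>fmult_interchange\<close>.\<close>
      let ?k = "action_mult C B (FObj R m \<otimes>N FObj R n) c (FObj R m' \<otimes>N FObj R n') c' \<cdot>C (AMult B (FObj R m) (FObj R n) c \<boxtimes>C AMult B (FObj R m') (FObj R n') c')"
      have "?thesis \<longleftrightarrow> ((FMult R (m \<otimes>M m', n \<otimes>M n') \<cdot>N (FMult R (m, m') \<boxtimes>N FMult R (n, n'))) \<star>B Idt C (c \<otimes>C c')) \<cdot>C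
          (AMult B (FObj R m \<otimes>N FObj R m') (FObj R n \<otimes>N FObj R n') (c \<otimes>C c') \<cdot>C
            ((Idt N (FObj R m \<otimes>N FObj R m') \<star>B action_mult C B (FObj R n) c (FObj R n') c') \<cdot>C action_mult C B (FObj R m) (FObj R n \<bullet>B c) (FObj R m') (FObj R n' \<bullet>B c')))
        = ((FArr R (interchange M m n m' n') \<cdot>N (FMult R (m \<otimes>M n, m' \<otimes>M n') \<cdot>N (FMult R (m, n) \<boxtimes>N FMult R (m', n')))) \<star>B Idt C (c \<otimes>C c')) \<cdot>C ?k"
        using B.acted.comp_extend[OF B.amult_nat_comp[of "FMult R (m, m')" "FMult R (n, n')" "Idt C (c \<otimes>C c')" "action_mult C B (FObj R n) c (FObj R n') c'"
            "FObj R (m \<otimes>M m')" "FObj R (n \<otimes>M n')" "c \<otimes>C c'"], of "action_mult C B (FObj R m) (FObj R n \<bullet>B c) (FObj R m') (FObj R n' \<bullet>B c')"]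
        by (simp add: restriction_simps B.action_mult_nat_comp)
      also have "\<dots> \<longleftrightarrow> ((FMult R (m \<otimes>M m', n \<otimes>M n') \<cdot>N (FMult R (m, m') \<boxtimes>N FMult R (n, n'))) \<star>B Idt C (c \<otimes>C c')) \<cdot>C
          ((interchange N (FObj R m) (FObj R n) (FObj R m') (FObj R n') \<star>B Idt C (c \<otimes>C c')) \<cdot>C ?k)
        = ((FMult R (m \<otimes>M m', n \<otimes>M n') \<cdot>N ((FMult R (m, m') \<boxtimes>N FMult R (n, n')) \<cdot>N interchange N (FObj R m) (FObj R n) (FObj R m') (FObj R n'))) \<star>B Idt C (c \<otimes>C c')) \<cdot>C ?k"
        by (subst B.amult_tens) (simp_all add: R.fmult_interchange)
      finally show ?thesis by simp
    qed
  qed (simp_all add: R.dom_smc.symmetric_monoidal_category_axioms B.acted.symmetric_monoidal_category_axioms restriction_simps)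
qed

section \<open>The functor represented by an action\<close>

text \<open>The monoidal inclusion of M at the unit of C. The unit is a monoid via
  \<open>Lunit C (Unt C)\<close>, which by \<open>lunit_unit\<close> is also the right unitor; this
  makes both unit laws hold.\<close>

definition unit_inj :: "('m, 'f) smc \<Rightarrow> ('o, 'a) smc \<Rightarrow> ('m, 'f, 'm \<times> 'o, 'f \<times> 'a) monfctr" where
  "unit_inj M C = \<lparr>FObj = \<lambda>m. (m, Unt C), FArr = \<lambda>f. (f, Idt C (Unt C)),
     FUnit = (Idt M (Unt M), Idt C (Unt C)), FMult = \<lambda>(m, n). (Idt M (m \<otimes>M n), Lunit C (Unt C))\<rparr>"

text \<open>Written as a composite of monoidal functors, so that strong symmetric monoidality needs
  no separate computation.\<close>

definition rep_functor :: "('m, 'f) smc \<Rightarrow> ('o, 'a) smc \<Rightarrow> ('m, 'f, 'o, 'a) monaction \<Rightarrow> ('m, 'f, 'o, 'a) monfctr" where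
  "rep_functor M C A = comp_monfctr M C (act_monfctr C A) (unit_inj M C)"

text \<open>Cut down to the carriers because the identification in a 1-cell has to be
  extensional.\<close>

definition rep_ident :: "('m, 'f) smc \<Rightarrow> ('o, 'a) smc \<Rightarrow> ('m, 'f, 'o, 'a) monaction \<Rightarrow> 'm \<times> 'o \<Rightarrow> 'a" where
  "rep_ident M C A = (\<lambda>(m, c) \<in> Obj M \<times> Obj C. (Runit M m \<star>A Lunit C c) \<cdot>C
     (action_mult C A m (Unt C) (Unt M) c \<cdot>C (Idt C (m \<bullet>A Unt C) \<boxtimes>C AUnit A c)))"

lemma sym_mon_functor_unit_inj:
  assumes "symmetric_monoidal_category M" "symmetric_monoidal_category C"
  shows "sym_mon_functor M (prod_smc M C) (unit_inj M C)"
proof -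
  interpret M: symmetric_monoidal_category M by fact
  interpret C: symmetric_monoidal_category C by fact
  show ?thesis
    by (intro sym_mon_functorI cat_functorI)
      (simp_all add: assms smc_prod M.category_axioms C.category_axioms category_prod_smc unit_inj_def
        C.lunit_unit C.triangle C.symm_unit flip: C.lunit_unit)
qed

lemma monfctr_ext_rep [simp]: "monfctr_ext M (rep_functor M C A)"
  by (simp add: rep_functor_def)

lemma rep_ident_ext [simp]: "rep_ident M C A \<in> extensional (Obj M \<times> Obj C)"
  by (simp add: rep_ident_def)

text \<open>Compatibility with interchangers is asked for their inverses, in terms of which \<theta>
  and restrictions are computed; cancelling an inverse interchanger on each side gives the required
  form.\<close>

lemma action_identificationI:
  assumes A: "symmetric_action M C A" and B: "symmetric_action M C B"
    and t: "\<And>m c. \<lbrakk>m \<in> Obj M; c \<in> Obj C\<rbrakk> \<Longrightarrow>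
      is_iso C (t (m, c)) \<and> Dom C (t (m, c)) = m \<bullet>A c \<and> Cod C (t (m, c)) = m \<bullet>B c"
    and "\<And>f g. \<lbrakk>f \<in> Arr M; g \<in> Arr C\<rbrakk> \<Longrightarrow> (f \<star>B g) \<cdot>C t (Dom M f, Dom C g) = t (Cod M f, Cod C g) \<cdot>C (f \<star>A g)"
    and "\<And>c. c \<in> Obj C \<Longrightarrow> t (Unt M, c) \<cdot>C AUnit A c = AUnit B c"
    and mult: "\<And>m n c. \<lbrakk>m \<in> Obj M; n \<in> Obj M; c \<in> Obj C\<rbrakk> \<Longrightarrow>
      t (m \<otimes>M n, c) \<cdot>C AMult A m n c = AMult B m n c \<cdot>C (t (m, n \<bullet>B c) \<cdot>C (Idt M m \<star>A t (n, c)))"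
    and inter: "\<And>m n c d. \<lbrakk>m \<in> Obj M; n \<in> Obj M; c \<in> Obj C; d \<in> Obj C\<rbrakk> \<Longrightarrow>
      t (m \<otimes>M n, c \<otimes>C d) \<cdot>C action_mult C A m c n d = action_mult C B m c n d \<cdot>C (t (m, c) \<boxtimes>C t (n, d))"
  shows "action_identification M C A B t"
proof -
  interpret A: symmetric_action M C A by fact
  interpret B: symmetric_action M C B by fact
  have [simp]: "t (m, c) \<in> Arr C" "Dom C (t (m, c)) = m \<bullet>A c" "Cod C (t (m, c)) = m \<bullet>B c" "is_iso C (t (m, c))"
    if "m \<in> Obj M" "c \<in> Obj C" for m c
    using t[OF that] A.acted.iso_arr by auto
  show ?thesis
  proof (intro action_identification.intro action_identification_axioms.intro)
    show "nat_iso (M \<times>\<^sub>c C) C (Act A) (Act B) t"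
      by (rule nat_isoI) (use A.act_functor B.act_functor assms(4) in auto)
    fix m n c d assume [simp]: "m \<in> Obj M" "n \<in> Obj M" "c \<in> Obj C" "d \<in> Obj C"
    show "t (m \<otimes>M n, c) \<cdot>C AMult A m n c = AMult B m n c \<cdot>C t (m, n \<bullet>B c) \<cdot>C (Idt M m \<star>A t (n, c))"
      by (simp add: mult)
    show "(t (m, c) \<boxtimes>C t (n, d)) \<cdot>C AInter A m n c d = AInter B m n c d \<cdot>C t (m \<otimes>M n, c \<otimes>C d)"
      by (rule A.acted.iso_cancel_left[where f = "action_mult C B m c n d"], rule A.acted.iso_cancel_right[where f = "action_mult C A m c n d"])
        (simp_all add: inter flip: A.action_mult_simps(5) B.action_mult_simps(5) del: A.action_mult_simps(5) B.action_mult_simps(5))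
  qed (use assms(5) in auto)
qed

text \<open>\<open>action_identification\<close> concerns only the family t; here it is joined with
  the two symmetric actions that it compares, whose rules its consequences use.\<close>

locale symmetric_action_identification =
  src: symmetric_action M C A + tgt: symmetric_action M C B + action_identification M C A B t
  for M :: "('m, 'f) smc" and C :: "('o, 'a) smc"
    and A :: "('m, 'f, 'o, 'a) monaction" and B :: "('m, 'f, 'o, 'a) monaction"
    and t :: "'m \<times> 'o \<Rightarrow> 'a"
begin

lemma ident_simps [simp]:
  assumes "m \<in> Obj M" "c \<in> Obj C"
  shows "t (m, c) \<in> Arr C" "Dom C (t (m, c)) = m \<bullet>A c" "Cod C (t (m, c)) = m \<bullet>B c" "is_iso C (t (m, c))"
  using assms component_arr[of "(m, c)"] dom_component[of "(m, c)"] cod_component[of "(m, c)"] component_iso[of "(m, c)"]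
  by simp_all

lemma ident_nat:
  "\<lbrakk>f \<in> Arr M; g \<in> Arr C; Dom M f = m; Dom C g = c\<rbrakk> \<Longrightarrow> (f \<star>B g) \<cdot>C t (m, c) = t (Cod M f, Cod C g) \<cdot>C (f \<star>A g)"
  using naturality'[of "(f, g)" "(m, c)"] by simp

lemma ident_mult:
  "\<lbrakk>m \<in> Obj M; n \<in> Obj M; c \<in> Obj C\<rbrakk> \<Longrightarrow>
      t (m \<otimes>M n, c) \<cdot>C AMult A m n c = AMult B m n c \<cdot>C (t (m, n \<bullet>B c) \<cdot>C (Idt M m \<star>A t (n, c)))"
  using amult_comp[of m n c] by simp

lemma ident_inter:
  assumes [simp]: "m \<in> Obj M" "n \<in> Obj M" "c \<in> Obj C" "d \<in> Obj C"
  shows "t (m \<otimes>M n, c \<otimes>C d) \<cdot>C action_mult C A m c n d = action_mult C B m c n d \<cdot>C (t (m, c) \<boxtimes>C t (n, d))"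
proof (rule src.acted.iso_cancel_left[where f = "AInter B m n c d"])
  show "AInter B m n c d \<cdot>C (t (m \<otimes>M n, c \<otimes>C d) \<cdot>C action_mult C A m c n d)
    = AInter B m n c d \<cdot>C (action_mult C B m c n d \<cdot>C (t (m, c) \<boxtimes>C t (n, d)))"
    using ainter_comp[of m n c d, symmetric] src.acted.comp_extend[OF ainter_comp[of m n c d, symmetric], of "action_mult C A m c n d"]
    by (simp add: action_mult_def)
qed simp_all

end

section \<open>The representing functor and the compatibilities of \<theta>\<close>

context symmetric_action
begin

abbreviation F where "F \<equiv> rep_functor M C A"
abbreviation \<theta> where "\<theta> \<equiv> rep_ident M C A"

lemma sym_mon_functor_rep: "sym_mon_functor M C F"
  unfolding rep_functor_def
  by (rule sym_mon_functor_comp[OF sym_mon_functor_unit_inj act_sym_mon])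
    (rule acting.symmetric_monoidal_category_axioms acted.symmetric_monoidal_category_axioms)+

lemma rep_functor_simps [simp]:
  "m \<in> Obj M \<Longrightarrow> FObj F m = m \<bullet>A Unt C"
  "f \<in> Arr M \<Longrightarrow> FArr F f = f \<star>A Idt C (Unt C)"
  "FUnit F = ANull A"
  "\<lbrakk>m \<in> Obj M; n \<in> Obj M\<rbrakk> \<Longrightarrow> FMult F (m, n) = (Idt M (m \<otimes>M n) \<star>A Lunit C (Unt C)) \<cdot>C \<mu> m (Unt C) n (Unt C)"
  by (simp_all add: rep_functor_def unit_inj_def act_monfctr_simps)

lemma rep_ident_eq:
  "\<lbrakk>m \<in> Obj M; c \<in> Obj C\<rbrakk> \<Longrightarrow> \<theta> (m, c) = (Runit M m \<star>A Lunit C c) \<cdot>C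
     (\<mu> m (Unt C) (Unt M) c \<cdot>C (Idt C (m \<bullet>A Unt C) \<boxtimes>C AUnit A c))"
  by (simp add: rep_ident_def)

lemma rep_ident_simps [simp]:
  assumes "m \<in> Obj M" "c \<in> Obj C"
  shows "\<theta> (m, c) \<in> Arr C" "Dom C (\<theta> (m, c)) = (m \<bullet>A Unt C) \<otimes>C c" "Cod C (\<theta> (m, c)) = m \<bullet>A c" "is_iso C (\<theta> (m, c))"
  using assms by (simp_all add: rep_ident_eq)

text \<open>Each factor of \<theta> is natural: the unitors of M and C, the inverse interchanger,
  and the unitor of the action.\<close>

lemma rep_ident_nat:
  assumes [simp]: "f \<in> Arr M" "g \<in> Arr C"
  shows "(f \<star>A g) \<cdot>C \<theta> (Dom M f, Dom C g) = \<theta> (Cod M f, Cod C g) \<cdot>C ((f \<star>A Idt C (Unt C)) \<boxtimes>C g)"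
proof -
  have "(f \<star>A g) \<cdot>C \<theta> (Dom M f, Dom C g)
    = ((f \<cdot>M Runit M (Dom M f)) \<star>A (g \<cdot>C Lunit C (Dom C g))) \<cdot>C (\<mu> (Dom M f) (Unt C) (Unt M) (Dom C g) \<cdot>C (Idt C (Dom M f \<bullet>A Unt C) \<boxtimes>C AUnit A (Dom C g)))"
    by (simp add: rep_ident_eq)
  also have "\<dots> = (Runit M (Cod M f) \<star>A Lunit C (Cod C g)) \<cdot>C
    (((f \<boxtimes>M Idt M (Unt M)) \<star>A (Idt C (Unt C) \<boxtimes>C g)) \<cdot>C \<mu> (Dom M f) (Unt C) (Unt M) (Dom C g)) \<cdot>C (Idt C (Dom M f \<bullet>A Unt C) \<boxtimes>C AUnit A (Dom C g))"
    by (simp add: acting.runit_nat[of f "Dom M f"] acted.lunit_nat[of g "Dom C g"])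
  also have "\<dots> = \<theta> (Cod M f, Cod C g) \<cdot>C ((f \<star>A Idt C (Unt C)) \<boxtimes>C g)"
    by (subst action_mult_nat) (simp_all add: aunit_nat rep_ident_eq)
  finally show ?thesis .
qed

text \<open>At the unit of M the two unitors of M coincide, and \<theta> becomes the left unit law
  of \<bullet> as a monoidal functor; naturality of the left unitor of C finishes.\<close>

lemma rep_ident_unit:
  assumes [simp]: "c \<in> Obj C"
  shows "\<theta> (Unt M, c) \<cdot>C (ANull A \<boxtimes>C Idt C c) = AUnit A c \<cdot>C Lunit C c"
proof -
  have "\<theta> (Unt M, c) \<cdot>C (ANull A \<boxtimes>C Idt C c)
    = ((Lunit M (Unt M) \<star>A Lunit C c) \<cdot>C (\<mu> (Unt M) (Unt C) (Unt M) c \<cdot>C (ANull A \<boxtimes>C Idt C (Unt M \<bullet>A c)))) \<cdot>C (Idt C (Unt C) \<boxtimes>C AUnit A c)"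
    by (simp add: rep_ident_eq acting.lunit_unit)
  also have "\<dots> = AUnit A c \<cdot>C Lunit C c"
    using acted.lunit_nat[of "AUnit A c" c] by (subst action_mult_lunit) simp_all
  finally show ?thesis .
qed

text \<open>Since \<open>AMult\<close> is a monoidal transformation and \<open>(m, n, c) = (m, j, i) \<otimes> (j, n, c)\<close> up to
  isomorphism, it is determined by \<open>AMult m j i\<close> and \<open>AMult j n c\<close>, which the unit laws compute.\<close>

lemma amult_rep_ident:
  assumes [simp]: "m \<in> Obj M" "n \<in> Obj M" "c \<in> Obj C"
  shows "AMult A m n c \<cdot>C \<theta> (m, n \<bullet>A c) = (Idt M (m \<otimes>M n) \<star>A Lunit C c) \<cdot>C \<mu> m (Unt C) n c"
proof -
  have 1: "(Idt M (m \<otimes>M Unt M) \<star>A (ANull A \<boxtimes>C Idt C (n \<bullet>A c))) \<cdot>C \<mu> m (Unt C) (Unt M) (n \<bullet>A c)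
    = \<mu> m (Unt M \<bullet>A Unt C) (Unt M) (n \<bullet>A c) \<cdot>C ((Idt M m \<star>A ANull A) \<boxtimes>C Idt C (Unt M \<bullet>A (n \<bullet>A c)))"
    using action_mult_nat[of "Idt M m" "Idt M (Unt M)" "ANull A" "Idt C (n \<bullet>A c)" m "Unt M" "Unt C" "n \<bullet>A c"] by simp
  have 2: "\<mu> (m \<otimes>M Unt M) (Unt C) (Unt M \<otimes>M n) c \<cdot>C ((inv_arr M (Runit M m) \<star>A Idt C (Unt C)) \<boxtimes>C (inv_arr M (Lunit M n) \<star>A Idt C c))
    = ((inv_arr M (Runit M m) \<boxtimes>M inv_arr M (Lunit M n)) \<star>A Idt C (Unt C \<otimes>C c)) \<cdot>C \<mu> m (Unt C) n c"
    using action_mult_nat[of "inv_arr M (Runit M m)" "inv_arr M (Lunit M n)" "Idt C (Unt C)" "Idt C c" m n "Unt C" c, symmetric] by simp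
  \<comment> \<open>The unitor of C at n \<bullet> c inside \<theta> is expanded by
    \<open>action_mult_lunit\<close>. This creates the nested pair of inverse interchangers to which
    \<open>amult_tens\<close> applies.\<close>
  have "\<theta> (m, n \<bullet>A c) = (Runit M m \<star>A ((Lunit M n \<star>A Lunit C c) \<cdot>C (\<mu> (Unt M) (Unt C) n c \<cdot>C (ANull A \<boxtimes>C Idt C (n \<bullet>A c))))) \<cdot>C
      (\<mu> m (Unt C) (Unt M) (n \<bullet>A c) \<cdot>C (Idt C (m \<bullet>A Unt C) \<boxtimes>C AUnit A (n \<bullet>A c)))"
    by (simp add: rep_ident_eq action_mult_lunit)
  also have "\<dots> = (Runit M m \<star>A (Lunit M n \<star>A Lunit C c)) \<cdot>C ((Idt M (m \<otimes>M Unt M) \<star>A \<mu> (Unt M) (Unt C) n c) \<cdot>C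
      (((Idt M (m \<otimes>M Unt M) \<star>A (ANull A \<boxtimes>C Idt C (n \<bullet>A c))) \<cdot>C \<mu> m (Unt C) (Unt M) (n \<bullet>A c)) \<cdot>C (Idt C (m \<bullet>A Unt C) \<boxtimes>C AUnit A (n \<bullet>A c))))"
    by simp
  also have "\<dots> = (Runit M m \<star>A (Lunit M n \<star>A Lunit C c)) \<cdot>C (((Idt M (m \<otimes>M Unt M) \<star>A \<mu> (Unt M) (Unt C) n c) \<cdot>C
      \<mu> m (Unt M \<bullet>A Unt C) (Unt M) (n \<bullet>A c)) \<cdot>C ((Idt M m \<star>A ANull A) \<boxtimes>C AUnit A (n \<bullet>A c)))"
    by (subst 1) simp_all
  finally have "AMult A m n c \<cdot>C \<theta> (m, n \<bullet>A c) = (AMult A m n c \<cdot>C (Runit M m \<star>A (Lunit M n \<star>A Lunit C c))) \<cdot>C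
      (((Idt M (m \<otimes>M Unt M) \<star>A \<mu> (Unt M) (Unt C) n c) \<cdot>C \<mu> m (Unt M \<bullet>A Unt C) (Unt M) (n \<bullet>A c)) \<cdot>C ((Idt M m \<star>A ANull A) \<boxtimes>C AUnit A (n \<bullet>A c)))"
    by simp
  also have "\<dots> = ((Runit M m \<boxtimes>M Lunit M n) \<star>A Lunit C c) \<cdot>C ((AMult A (m \<otimes>M Unt M) (Unt M \<otimes>M n) (Unt C \<otimes>C c) \<cdot>C
      ((Idt M (m \<otimes>M Unt M) \<star>A \<mu> (Unt M) (Unt C) n c) \<cdot>C \<mu> m (Unt M \<bullet>A Unt C) (Unt M) (n \<bullet>A c))) \<cdot>C ((Idt M m \<star>A ANull A) \<boxtimes>C AUnit A (n \<bullet>A c)))"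
    by (subst amult_nat) simp_all
  \<comment> \<open>\<open>amult_tens\<close> splits the multiplicator into its values at (m, j, i)
    and (j, n, c), with j and i the units. The interchange that appears exchanges two units and is
    the identity.\<close>
  also have "\<dots> = ((Runit M m \<boxtimes>M Lunit M n) \<star>A Lunit C c) \<cdot>C (\<mu> (m \<otimes>M Unt M) (Unt C) (Unt M \<otimes>M n) c \<cdot>C
      ((AMult A m (Unt M) (Unt C) \<cdot>C (Idt M m \<star>A ANull A)) \<boxtimes>C (AMult A (Unt M) n c \<cdot>C AUnit A (n \<bullet>A c))))"
    by (subst amult_tens) (simp_all add: acting.interchange_unit_middle)
  also have "\<dots> = (Idt M (m \<otimes>M n) \<star>A Lunit C c) \<cdot>C \<mu> m (Unt C) n c"
    by (simp add: anull_eq amult_aunit_left amult_aunit_right 2)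
  finally show ?thesis .
qed

text \<open>By \<open>amult_rep_ident\<close> the multiplicator disappears. What remains is
  associativity of the inverse interchanger for (m, i), (n, i), (j, c), together with the unit
  coherence of M and of C.\<close>

lemma rep_ident_mult:
  assumes [simp]: "m \<in> Obj M" "n \<in> Obj M" "c \<in> Obj C"
  shows "\<theta> (m \<otimes>M n, c) \<cdot>C (FMult F (m, n) \<boxtimes>C Idt C c)
    = AMult A m n c \<cdot>C (\<theta> (m, n \<bullet>A c) \<cdot>C ((Idt C (m \<bullet>A Unt C) \<boxtimes>C \<theta> (n, c)) \<cdot>C Assoc C (m \<bullet>A Unt C) (n \<bullet>A Unt C) c))"
proof -
  let ?a = "Assoc C (m \<bullet>A Unt C) (n \<bullet>A Unt C) (Unt M \<bullet>A c)"
  have "AMult A m n c \<cdot>C (\<theta> (m, n \<bullet>A c) \<cdot>C ((Idt C (m \<bullet>A Unt C) \<boxtimes>C \<theta> (n, c)) \<cdot>C Assoc C (m \<bullet>A Unt C) (n \<bullet>A Unt C) c))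
    = (AMult A m n c \<cdot>C \<theta> (m, n \<bullet>A c)) \<cdot>C ((Idt C (m \<bullet>A Unt C) \<boxtimes>C \<theta> (n, c)) \<cdot>C Assoc C (m \<bullet>A Unt C) (n \<bullet>A Unt C) c)"
    by simp
  also have "\<dots> = (Idt M (m \<otimes>M n) \<star>A Lunit C c) \<cdot>C ((\<mu> m (Unt C) n c \<cdot>C (Idt C (m \<bullet>A Unt C) \<boxtimes>C
      ((Runit M n \<star>A Lunit C c) \<cdot>C (\<mu> n (Unt C) (Unt M) c \<cdot>C (Idt C (n \<bullet>A Unt C) \<boxtimes>C AUnit A c))))) \<cdot>C Assoc C (m \<bullet>A Unt C) (n \<bullet>A Unt C) c)"
    by (subst amult_rep_ident) (simp_all add: rep_ident_eq)
  also have "\<dots> = ((Idt M m \<boxtimes>M Runit M n) \<star>A (Lunit C c \<cdot>C (Idt C (Unt C) \<boxtimes>C Lunit C c))) \<cdot>C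
      (\<mu> m (Unt C) (n \<otimes>M Unt M) (Unt C \<otimes>C c) \<cdot>C ((Idt C (m \<bullet>A Unt C) \<boxtimes>C \<mu> n (Unt C) (Unt M) c) \<cdot>C
        ((Idt C (m \<bullet>A Unt C) \<boxtimes>C (Idt C (n \<bullet>A Unt C) \<boxtimes>C AUnit A c)) \<cdot>C Assoc C (m \<bullet>A Unt C) (n \<bullet>A Unt C) c)))"
    by (subst action_mult_nat_comp_right) simp_all
  also have "(Idt C (m \<bullet>A Unt C) \<boxtimes>C (Idt C (n \<bullet>A Unt C) \<boxtimes>C AUnit A c)) \<cdot>C Assoc C (m \<bullet>A Unt C) (n \<bullet>A Unt C) c
    = ?a \<cdot>C (Idt C ((m \<bullet>A Unt C) \<otimes>C (n \<bullet>A Unt C)) \<boxtimes>C AUnit A c)"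
    by (simp add: acted.assoc_nat_idt)
  also have "((Idt M m \<boxtimes>M Runit M n) \<star>A (Lunit C c \<cdot>C (Idt C (Unt C) \<boxtimes>C Lunit C c))) \<cdot>C
      (\<mu> m (Unt C) (n \<otimes>M Unt M) (Unt C \<otimes>C c) \<cdot>C ((Idt C (m \<bullet>A Unt C) \<boxtimes>C \<mu> n (Unt C) (Unt M) c) \<cdot>C
        (?a \<cdot>C (Idt C ((m \<bullet>A Unt C) \<otimes>C (n \<bullet>A Unt C)) \<boxtimes>C AUnit A c))))
    = ((Idt M m \<boxtimes>M Runit M n) \<star>A (Lunit C c \<cdot>C (Idt C (Unt C) \<boxtimes>C Lunit C c))) \<cdot>C
      ((\<mu> m (Unt C) (n \<otimes>M Unt M) (Unt C \<otimes>C c) \<cdot>C ((Idt C (m \<bullet>A Unt C) \<boxtimes>C \<mu> n (Unt C) (Unt M) c) \<cdot>C ?a))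
        \<cdot>C (Idt C ((m \<bullet>A Unt C) \<otimes>C (n \<bullet>A Unt C)) \<boxtimes>C AUnit A c))"
    by simp
  also have "\<dots> = (((Idt M m \<boxtimes>M Runit M n) \<cdot>M Assoc M m n (Unt M)) \<star>A (Lunit C c \<cdot>C ((Idt C (Unt C) \<boxtimes>C Lunit C c) \<cdot>C Assoc C (Unt C) (Unt C) c))) \<cdot>C
      (\<mu> (m \<otimes>M n) (Unt C \<otimes>C Unt C) (Unt M) c \<cdot>C (\<mu> m (Unt C) n (Unt C) \<boxtimes>C AUnit A c))"
    by (subst action_mult_assoc[symmetric]) simp_all
  also have "\<dots> = (Runit M (m \<otimes>M n) \<star>A Lunit C c) \<cdot>C (((Idt M (m \<otimes>M n) \<boxtimes>M Idt M (Unt M)) \<star>A (Lunit C (Unt C) \<boxtimes>C Idt C c)) \<cdot>C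
      (\<mu> (m \<otimes>M n) (Unt C \<otimes>C Unt C) (Unt M) c \<cdot>C (\<mu> m (Unt C) n (Unt C) \<boxtimes>C Idt C (Unt M \<bullet>A c)))) \<cdot>C (Idt C ((m \<bullet>A Unt C) \<otimes>C (n \<bullet>A Unt C)) \<boxtimes>C AUnit A c)"
    by (simp add: acting.runit_tens acted.triangle acted.lunit_unit)
  also have "\<dots> = \<theta> (m \<otimes>M n, c) \<cdot>C (FMult F (m, n) \<boxtimes>C Idt C c)"
    using action_mult_nat_comp_left[of "Idt M (m \<otimes>M n)" "Unt M" "Lunit C (Unt C)" c "m \<otimes>M n" "Unt C" "\<mu> m (Unt C) n (Unt C)", symmetric]
      acted.comp_extend3[OF action_mult_nat_comp_left[of "Idt M (m \<otimes>M n)" "Unt M" "Lunit C (Unt C)" c "m \<otimes>M n" "Unt C" "\<mu> m (Unt C) n (Unt C)", symmetric],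
        of "Idt C ((m \<bullet>A Unt C) \<otimes>C (n \<bullet>A Unt C)) \<boxtimes>C AUnit A c"]
    by (simp add: rep_ident_eq)
  finally show ?thesis ..
qed

text \<open>The action functor respects the interchange of (m, i), (n, i), (j, c), (j, d). The
  interchanges in M and C then meet only units and reduce to unitors, and \<open>aunit_tens\<close>
  merges the two unitors of the action.\<close>

lemma rep_ident_inter:
  assumes [simp]: "m \<in> Obj M" "n \<in> Obj M" "c \<in> Obj C" "d \<in> Obj C"
  shows "\<theta> (m \<otimes>M n, c \<otimes>C d) \<cdot>C (FMult F (m, n) \<boxtimes>C Idt C (c \<otimes>C d))
    = \<mu> m c n d \<cdot>C ((\<theta> (m, c) \<boxtimes>C \<theta> (n, d)) \<cdot>C interchange C (m \<bullet>A Unt C) (n \<bullet>A Unt C) c d)"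
proof -
  let ?x = "interchange C (m \<bullet>A Unt C) (n \<bullet>A Unt C)"
  let ?i = "Unt C" and ?j = "Unt M"
  have "\<mu> m c n d \<cdot>C ((\<theta> (m, c) \<boxtimes>C \<theta> (n, d)) \<cdot>C ?x c d)
    = (\<mu> m c n d \<cdot>C (((Runit M m \<star>A Lunit C c) \<cdot>C (\<mu> m ?i ?j c \<cdot>C (Idt C (m \<bullet>A ?i) \<boxtimes>C AUnit A c))) \<boxtimes>C
        ((Runit M n \<star>A Lunit C d) \<cdot>C (\<mu> n ?i ?j d \<cdot>C (Idt C (n \<bullet>A ?i) \<boxtimes>C AUnit A d))))) \<cdot>C ?x c d"
    by (simp add: rep_ident_eq)
  also have "\<dots> = ((Runit M m \<boxtimes>M Runit M n) \<star>A (Lunit C c \<boxtimes>C Lunit C d)) \<cdot>C (\<mu> (m \<otimes>M ?j) (?i \<otimes>C c) (n \<otimes>M ?j) (?i \<otimes>C d) \<cdot>C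
      ((\<mu> m ?i ?j c \<boxtimes>C \<mu> n ?i ?j d) \<cdot>C (((Idt C (m \<bullet>A ?i) \<boxtimes>C AUnit A c) \<boxtimes>C (Idt C (n \<bullet>A ?i) \<boxtimes>C AUnit A d)) \<cdot>C ?x c d)))"
    by (subst action_mult_nat_comp) simp_all
  also have "((Idt C (m \<bullet>A ?i) \<boxtimes>C AUnit A c) \<boxtimes>C (Idt C (n \<bullet>A ?i) \<boxtimes>C AUnit A d)) \<cdot>C ?x c d
    = ?x (?j \<bullet>A c) (?j \<bullet>A d) \<cdot>C (Idt C ((m \<bullet>A ?i) \<otimes>C (n \<bullet>A ?i)) \<boxtimes>C (AUnit A c \<boxtimes>C AUnit A d))"
    using acted.interchange_nat[of "Idt C (m \<bullet>A ?i)" "Idt C (n \<bullet>A ?i)" "AUnit A c" "AUnit A d"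
      "m \<bullet>A ?i" "n \<bullet>A ?i" "?j \<bullet>A c" "?j \<bullet>A d"] by simp
  also have "((Runit M m \<boxtimes>M Runit M n) \<star>A (Lunit C c \<boxtimes>C Lunit C d)) \<cdot>C (\<mu> (m \<otimes>M ?j) (?i \<otimes>C c) (n \<otimes>M ?j) (?i \<otimes>C d) \<cdot>C
      ((\<mu> m ?i ?j c \<boxtimes>C \<mu> n ?i ?j d) \<cdot>C (?x (?j \<bullet>A c) (?j \<bullet>A d) \<cdot>C (Idt C ((m \<bullet>A ?i) \<otimes>C (n \<bullet>A ?i)) \<boxtimes>C (AUnit A c \<boxtimes>C AUnit A d)))))
    = ((Runit M m \<boxtimes>M Runit M n) \<star>A (Lunit C c \<boxtimes>C Lunit C d)) \<cdot>C ((\<mu> (m \<otimes>M ?j) (?i \<otimes>C c) (n \<otimes>M ?j) (?i \<otimes>C d) \<cdot>C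
      ((\<mu> m ?i ?j c \<boxtimes>C \<mu> n ?i ?j d) \<cdot>C ?x (?j \<bullet>A c) (?j \<bullet>A d))) \<cdot>C (Idt C ((m \<bullet>A ?i) \<otimes>C (n \<bullet>A ?i)) \<boxtimes>C (AUnit A c \<boxtimes>C AUnit A d)))"
    by simp
  also have "\<dots> = (((Runit M m \<boxtimes>M Runit M n) \<cdot>M interchange M m n ?j ?j) \<star>A ((Lunit C c \<boxtimes>C Lunit C d) \<cdot>C interchange C ?i ?i c d)) \<cdot>C
      (\<mu> (m \<otimes>M n) (?i \<otimes>C ?i) (?j \<otimes>M ?j) (c \<otimes>C d) \<cdot>C (\<mu> m ?i n ?i \<boxtimes>C (\<mu> ?j c ?j d \<cdot>C (AUnit A c \<boxtimes>C AUnit A d))))"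
    by (subst action_mult_interchange[symmetric]) simp_all
  also have "\<dots> = (Runit M (m \<otimes>M n) \<star>A Lunit C (c \<otimes>C d)) \<cdot>C (((Idt M (m \<otimes>M n) \<boxtimes>M Lunit M ?j) \<star>A (Lunit C ?i \<boxtimes>C Idt C (c \<otimes>C d))) \<cdot>C
      (\<mu> (m \<otimes>M n) (?i \<otimes>C ?i) (?j \<otimes>M ?j) (c \<otimes>C d) \<cdot>C (\<mu> m ?i n ?i \<boxtimes>C (\<mu> ?j c ?j d \<cdot>C (AUnit A c \<boxtimes>C AUnit A d)))))"
    by (simp add: acting.interchange_runit acted.interchange_lunit)
  also have "\<dots> = (Runit M (m \<otimes>M n) \<star>A Lunit C (c \<otimes>C d)) \<cdot>C (\<mu> (m \<otimes>M n) ?i ?j (c \<otimes>C d) \<cdot>C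
      (((Idt M (m \<otimes>M n) \<star>A Lunit C ?i) \<cdot>C \<mu> m ?i n ?i) \<boxtimes>C ((Lunit M ?j \<star>A Idt C (c \<otimes>C d)) \<cdot>C (\<mu> ?j c ?j d \<cdot>C (AUnit A c \<boxtimes>C AUnit A d)))))"
    by (subst action_mult_nat_comp) simp_all
  also have "\<dots> = \<theta> (m \<otimes>M n, c \<otimes>C d) \<cdot>C (FMult F (m, n) \<boxtimes>C Idt C (c \<otimes>C d))"
    by (subst aunit_tens[symmetric]) (simp_all add: rep_ident_eq)
  finally show ?thesis ..
qed

end

lemma action_mult_self:
  assumes "symmetric_monoidal_category C" "m \<in> Obj C" "n \<in> Obj C" "c \<in> Obj C" "d \<in> Obj C"
  shows "action_mult C (self_action C) m c n d = interchange C m c n d"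
  using assms by (simp add: action_mult_def symmetric_monoidal_category.inv_interchange)

lemma rep_identification:
  assumes "symmetric_action M C A"
  shows "action_identification M C (restriction C C (rep_functor M C A) (self_action C)) A (rep_ident M C A)"
proof -
  interpret symmetric_action M C A by fact
  interpret F: sym_mon_functor M C F by (rule sym_mon_functor_rep)
  have S: "symmetric_action C C (self_action C)"
    by (rule symmetric_action_self) (rule acted.symmetric_monoidal_category_axioms)
  show ?thesis
  proof (rule action_identificationI)
    show "symmetric_action M C (restriction C C F (self_action C))"
      by (rule symmetric_action_restriction[OF sym_mon_functor_rep S])
  next
    fix c assume [simp]: "c \<in> Obj C"
    have "\<theta> (Unt M, c) \<cdot>C AUnit (restriction C C F (self_action C)) c
      = (\<theta> (Unt M, c) \<cdot>C (ANull A \<boxtimes>C Idt C c)) \<cdot>C inv_arr C (Lunit C c)"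
      by (simp add: restriction_simps)
    also have "\<dots> = AUnit A c"
      by (subst rep_ident_unit) simp_all
    finally show "\<theta> (Unt M, c) \<cdot>C AUnit (restriction C C F (self_action C)) c = AUnit A c" .
  next
    fix m n c assume [simp]: "m \<in> Obj M" "n \<in> Obj M" "c \<in> Obj C"
    have "\<theta> (m \<otimes>M n, c) \<cdot>C AMult (restriction C C F (self_action C)) m n c
      = (\<theta> (m \<otimes>M n, c) \<cdot>C (FMult F (m, n) \<boxtimes>C Idt C c)) \<cdot>C inv_arr C (Assoc C (m \<bullet>A Unt C) (n \<bullet>A Unt C) c)"
      by (simp add: restriction_simps)
    also have "\<dots> = AMult A m n c \<cdot>C (\<theta> (m, n \<bullet>A c) \<cdot>C (Idt M m \<star>(restriction C C F (self_action C)) \<theta> (n, c)))"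
      by (subst rep_ident_mult) (simp_all add: restriction_simps)
    finally show "\<theta> (m \<otimes>M n, c) \<cdot>C AMult (restriction C C F (self_action C)) m n c
      = AMult A m n c \<cdot>C (\<theta> (m, n \<bullet>A c) \<cdot>C (Idt M m \<star>(restriction C C F (self_action C)) \<theta> (n, c)))" .
  next
    fix m n c d assume [simp]: "m \<in> Obj M" "n \<in> Obj M" "c \<in> Obj C" "d \<in> Obj C"
    have "\<theta> (m \<otimes>M n, c \<otimes>C d) \<cdot>C action_mult C (restriction C C F (self_action C)) m c n d
      = (\<theta> (m \<otimes>M n, c \<otimes>C d) \<cdot>C (FMult F (m, n) \<boxtimes>C Idt C (c \<otimes>C d))) \<cdot>C interchange C (m \<bullet>A Unt C) c (n \<bullet>A Unt C) d"
      by (simp add: action_mult_restriction[OF sym_mon_functor_rep S] action_mult_self acted.symmetric_monoidal_category_axioms)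
    also have "\<dots> = \<mu> m c n d \<cdot>C (\<theta> (m, c) \<boxtimes>C \<theta> (n, d))"
      by (subst rep_ident_inter) simp_all
    finally show "\<theta> (m \<otimes>M n, c \<otimes>C d) \<cdot>C action_mult C (restriction C C F (self_action C)) m c n d
      = \<mu> m c n d \<cdot>C (\<theta> (m, c) \<boxtimes>C \<theta> (n, d))" .
  qed (simp_all add: assms restriction_simps rep_ident_nat)
qed

section \<open>Naturality of \<theta> in the action\<close>

context symmetric_action_identification
begin

lemma rep_ident_natural:
  assumes [simp]: "m \<in> Obj M" "c \<in> Obj C"
  shows "t (m, c) \<cdot>C rep_ident M C A (m, c) = rep_ident M C B (m, c) \<cdot>C (t (m, Unt C) \<boxtimes>C Idt C c)"
proof -
  \<comment> \<open>The unitor of B is t at the unit of M after the unitor of A. This supplies the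
    second of the two components of t whose tensor product \<open>ident_inter\<close> moves past the
    inverse interchanger.\<close>
  have "rep_ident M C B (m, c) \<cdot>C (t (m, Unt C) \<boxtimes>C Idt C c)
    = (Runit M m \<star>B Lunit C c) \<cdot>C ((action_mult C B m (Unt C) (Unt M) c \<cdot>C (t (m, Unt C) \<boxtimes>C t (Unt M, c))) \<cdot>C (Idt C (m \<bullet>A Unt C) \<boxtimes>C AUnit A c))"
    by (simp add: tgt.rep_ident_eq flip: aunit_comp)
  also have "\<dots> = ((Runit M m \<star>B Lunit C c) \<cdot>C t (m \<otimes>M Unt M, Unt C \<otimes>C c)) \<cdot>C (action_mult C A m (Unt C) (Unt M) c \<cdot>C (Idt C (m \<bullet>A Unt C) \<boxtimes>C AUnit A c))"
    by (subst ident_inter[symmetric]) simp_all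
  also have "\<dots> = t (m, c) \<cdot>C rep_ident M C A (m, c)"
    by (subst ident_nat) (simp_all add: src.rep_ident_eq)
  finally show ?thesis ..
qed

text \<open>Multiplicativity is compatibility with interchangers at the unit of C, plus naturality
  of t at the unitor with which \<open>unit_inj\<close> multiplies two units.\<close>

lemma mon_trans_rep: "mon_trans M C (rep_functor M C A) (rep_functor M C B) (\<lambda>m\<in>Obj M. t (m, Unt C))"
proof -
  interpret F: sym_mon_functor M C "rep_functor M C A" by (rule src.sym_mon_functor_rep)
  interpret G: sym_mon_functor M C "rep_functor M C B" by (rule tgt.sym_mon_functor_rep)
  show ?thesis
  proof (intro mon_transI)
    fix f assume "f \<in> Arr M"
    then show "FArr (rep_functor M C B) f \<cdot>C (\<lambda>m\<in>Obj M. t (m, Unt C)) (Dom M f)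
      = (\<lambda>m\<in>Obj M. t (m, Unt C)) (Cod M f) \<cdot>C FArr (rep_functor M C A) f"
      by (simp add: ident_nat)
  next
    fix m n assume [simp]: "m \<in> Obj M" "n \<in> Obj M"
    show "(\<lambda>m\<in>Obj M. t (m, Unt C)) (m \<otimes>M n) \<cdot>C FMult (rep_functor M C A) (m, n)
      = FMult (rep_functor M C B) (m, n) \<cdot>C ((\<lambda>m\<in>Obj M. t (m, Unt C)) m \<boxtimes>C (\<lambda>m\<in>Obj M. t (m, Unt C)) n)"
      using ident_nat[of "Idt M (m \<otimes>M n)" "Lunit C (Unt C)" "m \<otimes>M n" "Unt C \<otimes>C Unt C", symmetric]
        src.acted.comp_extend[OF ident_nat[of "Idt M (m \<otimes>M n)" "Lunit C (Unt C)" "m \<otimes>M n" "Unt C \<otimes>C Unt C", symmetric],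
          of "action_mult C A m (Unt C) n (Unt C)"]
      by (simp add: ident_inter)
  qed (simp_all add: F.cat_functor_axioms G.cat_functor_axioms src.anull_eq tgt.anull_eq aunit_comp)
qed

end

text \<open>An equality of functors, not merely an isomorphism: on the carriers both records compute
  to the same terms. It provides the source of the 2-cells in \<open>rep_cell\<close>.\<close>

lemma rep_functor_restriction:
  assumes "sym_mon_functor M N R" "symmetric_action N C B"
  shows "rep_functor M C (restriction N C R B) = comp_monfctr M C (rep_functor N C B) R"
proof -
  interpret R: sym_mon_functor M N R by fact
  interpret B: symmetric_action N C B by fact
  interpret S: symmetric_action M C "restriction N C R B" by (rule symmetric_action_restriction) fact+
  show ?thesis
    by (rule monfctr_eqI[where M = M]) (simp_all add: restriction_simps action_mult_restriction[OF assms])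
qed

text \<open>The structure maps of R that enter through the restricted unitor and interchanger
  combine to the right unit law of R and disappear.\<close>

lemma rep_ident_restriction:
  assumes "sym_mon_functor M N R" "symmetric_action N C B" "m \<in> Obj M" "c \<in> Obj C"
  shows "rep_ident M C (restriction N C R B) (m, c) = rep_ident N C B (FObj R m, c)"
proof -
  interpret R: sym_mon_functor M N R by fact
  interpret B: symmetric_action N C B by fact
  interpret S: symmetric_action M C "restriction N C R B" by (rule symmetric_action_restriction) fact+
  note [simp] = assms(3,4)
  have "rep_ident M C (restriction N C R B) (m, c)
    = ((FArr R (Runit M m) \<cdot>N (FMult R (m, Unt M) \<cdot>N (Idt N (FObj R m) \<boxtimes>N FUnit R))) \<star>B Lunit C c) \<cdot>C
      (action_mult C B (FObj R m) (Unt C) (Unt N) c \<cdot>C (Idt C (FObj R m \<bullet>B Unt C) \<boxtimes>C AUnit B c))"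
    by (simp add: S.rep_ident_eq restriction_simps action_mult_restriction[OF assms(1,2)] B.action_mult_nat_comp_right)
  also have "\<dots> = rep_ident N C B (FObj R m, c)"
    by (simp add: R.fmult_runit' B.rep_ident_eq)
  finally show ?thesis .
qed

text \<open>The interchange in \<theta> has two inner units and is the identity, and the unitor of
  the action cancels the left unitor; only the right unitor survives.\<close>

lemma rep_ident_self:
  assumes "symmetric_monoidal_category C" "x \<in> Obj C" "c \<in> Obj C"
  shows "rep_ident C C (self_action C) (x, c) = Runit C x \<boxtimes>C Idt C c"
proof -
  interpret symmetric_monoidal_category C by fact
  show ?thesis
    using assms(2,3) by (simp add: rep_ident_def action_mult_self assms(1) interchange_unit_middle)
qed

text \<open>For the self-action the represented functor is tensoring with the unit. Multiplicativity
  of the right unitor is \<open>interchange_runit\<close>, its unit condition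
  \<open>lunit_unit\<close>.\<close>

lemma mon_trans_runit:
  assumes "symmetric_monoidal_category C"
  shows "mon_trans C C (rep_functor C C (self_action C)) (id_monfctr C) (\<lambda>x\<in>Obj C. Runit C x)"
proof -
  interpret K: symmetric_monoidal_category C by fact
  interpret symmetric_action C C "self_action C" by (rule symmetric_action_self) fact
  interpret F: sym_mon_functor C C F by (rule sym_mon_functor_rep)
  interpret I: sym_mon_functor C C "id_monfctr C" by (rule sym_mon_functor_id) fact
  show ?thesis
  proof (intro mon_transI)
    fix f assume "f \<in> Arr C"
    then show "FArr (id_monfctr C) f \<cdot>C (\<lambda>x\<in>Obj C. Runit C x) (Dom C f) = (\<lambda>x\<in>Obj C. Runit C x) (Cod C f) \<cdot>C FArr F f"
      using K.runit_nat[of f "Dom C f"] by simp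
  next
    fix x y assume [simp]: "x \<in> Obj C" "y \<in> Obj C"
    have "Runit C (x \<otimes>C y) \<cdot>C ((Idt C (x \<otimes>C y) \<boxtimes>C Lunit C (Unt C)) \<cdot>C interchange C x (Unt C) y (Unt C))
      = (Runit C (x \<otimes>C y) \<cdot>C (Idt C (x \<otimes>C y) \<boxtimes>C Lunit C (Unt C))) \<cdot>C interchange C x (Unt C) y (Unt C)"
      by simp
    also have "\<dots> = Runit C x \<boxtimes>C Runit C y"
      by (subst K.interchange_runit[symmetric]) simp_all
    finally show "(\<lambda>x\<in>Obj C. Runit C x) (x \<otimes>C y) \<cdot>C FMult F (x, y)
      = FMult (id_monfctr C) (x, y) \<cdot>C ((\<lambda>x\<in>Obj C. Runit C x) x \<boxtimes>C (\<lambda>x\<in>Obj C. Runit C x) y)"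
      by (simp add: action_mult_self assms)
  qed (simp_all add: F.cat_functor_axioms I.cat_functor_axioms K.lunit_unit)
qed

text \<open>\<open>mon_trans_runit\<close> whiskered with R; by
  \<open>rep_functor_restriction\<close> and the strict unit law the ends of the whiskered
  transformation are the ones required.\<close>

lemma mon_trans_rep_restriction_self:
  assumes "sym_mon_functor M C R" "monfctr_ext M R"
  shows "mon_trans M C (rep_functor M C (restriction C C R (self_action C))) R (\<lambda>m\<in>Obj M. Runit C (FObj R m))"
proof -
  interpret R: sym_mon_functor M C R by fact
  have C: "symmetric_monoidal_category C" by (rule R.cod_smc.symmetric_monoidal_category_axioms)
  interpret S: symmetric_action C C "self_action C" by (rule symmetric_action_self) fact
  have "hcomp_trans M C (rep_functor C C (self_action C)) (\<lambda>x\<in>Obj C. Runit C x) R (\<lambda>m\<in>Obj M. Idt C (FObj R m))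
    = (\<lambda>m\<in>Obj M. Runit C (FObj R m))"
    by (rule extensionalityI[where A = "Obj M"]) (simp_all add: hcomp_trans_def)
  with mon_trans_hcomp[OF assms(1,1) S.sym_mon_functor_rep sym_mon_functor_id[OF C] mon_trans_id[OF assms(1)] mon_trans_runit[OF C]]
  show ?thesis
    by (simp add: rep_functor_restriction[OF assms(1) S.symmetric_action_axioms] comp_monfctr_id_left assms)
qed

section \<open>The 2-category of symmetric actions\<close>

lemma symmetric_action_identification_restriction:
  assumes "symmetric_action M C A" "symmetric_action N C B" "sym_mon_functor M N R"
    "action_identification M C (restriction N C R B) A t"
  shows "symmetric_action_identification M C (restriction N C R B) A t"
  using assms by (intro symmetric_action_identification.intro symmetric_action_restriction)

lemma action_identification_id:
  assumes "symmetric_action M C A"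
  shows "action_identification M C (restriction M C (id_monfctr M) A) A (\<lambda>p\<in>Obj M \<times> Obj C. Idt C (fst p \<bullet>A snd p))"
proof -
  interpret A: symmetric_action M C A by fact
  have I: "sym_mon_functor M M (id_monfctr M)"
    by (rule sym_mon_functor_id) (rule A.acting.symmetric_monoidal_category_axioms)
  show ?thesis
    by (intro action_identificationI symmetric_action_restriction I)
      (simp_all add: assms restriction_simps action_mult_restriction[OF I assms])
qed

text \<open>The identification u is taken at images of R and followed by t. Each compatibility moves
  a structure map of R across u by naturality, and then uses the corresponding law of u and that of
  t.\<close>

lemma action_identification_comp:
  assumes A: "symmetric_action M C A" and B: "symmetric_action N C B" and D: "symmetric_action P C D"
    and R: "sym_mon_functor M N R" and S: "sym_mon_functor N P S"
    and t: "action_identification M C (restriction N C R B) A t"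
    and u: "action_identification N C (restriction P C S D) B u"
  shows "action_identification M C (restriction P C (comp_monfctr M P S R) D) A
    (\<lambda>p\<in>Obj M \<times> Obj C. t p \<cdot>C u (FObj R (fst p), snd p))"
proof -
  interpret A: symmetric_action M C A by fact
  interpret B: symmetric_action N C B by fact
  interpret D: symmetric_action P C D by fact
  interpret R: sym_mon_functor M N R by fact
  interpret S: sym_mon_functor N P S by fact
  interpret t: symmetric_action_identification M C "restriction N C R B" A t
    by (rule symmetric_action_identification_restriction) fact+
  interpret u: symmetric_action_identification N C "restriction P C S D" B u
    by (rule symmetric_action_identification_restriction) fact+
  have SR: "sym_mon_functor M P (comp_monfctr M P S R)"
    by (rule sym_mon_functor_comp) fact+
  note [simp] = restriction_simps
  \<comment> \<open>The action of \<open>FArr S f\<close> is the restricted action of f; the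
    naturality of u is stated in this unfolded form, in which the composite functor produces
    it.\<close>
  have u_nat: "u (n, c) \<cdot>C (FArr S f \<star>D g) = (f \<star>B g) \<cdot>C u (Dom N f, Dom C g)"
    if "f \<in> Arr N" "g \<in> Arr C" "Cod N f = n" "Cod C g = c" for f g n c
    using u.ident_nat[of f g] that by auto
  have u_nat1: "u (n, c) \<cdot>C (FArr S f \<star>D Idt C c) = (f \<star>B Idt C c) \<cdot>C u (Dom N f, c)"
    if "f \<in> Arr N" "c \<in> Obj C" "Cod N f = n" for f n c
    using u_nat[of f "Idt C c" n c] that by auto
  show ?thesis
  proof (rule action_identificationI)
    show "symmetric_action M C (restriction P C (comp_monfctr M P S R) D)"
      by (rule symmetric_action_restriction) fact+
    show "symmetric_action M C A" by fact
  next
    fix f g assume [simp]: "f \<in> Arr M" "g \<in> Arr C"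
    show "f \<star>A g \<cdot>C (\<lambda>p\<in>Obj M \<times> Obj C. t p \<cdot>C u (FObj R (fst p), snd p)) (Dom M f, Dom C g)
      = (\<lambda>p\<in>Obj M \<times> Obj C. t p \<cdot>C u (FObj R (fst p), snd p)) (Cod M f, Cod C g) \<cdot>C
        (f \<star>(restriction P C (comp_monfctr M P S R) D) g)"
      using A.acted.comp_extend[OF t.ident_nat[of f g "Dom M f" "Dom C g"], of "u (FObj R (Dom M f), Dom C g)"]
      by (simp add: u_nat)
  next
    fix c assume [simp]: "c \<in> Obj C"
    have "t (Unt M, c) \<cdot>C (u (FObj R (Unt M), c) \<cdot>C ((FArr S (FUnit R) \<cdot>P FUnit S) \<star>D Idt C c \<cdot>C AUnit D c))
      = t (Unt M, c) \<cdot>C ((u (FObj R (Unt M), c) \<cdot>C (FArr S (FUnit R) \<star>D Idt C c)) \<cdot>C AUnit (restriction P C S D) c)"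
      by simp
    also have "\<dots> = t (Unt M, c) \<cdot>C ((FUnit R \<star>B Idt C c) \<cdot>C (u (Unt N, c) \<cdot>C AUnit (restriction P C S D) c))"
      by (subst u_nat1) simp_all
    also have "\<dots> = t (Unt M, c) \<cdot>C AUnit (restriction N C R B) c"
      by (subst u.aunit_comp) simp_all
    also have "\<dots> = AUnit A c"
      by (rule t.aunit_comp) simp
    finally show "(\<lambda>p\<in>Obj M \<times> Obj C. t p \<cdot>C u (FObj R (fst p), snd p)) (Unt M, c) \<cdot>C
        AUnit (restriction P C (comp_monfctr M P S R) D) c = AUnit A c"
      by simp
  next
    fix m n c assume [simp]: "m \<in> Obj M" "n \<in> Obj M" "c \<in> Obj C"
    have "t (m \<otimes>M n, c) \<cdot>C (u (FObj R (m \<otimes>M n), c) \<cdot>C ((FArr S (FMult R (m, n)) \<cdot>P FMult S (FObj R m, FObj R n)) \<star>D Idt C c \<cdot>C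
        AMult D (FObj S (FObj R m)) (FObj S (FObj R n)) c))
      = t (m \<otimes>M n, c) \<cdot>C ((u (FObj R (m \<otimes>M n), c) \<cdot>C (FArr S (FMult R (m, n)) \<star>D Idt C c)) \<cdot>C AMult (restriction P C S D) (FObj R m) (FObj R n) c)"
      by simp
    also have "\<dots> = t (m \<otimes>M n, c) \<cdot>C ((FMult R (m, n) \<star>B Idt C c) \<cdot>C (u (FObj R m \<otimes>N FObj R n, c) \<cdot>C AMult (restriction P C S D) (FObj R m) (FObj R n) c))"
      by (subst u_nat1) simp_all
    also have "\<dots> = (t (m \<otimes>M n, c) \<cdot>C AMult (restriction N C R B) m n c) \<cdot>C (u (FObj R m, FObj R n \<bullet>B c) \<cdot>C (Idt P (FObj S (FObj R m)) \<star>D u (FObj R n, c)))"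
      by (subst u.ident_mult) simp_all
    also have "\<dots> = AMult A m n c \<cdot>C (t (m, n \<bullet>A c) \<cdot>C (((Idt N (FObj R m) \<star>B t (n, c)) \<cdot>C u (FObj R m, FObj R n \<bullet>B c)) \<cdot>C (Idt P (FObj S (FObj R m)) \<star>D u (FObj R n, c))))"
      by (subst t.ident_mult) simp_all
    also have "\<dots> = AMult A m n c \<cdot>C (t (m, n \<bullet>A c) \<cdot>C (u (FObj R m, n \<bullet>A c) \<cdot>C (Idt P (FObj S (FObj R m)) \<star>D (t (n, c) \<cdot>C u (FObj R n, c)))))"
      by (subst u.ident_nat) simp_all
    finally show "(\<lambda>p\<in>Obj M \<times> Obj C. t p \<cdot>C u (FObj R (fst p), snd p)) (m \<otimes>M n, c) \<cdot>C
        AMult (restriction P C (comp_monfctr M P S R) D) m n c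
      = AMult A m n c \<cdot>C ((\<lambda>p\<in>Obj M \<times> Obj C. t p \<cdot>C u (FObj R (fst p), snd p)) (m, n \<bullet>A c) \<cdot>C
        (Idt M m \<star>(restriction P C (comp_monfctr M P S R) D) (\<lambda>p\<in>Obj M \<times> Obj C. t p \<cdot>C u (FObj R (fst p), snd p)) (n, c)))"
      by simp
  next
    fix m n c d assume [simp]: "m \<in> Obj M" "n \<in> Obj M" "c \<in> Obj C" "d \<in> Obj C"
    have "t (m \<otimes>M n, c \<otimes>C d) \<cdot>C (u (FObj R (m \<otimes>M n), c \<otimes>C d) \<cdot>C ((FArr S (FMult R (m, n)) \<cdot>P FMult S (FObj R m, FObj R n)) \<star>D Idt C (c \<otimes>C d) \<cdot>C
        action_mult C D (FObj S (FObj R m)) c (FObj S (FObj R n)) d))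
      = t (m \<otimes>M n, c \<otimes>C d) \<cdot>C ((u (FObj R (m \<otimes>M n), c \<otimes>C d) \<cdot>C (FArr S (FMult R (m, n)) \<star>D Idt C (c \<otimes>C d))) \<cdot>C
        action_mult C (restriction P C S D) (FObj R m) c (FObj R n) d)"
      by (simp add: action_mult_restriction[OF S D])
    also have "\<dots> = t (m \<otimes>M n, c \<otimes>C d) \<cdot>C ((FMult R (m, n) \<star>B Idt C (c \<otimes>C d)) \<cdot>C (u (FObj R m \<otimes>N FObj R n, c \<otimes>C d) \<cdot>C
        action_mult C (restriction P C S D) (FObj R m) c (FObj R n) d))"
      by (subst u_nat1) (simp_all add: action_mult_restriction[OF S D])
    also have "\<dots> = (t (m \<otimes>M n, c \<otimes>C d) \<cdot>C action_mult C (restriction N C R B) m c n d) \<cdot>C (u (FObj R m, c) \<boxtimes>C u (FObj R n, d))"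
      by (subst u.ident_inter) (simp_all add: action_mult_restriction[OF R B])
    also have "\<dots> = action_mult C A m c n d \<cdot>C ((t (m, c) \<cdot>C u (FObj R m, c)) \<boxtimes>C (t (n, d) \<cdot>C u (FObj R n, d)))"
      by (subst t.ident_inter) simp_all
    finally show "(\<lambda>p\<in>Obj M \<times> Obj C. t p \<cdot>C u (FObj R (fst p), snd p)) (m \<otimes>M n, c \<otimes>C d) \<cdot>C
        action_mult C (restriction P C (comp_monfctr M P S R) D) m c n d
      = action_mult C A m c n d \<cdot>C ((\<lambda>p\<in>Obj M \<times> Obj C. t p \<cdot>C u (FObj R (fst p), snd p)) (m, c) \<boxtimes>C
        (\<lambda>p\<in>Obj M \<times> Obj C. t p \<cdot>C u (FObj R (fst p), snd p)) (n, d))"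
      by (simp add: action_mult_restriction[OF SR D])
  qed simp_all
qed

lemma act_hom_simps:
  "(R, t) \<in> Obj (act_hom C (M, A) (N, B)) \<longleftrightarrow> sym_mon_functor M N R \<and> monfctr_ext M R
     \<and> action_identification M C (restriction N C R B) A t \<and> t \<in> extensional (Obj M \<times> Obj C)"
  "((R, t), (R', t'), \<phi>) \<in> Arr (act_hom C (M, A) (N, B)) \<longleftrightarrow>
     (R, t) \<in> Obj (act_hom C (M, A) (N, B)) \<and> (R', t') \<in> Obj (act_hom C (M, A) (N, B))
     \<and> mon_trans M N R R' \<phi> \<and> \<phi> \<in> extensional (Obj M)
     \<and> (\<forall>m \<in> Obj M. \<forall>c \<in> Obj C. t' (m, c) \<cdot>C (\<phi> m \<star>B Idt C c) = t (m, c))"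
  "Dom (act_hom C (M, A) (N, B)) (k, k', \<phi>) = k"
  "Cod (act_hom C (M, A) (N, B)) (k, k', \<phi>) = k'"
  "Idt (act_hom C (M, A) (N, B)) k = (k, k, \<lambda>m\<in>Obj M. Idt N (FObj (fst k) m))"
  "(k', k'', \<psi>) \<cdot>(act_hom C (M, A) (N, B)) (l, l', \<phi>) = (l, k'', \<lambda>m\<in>Obj M. \<psi> m \<cdot>N \<phi> m)"
  by (auto simp: act_hom_def Let_def)

lemma act_2cat_simps:
  "(M, A) \<in> Obj2 (act_2cat C) \<longleftrightarrow> symmetric_action M C A"
  "HomCat (act_2cat C) = act_hom C"
  "Id1 (act_2cat C) (M, A) = (id_monfctr M, \<lambda>p\<in>Obj M \<times> Obj C. Idt C (fst p \<bullet>A snd p))"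
  "comp1 (act_2cat C) (M, A) (N, B) (P, D) (S, u) (R, t)
    = (comp_monfctr M P S R, \<lambda>p\<in>Obj M \<times> Obj C. t p \<cdot>C u (FObj R (fst p), snd p))"
  "hcomp (act_2cat C) (M, A) (N, B) (P, D) (k, k', \<psi>) (l, l', \<phi>)
    = (comp1 (act_2cat C) (M, A) (N, B) (P, D) k l, comp1 (act_2cat C) (M, A) (N, B) (P, D) k' l',
       hcomp_trans M P (fst k) \<psi> (fst l') \<phi>)"
  by (simp_all add: act_2cat_def act_comp1_def)

lemma category_act_hom:
  assumes A: "symmetric_action M C A" and B: "symmetric_action N C B"
  shows "category (act_hom C (M, A) (N, B))" (is "category ?H")
proof -
  interpret A: symmetric_action M C A by fact
  interpret B: symmetric_action N C B by fact
  have cellD: "sym_mon_functor M N R" "symmetric_action_identification M C (restriction N C R B) A t"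
    if "(R, t) \<in> Obj ?H" for R t
    using that symmetric_action_identification_restriction[OF A B] by (simp_all add: act_hom_simps)
  show ?thesis
  proof (rule categoryI)
    fix f assume "f \<in> Arr ?H"
    then show "Dom ?H f \<in> Obj ?H \<and> Cod ?H f \<in> Obj ?H"
      by (cases f) (auto simp: act_hom_simps)
  next
    fix k assume k: "k \<in> Obj ?H"
    obtain R t where e: "k = (R, t)" by (cases k)
    interpret R: sym_mon_functor M N R using cellD(1) k by (simp add: e)
    interpret t: symmetric_action_identification M C "restriction N C R B" A t using cellD(2) k by (simp add: e)
    have "mon_trans M N R R (\<lambda>m\<in>Obj M. Idt N (FObj R m))"
      by (rule mon_trans_id) unfold_locales
    then show "Idt ?H k \<in> Arr ?H \<and> Dom ?H (Idt ?H k) = k \<and> Cod ?H (Idt ?H k) = k"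
      using k by (simp add: e act_hom_simps restriction_simps)
  next
    fix f g assume fg: "f \<in> Arr ?H" "g \<in> Arr ?H" "Cod ?H f = Dom ?H g"
    obtain R t R' t' \<phi> R'' t'' \<psi> where e: "f = ((R, t), (R', t'), \<phi>)" "g = ((R', t'), (R'', t''), \<psi>)"
      using fg(3) by (cases f; cases g) (auto simp: act_hom_simps)
    interpret R: sym_mon_functor M N R using cellD(1) fg by (simp add: e act_hom_simps)
    interpret R': sym_mon_functor M N R' using cellD(1) fg by (simp add: e act_hom_simps)
    interpret R'': sym_mon_functor M N R'' using cellD(1) fg by (simp add: e act_hom_simps)
    interpret t'': symmetric_action_identification M C "restriction N C R'' B" A t'' using cellD(2) fg by (simp add: e act_hom_simps)
    interpret p: mon_trans M N R R' \<phi> using fg by (simp add: e act_hom_simps)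
    interpret q: mon_trans M N R' R'' \<psi> using fg by (simp add: e act_hom_simps)
    have "t'' (m, c) \<cdot>C ((\<psi> m \<cdot>N \<phi> m) \<star>B Idt C c) = t (m, c)" if [simp]: "m \<in> Obj M" "c \<in> Obj C" for m c
    proof -
      have "t'' (m, c) \<cdot>C ((\<psi> m \<cdot>N \<phi> m) \<star>B Idt C c) = (t'' (m, c) \<cdot>C (\<psi> m \<star>B Idt C c)) \<cdot>C (\<phi> m \<star>B Idt C c)"
        by (simp add: restriction_simps)
      also have "\<dots> = t (m, c)" using fg by (simp add: e act_hom_simps)
      finally show ?thesis .
    qed
    moreover have "mon_trans M N R R'' (\<lambda>m\<in>Obj M. \<psi> m \<cdot>N \<phi> m)"
      by (rule mon_trans_vcomp) unfold_locales
    ultimately show "g \<cdot>?H f \<in> Arr ?H \<and> Dom ?H (g \<cdot>?H f) = Dom ?H f \<and> Cod ?H (g \<cdot>?H f) = Cod ?H g"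
      using fg by (simp add: e act_hom_simps)
  next
    fix f g h assume "f \<in> Arr ?H" "g \<in> Arr ?H" "h \<in> Arr ?H" "Cod ?H f = Dom ?H g" "Cod ?H g = Dom ?H h"
    then show "(h \<cdot>?H g) \<cdot>?H f = h \<cdot>?H (g \<cdot>?H f)"
      by (cases f; cases g; cases h) (auto simp: act_hom_simps simp del: restrict_apply intro: vcomp_trans_assoc)
  next
    fix f assume "f \<in> Arr ?H"
    then show "f \<cdot>?H Idt ?H (Dom ?H f) = f \<and> Idt ?H (Cod ?H f) \<cdot>?H f = f"
      by (cases f) (auto simp: act_hom_simps simp del: restrict_apply intro: vcomp_trans_id)
  qed
qed

text \<open>The types of the acting categories are independent of those of C. The instance where
  they agree is the one that has the self-action among its objects.\<close>

lemma two_category_act: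
  fixes C :: "('o, 'a) smc"
  shows "two_category (act_2cat C :: (('m, 'f) smc \<times> ('m, 'f, 'o, 'a) monaction, _, _) twocat)"
    (is "two_category ?T")
proof -
  have cell: "comp1 ?T (M, A) (N, B) (P, D) (S, u) (R, t) \<in> Obj (act_hom C (M, A) (P, D))"
    if "symmetric_action M C A" "symmetric_action N C B" "symmetric_action P C D"
      and "(S, u) \<in> Obj (act_hom C (N, B) (P, D))" "(R, t) \<in> Obj (act_hom C (M, A) (N, B))"
    for M A N B P D R t S u
    using that action_identification_comp[of M C A N B P D R S t u] sym_mon_functor_comp[of M N R P S]
    by (simp add: act_2cat_simps act_hom_simps)
  have hcell: "hcomp ?T (M, A) (N, B) (P, D) ((S, u), (S', u'), \<psi>) ((R, t), (R', t'), \<phi>) \<in> Arr (act_hom C (M, A) (P, D))"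
    if s: "symmetric_action M C A" "symmetric_action N C B" "symmetric_action P C D"
      and a: "((S, u), (S', u'), \<psi>) \<in> Arr (act_hom C (N, B) (P, D))" "((R, t), (R', t'), \<phi>) \<in> Arr (act_hom C (M, A) (N, B))"
    for M A N B P D R t S u R' t' S' u' \<phi> \<psi>
  proof -
    interpret A: symmetric_action M C A by fact
    interpret B: symmetric_action N C B by fact
    interpret D: symmetric_action P C D by fact
    have R: "sym_mon_functor M N R" "sym_mon_functor M N R'" "sym_mon_functor N P S" "sym_mon_functor N P S'"
      and pq: "mon_trans M N R R' \<phi>" "mon_trans N P S S' \<psi>"
      and i: "action_identification M C (restriction N C R B) A t" "action_identification M C (restriction N C R' B) A t'"
        "action_identification N C (restriction P C S D) B u" "action_identification N C (restriction P C S' D) B u'"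
      and te: "\<And>m c. \<lbrakk>m \<in> Obj M; c \<in> Obj C\<rbrakk> \<Longrightarrow> t' (m, c) \<cdot>C (\<phi> m \<star>B Idt C c) = t (m, c)"
      and ue: "\<And>n c. \<lbrakk>n \<in> Obj N; c \<in> Obj C\<rbrakk> \<Longrightarrow> u' (n, c) \<cdot>C (\<psi> n \<star>D Idt C c) = u (n, c)"
      using a by (simp_all add: act_hom_simps)
    interpret R: sym_mon_functor M N R by fact
    interpret R': sym_mon_functor M N R' by fact
    interpret S: sym_mon_functor N P S by fact
    interpret S': sym_mon_functor N P S' by fact
    interpret p: mon_trans M N R R' \<phi> by fact
    interpret q: mon_trans N P S S' \<psi> by fact
    interpret t': symmetric_action_identification M C "restriction N C R' B" A t'
      by (rule symmetric_action_identification_restriction) fact+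
    interpret u: symmetric_action_identification N C "restriction P C S D" B u
      by (rule symmetric_action_identification_restriction) fact+
    interpret u': symmetric_action_identification N C "restriction P C S' D" B u'
      by (rule symmetric_action_identification_restriction) fact+
    note [simp] = restriction_simps
    \<comment> \<open>The horizontal composite respects the identifications: \<psi> is absorbed into
      u', naturality of u moves \<phi> in front of it, and \<phi> is absorbed into t'.\<close>
    have "(t' (m, c) \<cdot>C u' (FObj R' m, c)) \<cdot>C (hcomp_trans M P S \<psi> R' \<phi> m \<star>D Idt C c) = t (m, c) \<cdot>C u (FObj R m, c)"
      if [simp]: "m \<in> Obj M" "c \<in> Obj C" for m c
    proof -
      have "(t' (m, c) \<cdot>C u' (FObj R' m, c)) \<cdot>C (hcomp_trans M P S \<psi> R' \<phi> m \<star>D Idt C c)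
        = t' (m, c) \<cdot>C ((u' (FObj R' m, c) \<cdot>C (\<psi> (FObj R' m) \<star>D Idt C c)) \<cdot>C (FArr S (\<phi> m) \<star>D Idt C c))"
        by (simp add: hcomp_trans_def)
      also have "\<dots> = t' (m, c) \<cdot>C (u (FObj R' m, c) \<cdot>C (\<phi> m \<star>(restriction P C S D) Idt C c))"
        by (subst ue) simp_all
      also have "\<dots> = (t' (m, c) \<cdot>C (\<phi> m \<star>B Idt C c)) \<cdot>C u (FObj R m, c)"
        using u.ident_nat[of "\<phi> m" "Idt C c" "FObj R m" c, symmetric] by simp
      finally show ?thesis by (simp add: te)
    qed
    moreover have "mon_trans M P (comp_monfctr M P S R) (comp_monfctr M P S' R') (hcomp_trans M P S \<psi> R' \<phi>)"
      by (rule mon_trans_hcomp) fact+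
    ultimately show ?thesis
      using cell[OF s, of S u R t] cell[OF s, of S' u' R' t'] a
      by (simp add: act_2cat_simps act_hom_simps(2))
  qed
  have ident: "t (m, c) \<in> Arr C" "Dom C (t (m, c)) = FObj R m \<bullet>B c" "Cod C (t (m, c)) = m \<bullet>A c"
    if "symmetric_action M C A" "symmetric_action N C B" "(R, t) \<in> Obj (act_hom C (M, A) (N, B))" "m \<in> Obj M" "c \<in> Obj C"
    for M A N B R t m c
  proof -
    interpret t: symmetric_action_identification M C "restriction N C R B" A t
      using that by (intro symmetric_action_identification_restriction) (simp_all add: act_hom_simps)
    show "t (m, c) \<in> Arr C" "Dom C (t (m, c)) = FObj R m \<bullet>B c" "Cod C (t (m, c)) = m \<bullet>A c"
      using that(4,5) by (simp_all add: restriction_simps)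
  qed
  have ido: "Id1 ?T (M, A) \<in> Obj (act_hom C (M, A) (M, A))" if "symmetric_action M C A" for M A
    using that action_identification_id[OF that] sym_mon_functor_id[OF symmetric_action.axioms(1)[OF that]]
    by (simp add: act_2cat_simps act_hom_simps)
  have fobj: "FObj R m \<in> Obj N" if "(R, t) \<in> Obj (act_hom C (M, A) (N, B))" "m \<in> Obj M" for R t M A N B m
    using that by (auto simp: act_hom_simps sym_mon_functor_def intro: cat_functor.fobj)
  show ?thesis
  proof (rule two_category.intro)
    fix X Y k assume X: "X \<in> Obj2 ?T" and Y: "Y \<in> Obj2 ?T"
    obtain M A N B where e: "X = (M, A)" "Y = (N, B)" by (cases X; cases Y)
    have A: "symmetric_action M C A" and B: "symmetric_action N C B"
      using X Y by (simp_all add: e act_2cat_simps)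
    interpret A: symmetric_action M C A by fact
    interpret B: symmetric_action N C B by fact
    show "category (HomCat ?T X Y)"
      using A B by (simp add: e act_2cat_simps category_act_hom)
    show "Id1 ?T X \<in> Obj (HomCat ?T X X)"
      using ido[OF A] by (simp add: e act_2cat_simps(2))
    assume k: "k \<in> Obj (HomCat ?T X Y)"
    obtain R t where k': "k = (R, t)" by (cases k)
    have t: "(R, t) \<in> Obj (act_hom C (M, A) (N, B))" and R: "sym_mon_functor M N R" "monfctr_ext M R"
      and x: "t \<in> extensional (Obj M \<times> Obj C)"
      using k by (simp_all add: e k' act_2cat_simps act_hom_simps)
    note [simp] = ident[OF A B t] fobj[OF t]
    show "comp1 ?T X X Y k (Id1 ?T X) = k" "comp1 ?T X Y Y (Id1 ?T Y) k = k"
      using R x by (auto simp: e k' act_2cat_simps comp_monfctr_id_right comp_monfctr_id_left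
          intro!: extensionalityI[of _ "Obj M \<times> Obj C"])
  next
    fix X Y k assume X: "X \<in> Obj2 ?T" and Y: "Y \<in> Obj2 ?T" and k: "k \<in> Arr (HomCat ?T X Y)"
    obtain M A N B where e: "X = (M, A)" "Y = (N, B)" by (cases X; cases Y)
    have A: "symmetric_action M C A" and B: "symmetric_action N C B"
      using X Y by (simp_all add: e act_2cat_simps)
    interpret A: symmetric_action M C A by fact
    interpret B: symmetric_action N C B by fact
    obtain R t R' t' \<phi> where k': "k = ((R, t), (R', t'), \<phi>)" by (metis prod.exhaust)
    have t: "(R, t) \<in> Obj (act_hom C (M, A) (N, B))" "(R', t') \<in> Obj (act_hom C (M, A) (N, B))"
      and R: "sym_mon_functor M N R" "monfctr_ext M R" "sym_mon_functor M N R'" "monfctr_ext M R'"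
      and x: "t \<in> extensional (Obj M \<times> Obj C)" "t' \<in> extensional (Obj M \<times> Obj C)"
      and p: "mon_trans M N R R' \<phi>" "\<phi> \<in> extensional (Obj M)"
      using k by (simp_all add: e k' act_2cat_simps act_hom_simps)
    note [simp] = ident[OF A B t(1)] fobj[OF t(1)] ident[OF A B t(2)] fobj[OF t(2)]
    show "hcomp ?T X X Y k (id2 ?T X X (Id1 ?T X)) = k" "hcomp ?T X Y Y (id2 ?T Y Y (Id1 ?T Y)) k = k"
      using R x p hcomp_trans_id_right[OF R(1,3) p] hcomp_trans_id_left[OF R(1,3) p]
      by (auto simp: e k' act_2cat_simps act_hom_simps(5) comp_monfctr_id_right comp_monfctr_id_left simp del: restrict_apply
          intro!: extensionalityI[of _ "Obj M \<times> Obj C"]) (simp_all)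
  next
    fix X Y Z assume X: "X \<in> Obj2 ?T" and Y: "Y \<in> Obj2 ?T" and Z: "Z \<in> Obj2 ?T"
    obtain M A N B P D where e: "X = (M, A)" "Y = (N, B)" "Z = (P, D)" by (cases X; cases Y; cases Z)
    have A: "symmetric_action M C A" and B: "symmetric_action N C B" and D: "symmetric_action P C D"
      using X Y Z by (simp_all add: e act_2cat_simps)
    show "cat_functor (HomCat ?T Y Z \<times>\<^sub>c HomCat ?T X Y) (HomCat ?T X Z) (Comp2 ?T X Y Z)"
    proof (rule cat_functorI)
      fix p assume "p \<in> Obj (HomCat ?T Y Z \<times>\<^sub>c HomCat ?T X Y)"
      then show "FObj (Comp2 ?T X Y Z) p \<in> Obj (HomCat ?T X Z)"
        using cell[OF A B D] by (auto simp: e act_2cat_simps(2))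
    next
      fix p assume p: "p \<in> Arr (HomCat ?T Y Z \<times>\<^sub>c HomCat ?T X Y)"
      obtain S u S' u' \<psi> R t R' t' \<phi> where "p = (((S, u), (S', u'), \<psi>), ((R, t), (R', t'), \<phi>))"
        by (metis prod.exhaust)
      then show "FArr (Comp2 ?T X Y Z) p \<in> Arr (HomCat ?T X Z)
        \<and> Dom (HomCat ?T X Z) (FArr (Comp2 ?T X Y Z) p) = FObj (Comp2 ?T X Y Z) (Dom (HomCat ?T Y Z \<times>\<^sub>c HomCat ?T X Y) p)
        \<and> Cod (HomCat ?T X Z) (FArr (Comp2 ?T X Y Z) p) = FObj (Comp2 ?T X Y Z) (Cod (HomCat ?T Y Z \<times>\<^sub>c HomCat ?T X Y) p)"
        using p hcell[OF A B D, of S u S' u' \<psi> R t R' t' \<phi>]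
        by (simp add: e act_2cat_simps act_hom_simps(3,4))
    next
      fix p assume "p \<in> Obj (HomCat ?T Y Z \<times>\<^sub>c HomCat ?T X Y)"
      then obtain S u R t where p: "p = ((S, u), (R, t))" and "sym_mon_functor N P S" "sym_mon_functor M N R"
        by (cases p) (auto simp: e act_2cat_simps act_hom_simps)
      then show "FArr (Comp2 ?T X Y Z) (Idt (HomCat ?T Y Z \<times>\<^sub>c HomCat ?T X Y) p) = Idt (HomCat ?T X Z) (FObj (Comp2 ?T X Y Z) p)"
        by (auto simp: e p act_2cat_simps act_hom_simps(5) hcomp_trans_id intro!: restrict_ext)
    next
      fix p q assume "p \<in> Arr (HomCat ?T Y Z \<times>\<^sub>c HomCat ?T X Y)" "q \<in> Arr (HomCat ?T Y Z \<times>\<^sub>c HomCat ?T X Y)"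
        "Cod (HomCat ?T Y Z \<times>\<^sub>c HomCat ?T X Y) p = Dom (HomCat ?T Y Z \<times>\<^sub>c HomCat ?T X Y) q"
      then show "FArr (Comp2 ?T X Y Z) (q \<cdot>(HomCat ?T Y Z \<times>\<^sub>c HomCat ?T X Y) p)
        = FArr (Comp2 ?T X Y Z) q \<cdot>(HomCat ?T X Z) FArr (Comp2 ?T X Y Z) p"
        by (cases p; cases q) (auto simp: e act_2cat_simps act_hom_simps hcomp_trans_vcomp)
    qed (simp_all add: e act_2cat_simps(2) category_prod category_act_hom A B D)
  next
    fix W X Y Z k l n assume W: "W \<in> Obj2 ?T" and X: "X \<in> Obj2 ?T" and Y: "Y \<in> Obj2 ?T" and Z: "Z \<in> Obj2 ?T"
      and k: "k \<in> Obj (HomCat ?T W X)" "l \<in> Obj (HomCat ?T X Y)" "n \<in> Obj (HomCat ?T Y Z)"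
    obtain M A N B P D Q E where e: "W = (M, A)" "X = (N, B)" "Y = (P, D)" "Z = (Q, E)" by (cases W; cases X; cases Y; cases Z)
    obtain R t S u T v where e': "k = (R, t)" "l = (S, u)" "n = (T, v)" by (cases k; cases l; cases n)
    have act: "symmetric_action M C A" "symmetric_action N C B" "symmetric_action P C D" "symmetric_action Q C E"
      using W X Y Z by (simp_all add: e act_2cat_simps)
    have cells: "(R, t) \<in> Obj (act_hom C (M, A) (N, B))" "(S, u) \<in> Obj (act_hom C (N, B) (P, D))" "(T, v) \<in> Obj (act_hom C (P, D) (Q, E))"
      using k by (simp_all add: e e' act_2cat_simps(2))
    have c: "category C" using act(1) by (simp add: symmetric_action_def smc_category)
    interpret C: category C by fact
    show "comp1 ?T W X Z (comp1 ?T X Y Z n l) k = comp1 ?T W Y Z n (comp1 ?T W X Y l k)"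
      using cells by (auto simp: e e' act_2cat_simps comp_monfctr_assoc act_hom_simps(1)
          ident[OF act(1,2) cells(1)] ident[OF act(2,3) cells(2)] ident[OF act(3,4) cells(3)] fobj[OF cells(1)] fobj[OF cells(2)]
          intro!: restrict_ext)
  next
    fix W X Y Z k l n assume W: "W \<in> Obj2 ?T" and X: "X \<in> Obj2 ?T" and Y: "Y \<in> Obj2 ?T" and Z: "Z \<in> Obj2 ?T"
      and k: "k \<in> Arr (HomCat ?T W X)" "l \<in> Arr (HomCat ?T X Y)" "n \<in> Arr (HomCat ?T Y Z)"
    obtain M A N B P D Q E where e: "W = (M, A)" "X = (N, B)" "Y = (P, D)" "Z = (Q, E)" by (cases W; cases X; cases Y; cases Z)
    obtain R t R' t' \<phi> S u S' u' \<psi> T v T' v' \<omega> where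
      e': "k = ((R, t), (R', t'), \<phi>)" "l = ((S, u), (S', u'), \<psi>)" "n = ((T, v), (T', v'), \<omega>)" by (metis prod.exhaust)
    have act: "symmetric_action M C A" "symmetric_action N C B" "symmetric_action P C D" "symmetric_action Q C E"
      using W X Y Z by (simp_all add: e act_2cat_simps)
    have cells: "(R, t) \<in> Obj (act_hom C (M, A) (N, B))" "(S, u) \<in> Obj (act_hom C (N, B) (P, D))" "(T, v) \<in> Obj (act_hom C (P, D) (Q, E))"
      and cells': "(R', t') \<in> Obj (act_hom C (M, A) (N, B))" "(S', u') \<in> Obj (act_hom C (N, B) (P, D))" "(T', v') \<in> Obj (act_hom C (P, D) (Q, E))"
      and tr: "mon_trans M N R R' \<phi>" "mon_trans N P S S' \<psi>" "mon_trans P Q T T' \<omega>"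
      using k by (simp_all add: e e' act_2cat_simps(2) act_hom_simps(2))
    have c: "category C" using act(1) by (simp add: symmetric_action_def smc_category)
    interpret C: category C by fact
    show "hcomp ?T W X Z (hcomp ?T X Y Z n l) k = hcomp ?T W Y Z n (hcomp ?T W X Y l k)"
      using cells cells' tr by (auto simp: e e' act_2cat_simps comp_monfctr_assoc hcomp_trans_assoc act_hom_simps(1)
          ident[OF act(1,2) cells(1)] ident[OF act(2,3) cells(2)] ident[OF act(3,4) cells(3)] fobj[OF cells(1)] fobj[OF cells(2)]
          ident[OF act(1,2) cells'(1)] ident[OF act(2,3) cells'(2)] ident[OF act(3,4) cells'(3)] fobj[OF cells'(1)] fobj[OF cells'(2)]
          intro!: restrict_ext)
  qed
qed

section \<open>Terminality of the self-action\<close>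

text \<open>Compatibility of the inverse components with the identifications is the compatibility of
  \<phi> itself, solved for the other side.\<close>

lemma act_hom_is_iso:
  assumes A: "symmetric_action M C A" and B: "symmetric_action N C B"
    and a: "((R, t), (R', t'), \<phi>) \<in> Arr (act_hom C (M, A) (N, B))"
    and i: "\<And>m. m \<in> Obj M \<Longrightarrow> is_iso N (\<phi> m)"
  shows "is_iso (act_hom C (M, A) (N, B)) ((R, t), (R', t'), \<phi>)"
proof -
  interpret H: category "act_hom C (M, A) (N, B)" by (rule category_act_hom) fact+
  interpret B: symmetric_action N C B by fact
  have R: "sym_mon_functor M N R" "sym_mon_functor M N R'" and p: "mon_trans M N R R' \<phi>"
    and t: "action_identification M C (restriction N C R' B) A t'"
    and te: "\<And>m c. \<lbrakk>m \<in> Obj M; c \<in> Obj C\<rbrakk> \<Longrightarrow> t' (m, c) \<cdot>C (\<phi> m \<star>B Idt C c) = t (m, c)"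
    using a by (simp_all add: act_hom_simps)
  interpret R: sym_mon_functor M N R by fact
  interpret R': sym_mon_functor M N R' by fact
  interpret p: mon_trans M N R R' \<phi> by fact
  interpret t': symmetric_action_identification M C "restriction N C R' B" A t'
    by (rule symmetric_action_identification_restriction) fact+
  note [simp] = i
  have "t (m, c) \<cdot>C (inv_arr N (\<phi> m) \<star>B Idt C c) = t' (m, c)" if [simp]: "m \<in> Obj M" "c \<in> Obj C" for m c
    by (simp add: restriction_simps flip: te)
  then have b: "((R', t'), (R, t), \<lambda>m\<in>Obj M. inv_arr N (\<phi> m)) \<in> Arr (act_hom C (M, A) (N, B))"
    using a mon_trans_inv[OF R p] by (simp add: act_hom_simps)
  show ?thesis
    by (rule H.is_isoI[OF a b]) (auto simp: act_hom_simps intro!: restrict_ext)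
qed

context symmetric_action
begin

lemma rep_cell_obj: "(F, \<theta>) \<in> Obj (act_hom C (M, A) (C, self_action C))"
  using rep_identification[OF symmetric_action_axioms] sym_mon_functor_rep by (simp add: act_hom_simps)

text \<open>By \<open>rep_ident_natural\<close>, every \<open>(R, t)\<close> maps to \<open>(F, \<theta>)\<close> by the components
  \<open>R m \<rightarrow> R m \<boxtimes> i \<rightarrow> m \<bullet> i\<close>.\<close>

lemma to_rep_cell:
  assumes k: "(R, t) \<in> Obj (act_hom C (M, A) (C, self_action C))"
  shows "\<exists>\<phi>. ((R, t), (F, \<theta>), \<phi>) \<in> Arr (act_hom C (M, A) (C, self_action C)) \<and>
    is_iso (act_hom C (M, A) (C, self_action C)) ((R, t), (F, \<theta>), \<phi>)"
proof -
  have S: "symmetric_action C C (self_action C)"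
    by (rule symmetric_action_self) (rule acted.symmetric_monoidal_category_axioms)
  interpret S: symmetric_action C C "self_action C" by fact
  have R: "sym_mon_functor M C R" "monfctr_ext M R"
    and t: "action_identification M C (restriction C C R (self_action C)) A t"
    using k by (simp_all add: act_hom_simps)
  interpret R: sym_mon_functor M C R by fact
  interpret t: symmetric_action_identification M C "restriction C C R (self_action C)" A t
    by (rule symmetric_action_identification_restriction) (fact symmetric_action_axioms S R t)+
  note [simp] = restriction_simps
  \<comment> \<open>The nested restrictions reproduce literally the forms that
    \<open>mon_trans_inv\<close> and \<open>mon_trans_vcomp\<close> deliver.\<close>
  let ?r = "\<lambda>m\<in>Obj M. inv_arr C ((\<lambda>m\<in>Obj M. Runit C (FObj R m)) m)"
  let ?\<phi> = "\<lambda>m\<in>Obj M. (\<lambda>m\<in>Obj M. t (m, Unt C)) m \<cdot>C ?r m"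
  have "mon_trans M C R (rep_functor M C (restriction C C R (self_action C))) ?r"
    by (rule mon_trans_inv[OF t.src.sym_mon_functor_rep R(1) mon_trans_rep_restriction_self[OF R]]) simp
  then have p: "mon_trans M C R F ?\<phi>"
    by (rule mon_trans_vcomp[OF R(1) t.src.sym_mon_functor_rep sym_mon_functor_rep _ t.mon_trans_rep])
  have i: "is_iso C (?\<phi> m)" if "m \<in> Obj M" for m
    using that by simp
  have "\<theta> (m, c) \<cdot>C (?\<phi> m \<boxtimes>C Idt C c) = t (m, c)" if [simp]: "m \<in> Obj M" "c \<in> Obj C" for m c
  proof -
    \<comment> \<open>\<open>rep_ident_natural\<close> brings \<open>t (m, c)\<close> to the front.
      The \<theta> of the restricted self-action is the right unitor tensored with c, which
      cancels.\<close>
    have "\<theta> (m, c) \<cdot>C (?\<phi> m \<boxtimes>C Idt C c) = (\<theta> (m, c) \<cdot>C (t (m, Unt C) \<boxtimes>C Idt C c)) \<cdot>C (inv_arr C (Runit C (FObj R m)) \<boxtimes>C Idt C c)"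
      by simp
    also have "\<dots> = t (m, c)"
      by (subst t.rep_ident_natural[symmetric])
        (simp_all add: rep_ident_restriction[OF R(1) S] rep_ident_self acted.symmetric_monoidal_category_axioms)
    finally show ?thesis .
  qed
  with p k rep_cell_obj have "((R, t), (F, \<theta>), ?\<phi>) \<in> Arr (act_hom C (M, A) (C, self_action C))"
    by (simp add: act_hom_simps(2))
  then show ?thesis
    using act_hom_is_iso[OF symmetric_action_axioms S, of R t F \<theta> ?\<phi>] i by blast
qed

text \<open>Compatibility at the unit of C determines the component at m after tensoring with the
  unit, because the identification is invertible; and tensoring with the unit is faithful.\<close>

lemma act_hom_self_faithful:
  assumes "\<phi> \<in> hom (act_hom C (M, A) (C, self_action C)) k l" "\<psi> \<in> hom (act_hom C (M, A) (C, self_action C)) k l"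
  shows "\<phi> = \<psi>"
proof -
  obtain R t R' t' f g where e: "\<phi> = ((R, t), (R', t'), f)" "\<psi> = ((R, t), (R', t'), g)"
    and a: "((R, t), (R', t'), f) \<in> Arr (act_hom C (M, A) (C, self_action C))"
      "((R, t), (R', t'), g) \<in> Arr (act_hom C (M, A) (C, self_action C))"
    using assms by (cases \<phi>; cases \<psi>; cases k; cases l) (auto simp: hom_iff act_hom_simps(3,4))
  have S: "symmetric_action C C (self_action C)"
    by (rule symmetric_action_self) (rule acted.symmetric_monoidal_category_axioms)
  interpret R': sym_mon_functor M C R' using a by (simp add: act_hom_simps)
  interpret R: sym_mon_functor M C R using a by (simp add: act_hom_simps)
  interpret f: mon_trans M C R R' f using a by (simp add: act_hom_simps)
  interpret g: mon_trans M C R R' g using a by (simp add: act_hom_simps)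
  interpret t': symmetric_action_identification M C "restriction C C R' (self_action C)" A t'
    by (rule symmetric_action_identification_restriction) (use symmetric_action_axioms S a in \<open>simp_all add: act_hom_simps\<close>)
  have "f m = g m" if [simp]: "m \<in> Obj M" for m
  proof -
    have "t' (m, Unt C) \<cdot>C (f m \<boxtimes>C Idt C (Unt C)) = t' (m, Unt C) \<cdot>C (g m \<boxtimes>C Idt C (Unt C))"
      using a by (simp add: act_hom_simps)
    then have "f m \<boxtimes>C Idt C (Unt C) = g m \<boxtimes>C Idt C (Unt C)"
      by (rule acted.iso_cancel_left) (simp_all add: restriction_simps)
    then show ?thesis
      by (rule acted.runit_faithful) simp_all
  qed
  moreover have "f \<in> extensional (Obj M)" "g \<in> extensional (Obj M)"
    using a by (simp_all add: act_hom_simps)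
  ultimately show ?thesis
    unfolding e by (auto intro: extensionalityI)
qed

text \<open>Existence goes through (F, \<theta>): the isomorphism from \<open>k\<close> to it,
  followed by the inverse of the one from \<open>l\<close>.\<close>

lemma act_hom_self_unique:
  assumes k: "k \<in> Obj (act_hom C (M, A) (C, self_action C))" and l: "l \<in> Obj (act_hom C (M, A) (C, self_action C))"
  shows "\<exists>!\<phi>. \<phi> \<in> hom (act_hom C (M, A) (C, self_action C)) k l"
proof -
  let ?H = "act_hom C (M, A) (C, self_action C)"
  interpret H: category ?H
    by (rule category_act_hom[OF symmetric_action_axioms symmetric_action_self])
      (rule acted.symmetric_monoidal_category_axioms)
  have ex: "\<exists>f. f \<in> Arr ?H \<and> Dom ?H f = k \<and> Cod ?H f = (F, \<theta>) \<and> is_iso ?H f" if "k \<in> Obj ?H" for k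
    using that to_rep_cell[of "fst k" "snd k"] by (metis act_hom_simps(3,4) prod.collapse)
  obtain f g where f: "f \<in> Arr ?H" "Dom ?H f = k" "Cod ?H f = (F, \<theta>)"
    and g: "is_iso ?H g" "Dom ?H g = l" "Cod ?H g = (F, \<theta>)"
    using ex[OF k] ex[OF l] by blast
  then have "inv_arr ?H g \<cdot>?H f \<in> hom ?H k l"
    by (simp add: hom_iff)
  then show ?thesis
    using act_hom_self_faithful by blast
qed

text \<open>Any 2-cell in the other direction is an inverse, since both composites are parallel to
  identities.\<close>

lemma act_hom_self_iso:
  assumes "k \<in> Obj (act_hom C (M, A) (C, self_action C))" "l \<in> Obj (act_hom C (M, A) (C, self_action C))"
    and "\<phi> \<in> hom (act_hom C (M, A) (C, self_action C)) k l"
  shows "is_iso (act_hom C (M, A) (C, self_action C)) \<phi>"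
proof -
  let ?H = "act_hom C (M, A) (C, self_action C)"
  interpret H: category ?H
    by (rule category_act_hom[OF symmetric_action_axioms symmetric_action_self])
      (rule acted.symmetric_monoidal_category_axioms)
  obtain \<psi> where p: "\<psi> \<in> hom ?H l k"
    using act_hom_self_unique[OF assms(2,1)] by blast
  have "\<psi> \<cdot>?H \<phi> = Idt ?H k"
    using assms p by (intro act_hom_self_faithful[of _ k k]) (simp_all add: hom_iff)
  moreover have "\<phi> \<cdot>?H \<psi> = Idt ?H l"
    using assms p by (intro act_hom_self_faithful[of _ l l]) (simp_all add: hom_iff)
  ultimately show ?thesis
    using assms p by (intro H.is_isoI[where g = \<psi>]) (simp_all add: hom_iff)
qed

end

text \<open>The quasi-inverse picks the given object u. All equations of arrows hold because
  parallel arrows are equal, which also makes every arrow invertible.\<close>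

lemma equivalent_one_cat:
  assumes "category H" "u \<in> Obj H" and ex1: "\<And>x y. \<lbrakk>x \<in> Obj H; y \<in> Obj H\<rbrakk> \<Longrightarrow> \<exists>!f. f \<in> hom H x y"
  shows "equivalent_categories H one_cat"
proof -
  interpret H: category H by fact
  have O: "category one_cat" by (rule categoryI) (simp_all add: one_cat_def)
  let ?F = "\<lparr>FObj = \<lambda>_. (), FArr = \<lambda>_. ()\<rparr>" and ?G = "\<lparr>FObj = \<lambda>_. u, FArr = \<lambda>_. Idt H u\<rparr>"
  have F: "cat_functor H one_cat ?F"
    by (rule cat_functorI) (simp_all add: O assms(1), simp_all add: one_cat_def)
  have G: "cat_functor one_cat H ?G"
    by (rule cat_functorI) (simp_all add: O assms(1,2))
  have uniq: "f = g" if "f \<in> Arr H" "g \<in> Arr H" "Dom H f = Dom H g" "Cod H f = Cod H g" for f g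
    using that ex1[of "Dom H f" "Cod H f"] by (auto simp: hom_iff)
  \<comment> \<open>The unique arrow to u serves as the component of the natural isomorphism to the
    constant functor.\<close>
  define s where "s x = (THE f. f \<in> hom H x u)" for x
  have s: "s x \<in> Arr H" "Dom H (s x) = x" "Cod H (s x) = u" if "x \<in> Obj H" for x
    using theI'[OF ex1[OF that assms(2)]] by (simp_all add: s_def hom_iff)
  have si: "is_iso H (s x)" if x: "x \<in> Obj H" for x
  proof -
    obtain g where g: "g \<in> hom H u x" using ex1[OF assms(2) x] by blast
    show ?thesis
      by (rule H.is_isoI[where g = g]) (use g s[OF x] x assms(2) in \<open>auto simp: hom_iff intro!: uniq\<close>)
  qed
  have "nat_iso H H id_fctr (comp_fctr ?G ?F) s"
  proof (rule nat_isoI)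
    show "cat_functor H H id_fctr" "cat_functor H H (comp_fctr ?G ?F)"
      by (rule cat_functorI; simp add: comp_fctr_def assms(1,2))+
  qed (use assms(2) in \<open>auto simp: comp_fctr_def s si intro!: uniq\<close>)
  moreover have "nat_iso one_cat one_cat (comp_fctr ?F ?G) id_fctr (\<lambda>_. ())"
  proof (rule nat_isoI)
    show "cat_functor one_cat one_cat id_fctr"
      by (rule cat_functorI) (simp_all add: O)
    show "cat_functor one_cat one_cat (comp_fctr ?F ?G)"
      by (rule cat_functorI) (simp_all add: O)
  qed (simp_all add: is_iso_def inverse_arrows_def hom_iff one_cat_def)
  ultimately show ?thesis
    unfolding equivalent_categories_def using F G by blast
qed

lemma two_terminal_self:
  fixes C :: "('o, 'a) smc"
  assumes "symmetric_monoidal_category C"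
  shows "two_terminal (act_2cat C) (C, self_action C)"
  unfolding two_terminal_def
proof (intro conjI ballI two_category_act)
  have S: "symmetric_action C C (self_action C)" by (rule symmetric_action_self) fact
  then show "(C, self_action C) \<in> Obj2 (act_2cat C)" by (simp add: act_2cat_simps)
  fix X :: "('o, 'a) smc \<times> ('o, 'a, 'o, 'a) monaction"
  assume X: "X \<in> Obj2 (act_2cat C)"
  obtain M A where e: "X = (M, A)" by (cases X)
  interpret A: symmetric_action M C A using X by (simp add: e act_2cat_simps)
  show "equivalent_categories (HomCat (act_2cat C) X (C, self_action C)) one_cat"
    unfolding e act_2cat_simps(2)
    by (rule equivalent_one_cat[OF category_act_hom[OF A.symmetric_action_axioms S] A.rep_cell_obj A.act_hom_self_unique])
qed

text \<open>Shows that restriction of the self-action is well defined on 1-cells. The source is a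
  double restriction because the object over N is already the restriction along G, and the 1-cell
  restricts it further along R.\<close>

lemma action_identification_trans:
  assumes R: "sym_mon_functor M N R" and G: "sym_mon_functor N C G" and F: "sym_mon_functor M C F"
    and g: "mon_trans M C (comp_monfctr M C G R) F \<gamma>" and i: "\<And>m. m \<in> Obj M \<Longrightarrow> is_iso C (\<gamma> m)"
  shows "action_identification M C (restriction N C R (restriction C C G (self_action C)))
    (restriction C C F (self_action C)) (\<lambda>p\<in>Obj M \<times> Obj C. \<gamma> (fst p) \<boxtimes>C Idt C (snd p))"
proof -
  interpret R: sym_mon_functor M N R by fact
  interpret G: sym_mon_functor N C G by fact
  interpret F: sym_mon_functor M C F by fact
  interpret g: mon_trans M C "comp_monfctr M C G R" F \<gamma> by fact
  have S: "symmetric_action C C (self_action C)" by (rule symmetric_action_self) (rule G.cod_smc.symmetric_monoidal_category_axioms)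
  have GS: "symmetric_action N C (restriction C C G (self_action C))"
    by (rule symmetric_action_restriction) fact+
  note [simp] = restriction_simps i
  have gs [simp]: "\<gamma> m \<in> Arr C" "Dom C (\<gamma> m) = FObj G (FObj R m)" "Cod C (\<gamma> m) = FObj F m" if "m \<in> Obj M" for m
    using that g.component_arr[OF that] g.dom_component[OF that] g.cod_component[OF that] by simp_all
  have mult: "\<gamma> (m \<otimes>M n) \<cdot>C (FArr G (FMult R (m, n)) \<cdot>C FMult G (FObj R m, FObj R n)) = FMult F (m, n) \<cdot>C (\<gamma> m \<boxtimes>C \<gamma> n)"
    if "m \<in> Obj M" "n \<in> Obj M" for m n
    using g.mult_comp[of m n] that by simp
  show ?thesis
  proof (rule action_identificationI)
    show "symmetric_action M C (restriction N C R (restriction C C G (self_action C)))"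
      "symmetric_action M C (restriction C C F (self_action C))"
      by (rule symmetric_action_restriction; fact)+
  next
    fix f h assume [simp]: "f \<in> Arr M" "h \<in> Arr C"
    show "(f \<star>(restriction C C F (self_action C)) h) \<cdot>C (\<lambda>p\<in>Obj M \<times> Obj C. \<gamma> (fst p) \<boxtimes>C Idt C (snd p)) (Dom M f, Dom C h)
      = (\<lambda>p\<in>Obj M \<times> Obj C. \<gamma> (fst p) \<boxtimes>C Idt C (snd p)) (Cod M f, Cod C h) \<cdot>C
        (f \<star>(restriction N C R (restriction C C G (self_action C))) h)"
      using g.naturality'[of f "Dom M f"] by simp
  next
    fix c assume [simp]: "c \<in> Obj C"
    have "\<gamma> (Unt M) \<cdot>C (FArr G (FUnit R) \<cdot>C FUnit G) = FUnit F"
      using g.unit_comp by simp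
    then show "(\<lambda>p\<in>Obj M \<times> Obj C. \<gamma> (fst p) \<boxtimes>C Idt C (snd p)) (Unt M, c) \<cdot>C
        AUnit (restriction N C R (restriction C C G (self_action C))) c = AUnit (restriction C C F (self_action C)) c"
      by simp
  next
    fix m n c assume [simp]: "m \<in> Obj M" "n \<in> Obj M" "c \<in> Obj C"
    show "(\<lambda>p\<in>Obj M \<times> Obj C. \<gamma> (fst p) \<boxtimes>C Idt C (snd p)) (m \<otimes>M n, c) \<cdot>C
        AMult (restriction N C R (restriction C C G (self_action C))) m n c
      = AMult (restriction C C F (self_action C)) m n c \<cdot>C ((\<lambda>p\<in>Obj M \<times> Obj C. \<gamma> (fst p) \<boxtimes>C Idt C (snd p)) (m, n \<bullet>(restriction C C F (self_action C)) c) \<cdot>C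
        (Idt M m \<star>(restriction N C R (restriction C C G (self_action C))) (\<lambda>p\<in>Obj M \<times> Obj C. \<gamma> (fst p) \<boxtimes>C Idt C (snd p)) (n, c)))"
      by (simp add: mult G.cod_smc.assoc_inv_nat)
  next
    fix m n c d assume [simp]: "m \<in> Obj M" "n \<in> Obj M" "c \<in> Obj C" "d \<in> Obj C"
    show "(\<lambda>p\<in>Obj M \<times> Obj C. \<gamma> (fst p) \<boxtimes>C Idt C (snd p)) (m \<otimes>M n, c \<otimes>C d) \<cdot>C
        action_mult C (restriction N C R (restriction C C G (self_action C))) m c n d
      = action_mult C (restriction C C F (self_action C)) m c n d \<cdot>C
        ((\<lambda>p\<in>Obj M \<times> Obj C. \<gamma> (fst p) \<boxtimes>C Idt C (snd p)) (m, c) \<boxtimes>C (\<lambda>p\<in>Obj M \<times> Obj C. \<gamma> (fst p) \<boxtimes>C Idt C (snd p)) (n, d))"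
      by (simp add: action_mult_restriction[OF R GS] action_mult_restriction[OF G S] action_mult_restriction[OF F S]
          action_mult_self G.cod_smc.symmetric_monoidal_category_axioms mult G.cod_smc.interchange_nat)
  qed simp_all
qed

lemma action_identification_inv:
  assumes A: "symmetric_action M C A" and B: "symmetric_action M C B" and t: "action_identification M C A B t"
  shows "action_identification M C B A (\<lambda>p\<in>Obj M \<times> Obj C. inv_arr C (t p))"
proof -
  interpret t: symmetric_action_identification M C A B t
    by (intro symmetric_action_identification.intro) fact+
  show ?thesis
  proof (rule action_identificationI[OF B A])
    fix f g assume [simp]: "f \<in> Arr M" "g \<in> Arr C"
    show "f \<star>A g \<cdot>C (\<lambda>p\<in>Obj M \<times> Obj C. inv_arr C (t p)) (Dom M f, Dom C g)
      = (\<lambda>p\<in>Obj M \<times> Obj C. inv_arr C (t p)) (Cod M f, Cod C g) \<cdot>C (f \<star>B g)"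
      by (rule t.src.acted.iso_cancel_left[where f = "t (Cod M f, Cod C g)"],
          rule t.src.acted.iso_cancel_right[where f = "t (Dom M f, Dom C g)"])
        (simp_all add: t.ident_nat)
  next
    fix c assume [simp]: "c \<in> Obj C"
    show "(\<lambda>p\<in>Obj M \<times> Obj C. inv_arr C (t p)) (Unt M, c) \<cdot>C AUnit B c = AUnit A c"
      by (simp flip: t.aunit_comp)
  next
    fix m n c assume [simp]: "m \<in> Obj M" "n \<in> Obj M" "c \<in> Obj C"
    have 1: "t (m, n \<bullet>B c) \<cdot>C (Idt M m \<star>A t (n, c)) = (Idt M m \<star>B t (n, c)) \<cdot>C t (m, n \<bullet>A c)"
      using t.ident_nat[of "Idt M m" "t (n, c)" m "n \<bullet>A c"] by simp
    have "(t (m \<otimes>M n, c) \<cdot>C AMult A m n c) \<cdot>C (inv_arr C (t (m, n \<bullet>A c)) \<cdot>C (Idt M m \<star>B inv_arr C (t (n, c)))) = AMult B m n c"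
      unfolding t.ident_mult[OF \<open>m \<in> Obj M\<close> \<open>n \<in> Obj M\<close> \<open>c \<in> Obj C\<close>] 1 by simp
    then show "(\<lambda>p\<in>Obj M \<times> Obj C. inv_arr C (t p)) (m \<otimes>M n, c) \<cdot>C AMult B m n c
      = AMult A m n c \<cdot>C ((\<lambda>p\<in>Obj M \<times> Obj C. inv_arr C (t p)) (m, n \<bullet>A c) \<cdot>C (Idt M m \<star>B (\<lambda>p\<in>Obj M \<times> Obj C. inv_arr C (t p)) (n, c)))"
      by (auto simp flip: \<open>_ = AMult B m n c\<close>)
  next
    fix m n c d assume [simp]: "m \<in> Obj M" "n \<in> Obj M" "c \<in> Obj C" "d \<in> Obj C"
    show "(\<lambda>p\<in>Obj M \<times> Obj C. inv_arr C (t p)) (m \<otimes>M n, c \<otimes>C d) \<cdot>C action_mult C B m c n d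
      = action_mult C A m c n d \<cdot>C ((\<lambda>p\<in>Obj M \<times> Obj C. inv_arr C (t p)) (m, c) \<boxtimes>C (\<lambda>p\<in>Obj M \<times> Obj C. inv_arr C (t p)) (n, d))"
      by (rule t.src.acted.iso_cancel_left[where f = "t (m \<otimes>M n, c \<otimes>C d)"],
          rule t.src.acted.iso_cancel_right[where f = "t (m, c) \<boxtimes>C t (n, d)"])
        (simp_all add: t.ident_inter)
  qed simp_all
qed

text \<open>An identification of two actions of the same category has to be presented as a 1-cell
  over the identity functor, whose identification starts from the restriction along the
  identity.\<close>

lemma action_identification_restrict_id:
  assumes A: "symmetric_action M C A" and B: "symmetric_action M C B" and t: "action_identification M C A B t"
  shows "action_identification M C (restriction M C (id_monfctr M) A) B t"
proof -
  interpret t: symmetric_action_identification M C A B t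
    by (intro symmetric_action_identification.intro) fact+
  have I: "sym_mon_functor M M (id_monfctr M)"
    by (rule sym_mon_functor_id) (rule t.src.acting.symmetric_monoidal_category_axioms)
  show ?thesis
    by (intro action_identificationI symmetric_action_restriction I)
      (simp_all add: A B restriction_simps action_mult_restriction[OF I A] t.aunit_comp t.ident_mult t.ident_inter t.ident_nat)
qed

section \<open>The biequivalence\<close>

lemma slice_smc_obj2:
  "(M, F) \<in> Obj2 (slice_2cat smc_2cat C) \<longleftrightarrow> symmetric_monoidal_category M \<and> sym_mon_functor M C F \<and> monfctr_ext M F"
  by (simp add: slice_2cat_simps smc_2cat_simps smc_hom_simps)

text \<open>A 2-cell of \<open>smc_2cat\<close> carries its source and target, so a 1-cell of the
  slice is a quadruple whose entries \<open>H\<close> and \<open>K\<close> are forced; its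
  invertibility is expressed pointwise.\<close>

lemma slice_smc_obj:
  assumes F: "sym_mon_functor M C F" "monfctr_ext M F" and G: "sym_mon_functor N C G" "monfctr_ext N G"
  shows "(R, H, K, \<gamma>) \<in> Obj (slice_hom smc_2cat C (M, F) (N, G)) \<longleftrightarrow>
    sym_mon_functor M N R \<and> monfctr_ext M R \<and> H = comp_monfctr M C G R \<and> K = F \<and>
    mon_trans M C (comp_monfctr M C G R) F \<gamma> \<and> \<gamma> \<in> extensional (Obj M) \<and> (\<forall>m \<in> Obj M. is_iso C (\<gamma> m))"
  (is "?l \<longleftrightarrow> ?r")
proof
  assume ?l
  then show ?r
    by (auto simp: slice_hom_simps smc_2cat_simps smc_hom_simps smc_hom_iso_component)
next
  assume r: ?r
  then have "sym_mon_functor M C (comp_monfctr M C G R)"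
    using G sym_mon_functor_comp by blast
  with r F show ?l
    by (auto simp: slice_hom_simps smc_2cat_simps smc_hom_simps intro!: smc_hom_is_iso)
qed

text \<open>Whiskering with an identity 2-cell leaves only the image of \<phi> under G, so the
  triangle of the slice becomes an equation for each object of M.\<close>

lemma slice_smc_arr:
  assumes F: "sym_mon_functor M C F" "monfctr_ext M F" and G: "sym_mon_functor N C G" "monfctr_ext N G"
    and k: "(R, H, K, \<gamma>) \<in> Obj (slice_hom smc_2cat C (M, F) (N, G))" "(R', H', K', \<gamma>') \<in> Obj (slice_hom smc_2cat C (M, F) (N, G))"
  shows "((R, H, K, \<gamma>), (R', H', K', \<gamma>'), (S, S', \<phi>)) \<in> Arr (slice_hom smc_2cat C (M, F) (N, G)) \<longleftrightarrow>
    S = R \<and> S' = R' \<and> mon_trans M N R R' \<phi> \<and> \<phi> \<in> extensional (Obj M) \<and>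
    (\<forall>m \<in> Obj M. \<gamma>' m \<cdot>C FArr G (\<phi> m) = \<gamma> m)"
proof -
  have R: "sym_mon_functor M N R" "monfctr_ext M R" "sym_mon_functor M N R'" "monfctr_ext M R'"
    and \<gamma>: "H = comp_monfctr M C G R" "K = F" "H' = comp_monfctr M C G R'" "K' = F" "\<gamma> \<in> extensional (Obj M)"
    using k by (simp_all add: slice_smc_obj[OF F G])
  interpret R': sym_mon_functor M N R' by fact
  interpret G: sym_mon_functor N C G by fact
  have "(\<lambda>m\<in>Obj M. \<gamma>' m \<cdot>C hcomp_trans M C G (\<lambda>n\<in>Obj N. Idt C (FObj G n)) R' \<phi> m) = \<gamma> \<longleftrightarrow>
    (\<forall>m \<in> Obj M. \<gamma>' m \<cdot>C FArr G (\<phi> m) = \<gamma> m)" if p: "mon_trans M N R R' \<phi>"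
  proof -
    interpret p: mon_trans M N R R' \<phi> by fact
    have "(\<lambda>m\<in>Obj M. \<gamma>' m \<cdot>C hcomp_trans M C G (\<lambda>n\<in>Obj N. Idt C (FObj G n)) R' \<phi> m) = (\<lambda>m\<in>Obj M. \<gamma>' m \<cdot>C FArr G (\<phi> m))"
      by (auto simp: hcomp_trans_def intro!: restrict_ext)
    moreover have "(\<lambda>m\<in>Obj M. \<gamma>' m \<cdot>C FArr G (\<phi> m)) = \<gamma> \<longleftrightarrow> (\<forall>m \<in> Obj M. \<gamma>' m \<cdot>C FArr G (\<phi> m) = \<gamma> m)"
      using \<gamma>(5) by (auto intro: extensionalityI)
    ultimately show ?thesis by simp
  qed
  then show ?thesis
    using k R by (auto simp: slice_hom_simps(2) smc_2cat_simps smc_hom_simps \<gamma> simp del: restrict_apply)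
qed

lemma slice_smc_comp1:
  assumes F: "sym_mon_functor M C F" "monfctr_ext M F" and G: "sym_mon_functor N C G" "monfctr_ext N G"
    and H: "sym_mon_functor P C H" "monfctr_ext P H"
    and k: "(R, K, L, \<gamma>) \<in> Obj (slice_hom smc_2cat C (M, F) (N, G))" "(S, K', L', \<delta>) \<in> Obj (slice_hom smc_2cat C (N, G) (P, H))"
  shows "comp1 (slice_2cat smc_2cat C) (M, F) (N, G) (P, H) (S, K', L', \<delta>) (R, K, L, \<gamma>)
    = (comp_monfctr M P S R, comp_monfctr M C H (comp_monfctr M P S R), F, \<lambda>m\<in>Obj M. \<gamma> m \<cdot>C \<delta> (FObj R m))"
proof -
  have R: "sym_mon_functor M N R" "sym_mon_functor N P S" and d: "mon_trans N C (comp_monfctr N C H S) G \<delta>"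
    and e: "K = comp_monfctr M C G R" "L = F" "K' = comp_monfctr N C H S" "L' = G"
    using k by (simp_all add: slice_smc_obj[OF F G] slice_smc_obj[OF G H])
  interpret R: sym_mon_functor M N R by fact
  interpret S: sym_mon_functor N P S by fact
  interpret H: sym_mon_functor P C H by fact
  interpret d: mon_trans N C "comp_monfctr N C H S" G \<delta> by fact
  have "\<delta> (FObj R m) \<in> Arr C" "Dom C (\<delta> (FObj R m)) = FObj H (FObj S (FObj R m))" if "m \<in> Obj M" for m
    using that d.component_arr[of "FObj R m"] d.dom_component[of "FObj R m"] by simp_all
  then show ?thesis
    by (auto simp: slice_2cat_simps smc_2cat_simps smc_hom_simps e comp_monfctr_assoc[OF R H(1)] hcomp_trans_def intro!: restrict_ext)
qed

lemma self_restriction_simps: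
  "PObj (self_restriction C) (M, F) = (M, restriction C C F (self_action C))"
  "P1 (self_restriction C) (M, F) Y (R, H, K, \<gamma>) = (R, \<lambda>p\<in>Obj M \<times> Obj C. \<gamma> (fst p) \<boxtimes>C Idt C (snd p))"
  "P2 (self_restriction C) X Y (k, k', (S, S', \<phi>))
    = (P1 (self_restriction C) X Y k, P1 (self_restriction C) X Y k', \<phi>)"
  "PUnit (self_restriction C) X = id2 (act_2cat C) (PObj (self_restriction C) X) (PObj (self_restriction C) X)
    (Id1 (act_2cat C) (PObj (self_restriction C) X))"
  "PComp (self_restriction C) X Y Z (k, l) = id2 (act_2cat C) (PObj (self_restriction C) X) (PObj (self_restriction C) Z)
    (comp1 (act_2cat C) (PObj (self_restriction C) X) (PObj (self_restriction C) Y) (PObj (self_restriction C) Z)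
      (P1 (self_restriction C) Y Z k) (P1 (self_restriction C) X Y l))"
  by (simp_all add: self_restriction_def Let_def restrict_cell_def)

lemma strict_self_restriction:
  assumes C: "symmetric_monoidal_category C"
  shows "strict_psfctr (slice_2cat smc_2cat C) (act_2cat C) (self_restriction C)"
    (is "strict_psfctr ?S ?T ?P")
proof -
  interpret K: symmetric_monoidal_category C by fact
  have S: "symmetric_action C C (self_action C)" by (rule symmetric_action_self) fact
  interpret SL: two_category ?S
    by (rule two_category_slice[OF two_category_smc]) (simp add: smc_2cat_simps C)
  interpret AC: two_category ?T by (rule two_category_act)
  have act: "symmetric_action M C (restriction C C F (self_action C))" if "sym_mon_functor M C F" for M F
    by (rule symmetric_action_restriction[OF that S])
  have cell: "P1 ?P (M, F) (N, G) k \<in> Obj (act_hom C (PObj ?P (M, F)) (PObj ?P (N, G)))"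
    if F: "sym_mon_functor M C F" "monfctr_ext M F" and G: "sym_mon_functor N C G" "monfctr_ext N G"
      and k: "k \<in> Obj (slice_hom smc_2cat C (M, F) (N, G))" for M F N G k
  proof -
    obtain R H L \<gamma> where e: "k = (R, H, L, \<gamma>)" by (metis prod.exhaust)
    then show ?thesis
      using k action_identification_trans[of M N R C G F \<gamma>] F G
      by (simp add: e self_restriction_simps act_hom_simps(1) slice_smc_obj[OF F G])
  qed
  show ?thesis
  proof (intro strict_psfctr.intro strict_psfctr_axioms.intro)
    show "two_category ?S" "two_category ?T" ..
  next
    fix X assume X: "X \<in> Obj2 ?S"
    obtain M F where e: "X = (M, F)" by (cases X)
    have F: "sym_mon_functor M C F" using X by (simp add: e slice_smc_obj2)
    interpret F: sym_mon_functor M C F by fact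
    show "PObj ?P X \<in> Obj2 ?T"
      using act[OF F] by (simp add: e self_restriction_simps act_2cat_simps)
    show "P1 ?P X X (Id1 ?S X) = Id1 ?T (PObj ?P X)"
      by (auto simp: e self_restriction_simps slice_2cat_simps smc_2cat_simps smc_hom_simps act_2cat_simps restriction_simps intro!: restrict_ext)
    show "PUnit ?P X = id2 ?T (PObj ?P X) (PObj ?P X) (Id1 ?T (PObj ?P X))"
      by (simp add: self_restriction_simps)
  next
    fix X Y assume XY: "X \<in> Obj2 ?S" "Y \<in> Obj2 ?S"
    obtain M F N G where e: "X = (M, F)" "Y = (N, G)" by (cases X; cases Y)
    have F: "sym_mon_functor M C F" "monfctr_ext M F" and G: "sym_mon_functor N C G" "monfctr_ext N G"
      using XY by (simp_all add: e slice_smc_obj2)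
    show "cat_functor (HomCat ?S X Y) (HomCat ?T (PObj ?P X) (PObj ?P Y)) (PHom ?P X Y)"
    proof (rule cat_functorI)
      show "category (HomCat ?S X Y)"
        using XY by simp
      show "category (HomCat ?T (PObj ?P X) (PObj ?P Y))"
        using category_act_hom[OF act[OF F(1)] act[OF G(1)]] by (simp add: e self_restriction_simps act_2cat_simps)
    next
      fix k assume "k \<in> Obj (HomCat ?S X Y)"
      then show "P1 ?P X Y k \<in> Obj (HomCat ?T (PObj ?P X) (PObj ?P Y))"
        using cell[OF F G] by (simp add: e slice_2cat_simps act_2cat_simps)
    next
      fix a assume a: "a \<in> Arr (HomCat ?S X Y)"
      obtain R H L \<gamma> R' H' L' \<gamma>' T T' \<phi> where a': "a = ((R, H, L, \<gamma>), (R', H', L', \<gamma>'), (T, T', \<phi>))"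
        by (metis prod.exhaust)
      have k: "(R, H, L, \<gamma>) \<in> Obj (slice_hom smc_2cat C (M, F) (N, G))" "(R', H', L', \<gamma>') \<in> Obj (slice_hom smc_2cat C (M, F) (N, G))"
        using a by (simp_all add: e a' slice_2cat_simps slice_hom_simps(2))
      have R: "sym_mon_functor M N R" "sym_mon_functor M N R'" "mon_trans M N R R' \<phi>" "\<phi> \<in> extensional (Obj M)"
        "mon_trans M C (comp_monfctr M C G R') F \<gamma>'"
        and ge: "\<And>m. m \<in> Obj M \<Longrightarrow> \<gamma>' m \<cdot>C FArr G (\<phi> m) = \<gamma> m"
        using a k by (simp_all add: e a' slice_2cat_simps slice_smc_arr[OF F G k] slice_smc_obj[OF F G])
      interpret R: sym_mon_functor M N R by fact
      interpret R': sym_mon_functor M N R' by fact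
      interpret G: sym_mon_functor N C G by (rule G(1))
      interpret p: mon_trans M N R R' \<phi> by fact
      interpret g: mon_trans M C "comp_monfctr M C G R'" F \<gamma>' by fact
      \<comment> \<open>The triangle of the slice tensored with c is the compatibility of \<phi>
        with the two identifications.\<close>
      have "(\<gamma>' m \<boxtimes>C Idt C c) \<cdot>C (FArr G (\<phi> m) \<boxtimes>C Idt C c) = \<gamma> m \<boxtimes>C Idt C c" if "m \<in> Obj M" "c \<in> Obj C" for m c
        using that g.component_arr[of m] g.dom_component[of m] by (simp flip: ge)
      then have "P2 ?P X Y a \<in> Arr (act_hom C (PObj ?P X) (PObj ?P Y))"
        using cell[OF F G k(1)] cell[OF F G k(2)] R
        by (simp add: e a' self_restriction_simps act_hom_simps(2) restriction_simps)
      then show "P2 ?P X Y a \<in> Arr (HomCat ?T (PObj ?P X) (PObj ?P Y)) \<and>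
          Dom (HomCat ?T (PObj ?P X) (PObj ?P Y)) (P2 ?P X Y a) = P1 ?P X Y (Dom (HomCat ?S X Y) a) \<and>
          Cod (HomCat ?T (PObj ?P X) (PObj ?P Y)) (P2 ?P X Y a) = P1 ?P X Y (Cod (HomCat ?S X Y) a)"
        by (simp add: e a' slice_2cat_simps slice_hom_simps act_2cat_simps self_restriction_simps act_hom_simps(3,4))
    next
      fix k assume "k \<in> Obj (HomCat ?S X Y)"
      then show "P2 ?P X Y (Idt (HomCat ?S X Y) k) = Idt (HomCat ?T (PObj ?P X) (PObj ?P Y)) (P1 ?P X Y k)"
        by (cases k) (simp add: e slice_2cat_simps slice_hom_simps smc_2cat_simps smc_hom_simps act_2cat_simps self_restriction_simps act_hom_simps)
    next
      fix a b assume "a \<in> Arr (HomCat ?S X Y)" "b \<in> Arr (HomCat ?S X Y)" "Cod (HomCat ?S X Y) a = Dom (HomCat ?S X Y) b"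
      then show "P2 ?P X Y (b \<cdot>(HomCat ?S X Y) a) = P2 ?P X Y b \<cdot>(HomCat ?T (PObj ?P X) (PObj ?P Y)) P2 ?P X Y a"
        by (cases a; cases b) (auto simp: e slice_2cat_simps slice_hom_simps smc_2cat_simps smc_hom_simps act_2cat_simps self_restriction_simps act_hom_simps)
    qed
  next
    fix X Y Z assume XYZ: "X \<in> Obj2 ?S" "Y \<in> Obj2 ?S" "Z \<in> Obj2 ?S"
    obtain M F N G P H where e: "X = (M, F)" "Y = (N, G)" "Z = (P, H)" by (cases X; cases Y; cases Z)
    have F: "sym_mon_functor M C F" "monfctr_ext M F" and G: "sym_mon_functor N C G" "monfctr_ext N G"
      and H: "sym_mon_functor P C H" "monfctr_ext P H"
      using XYZ by (simp_all add: e slice_smc_obj2)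
    have comp1: "P1 ?P X Z (comp1 ?S X Y Z l k) = comp1 ?T (PObj ?P X) (PObj ?P Y) (PObj ?P Z) (P1 ?P Y Z l) (P1 ?P X Y k)"
      if kl: "k \<in> Obj (HomCat ?S X Y)" "l \<in> Obj (HomCat ?S Y Z)" for k l
    proof -
      obtain R K L \<gamma> T K' L' \<delta> where kl': "k = (R, K, L, \<gamma>)" "l = (T, K', L', \<delta>)" by (metis prod.exhaust)
      have k: "(R, K, L, \<gamma>) \<in> Obj (slice_hom smc_2cat C (M, F) (N, G))" "(T, K', L', \<delta>) \<in> Obj (slice_hom smc_2cat C (N, G) (P, H))"
        using kl by (simp_all add: e kl' slice_2cat_simps)
      have R: "sym_mon_functor M N R" "sym_mon_functor N P T"
        "mon_trans M C (comp_monfctr M C G R) F \<gamma>" "mon_trans N C (comp_monfctr N C H T) G \<delta>"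
        using k by (simp_all add: slice_smc_obj[OF F G] slice_smc_obj[OF G H])
      interpret R: sym_mon_functor M N R by fact
      interpret g: mon_trans M C "comp_monfctr M C G R" F \<gamma> by fact
      interpret d: mon_trans N C "comp_monfctr N C H T" G \<delta> by fact
      have "\<gamma> m \<in> Arr C" "Dom C (\<gamma> m) = FObj G (FObj R m)" "\<delta> (FObj R m) \<in> Arr C" "Cod C (\<delta> (FObj R m)) = FObj G (FObj R m)"
        if "m \<in> Obj M" for m
        using that g.component_arr[of m] g.dom_component[of m] d.component_arr[of "FObj R m"] d.cod_component[of "FObj R m"] by simp_all
      then show ?thesis
        by (auto simp: e kl' slice_smc_comp1[OF F G H k] self_restriction_simps act_2cat_simps intro!: restrict_ext)
    qed
    {
      fix k l assume kl: "k \<in> Obj (HomCat ?S X Y)" "l \<in> Obj (HomCat ?S Y Z)"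
      show "P1 ?P X Z (comp1 ?S X Y Z l k) = comp1 ?T (PObj ?P X) (PObj ?P Y) (PObj ?P Z) (P1 ?P Y Z l) (P1 ?P X Y k)"
        using kl by (rule comp1)
      show "PComp ?P X Y Z (l, k) = id2 ?T (PObj ?P X) (PObj ?P Z) (comp1 ?T (PObj ?P X) (PObj ?P Y) (PObj ?P Z) (P1 ?P Y Z l) (P1 ?P X Y k))"
        by (simp add: self_restriction_simps)
    }
    fix a b assume ab: "a \<in> Arr (HomCat ?S X Y)" "b \<in> Arr (HomCat ?S Y Z)"
    obtain k k' T T' \<phi> l l' U U' \<psi> where ab': "a = (k, k', (T, T', \<phi>))" "b = (l, l', (U, U', \<psi>))"
      by (metis prod.exhaust)
    have o: "k \<in> Obj (HomCat ?S X Y)" "k' \<in> Obj (HomCat ?S X Y)" "l \<in> Obj (HomCat ?S Y Z)" "l' \<in> Obj (HomCat ?S Y Z)"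
      using ab category.dom_obj'[OF SL.homcat'[OF XYZ(1,2)] ab(1)] category.cod_obj'[OF SL.homcat'[OF XYZ(1,2)] ab(1)]
        category.dom_obj'[OF SL.homcat'[OF XYZ(2,3)] ab(2)] category.cod_obj'[OF SL.homcat'[OF XYZ(2,3)] ab(2)]
      by (simp_all add: e ab' slice_2cat_simps slice_hom_simps(3,4))
    \<comment> \<open>Horizontal composition needs the two inner functors. In
      \<open>smc_2cat\<close> they are read off the stored ends of the 2-cells, in
      \<open>act_2cat\<close> off the 1-cells; membership in the slice makes these agree.\<close>
    have f: "fst k' = T'" "fst l = U"
      using ab by (cases k; cases k'; cases l; cases l'; simp add: e ab' slice_2cat_simps slice_hom_simps(2) smc_2cat_simps smc_hom_simps)+
    have f': "fst (P1 ?P X Y k') = fst k'" "fst (P1 ?P Y Z l) = fst l"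
      by (cases k'; cases l; simp add: e self_restriction_simps)+
    show "P2 ?P X Z (hcomp ?S X Y Z b a) = hcomp ?T (PObj ?P X) (PObj ?P Y) (PObj ?P Z) (P2 ?P Y Z b) (P2 ?P X Y a)"
      using comp1[OF o(1,3)] comp1[OF o(2,4)] f f'
      by (simp add: e ab' slice_2cat_simps(5) smc_2cat_simps self_restriction_simps(1,3) act_2cat_simps(5))
  qed
qed

text \<open>The transformation at the unit of C is packed with its source and target. Its source is
  the functor represented by the restriction of B, written as the composite to which it is
  equal.\<close>

definition rep_cell :: "('o, 'a) smc \<Rightarrow> ('m, 'f) smc \<times> ('m, 'f, 'o, 'a) monaction \<Rightarrow> ('n, 'g) smc \<times> ('n, 'g, 'o, 'a) monaction
    \<Rightarrow> ('m, 'f, 'n, 'g) monfctr \<times> ('m \<times> 'o \<Rightarrow> 'a)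
    \<Rightarrow> ('m, 'f, 'n, 'g) monfctr \<times> ('m, 'f, 'o, 'a) monfctr \<times> ('m, 'f, 'o, 'a) monfctr \<times> ('m \<Rightarrow> 'a)" where
  "rep_cell C = (\<lambda>(M, A) (N, B) (R, t). (R, comp_monfctr M C (rep_functor N C B) R, rep_functor M C A,
     \<lambda>m\<in>Obj M. t (m, Unt C)))"

definition rep_psfctr where
  "rep_psfctr C = (let S = slice_2cat smc_2cat C; ob = (\<lambda>(M, A). (M, rep_functor M C A)) in
     \<lparr>PObj = ob,
      PHom = \<lambda>X Y. \<lparr>FObj = rep_cell C X Y,
        FArr = \<lambda>(k, k', \<phi>). (rep_cell C X Y k, rep_cell C X Y k', (fst k, fst k', \<phi>))\<rparr>,
      PUnit = \<lambda>X. id2 S (ob X) (ob X) (Id1 S (ob X)),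
      PComp = \<lambda>X Y Z (k, l). id2 S (ob X) (ob Z) (comp1 S (ob X) (ob Y) (ob Z) (rep_cell C Y Z k) (rep_cell C X Y l))\<rparr>)"

lemma rep_psfctr_simps:
  "PObj (rep_psfctr C) (M, A) = (M, rep_functor M C A)"
  "P1 (rep_psfctr C) (M, A) (N, B) (R, t) = (R, comp_monfctr M C (rep_functor N C B) R, rep_functor M C A,
     \<lambda>m\<in>Obj M. t (m, Unt C))"
  "P2 (rep_psfctr C) X Y (k, k', \<phi>) = (P1 (rep_psfctr C) X Y k, P1 (rep_psfctr C) X Y k', (fst k, fst k', \<phi>))"
  "PUnit (rep_psfctr C) X = id2 (slice_2cat smc_2cat C) (PObj (rep_psfctr C) X) (PObj (rep_psfctr C) X)
    (Id1 (slice_2cat smc_2cat C) (PObj (rep_psfctr C) X))"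
  "PComp (rep_psfctr C) X Y Z (k, l) = id2 (slice_2cat smc_2cat C) (PObj (rep_psfctr C) X) (PObj (rep_psfctr C) Z)
    (comp1 (slice_2cat smc_2cat C) (PObj (rep_psfctr C) X) (PObj (rep_psfctr C) Y) (PObj (rep_psfctr C) Z)
      (P1 (rep_psfctr C) Y Z k) (P1 (rep_psfctr C) X Y l))"
  by (simp_all add: rep_psfctr_def Let_def rep_cell_def)

lemma strict_rep_psfctr:
  assumes C: "symmetric_monoidal_category C"
  shows "strict_psfctr (act_2cat C) (slice_2cat smc_2cat C) (rep_psfctr C)"
    (is "strict_psfctr ?T ?S ?Q")
proof -
  interpret K: symmetric_monoidal_category C by fact
  interpret SL: two_category ?S
    by (rule two_category_slice[OF two_category_smc]) (simp add: smc_2cat_simps C)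
  interpret AC: two_category ?T by (rule two_category_act)
  have rep: "sym_mon_functor M C (rep_functor M C A)" if "symmetric_action M C A" for M A
    using that by (rule symmetric_action.sym_mon_functor_rep)
  have cell: "P1 ?Q (M, A) (N, B) (R, t) \<in> Obj (slice_hom smc_2cat C (M, rep_functor M C A) (N, rep_functor N C B))"
    if A: "symmetric_action M C A" and B: "symmetric_action N C B"
      and k: "(R, t) \<in> Obj (act_hom C (M, A) (N, B))" for M A N B R t
  proof -
    have R: "sym_mon_functor M N R" "monfctr_ext M R" and t: "action_identification M C (restriction N C R B) A t"
      using k by (simp_all add: act_hom_simps)
    interpret t: symmetric_action_identification M C "restriction N C R B" A t
      by (rule symmetric_action_identification_restriction) fact+
    \<comment> \<open>\<open>mon_trans_rep\<close> starts at the functor represented by the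
      restricted action; \<open>rep_functor_restriction\<close> replaces it by the composite that a
      1-cell of the slice requires.\<close>
    show ?thesis
      using t.mon_trans_rep R
      by (simp add: rep_psfctr_simps slice_smc_obj[OF rep[OF A] monfctr_ext_rep rep[OF B] monfctr_ext_rep] rep_functor_restriction[OF R(1) B])
  qed
  show ?thesis
  proof (intro strict_psfctr.intro strict_psfctr_axioms.intro)
    show "two_category ?T" "two_category ?S" ..
  next
    fix X assume X: "X \<in> Obj2 ?T"
    obtain M A where e: "X = (M, A)" by (cases X)
    have A: "symmetric_action M C A" using X by (simp add: e act_2cat_simps)
    interpret A: symmetric_action M C A by fact
    show "PObj ?Q X \<in> Obj2 ?S"
      using rep[OF A] A.acting.symmetric_monoidal_category_axioms by (simp add: e rep_psfctr_simps slice_smc_obj2)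
    show "P1 ?Q X X (Id1 ?T X) = Id1 ?S (PObj ?Q X)"
      by (auto simp: e rep_psfctr_simps slice_2cat_simps smc_2cat_simps smc_hom_simps act_2cat_simps
          comp_monfctr_id_right[OF rep[OF A]] intro!: restrict_ext)
    show "PUnit ?Q X = id2 ?S (PObj ?Q X) (PObj ?Q X) (Id1 ?S (PObj ?Q X))"
      by (simp add: rep_psfctr_simps)
  next
    fix X Y assume XY: "X \<in> Obj2 ?T" "Y \<in> Obj2 ?T"
    obtain M A N B where e: "X = (M, A)" "Y = (N, B)" by (cases X; cases Y)
    have A: "symmetric_action M C A" and B: "symmetric_action N C B"
      using XY by (simp_all add: e act_2cat_simps)
    interpret A: symmetric_action M C A by fact
    interpret B: symmetric_action N C B by fact
    have obs: "PObj ?Q X \<in> Obj2 ?S" "PObj ?Q Y \<in> Obj2 ?S"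
      using rep[OF A] rep[OF B] A.acting.symmetric_monoidal_category_axioms B.acting.symmetric_monoidal_category_axioms
      by (simp_all add: e rep_psfctr_simps slice_smc_obj2)
    show "cat_functor (HomCat ?T X Y) (HomCat ?S (PObj ?Q X) (PObj ?Q Y)) (PHom ?Q X Y)"
    proof (rule cat_functorI)
      show "category (HomCat ?T X Y)" "category (HomCat ?S (PObj ?Q X) (PObj ?Q Y))"
        using XY obs by simp_all
    next
      fix k assume "k \<in> Obj (HomCat ?T X Y)"
      then show "P1 ?Q X Y k \<in> Obj (HomCat ?S (PObj ?Q X) (PObj ?Q Y))"
        using cell[OF A B] by (cases k) (simp add: e slice_2cat_simps act_2cat_simps rep_psfctr_simps(1))
    next
      fix a assume a: "a \<in> Arr (HomCat ?T X Y)"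
      obtain R t R' t' \<phi> where a': "a = ((R, t), (R', t'), \<phi>)" by (metis prod.exhaust)
      have k: "(R, t) \<in> Obj (act_hom C (M, A) (N, B))" "(R', t') \<in> Obj (act_hom C (M, A) (N, B))"
        and p: "mon_trans M N R R' \<phi>" "\<phi> \<in> extensional (Obj M)"
        and te: "\<And>m. m \<in> Obj M \<Longrightarrow> t' (m, Unt C) \<cdot>C (\<phi> m \<star>B Idt C (Unt C)) = t (m, Unt C)"
        using a by (simp_all add: e a' act_2cat_simps act_hom_simps(2))
      interpret R: sym_mon_functor M N R using k by (simp add: act_hom_simps)
      interpret p: mon_trans M N R R' \<phi> by (rule p(1))
      have "P2 ?Q X Y a \<in> Arr (slice_hom smc_2cat C (M, rep_functor M C A) (N, rep_functor N C B))"
        using slice_smc_arr[OF rep[OF A] monfctr_ext_rep rep[OF B] monfctr_ext_rep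
            cell[OF A B k(1), unfolded rep_psfctr_simps] cell[OF A B k(2), unfolded rep_psfctr_simps]] p te
        by (simp add: e a' rep_psfctr_simps)
      then show "P2 ?Q X Y a \<in> Arr (HomCat ?S (PObj ?Q X) (PObj ?Q Y)) \<and>
          Dom (HomCat ?S (PObj ?Q X) (PObj ?Q Y)) (P2 ?Q X Y a) = P1 ?Q X Y (Dom (HomCat ?T X Y) a) \<and>
          Cod (HomCat ?S (PObj ?Q X) (PObj ?Q Y)) (P2 ?Q X Y a) = P1 ?Q X Y (Cod (HomCat ?T X Y) a)"
        by (simp add: e a' slice_2cat_simps slice_hom_simps(3,4) act_2cat_simps rep_psfctr_simps act_hom_simps(3,4))
    next
      fix k assume "k \<in> Obj (HomCat ?T X Y)"
      then show "P2 ?Q X Y (Idt (HomCat ?T X Y) k) = Idt (HomCat ?S (PObj ?Q X) (PObj ?Q Y)) (P1 ?Q X Y k)"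
        by (cases k) (simp add: e slice_2cat_simps slice_hom_simps smc_2cat_simps smc_hom_simps act_2cat_simps rep_psfctr_simps act_hom_simps)
    next
      fix a b assume "a \<in> Arr (HomCat ?T X Y)" "b \<in> Arr (HomCat ?T X Y)" "Cod (HomCat ?T X Y) a = Dom (HomCat ?T X Y) b"
      then show "P2 ?Q X Y (b \<cdot>(HomCat ?T X Y) a) = P2 ?Q X Y b \<cdot>(HomCat ?S (PObj ?Q X) (PObj ?Q Y)) P2 ?Q X Y a"
        by (cases a; cases b) (auto simp: e slice_2cat_simps slice_hom_simps smc_2cat_simps smc_hom_simps act_2cat_simps rep_psfctr_simps act_hom_simps)
    qed
  next
    fix X Y Z assume XYZ: "X \<in> Obj2 ?T" "Y \<in> Obj2 ?T" "Z \<in> Obj2 ?T"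
    obtain M A N B P D where e: "X = (M, A)" "Y = (N, B)" "Z = (P, D)" by (cases X; cases Y; cases Z)
    have A: "symmetric_action M C A" and B: "symmetric_action N C B" and D: "symmetric_action P C D"
      using XYZ by (simp_all add: e act_2cat_simps)
    have comp1: "P1 ?Q X Z (comp1 ?T X Y Z l k) = comp1 ?S (PObj ?Q X) (PObj ?Q Y) (PObj ?Q Z) (P1 ?Q Y Z l) (P1 ?Q X Y k)"
      if kl: "k \<in> Obj (HomCat ?T X Y)" "l \<in> Obj (HomCat ?T Y Z)" for k l
    proof -
      obtain R t S u where kl': "k = (R, t)" "l = (S, u)" by (cases k; cases l)
      have k: "(R, t) \<in> Obj (act_hom C (M, A) (N, B))" "(S, u) \<in> Obj (act_hom C (N, B) (P, D))"
        using kl by (simp_all add: e kl' act_2cat_simps)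
      interpret R: sym_mon_functor M N R using k by (simp add: act_hom_simps)
      note c = cell[OF A B k(1), unfolded rep_psfctr_simps] cell[OF B D k(2), unfolded rep_psfctr_simps]
      show ?thesis
        by (auto simp: e kl' rep_psfctr_simps act_2cat_simps
            slice_smc_comp1[OF rep[OF A] monfctr_ext_rep rep[OF B] monfctr_ext_rep rep[OF D] monfctr_ext_rep c] intro!: restrict_ext)
    qed
    {
      fix k l assume kl: "k \<in> Obj (HomCat ?T X Y)" "l \<in> Obj (HomCat ?T Y Z)"
      show "P1 ?Q X Z (comp1 ?T X Y Z l k) = comp1 ?S (PObj ?Q X) (PObj ?Q Y) (PObj ?Q Z) (P1 ?Q Y Z l) (P1 ?Q X Y k)"
        using kl by (rule comp1)
      show "PComp ?Q X Y Z (l, k) = id2 ?S (PObj ?Q X) (PObj ?Q Z) (comp1 ?S (PObj ?Q X) (PObj ?Q Y) (PObj ?Q Z) (P1 ?Q Y Z l) (P1 ?Q X Y k))"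
        by (simp add: rep_psfctr_simps)
    }
    fix a b assume ab: "a \<in> Arr (HomCat ?T X Y)" "b \<in> Arr (HomCat ?T Y Z)"
    obtain R t R' t' \<phi> S u S' u' \<psi> where ab': "a = ((R, t), (R', t'), \<phi>)" "b = ((S, u), (S', u'), \<psi>)"
      by (metis prod.exhaust)
    have o: "(R, t) \<in> Obj (HomCat ?T X Y)" "(R', t') \<in> Obj (HomCat ?T X Y)" "(S, u) \<in> Obj (HomCat ?T Y Z)" "(S', u') \<in> Obj (HomCat ?T Y Z)"
      using ab by (simp_all add: e ab' act_2cat_simps act_hom_simps(2))
    show "P2 ?Q X Z (hcomp ?T X Y Z b a) = hcomp ?S (PObj ?Q X) (PObj ?Q Y) (PObj ?Q Z) (P2 ?Q Y Z b) (P2 ?Q X Y a)"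
      using comp1[OF o(1,3)] comp1[OF o(2,4)]
      by (simp add: e ab' slice_2cat_simps(5) smc_2cat_simps rep_psfctr_simps(1,3) act_2cat_simps(4,5))
  qed
qed

section \<open>Unit and counit of the biequivalence\<close>

lemma (in two_category) strict_inverse_equivalence_1cell:
  assumes [simp]: "x \<in> Obj2 A" "y \<in> Obj2 A" "f \<in> Obj (HomCat A x y)" "g \<in> Obj (HomCat A y x)"
    and "comp1 A x y x g f = Id1 A x" "comp1 A y x y f g = Id1 A y"
  shows "equivalence_1cell A x y f"
proof -
  have "isomorphic (HomCat A z z) (Id1 A z) (Id1 A z)" if [simp]: "z \<in> Obj2 A" for z
  proof -
    interpret H: category "HomCat A z z" by simp
    show ?thesis
      unfolding isomorphic_def by (rule bexI[where x = "id2 A z z (Id1 A z)"]) (simp_all add: hom_iff)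
  qed
  with assms show ?thesis
    unfolding equivalence_1cell_def by (intro conjI bexI[where x = g]) simp_all
qed

text \<open>A 1-cell from (x, f) to (x, g) over the identity carries a 2-cell from g to f, whence
  the direction of \<open>\<gamma>\<close>. The inverse 2-cell gives an inverse on the nose.\<close>

lemma slice_equivalence_1cell:
  assumes "two_category A" and [simp]: "c \<in> Obj2 A" "x \<in> Obj2 A" "f \<in> Obj (HomCat A x c)" "g \<in> Obj (HomCat A x c)"
    and i: "is_iso (HomCat A x c) \<gamma>" "Dom (HomCat A x c) \<gamma> = g" "Cod (HomCat A x c) \<gamma> = f"
  shows "equivalence_1cell (slice_2cat A c) (x, f) (x, g) (Id1 A x, \<gamma>)"
proof -
  interpret A: two_category A by fact
  interpret S: two_category "slice_2cat A c" by (rule two_category_slice) fact+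
  interpret xc: category "HomCat A x c" by simp
  note g = xc.iso_arr[OF i(1)]
  let ?\<gamma>' = "inv_arr (HomCat A x c) \<gamma>"
  have o: "(x, f) \<in> Obj2 (slice_2cat A c)" "(x, g) \<in> Obj2 (slice_2cat A c)"
    by (simp_all add: slice_2cat_simps)
  have 1: "(Id1 A x, \<gamma>) \<in> Obj (HomCat (slice_2cat A c) (x, f) (x, g))"
    "(Id1 A x, ?\<gamma>') \<in> Obj (HomCat (slice_2cat A c) (x, g) (x, f))"
    using i g by (simp_all add: slice_2cat_simps slice_hom_simps A.comp1_id_right)
  have 2: "comp1 (slice_2cat A c) (x, f) (x, g) (x, f) (Id1 A x, ?\<gamma>') (Id1 A x, \<gamma>) = Id1 (slice_2cat A c) (x, f)"
    "comp1 (slice_2cat A c) (x, g) (x, f) (x, g) (Id1 A x, \<gamma>) (Id1 A x, ?\<gamma>') = Id1 (slice_2cat A c) (x, g)"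
    using i g by (simp_all add: slice_2cat_simps A.comp1_id_right A.hcomp_id_right)
  show ?thesis
    by (rule S.strict_inverse_equivalence_1cell[OF o 1 2])
qed

text \<open>A 1-cell into (M, B) over the identity carries an identification from B to A, so it is
  the inverse of t that appears; t itself gives the inverse 1-cell.\<close>

lemma act_equivalence_1cell:
  assumes A: "symmetric_action M C A" and B: "symmetric_action M C B" and t: "action_identification M C A B t"
    and x: "t \<in> extensional (Obj M \<times> Obj C)"
  shows "equivalence_1cell (act_2cat C) (M, A) (M, B) (id_monfctr M, \<lambda>p\<in>Obj M \<times> Obj C. inv_arr C (t p))"
proof -
  interpret t: symmetric_action_identification M C A B t
    by (intro symmetric_action_identification.intro) fact+
  have I: "sym_mon_functor M M (id_monfctr M)"
    by (rule sym_mon_functor_id) (rule t.src.acting.symmetric_monoidal_category_axioms)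
  let ?t' = "\<lambda>p\<in>Obj M \<times> Obj C. inv_arr C (t p)"
  have 1: "(id_monfctr M, ?t') \<in> Obj (HomCat (act_2cat C) (M, A) (M, B))"
    "(id_monfctr M, t) \<in> Obj (HomCat (act_2cat C) (M, B) (M, A))"
    using action_identification_restrict_id[OF A B t] action_identification_restrict_id[OF B A action_identification_inv[OF A B t]] x I
    by (simp_all add: act_2cat_simps act_hom_simps)
  have 2: "comp1 (act_2cat C) (M, A) (M, B) (M, A) (id_monfctr M, t) (id_monfctr M, ?t') = Id1 (act_2cat C) (M, A)"
    "comp1 (act_2cat C) (M, B) (M, A) (M, B) (id_monfctr M, ?t') (id_monfctr M, t) = Id1 (act_2cat C) (M, B)"
    by (auto simp: act_2cat_simps comp_monfctr_id_right[OF I] intro!: restrict_ext)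
  have o: "(M, A) \<in> Obj2 (act_2cat C)" "(M, B) \<in> Obj2 (act_2cat C)"
    using A B by (simp_all add: act_2cat_simps)
  show ?thesis
    by (rule two_category.strict_inverse_equivalence_1cell[OF two_category_act o 1 2])
qed

text \<open>Restricting the self-action along F and taking the represented functor tensors F with
  the unit, and the right unitor compares the result with F.\<close>

lemma pseudonatural_equivalence_runit:
  fixes C :: "('a, 'b) smc"
  assumes C: "symmetric_monoidal_category C"
  shows "\<exists>s. pseudonatural_equivalence (slice_2cat smc_2cat C) (slice_2cat smc_2cat C) (id_psfctr (slice_2cat smc_2cat C))
    (comp_psfctr (slice_2cat smc_2cat C) (rep_psfctr C) (self_restriction C)) s"
proof -
  let ?S = "slice_2cat smc_2cat C"
  let ?QP = "comp_psfctr ?S (rep_psfctr C) (self_restriction C)"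
  interpret K: symmetric_monoidal_category C by fact
  have S: "symmetric_action C C (self_action C)" by (rule symmetric_action_self) fact
  have C2: "C \<in> Obj2 smc_2cat" using C by (simp add: smc_2cat_simps)
  interpret SL: two_category ?S by (rule two_category_slice[OF two_category_smc C2])
  have QP: "strict_psfctr ?S ?S ?QP"
    by (rule strict_psfctr_comp[OF strict_self_restriction[OF C] strict_rep_psfctr[OF C]])
  define G where "G M F = rep_functor M C (restriction C C F (self_action C))"
    for M :: "('a, 'b) smc" and F :: "('a, 'b, 'a, 'b) monfctr"
  \<comment> \<open>A 1-cell from (M, F) to (M, G M F) over the identity needs a 2-cell from
    \<open>G M F\<close> to F, which is the direction of the right unitor.\<close>
  define s where "s = (\<lambda>(M, F). (id_monfctr M, G M F, F, \<lambda>m\<in>Obj M. Runit C (FObj F m)))"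
  have QP1: "PObj ?QP (M, F) = (M, G M F)" for M F
    by (simp add: comp_psfctr_def self_restriction_simps rep_psfctr_simps G_def)
  have QP2: "P1 ?QP (M, F) (N, H) (R, K, L, \<gamma>) = (R, comp_monfctr M C (G N H) R, G M F, \<lambda>m\<in>Obj M. \<gamma> m \<boxtimes>C Idt C (Unt C))"
    for M F N H R K L \<gamma>
    by (auto simp: comp_psfctr_def comp_fctr_def self_restriction_simps rep_psfctr_simps G_def intro!: restrict_ext)
  have QP3: "P2 ?QP X Y (k, k', (fst k, fst k', \<phi>)) = (P1 ?QP X Y k, P1 ?QP X Y k', (fst k, fst k', \<phi>))" for X Y k k' \<phi>
    by (cases X; cases Y; cases k; cases k') (simp add: comp_psfctr_def comp_fctr_def self_restriction_simps rep_psfctr_simps)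
  have G: "sym_mon_functor M C (G M F)" "monfctr_ext M (G M F)" if "sym_mon_functor M C F" for M F
    unfolding G_def using symmetric_action.sym_mon_functor_rep[OF symmetric_action_restriction[OF that S]] by simp_all
  have s_obj: "s (M, F) \<in> Obj (slice_hom smc_2cat C (M, F) (M, G M F))"
    if F: "sym_mon_functor M C F" "monfctr_ext M F" for M F
  proof -
    interpret F: sym_mon_functor M C F by (rule F(1))
    show ?thesis
      using mon_trans_rep_restriction_self[OF F, folded G_def] comp_monfctr_id_right[OF G[OF F(1)]]
        sym_mon_functor_id[OF F.dom_smc.symmetric_monoidal_category_axioms]
      by (simp add: s_def slice_smc_obj[OF F G[OF F(1)]])
  qed
  have nat1: "comp1 ?S X (PObj ?QP X) (PObj ?QP Y) (P1 ?QP X Y k) (s X) = comp1 ?S X Y (PObj ?QP Y) (s Y) k"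
    if XY: "X \<in> Obj2 ?S" "Y \<in> Obj2 ?S" and k: "k \<in> Obj (HomCat ?S X Y)" for X Y k
  proof -
    obtain M F N H R K L \<gamma> where e: "X = (M, F)" "Y = (N, H)" "k = (R, K, L, \<gamma>)" by (metis prod.exhaust)
    have F: "sym_mon_functor M C F" "monfctr_ext M F" and H: "sym_mon_functor N C H" "monfctr_ext N H"
      using XY by (simp_all add: e slice_smc_obj2)
    have k': "(R, K, L, \<gamma>) \<in> Obj (slice_hom smc_2cat C (M, F) (N, H))"
      using k by (simp add: e slice_2cat_simps)
    have R: "sym_mon_functor M N R" "monfctr_ext M R" "mon_trans M C (comp_monfctr M C H R) F \<gamma>"
      using k' by (simp_all add: slice_smc_obj[OF F H])
    interpret F: sym_mon_functor M C F by (rule F(1))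
    interpret H: sym_mon_functor N C H by (rule H(1))
    interpret R: sym_mon_functor M N R by (rule R(1))
    interpret g: mon_trans M C "comp_monfctr M C H R" F \<gamma> by (rule R(3))
    have g: "\<gamma> m \<in> Arr C" "Dom C (\<gamma> m) = FObj H (FObj R m)" "Cod C (\<gamma> m) = FObj F m" if "m \<in> Obj M" for m
      using that g.component_arr[of m] g.dom_component[of m] g.cod_component[of m] by simp_all
    have QPk: "P1 ?QP (M, F) (N, H) (R, K, L, \<gamma>) \<in> Obj (slice_hom smc_2cat C (M, G M F) (N, G N H))"
      using strict_psfctr.p1_obj[OF QP XY k] by (simp add: e QP1 slice_2cat_simps)
    have "comp1 ?S X (PObj ?QP X) (PObj ?QP Y) (P1 ?QP X Y k) (s X)
      = (R, comp_monfctr M C (G N H) R, F, \<lambda>m\<in>Obj M. Runit C (FObj F m) \<cdot>C (\<gamma> m \<boxtimes>C Idt C (Unt C)))"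
      using slice_smc_comp1[OF F G[OF F(1)] G[OF H(1)] s_obj[OF F, unfolded s_def prod.case] QPk[unfolded QP2]] R
      by (auto simp: e QP1 QP2 s_def comp_monfctr_id_right intro!: restrict_ext)
    moreover have "comp1 ?S X Y (PObj ?QP Y) (s Y) k
      = (R, comp_monfctr M C (G N H) R, F, \<lambda>m\<in>Obj M. \<gamma> m \<cdot>C Runit C (FObj H (FObj R m)))"
      using slice_smc_comp1[OF F H G[OF H(1)] k' s_obj[OF H, unfolded s_def prod.case]] R
      by (auto simp: e QP1 s_def comp_monfctr_id_left intro!: restrict_ext)
    \<comment> \<open>The two sides differ by naturality of the right unitor at the components of
      \<gamma>.\<close>
    ultimately show ?thesis
      using g by (auto simp: K.runit_nat intro!: restrict_ext)
  qed
  have eq: "equivalence_1cell ?S X (PObj ?QP X) (s X)" if X: "X \<in> Obj2 ?S" for X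
  proof -
    obtain M F where e: "X = (M, F)" by (cases X)
    have F: "symmetric_monoidal_category M" "sym_mon_functor M C F" "monfctr_ext M F"
      using X by (simp_all add: e slice_smc_obj2)
    have "equivalence_1cell ?S (M, F) (M, G M F) (Id1 smc_2cat M, (G M F, F, \<lambda>m\<in>Obj M. Runit C (FObj F m)))"
      using s_obj[OF F(2,3)] F G[OF F(2)]
      by (intro slice_equivalence_1cell[OF two_category_smc C2])
        (simp_all add: smc_2cat_simps smc_hom_simps s_def slice_hom_simps)
    then show ?thesis
      by (simp add: e QP1 s_def smc_2cat_simps)
  qed
  have "pseudonatural ?S ?S (id_psfctr ?S) ?QP \<lparr>TObj = s, THom = \<lambda>x y f. id2 ?S (PObj (id_psfctr ?S) x) (PObj ?QP y)
    (comp1 ?S (PObj (id_psfctr ?S) x) (PObj ?QP x) (PObj ?QP y) (P1 ?QP x y f) (s x))\<rparr>"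
  proof (rule strict_pseudonatural[OF strict_psfctr_id[OF SL.two_category_axioms] QP])
    show "s X \<in> Obj (HomCat ?S (PObj (id_psfctr ?S) X) (PObj ?QP X))" if "X \<in> Obj2 ?S" for X
      using eq[OF that] by (simp add: equivalence_1cell_def id_psfctr_def)
    show "comp1 ?S (PObj (id_psfctr ?S) X) (PObj ?QP X) (PObj ?QP Y) (P1 ?QP X Y k) (s X)
      = comp1 ?S (PObj (id_psfctr ?S) X) (PObj (id_psfctr ?S) Y) (PObj ?QP Y) (s Y) (P1 (id_psfctr ?S) X Y k)"
      if "X \<in> Obj2 ?S" "Y \<in> Obj2 ?S" "k \<in> Obj (HomCat ?S X Y)" for X Y k
      using nat1[OF that] by (simp add: id_psfctr_def)
    fix X Y a assume XY: "X \<in> Obj2 ?S" "Y \<in> Obj2 ?S" and a: "a \<in> Arr (HomCat ?S X Y)"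
    obtain M F N H where e: "X = (M, F)" "Y = (N, H)" by (cases X; cases Y)
    obtain R K L \<gamma> R' K' L' \<gamma>' T T' \<phi> where a': "a = ((R, K, L, \<gamma>), (R', K', L', \<gamma>'), (T, T', \<phi>))"
      by (metis prod.exhaust)
    have F: "sym_mon_functor M C F" "monfctr_ext M F" and H: "sym_mon_functor N C H" "monfctr_ext N H"
      using XY by (simp_all add: e slice_smc_obj2)
    have k: "(R, K, L, \<gamma>) \<in> Obj (slice_hom smc_2cat C (M, F) (N, H))" "(R', K', L', \<gamma>') \<in> Obj (slice_hom smc_2cat C (M, F) (N, H))"
      using a by (simp_all add: e a' slice_2cat_simps slice_hom_simps(2))
    have T: "T = R" "T' = R'" "mon_trans M N R R' \<phi>" "\<phi> \<in> extensional (Obj M)"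
      using a k by (simp_all add: e a' slice_2cat_simps slice_smc_arr[OF F H k])
    have R: "sym_mon_functor M N R" "monfctr_ext M R" "sym_mon_functor M N R'" "monfctr_ext M R'"
      using k by (simp_all add: slice_smc_obj[OF F H])
    have o: "(R, K, L, \<gamma>) \<in> Obj (HomCat ?S X Y)" "(R', K', L', \<gamma>') \<in> Obj (HomCat ?S X Y)"
      using k by (simp_all add: e slice_2cat_simps)
    have QPa: "P2 ?QP X Y a = (P1 ?QP X Y (R, K, L, \<gamma>), P1 ?QP X Y (R', K', L', \<gamma>'), (R, R', \<phi>))"
      using QP3[of X Y "(R, K, L, \<gamma>)" "(R', K', L', \<gamma>')" \<phi>] by (simp add: a' T)
    have ids: "id2 ?S X (PObj ?QP X) (s X) = (s X, s X, id2 smc_2cat M M (Id1 smc_2cat M))"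
      "id2 ?S Y (PObj ?QP Y) (s Y) = (s Y, s Y, id2 smc_2cat N N (Id1 smc_2cat N))"
      by (simp_all add: e QP1 slice_2cat_simps slice_hom_simps s_def smc_2cat_simps)
    have MN: "M \<in> Obj2 smc_2cat" "N \<in> Obj2 smc_2cat"
      using XY by (simp_all add: e slice_2cat_simps)
    have \<phi>: "(R, R', \<phi>) \<in> Arr (HomCat smc_2cat M N)"
      using R T by (simp add: smc_2cat_simps smc_hom_simps)
    \<comment> \<open>The components of \<open>s\<close> lie over identity functors, so both
      whiskerings leave the transformation \<phi> unchanged; the recorded ends agree by
      \<open>nat1\<close>.\<close>
    have "hcomp ?S X (PObj ?QP X) (PObj ?QP Y) (P2 ?QP X Y a) (id2 ?S X (PObj ?QP X) (s X))
      = (comp1 ?S X (PObj ?QP X) (PObj ?QP Y) (P1 ?QP X Y (R, K, L, \<gamma>)) (s X),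
         comp1 ?S X (PObj ?QP X) (PObj ?QP Y) (P1 ?QP X Y (R', K', L', \<gamma>')) (s X), (R, R', \<phi>))"
      unfolding QPa ids using two_category.hcomp_id_right[OF two_category_smc MN \<phi>] by (simp add: e QP1 slice_2cat_simps(5))
    also have "\<dots> = hcomp ?S X Y (PObj ?QP Y) (id2 ?S Y (PObj ?QP Y) (s Y)) a"
      unfolding nat1[OF XY o(1)] nat1[OF XY o(2)] ids
      using two_category.hcomp_id_left[OF two_category_smc MN \<phi>] by (simp add: e a' QP1 slice_2cat_simps(5) T)
    finally show "hcomp ?S (PObj (id_psfctr ?S) X) (PObj ?QP X) (PObj ?QP Y) (P2 ?QP X Y a) (id2 ?S (PObj (id_psfctr ?S) X) (PObj ?QP X) (s X))
      = hcomp ?S (PObj (id_psfctr ?S) X) (PObj (id_psfctr ?S) Y) (PObj ?QP Y) (id2 ?S (PObj (id_psfctr ?S) Y) (PObj ?QP Y) (s Y)) (P2 (id_psfctr ?S) X Y a)"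
      by (simp add: id_psfctr_def)
  qed
  then show ?thesis
    using eq unfolding pseudonatural_equivalence_def by (intro exI conjI) (auto simp: id_psfctr_def)
qed

text \<open>On the side of actions the comparison is \<theta>. Its strict naturality combines
  \<open>rep_ident_natural\<close> with \<open>rep_ident_restriction\<close>.\<close>

lemma pseudonatural_equivalence_rep_ident:
  fixes C :: "('a, 'b) smc"
  assumes C: "symmetric_monoidal_category C"
  shows "\<exists>t. pseudonatural_equivalence (act_2cat C) (act_2cat C) (comp_psfctr (act_2cat C) (self_restriction C) (rep_psfctr C))
    (id_psfctr (act_2cat C)) t"
proof -
  let ?T = "act_2cat C :: (('a, 'b) smc \<times> ('a, 'b, 'a, 'b) monaction, _, _) twocat"
  let ?PQ = "comp_psfctr ?T (self_restriction C) (rep_psfctr C)"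
  have S: "symmetric_action C C (self_action C)" by (rule symmetric_action_self) fact
  interpret T: two_category ?T by (rule two_category_act)
  have PQ: "strict_psfctr ?T ?T ?PQ"
    by (rule strict_psfctr_comp[OF strict_rep_psfctr[OF C] strict_self_restriction[OF C]])
  define G where "G M A = restriction C C (rep_functor M C A) (self_action C)"
    for M :: "('a, 'b) smc" and A :: "('a, 'b, 'a, 'b) monaction"
  \<comment> \<open>A 1-cell into (M, A) carries an identification that starts from A, hence the
    inverse of \<theta>.\<close>
  define s :: "('a, 'b) smc \<times> ('a, 'b, 'a, 'b) monaction \<Rightarrow> _"
    where "s = (\<lambda>(M, A). (id_monfctr M, \<lambda>p\<in>Obj M \<times> Obj C. inv_arr C (rep_ident M C A p)))"
  have PQ1: "PObj ?PQ (M, A) = (M, G M A)" for M A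
    by (simp add: comp_psfctr_def self_restriction_simps rep_psfctr_simps G_def)
  have PQ2: "P1 ?PQ (M, A) (N, B) (R, t) = (R, \<lambda>p\<in>Obj M \<times> Obj C. t (fst p, Unt C) \<boxtimes>C Idt C (snd p))" for M A N B R t
    by (auto simp: comp_psfctr_def comp_fctr_def self_restriction_simps rep_psfctr_simps intro!: restrict_ext)
  have PQ3: "P2 ?PQ X Y (k, k', \<phi>) = (P1 ?PQ X Y k, P1 ?PQ X Y k', \<phi>)" for X Y k k' \<phi>
    by (simp add: comp_psfctr_def comp_fctr_def self_restriction_simps rep_psfctr_simps)
  have eq: "equivalence_1cell ?T (PObj ?PQ X) X (s X)" if X: "X \<in> Obj2 ?T" for X
  proof -
    obtain M A where e: "X = (M, A)" by (cases X)
    have A: "symmetric_action M C A" using X by (simp add: e act_2cat_simps)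
    have "symmetric_action M C (G M A)"
      unfolding G_def by (rule symmetric_action_restriction[OF symmetric_action.sym_mon_functor_rep[OF A] S])
    then show ?thesis
      using act_equivalence_1cell[of M C "G M A" A "rep_ident M C A"] A rep_identification[OF A]
      by (simp add: e PQ1 s_def G_def)
  qed
  have nat1: "comp1 ?T (PObj ?PQ X) X Y k (s X) = comp1 ?T (PObj ?PQ X) (PObj ?PQ Y) Y (s Y) (P1 ?PQ X Y k)"
    if XY: "X \<in> Obj2 ?T" "Y \<in> Obj2 ?T" and k: "k \<in> Obj (HomCat ?T X Y)" for X Y k
  proof -
    obtain M A N B R t where e: "X = (M, A)" "Y = (N, B)" "k = (R, t)" by (metis prod.exhaust)
    have A: "symmetric_action M C A" and B: "symmetric_action N C B"
      using XY by (simp_all add: e act_2cat_simps)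
    have R: "sym_mon_functor M N R" "monfctr_ext M R" "action_identification M C (restriction N C R B) A t"
      using k by (simp_all add: e act_2cat_simps act_hom_simps)
    interpret A: symmetric_action M C A by fact
    interpret B: symmetric_action N C B by fact
    interpret R: sym_mon_functor M N R by fact
    interpret t: symmetric_action_identification M C "restriction N C R B" A t
      by (rule symmetric_action_identification_restriction) fact+
    \<comment> \<open>\<open>rep_ident_natural\<close> for t, with the \<theta> of the restriction
      replaced by that of B at the image of m, solved for the inverses.\<close>
    have "inv_arr C (rep_ident M C A (m, c)) \<cdot>C t (m, c) = (t (m, Unt C) \<boxtimes>C Idt C c) \<cdot>C inv_arr C (rep_ident N C B (FObj R m, c))"
      if [simp]: "m \<in> Obj M" "c \<in> Obj C" for m c
    proof -
      have "t (m, c) \<cdot>C rep_ident N C B (FObj R m, c) = rep_ident M C A (m, c) \<cdot>C (t (m, Unt C) \<boxtimes>C Idt C c)"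
        using t.rep_ident_natural[of m c] by (simp add: rep_ident_restriction[OF R(1) B])
      then have "(rep_ident M C A (m, c) \<cdot>C (t (m, Unt C) \<boxtimes>C Idt C c)) \<cdot>C inv_arr C (rep_ident N C B (FObj R m, c)) = t (m, c)"
        by (auto simp: restriction_simps simp flip: \<open>t (m, c) \<cdot>C _ = _\<close>)
      then show ?thesis
        by (auto simp: restriction_simps simp flip: \<open>_ = t (m, c)\<close>)
    qed
    then show ?thesis
      using comp_monfctr_id_right[OF R(1,2)] comp_monfctr_id_left[OF R(1,2)]
      by (auto simp: e PQ1 PQ2 s_def act_2cat_simps intro!: restrict_ext)
  qed
  have "pseudonatural ?T ?T ?PQ (id_psfctr ?T) \<lparr>TObj = s, THom = \<lambda>x y f. id2 ?T (PObj ?PQ x) (PObj (id_psfctr ?T) y)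
    (comp1 ?T (PObj ?PQ x) (PObj (id_psfctr ?T) x) (PObj (id_psfctr ?T) y) (P1 (id_psfctr ?T) x y f) (s x))\<rparr>"
  proof (rule strict_pseudonatural[OF PQ strict_psfctr_id[OF T.two_category_axioms]])
    show "s X \<in> Obj (HomCat ?T (PObj ?PQ X) (PObj (id_psfctr ?T) X))" if "X \<in> Obj2 ?T" for X
      using eq[OF that] by (simp add: equivalence_1cell_def id_psfctr_def)
    show "comp1 ?T (PObj ?PQ X) (PObj (id_psfctr ?T) X) (PObj (id_psfctr ?T) Y) (P1 (id_psfctr ?T) X Y k) (s X)
      = comp1 ?T (PObj ?PQ X) (PObj ?PQ Y) (PObj (id_psfctr ?T) Y) (s Y) (P1 ?PQ X Y k)"
      if "X \<in> Obj2 ?T" "Y \<in> Obj2 ?T" "k \<in> Obj (HomCat ?T X Y)" for X Y k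
      using nat1[OF that] by (simp add: id_psfctr_def)
    fix X Y a assume XY: "X \<in> Obj2 ?T" "Y \<in> Obj2 ?T" and a: "a \<in> Arr (HomCat ?T X Y)"
    obtain M A N B where e: "X = (M, A)" "Y = (N, B)" by (cases X; cases Y)
    obtain R t R' t' \<phi> where a': "a = ((R, t), (R', t'), \<phi>)" by (metis prod.exhaust)
    have o: "(R, t) \<in> Obj (HomCat ?T X Y)" "(R', t') \<in> Obj (HomCat ?T X Y)"
      and R: "sym_mon_functor M N R" "sym_mon_functor M N R'" "mon_trans M N R R' \<phi>" "\<phi> \<in> extensional (Obj M)"
      using a by (simp_all add: e a' act_2cat_simps act_hom_simps)
    have "hcomp ?T (PObj ?PQ X) X Y a (id2 ?T (PObj ?PQ X) X (s X))
      = (comp1 ?T (PObj ?PQ X) X Y (R, t) (s X), comp1 ?T (PObj ?PQ X) X Y (R', t') (s X), \<phi>)"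
      using hcomp_trans_id_right[OF R] by (simp add: e a' PQ1 act_2cat_simps(2,5) act_hom_simps s_def del: restrict_apply)
    also have "\<dots> = hcomp ?T (PObj ?PQ X) (PObj ?PQ Y) Y (id2 ?T (PObj ?PQ Y) Y (s Y)) (P2 ?PQ X Y a)"
      unfolding nat1[OF XY o(1)] nat1[OF XY o(2)] a' PQ3
      using hcomp_trans_id_left[OF R] by (simp add: e PQ1 PQ2 act_2cat_simps(2,5) act_hom_simps s_def del: restrict_apply)
    finally show "hcomp ?T (PObj ?PQ X) (PObj (id_psfctr ?T) X) (PObj (id_psfctr ?T) Y) (P2 (id_psfctr ?T) X Y a) (id2 ?T (PObj ?PQ X) (PObj (id_psfctr ?T) X) (s X))
      = hcomp ?T (PObj ?PQ X) (PObj ?PQ Y) (PObj (id_psfctr ?T) Y) (id2 ?T (PObj ?PQ Y) (PObj (id_psfctr ?T) Y) (s Y)) (P2 ?PQ X Y a)"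
      by (simp add: id_psfctr_def)
  qed
  then show ?thesis
    using eq unfolding pseudonatural_equivalence_def by (intro exI conjI) (auto simp: id_psfctr_def)
qed

text \<open>The factorisation clause allows acting categories over arbitrary carrier types, whereas
  \<open>two_terminal\<close> speaks of hom-categories of one 2-category and so takes the types of
  C. Uniqueness of the factorisation is meant up to a unique 2-cell, which is moreover
  invertible.\<close>

theorem corollary5p5p12:
  fixes C :: "('o, 'a) smc"
  assumes "symmetric_monoidal_category C"
  shows "symmetric_action C C (self_action C)
    \<and> (\<forall>(M :: ('m, 'f) smc) (A :: ('m, 'f, 'o, 'a) monaction). symmetric_action M C A \<longrightarrow>
         (\<exists>k. k \<in> Obj (act_hom C (M, A) (C, self_action C)))
         \<and> (\<forall>k \<in> Obj (act_hom C (M, A) (C, self_action C)).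
              \<forall>l \<in> Obj (act_hom C (M, A) (C, self_action C)).
                (\<exists>!\<phi>. \<phi> \<in> hom (act_hom C (M, A) (C, self_action C)) k l)
                \<and> (\<forall>\<phi> \<in> hom (act_hom C (M, A) (C, self_action C)) k l.
                     is_iso (act_hom C (M, A) (C, self_action C)) \<phi>)))
    \<and> two_terminal (act_2cat C) (C, self_action C)
    \<and> biequivalence (slice_2cat smc_2cat C) (act_2cat C) (self_restriction C)"
proof (intro conjI allI impI ballI)
  show "symmetric_action C C (self_action C)"
    by (rule symmetric_action_self) fact
  show "two_terminal (act_2cat C) (C, self_action C)"
    by (rule two_terminal_self) fact
  interpret P: strict_psfctr "slice_2cat smc_2cat C" "act_2cat C" "self_restriction C"
    by (rule strict_self_restriction) fact
  interpret Q: strict_psfctr "act_2cat C" "slice_2cat smc_2cat C" "rep_psfctr C"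
    by (rule strict_rep_psfctr) fact
  show "biequivalence (slice_2cat smc_2cat C) (act_2cat C) (self_restriction C)"
    unfolding biequivalence_def
    using pseudonatural_equivalence_runit[OF assms] pseudonatural_equivalence_rep_ident[OF assms]
      P.pseudofunctor_axioms Q.pseudofunctor_axioms by blast
next
  fix M :: "('m, 'f) smc" and A :: "('m, 'f, 'o, 'a) monaction"
  assume "symmetric_action M C A"
  then interpret A: symmetric_action M C A .
  show "\<exists>k. k \<in> Obj (act_hom C (M, A) (C, self_action C))"
    using A.rep_cell_obj by blast
  fix k l
  assume kl: "k \<in> Obj (act_hom C (M, A) (C, self_action C))" "l \<in> Obj (act_hom C (M, A) (C, self_action C))"
  then show "\<exists>!\<phi>. \<phi> \<in> hom (act_hom C (M, A) (C, self_action C)) k l"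
    by (rule A.act_hom_self_unique)
  show "is_iso (act_hom C (M, A) (C, self_action C)) \<phi>"
    if "\<phi> \<in> hom (act_hom C (M, A) (C, self_action C)) k l" for \<phi>
    using kl that by (rule A.act_hom_self_iso)
qed

end
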